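(* Let $d\ge 2$ and $1\le d_0\le d$ be integers, and let $(X_{n,j},A_{n,j}: n\ge 1,\ 1\le j\le d)$ be the variables of a multicolor urn satisfying assumptions (A) and (B) of the context. For $j\in\{1,\ldots,d_0\}$ let $Z_{(j)}$ be the a.s. limit of $Z_{n,j}$ and put $$V_j=\frac{Z_{(j)}}{m^2}\Bigl\{q_j(1-Z_{(j)})^2+Z_{(j)}\sum_{i\le d_0,\,i\ne j}q_i\,Z_{(i)}\Bigr\},\qquad U_j=V_j-Z_{(j)}(1-Z_{(j)}).$$ Then, for each $j\in\{1,\ldots,d_0\}$, as $n\to\infty$, $$C^*_{n,j}\longrightarrow\mathcal N(0,U_j)\ \text{ stably},\qquad D^*_{n,j}\longrightarrow\mathcal N(0,V_j)\ \ \mathcal G\text{-stably in strong sense}.$$ In particular, $$(C^*_{n,j},D^*_{n,j})\longrightarrow\mathcal N(0,U_j)\times\mathcal N(0,V_j)\ \text{ stably}.$$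
   Context: **Urn setting.** $X_{n,j}$ and $A_{n,j}$ ($n\ge1$, $1\le j\le d$) are real random variables on a probability space $(\Omega,\mathcal A,P)$; $\mathcal G=(\mathcal G_n:n\ge0)$ with $\mathcal G_0=\{\emptyset,\Omega\}$ and $\mathcal G_n=\sigma(X_{k,j},A_{k,j}:1\le k\le n,\,1\le j\le d)$. For constants $a_j>0$, set $N_{n,j}=a_j+\sum_{k=1}^nX_{k,j}A_{k,j}$. Assumption (A): $X_{n,j}\in\{0,1\}$; $\sum_{j=1}^dX_{n,j}=1$; $0\le A_{n,j}\le\beta$ for some constant $\beta$; the vector $(A_{n,j}:1\le j\le d)$ is independent of $\mathcal G_{n-1}\vee\sigma(X_{n,j}:1\le j\le d)$ for every $n\ge 1$; and, for every $n\ge 0$ and $1\le j\le d$, $$Z_{n,j}:=\frac{N_{n,j}}{\sum_{i=1}^dN_{n,i}}=P(X_{n+1,j}=1\mid\mathcal G_n)\quad\text{a.s.}$$ Assumption (B): let $\lambda_0=0$ if $d_0=d$ and $\lambda_0=\max_{d_0<j\le d}\limsup_nEA_{n,j}$ if $d_0<d$. Then $EA_{n,j}=EA_{n,1}$ for all $n\ge1$ and $1\le j\le d_0$; the limit $m:=\lim_nEA_{n,1}$ exists and $m>\lambda_0$; and the limits $q_j:=\lim_nEA_{n,j}^2$ exist for $1\le j\le d_0$. Under (A) and (B), for each $1\le j\le d_0$ the sequence $Z_{n,j}$ converges a.s.; its limit is denoted $Z_{(j)}$. For $1\le j\le d_0$ define $$M^*_{n,j}=\frac{\sum_{k=1}^nX_{k,j}}{1+\sum_{k=1}^n\sum_{i=1}^{d_0}X_{k,i}},\qquad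 Z^*_{n,j}=\frac{N_{n,j}}{\sum_{i=1}^{d_0}N_{n,i}},$$ $$C^*_{n,j}=\sqrt n\,(M^*_{n,j}-Z^*_{n,j}),\qquad D^*_{n,j}=\sqrt n\,(Z^*_{n,j}-Z_{(j)}).$$ **Kernels and stable convergence.** A kernel on a metric space $S$ is a collection $N=\{N(\omega):\omega\in\Omega\}$ of Borel probability measures on $S$ such that $\omega\mapsto N(\omega)(f)=\int f\,dN(\omega)$ is $\mathcal A$-measurable for each bounded Borel $f:S\to\mathbb R$. For kernels $M,N$ on $S$, $M\times N$ is the kernel on $S\times S$ given by $(M\times N)(\omega)=M(\omega)\times N(\omega)$ (product measure). $\mathcal N(a,b)$ is the Gaussian law on $\mathbb R$ with mean $a$ and variance $b\ge0$ ($\mathcal N(a,0)=\delta_a$); for a non negative real random variable $L$, $\mathcal N(0,L)$ is the kernel $\omega\mapsto\mathcal N(0,L(\omega))$. $S$-valued random variables $Y_n$ converge stably to a kernel $N$ if $P(Y_n\in\cdot\mid H)\to E(N(\cdot)\mid H)$ weakly for all $H\in\mathcal A$ with $P(H)>0$ (where $E(N(\cdot)\mid H)=E(I_HN(\cdot))/P(H)$). For a sequence $\mathcal F=(\mathcal F_n)$ of sub-$\sigma$-fields of $\mathcal A$, $Y_n$ converges $\mathcal F$-stably in strong sense to $N$ if $E(f(Y_n)\mid\mathcal F_n)\to N(f)$ in probability for all bounded continuous $f:S\to\mathbb R$. *)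

theory Defs
  imports "HOL-Probability.Probability"
begin

section \<open>Kernels and modes of convergence\<close>

definition is_kernel :: "'w measure \<Rightarrow> ('w \<Rightarrow> 's::metric_space measure) \<Rightarrow> bool" where
  "is_kernel M N \<longleftrightarrow>
     (\<forall>w\<in>space M. prob_space (N w) \<and> sets (N w) = sets borel) \<and>
     (\<forall>f :: 's \<Rightarrow> real. f \<in> borel_measurable borel \<and> bounded (range f) \<longrightarrow>
        (\<lambda>w. \<integral>x. f x \<partial>N w) \<in> borel_measurable M)"

definition kernel_prod ::
  "('w \<Rightarrow> 's measure) \<Rightarrow> ('w \<Rightarrow> 't measure) \<Rightarrow> 'w \<Rightarrow> ('s \<times> 't) measure" where
  "kernel_prod K L = (\<lambda>w. K w \<Otimes>\<^sub>M L w)"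

text \<open>For \<open>v > 0\<close> this is the Gaussian law with mean \<open>\<mu>\<close> and variance \<open>v\<close>, and for \<open>v = 0\<close> the
  point mass at \<open>\<mu>\<close>. Negative \<open>v\<close> also gives the point mass; it occurs only on a null set,
  where the random variance is defined through a limit that need not exist.\<close>

definition gauss :: "real \<Rightarrow> real \<Rightarrow> real measure" where
  "gauss \<mu> v = (if 0 < v then density lborel (\<lambda>x. ennreal (normal_density \<mu> (sqrt v) x))
                else return borel \<mu>)"

definition gauss_kernel :: "('w \<Rightarrow> real) \<Rightarrow> 'w \<Rightarrow> real measure" where
  "gauss_kernel L = (\<lambda>w. gauss 0 (L w))"

text \<open>Weak convergence on a metric space; the library notion \<^const>\<open>weak_conv_m\<close> covers
  the real line only.\<close>

definition weakly_converges :: "(nat \<Rightarrow> 's::metric_space measure) \<Rightarrow> 's measure \<Rightarrow> bool" where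
  "weakly_converges \<mu> \<nu> \<longleftrightarrow>
     (\<forall>f :: 's \<Rightarrow> real. continuous_on UNIV f \<and> bounded (range f) \<longrightarrow>
        (\<lambda>n. \<integral>x. f x \<partial>\<mu> n) \<longlonglongrightarrow> (\<integral>x. f x \<partial>\<nu>))"

text \<open>\<^term>\<open>uniform_measure M H\<close> is \<open>P(\<cdot> | H)\<close>, so binding it with the kernel \<open>N\<close> yields the
  averaged law \<open>B \<mapsto> E(I\<^sub>H N(B)) / P(H)\<close>.\<close>

definition converges_stably ::
  "'w measure \<Rightarrow> (nat \<Rightarrow> 'w \<Rightarrow> 's::metric_space) \<Rightarrow> ('w \<Rightarrow> 's measure) \<Rightarrow> bool" where
  "converges_stably M Y N \<longleftrightarrow>
     (\<forall>n. Y n \<in> borel_measurable M) \<and> is_kernel M N \<and>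
     (\<forall>H\<in>sets M. 0 < measure M H \<longrightarrow>
        weakly_converges (\<lambda>n. distr (uniform_measure M H) borel (Y n))
          (uniform_measure M H \<bind> N))"

definition converges_in_prob ::
  "'w measure \<Rightarrow> (nat \<Rightarrow> 'w \<Rightarrow> real) \<Rightarrow> ('w \<Rightarrow> real) \<Rightarrow> bool" where
  "converges_in_prob M g h \<longleftrightarrow>
     (\<forall>e>0. (\<lambda>n. measure M {w \<in> space M. e < \<bar>g n w - h w\<bar>}) \<longlonglongrightarrow> 0)"

definition converges_stably_strong ::
  "'w measure \<Rightarrow> (nat \<Rightarrow> 'w measure) \<Rightarrow> (nat \<Rightarrow> 'w \<Rightarrow> 's::metric_space) \<Rightarrow>
     ('w \<Rightarrow> 's measure) \<Rightarrow> bool" where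
  "converges_stably_strong M F Y N \<longleftrightarrow>
     (\<forall>n. subalgebra M (F n)) \<and> (\<forall>n. Y n \<in> borel_measurable M) \<and> is_kernel M N \<and>
     (\<forall>f :: 's \<Rightarrow> real. continuous_on UNIV f \<and> bounded (range f) \<longrightarrow>
        converges_in_prob M (\<lambda>n. real_cond_exp M (F n) (\<lambda>w. f (Y n w)))
          (\<lambda>w. \<integral>x. f x \<partial>N w))"


section \<open>Multicolor urns\<close>

text \<open>Colors are numbered \<open>1, \<dots>, d\<close> and drawings \<open>1, 2, \<dots>\<close>; the values of \<open>X n j\<close> and
  \<open>A n j\<close> for other indices play no role.\<close>

definition sigma_gen :: "'w measure \<Rightarrow> ('w \<Rightarrow> real) set \<Rightarrow> 'w measure" where
  "sigma_gen M Fs = sigma (space M) {f -` B \<inter> space M | f B. f \<in> Fs \<and> B \<in> sets borel}"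

definition sigma_join :: "'w measure \<Rightarrow> 'w measure \<Rightarrow> 'w measure \<Rightarrow> 'w measure" where
  "sigma_join M F G = sigma (space M) (sets F \<union> sets G)"

definition urn_G ::
  "'w measure \<Rightarrow> (nat \<Rightarrow> nat \<Rightarrow> 'w \<Rightarrow> real) \<Rightarrow> (nat \<Rightarrow> nat \<Rightarrow> 'w \<Rightarrow> real) \<Rightarrow> nat \<Rightarrow> nat \<Rightarrow> 'w measure" where
  "urn_G M X A d n =
     sigma_gen M ({X k j | k j. k \<in> {1..n} \<and> j \<in> {1..d}} \<union> {A k j | k j. k \<in> {1..n} \<and> j \<in> {1..d}})"

definition urn_N ::
  "(nat \<Rightarrow> nat \<Rightarrow> 'w \<Rightarrow> real) \<Rightarrow> (nat \<Rightarrow> nat \<Rightarrow> 'w \<Rightarrow> real) \<Rightarrow> (nat \<Rightarrow> real) \<Rightarrow> nat \<Rightarrow> nat \<Rightarrow> 'w \<Rightarrow> real" where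
  "urn_N X A a n j w = a j + (\<Sum>k=1..n. X k j w * A k j w)"

definition urn_Z ::
  "(nat \<Rightarrow> nat \<Rightarrow> 'w \<Rightarrow> real) \<Rightarrow> (nat \<Rightarrow> nat \<Rightarrow> 'w \<Rightarrow> real) \<Rightarrow> (nat \<Rightarrow> real) \<Rightarrow> nat \<Rightarrow> nat \<Rightarrow> nat \<Rightarrow> 'w \<Rightarrow> real" where
  "urn_Z X A a d n j w = urn_N X A a n j w / (\<Sum>i=1..d. urn_N X A a n i w)"

definition assumption_A ::
  "'w measure \<Rightarrow> (nat \<Rightarrow> nat \<Rightarrow> 'w \<Rightarrow> real) \<Rightarrow> (nat \<Rightarrow> nat \<Rightarrow> 'w \<Rightarrow> real) \<Rightarrow> (nat \<Rightarrow> real) \<Rightarrow> nat \<Rightarrow> bool" where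
  "assumption_A M X A a d \<longleftrightarrow>
     (\<forall>n\<ge>1. \<forall>j\<in>{1..d}. \<forall>w\<in>space M. X n j w \<in> {0, 1}) \<and>
     (\<forall>n\<ge>1. \<forall>w\<in>space M. (\<Sum>j=1..d. X n j w) = 1) \<and>
     (\<exists>\<beta>. \<forall>n\<ge>1. \<forall>j\<in>{1..d}. \<forall>w\<in>space M. 0 \<le> A n j w \<and> A n j w \<le> \<beta>) \<and>
     (\<forall>n\<ge>1. prob_space.indep_set M
        (sets (sigma_gen M {A n j | j. j \<in> {1..d}}))
        (sets (sigma_join M (urn_G M X A d (n - 1)) (sigma_gen M {X n j | j. j \<in> {1..d}})))) \<and>
     (\<forall>n. \<forall>j\<in>{1..d}. AE w in M.
        urn_Z X A a d n j w
          = real_cond_exp M (urn_G M X A d n) (indicator {v \<in> space M. X (Suc n) j v = 1}) w)"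

text \<open>The limsup is taken in \<^typ>\<open>ereal\<close>, where it is always defined; it is finite
  for bounded \<open>A\<close>.\<close>

definition lambda0 :: "'w measure \<Rightarrow> (nat \<Rightarrow> nat \<Rightarrow> 'w \<Rightarrow> real) \<Rightarrow> nat \<Rightarrow> nat \<Rightarrow> ereal" where
  "lambda0 M A d d0 =
     (if d0 = d then 0
      else Max ((\<lambda>j. limsup (\<lambda>n. ereal (\<integral>w. A n j w \<partial>M))) ` {d0<..d}))"

definition assumption_B ::
  "'w measure \<Rightarrow> (nat \<Rightarrow> nat \<Rightarrow> 'w \<Rightarrow> real) \<Rightarrow> nat \<Rightarrow> nat \<Rightarrow> real \<Rightarrow> (nat \<Rightarrow> real) \<Rightarrow> bool" where
  "assumption_B M A d d0 m q \<longleftrightarrow>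
     (\<forall>n\<ge>1. \<forall>j\<in>{1..d0}. (\<integral>w. A n j w \<partial>M) = (\<integral>w. A n 1 w \<partial>M)) \<and>
     (\<lambda>n. \<integral>w. A n 1 w \<partial>M) \<longlonglongrightarrow> m \<and>
     lambda0 M A d d0 < ereal m \<and>
     (\<forall>j\<in>{1..d0}. (\<lambda>n. \<integral>w. (A n j w)\<^sup>2 \<partial>M) \<longlonglongrightarrow> q j)"

definition urn_Zlim ::
  "(nat \<Rightarrow> nat \<Rightarrow> 'w \<Rightarrow> real) \<Rightarrow> (nat \<Rightarrow> nat \<Rightarrow> 'w \<Rightarrow> real) \<Rightarrow> (nat \<Rightarrow> real) \<Rightarrow> nat \<Rightarrow> nat \<Rightarrow> 'w \<Rightarrow> real" where
  "urn_Zlim X A a d j w = lim (\<lambda>n. urn_Z X A a d n j w)"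

definition Mstar :: "(nat \<Rightarrow> nat \<Rightarrow> 'w \<Rightarrow> real) \<Rightarrow> nat \<Rightarrow> nat \<Rightarrow> nat \<Rightarrow> 'w \<Rightarrow> real" where
  "Mstar X d0 n j w = (\<Sum>k=1..n. X k j w) / (1 + (\<Sum>k=1..n. \<Sum>i=1..d0. X k i w))"

definition Zstar ::
  "(nat \<Rightarrow> nat \<Rightarrow> 'w \<Rightarrow> real) \<Rightarrow> (nat \<Rightarrow> nat \<Rightarrow> 'w \<Rightarrow> real) \<Rightarrow> (nat \<Rightarrow> real) \<Rightarrow> nat \<Rightarrow> nat \<Rightarrow> nat \<Rightarrow> 'w \<Rightarrow> real" where
  "Zstar X A a d0 n j w = urn_N X A a n j w / (\<Sum>i=1..d0. urn_N X A a n i w)"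

definition Cstar ::
  "(nat \<Rightarrow> nat \<Rightarrow> 'w \<Rightarrow> real) \<Rightarrow> (nat \<Rightarrow> nat \<Rightarrow> 'w \<Rightarrow> real) \<Rightarrow> (nat \<Rightarrow> real) \<Rightarrow> nat \<Rightarrow> nat \<Rightarrow> nat \<Rightarrow> 'w \<Rightarrow> real" where
  "Cstar X A a d0 n j w = sqrt (real n) * (Mstar X d0 n j w - Zstar X A a d0 n j w)"

definition Dstar ::
  "(nat \<Rightarrow> nat \<Rightarrow> 'w \<Rightarrow> real) \<Rightarrow> (nat \<Rightarrow> nat \<Rightarrow> 'w \<Rightarrow> real) \<Rightarrow> (nat \<Rightarrow> real) \<Rightarrow>
     nat \<Rightarrow> nat \<Rightarrow> nat \<Rightarrow> nat \<Rightarrow> 'w \<Rightarrow> real" where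
  "Dstar X A a d d0 n j w = sqrt (real n) * (Zstar X A a d0 n j w - urn_Zlim X A a d j w)"

definition urn_V ::
  "(nat \<Rightarrow> nat \<Rightarrow> 'w \<Rightarrow> real) \<Rightarrow> (nat \<Rightarrow> nat \<Rightarrow> 'w \<Rightarrow> real) \<Rightarrow> (nat \<Rightarrow> real) \<Rightarrow> nat \<Rightarrow> nat \<Rightarrow>
     real \<Rightarrow> (nat \<Rightarrow> real) \<Rightarrow> nat \<Rightarrow> 'w \<Rightarrow> real" where
  "urn_V X A a d d0 m q j w =
     (let Z = (\<lambda>i. urn_Zlim X A a d i w)
      in Z j / m\<^sup>2 * (q j * (1 - Z j)\<^sup>2 + Z j * (\<Sum>i\<in>{1..d0} - {j}. q i * Z i)))"

definition urn_U ::
  "(nat \<Rightarrow> nat \<Rightarrow> 'w \<Rightarrow> real) \<Rightarrow> (nat \<Rightarrow> nat \<Rightarrow> 'w \<Rightarrow> real) \<Rightarrow> (nat \<Rightarrow> real) \<Rightarrow> nat \<Rightarrow> nat \<Rightarrow>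
     real \<Rightarrow> (nat \<Rightarrow> real) \<Rightarrow> nat \<Rightarrow> 'w \<Rightarrow> real" where
  "urn_U X A a d d0 m q j w =
     urn_V X A a d d0 m q j w - urn_Zlim X A a d j w * (1 - urn_Zlim X A a d j w)"

end

theory Submission
  imports Defs
begin

text \<open>Write \<open>S\<close> and \<open>R\<close> for the total weights of the first \<open>d0\<close> and of the remaining colors. Once
  \<open>S\<close> is large, \<open>R / S\<close> is a supermartingale with negative drift, so by Ville's inequality it
  vanishes almost surely and \<open>S / n \<longlonglongrightarrow> m\<close>. Up to errors of order \<open>1 / n\<^sup>2\<close>, \<open>Z\<^sup>*\<close> is then a martingale, and
  both \<open>C\<^sup>*\<close> and \<open>D\<^sup>*\<close> are, up to negligible terms, weighted sums of bounded martingale differences,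
  whose conditional variances converge almost surely. In a block of such differences starting at time
  \<open>l\<close>, freezing the conditional variance at its value at time \<open>l\<close> lets the conditional characteristic
  function telescope; this gives the central limit theorem tested against weights measurable at time \<open>l\<close>,
  hence convergence in the strong sense. For \<open>D\<^sup>*\<close> the block is \<open>[n, n\<^sup>2)\<close>, for \<open>C\<^sup>*\<close> it is
  \<open>[sqrt n, n)\<close>. Since \<open>D\<^sup>*\<close> is asymptotically independent of \<open>\<G>\<^sub>n\<close> given its variance
  and \<open>C\<^sup>*\<close> is \<open>\<G>\<^sub>n\<close>-measurable, product test functions factor in the limit, and
  Stone--Weierstrass extends this to all bounded continuous functions of the pair.\<close>

section \<open>Gaussian laws and a weighted Levy continuity theorem\<close>

text \<open>The limit variances \<open>urn_U\<close> and \<open>urn_V\<close> are random, so there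
  is no single limit law, and Levy's theorem, which speaks of fixed probability measures, does not
  apply directly. Both modes of convergence are therefore reduced to one kind of statement: the
  expectation of \<open>s n * (f (Y n) - E f(N(0, V)))\<close> tends to 0 for bounded weights
  \<open>s n\<close> that may change with \<open>n\<close>. A signed weight becomes a probability
  density by passing to \<open>2 + s n\<close> and normalising. Weights measurable at time
  \<open>n\<close> yield the strong sense, because the sign of a conditional expectation is such a
  weight; approximation of arbitrary events yields the stable sense. Blocks must start at times
  tending to infinity, so that freezing the variance costs little in \<open>L1\<close>: hence the
  lower end \<open>sqrt n\<close> for C*, where the omitted initial piece has variance of order
  \<open>sqrt n / n\<close>, and the upper end \<open>n^2\<close> for D*, where the omitted tail has
  variance of order \<open>n / n^2\<close>. The limits of \<open>n / S\<close> and
  \<open>K / S\<close> come without a deterministic rate, so their boundedness is enforced by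
  truncation at \<open>2 / m\<close>.\<close>

lemma gauss_zero_eq_distr:
  "gauss 0 v = distr std_normal_distribution borel (\<lambda>x. sqrt (max 0 v) * x)"
proof (cases "0 < v")
  case True
  interpret N: prob_space std_normal_distribution
    by (rule prob_space_normal_density) simp
  have "distributed std_normal_distribution lborel (\<lambda>x. x) (normal_density 0 1)"
    by (simp add: distributed_def distr_id2)
  from N.normal_density_affine[OF this, of "sqrt v" 0] True
  have "distributed std_normal_distribution lborel (\<lambda>x. sqrt v * x) (normal_density 0 (sqrt v))"
    by simp
  then have "distr std_normal_distribution lborel (\<lambda>x. sqrt v * x)
      = density lborel (\<lambda>x. ennreal (normal_density 0 (sqrt v) x))"
    by (simp add: distributed_def)
  moreover have "distr std_normal_distribution lborel (\<lambda>x. sqrt v * x) =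
     distr std_normal_distribution borel (\<lambda>x. sqrt v * x)"
    by (rule distr_cong) auto
  ultimately show ?thesis using True by (simp add: gauss_def)
next
  case False
  interpret N: prob_space std_normal_distribution
    by (rule prob_space_normal_density) simp
  have "distr std_normal_distribution borel (\<lambda>x. 0 :: real) = return borel 0"
    by (rule N.distr_const) simp
  moreover from False have "sqrt (max 0 v) = 0" by simp
  ultimately show ?thesis using False by (simp only: gauss_def if_False mult_zero_left)
qed

lemma prob_space_std_normal: "prob_space std_normal_distribution"
  by (rule prob_space_normal_density) simp

lemma prob_space_gauss: "prob_space (gauss 0 v)"
  unfolding gauss_zero_eq_distr by (intro prob_space.prob_space_distr prob_space_std_normal) simp

lemma sets_gauss [simp, measurable_cong]: "sets (gauss 0 v) = sets borel"
  unfolding gauss_zero_eq_distr by simp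

lemma space_gauss [simp]: "space (gauss 0 v) = UNIV"
  unfolding gauss_zero_eq_distr by simp

lemma integral_gauss:
  fixes f :: "real \<Rightarrow> 'b::{banach, second_countable_topology}"
  assumes "f \<in> borel_measurable borel"
  shows "(\<integral>x. f x \<partial>gauss 0 v) = (\<integral>x. f (sqrt (max 0 v) * x) \<partial>std_normal_distribution)"
  unfolding gauss_zero_eq_distr by (rule integral_distr) (use assms in auto)

lemma char_gauss: "(CLINT x|gauss 0 v. iexp (t * x)) = of_real (exp (- (t\<^sup>2 * max 0 v / 2)))"
proof -
  have "(CLINT x|gauss 0 v. iexp (t * x))
      = (CLINT x|std_normal_distribution. iexp ((t * sqrt (max 0 v)) * x))"
    by (subst integral_gauss) (auto simp: mult.assoc)
  also have "\<dots> = char std_normal_distribution (t * sqrt (max 0 v))"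
    by (simp add: char_def)
  also have "\<dots> = of_real (exp (- (t\<^sup>2 * max 0 v / 2)))"
    by (simp add: char_std_normal_distribution power_mult_distrib del: of_real_exp)
  finally show ?thesis .
qed

lemma borel_measurable_integral_gauss:
  fixes f :: "real \<Rightarrow> real"
  assumes [measurable]: "f \<in> borel_measurable borel"
  shows "(\<lambda>v. \<integral>x. f x \<partial>gauss 0 v) \<in> borel_measurable borel"
proof -
  interpret N: prob_space std_normal_distribution by (rule prob_space_std_normal)
  show ?thesis
    unfolding integral_gauss[OF assms] by measurable
qed

lemma abs_integral_gauss_le:
  fixes f :: "real \<Rightarrow> real"
  assumes [measurable]: "f \<in> borel_measurable borel" and B: "\<And>x. \<bar>f x\<bar> \<le> B"
  shows "\<bar>\<integral>x. f x \<partial>gauss 0 v\<bar> \<le> B"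
proof -
  interpret prob_space "gauss 0 v" by (rule prob_space_gauss)
  have "0 \<le> B" using B[of 0] by linarith
  have [simp]: "integrable (gauss 0 v) f"
    by (rule integrable_const_bound[where B = B]) (use B in auto)
  have "\<bar>\<integral>x. f x \<partial>gauss 0 v\<bar> \<le> (\<integral>x. \<bar>f x\<bar> \<partial>gauss 0 v)"
    by (rule integral_abs_bound)
  also have "\<dots> \<le> (\<integral>x. B \<partial>gauss 0 v)" by (rule integral_mono) (use B in auto)
  finally show ?thesis using prob_space by simp
qed

text \<open>Through the scaling \<open>sqrt (max 0 v)\<close> the parameter moves into the argument
  of \<open>f\<close>, where dominated convergence applies; the degenerate law at
  \<open>v = 0\<close> is covered by the same formula.\<close>

lemma isCont_integral_gauss:
  fixes f :: "real \<Rightarrow> real"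
  assumes f: "continuous_on UNIV f" and B: "\<And>x. \<bar>f x\<bar> \<le> B"
  shows "isCont (\<lambda>v. \<integral>x. f x \<partial>gauss 0 v) v"
proof -
  interpret N: prob_space std_normal_distribution by (rule prob_space_std_normal)
  have [measurable]: "f \<in> borel_measurable borel" using f by (rule borel_measurable_continuous_onI)
  have c: "isCont f x" for x using f continuous_on_eq_continuous_at by blast
  show ?thesis
    unfolding continuous_at_sequentially o_def
  proof (intro allI impI)
    fix u assume u: "u \<longlonglongrightarrow> v"
    have "(\<lambda>n. \<integral>x. f (sqrt (max 0 (u n)) * x) \<partial>std_normal_distribution)
        \<longlonglongrightarrow> (\<integral>x. f (sqrt (max 0 v) * x) \<partial>std_normal_distribution)"
    proof (rule integral_dominated_convergence[where w = "\<lambda>_. B"])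
      show "AE x in std_normal_distribution.
          (\<lambda>n. f (sqrt (max 0 (u n)) * x)) \<longlonglongrightarrow> f (sqrt (max 0 v) * x)"
        by (intro AE_I2 isCont_tendsto_compose[OF c] tendsto_intros u)
    qed (use B in auto)
    then show "(\<lambda>n. \<integral>x. f x \<partial>gauss 0 (u n)) \<longlonglongrightarrow> (\<integral>x. f x \<partial>gauss 0 v)"
      by (simp add: integral_gauss)
  qed
qed

text \<open>Compactness comes from \<nu>: a subsequence along which the difference stays large has a
  further subsequence with \<nu> converging weakly to some \<open>L\<close>. Along it the
  characteristic functions of \<mu> tend to that of \<open>L\<close> as well, so Levy's theorem
  gives both the same limit. The full sequences may well diverge.\<close>

lemma char_diff_imp_integral_diff:
  fixes f :: "real \<Rightarrow> real"
  assumes \<mu>: "\<And>n. real_distribution (\<mu> n)" and \<nu>: "tight \<nu>"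
    and char: "\<And>t. (\<lambda>n. char (\<mu> n) t - char (\<nu> n) t) \<longlonglongrightarrow> 0"
    and f: "continuous_on UNIV f" and B: "\<And>x. \<bar>f x\<bar> \<le> B"
  shows "(\<lambda>n. (\<integral>x. f x \<partial>\<mu> n) - (\<integral>x. f x \<partial>\<nu> n)) \<longlonglongrightarrow> 0"
proof (rule LIMSEQ_I, rule ccontr)
  fix e :: real assume e: "e > 0"
  let ?d = "\<lambda>n. (\<integral>x. f x \<partial>\<mu> n) - (\<integral>x. f x \<partial>\<nu> n)"
  have c: "isCont f x" for x using f continuous_on_eq_continuous_at by blast
  assume "\<not> (\<exists>no. \<forall>n\<ge>no. norm (?d n - 0) < e)"
  then have "\<exists>\<^sub>\<infinity>n. norm (?d n) \<ge> e"
    unfolding INFM_nat_le by (auto simp: not_less)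
  then have "infinite {n. norm (?d n) \<ge> e}" by (simp add: frequently_cofinite)
  from infinite_enumerate[OF this] obtain s :: "nat \<Rightarrow> nat"
    where s: "strict_mono s" "\<And>n. norm (?d (s n)) \<ge> e" by auto
  from tight_imp_convergent_subsubsequence[OF \<nu> s(1)] obtain r L
    where r: "strict_mono (r :: nat \<Rightarrow> nat)" and L: "real_distribution L"
      and w: "weak_conv_m (\<nu> \<circ> s \<circ> r) L" by blast
  have \<nu>': "real_distribution (\<nu> n)" for n using \<nu> by (auto simp: tight_def)
  have sr: "strict_mono (s \<circ> r)" by (rule strict_mono_o[OF s(1) r])
  have cL: "(\<lambda>n. char (\<nu> (s (r n))) t) \<longlonglongrightarrow> char L t" for t
    using levy_continuity1[OF _ L w, of t] \<nu>' by (simp add: o_def)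
  have cd: "(\<lambda>n. char (\<mu> (s (r n))) t - char (\<nu> (s (r n))) t) \<longlonglongrightarrow> 0" for t
    using LIMSEQ_subseq_LIMSEQ[OF char sr] by (simp add: o_def)
  have "(\<lambda>n. char (\<mu> (s (r n))) t) \<longlonglongrightarrow> char L t" for t
    using tendsto_add[OF cd[of t] cL[of t]] by simp
  then have w2: "weak_conv_m (\<lambda>n. \<mu> (s (r n))) L"
    by (intro levy_continuity \<mu> L)
  have "(\<lambda>n. \<integral>x. f x \<partial>\<nu> (s (r n))) \<longlonglongrightarrow> (\<integral>x. f x \<partial>L)"
    using weak_conv_imp_integral_bdd_continuous_conv[OF _ L w c, of B] \<nu>' B by (simp add: o_def)
  moreover have "(\<lambda>n. \<integral>x. f x \<partial>\<mu> (s (r n))) \<longlonglongrightarrow> (\<integral>x. f x \<partial>L)"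
    using weak_conv_imp_integral_bdd_continuous_conv[OF \<mu> L w2 c, of B] B by simp
  ultimately have "(\<lambda>n. ?d (s (r n))) \<longlonglongrightarrow> (\<integral>x. f x \<partial>L) - (\<integral>x. f x \<partial>L)"
    by (intro tendsto_diff)
  then have "\<forall>\<^sub>F n in sequentially. dist (?d (s (r n))) 0 < e" using e by (simp add: tendsto_iff)
  then obtain n where "norm (?d (s (r n))) < e"
    unfolding eventually_sequentially dist_norm by auto
  with s(2)[of "r n"] show False by simp
qed

lemma measure_atLeast_tendsto_1:
  fixes \<nu> :: "real measure"
  assumes "real_distribution \<nu>" "e > 0"
  obtains K where "K > 0" "measure \<nu> {-K<..K} > 1 - e"
proof -
  interpret real_distribution \<nu> by fact
  have "eventually (\<lambda>x. cdf \<nu> x > 1 - e / 2) at_top"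
    by (rule order_tendstoD(1)[OF cdf_lim_at_top_prob]) (use assms in auto)
  moreover have "eventually (\<lambda>x. cdf \<nu> (- x) < e / 2) at_top"
    using order_tendstoD(2)[OF cdf_lim_at_bot, of "e / 2"] assms
    by (simp add: at_bot_mirror eventually_filtermap)
  moreover have "eventually (\<lambda>x::real. x > 0) at_top" by (rule eventually_gt_at_top)
  ultimately have "eventually (\<lambda>x. cdf \<nu> x > 1 - e / 2 \<and> cdf \<nu> (- x) < e / 2 \<and> x > 0) at_top"
    by eventually_elim auto
  then obtain K where K: "cdf \<nu> K > 1 - e / 2" "cdf \<nu> (- K) < e / 2" "K > 0"
    by (auto simp: eventually_at_top_linorder)
  have "cdf \<nu> K - cdf \<nu> (- K) = measure \<nu> {-K<..K}"
    using K by (intro cdf_diff_eq) auto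
  with K that[of K] show ?thesis by linarith
qed

text \<open>Fubini: a Gaussian law with random variance \<open>V\<close> is the law of
  \<open>sqrt V\<close> times a standard normal coordinate that is independent of \<open>M\<close>
  on the product space. This turns the mixture into an image measure.\<close>

lemma (in prob_space) integral_mult_gauss:
  fixes f :: "real \<Rightarrow> 'b::{banach, second_countable_topology}" and g V :: "'a \<Rightarrow> real"
  assumes [measurable]: "f \<in> borel_measurable borel" "g \<in> borel_measurable M" "V \<in> borel_measurable M"
    and f: "\<And>x. norm (f x) \<le> B" and g: "\<And>w. w \<in> space M \<Longrightarrow> \<bar>g w\<bar> \<le> C"
  shows "(\<integral>p. g (fst p) *\<^sub>R f (sqrt (max 0 (V (fst p))) * snd p) \<partial>(M \<Otimes>\<^sub>M std_normal_distribution))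
    = (\<integral>w. g w *\<^sub>R (\<integral>x. f x \<partial>gauss 0 (V w)) \<partial>M)"
proof -
  interpret N: prob_space std_normal_distribution by (rule prob_space_std_normal)
  interpret P: pair_prob_space M std_normal_distribution ..
  have "0 \<le> B" using f[of 0] norm_ge_zero order_trans by blast
  have "0 \<le> C" using g not_empty abs_ge_zero order_trans by blast
  have "integrable (M \<Otimes>\<^sub>M std_normal_distribution)
      (\<lambda>p. g (fst p) *\<^sub>R f (sqrt (max 0 (V (fst p))) * snd p))"
  proof (rule P.integrable_const_bound[where B = "C * B"])
    show "AE p in M \<Otimes>\<^sub>M std_normal_distribution.
        norm (g (fst p) *\<^sub>R f (sqrt (max 0 (V (fst p))) * snd p)) \<le> C * B"
      using f g \<open>0 \<le> C\<close> by (intro AE_I2) (auto simp: space_pair_measure intro!: mult_mono)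
  qed measurable
  from P.integral_fst'[OF this]
  show ?thesis by (simp add: integral_gauss)
qed

text \<open>A signed weight is no density, but \<open>2 + s n\<close> lies between 1 and 3. Divided
  by its mean \<open>c n\<close> it tilts \<open>M\<close> to a probability measure, and the law of
  \<open>Y n\<close> under the tilt is compared with the tilted Gaussian mixture. The hypotheses on
  characteristic functions enter in the combination of twice the unweighted and once the weighted
  term, which is also the form of the conclusion.\<close>

lemma (in prob_space) weighted_levy_aux:
  fixes s Y :: "nat \<Rightarrow> 'a \<Rightarrow> real" and V :: "'a \<Rightarrow> real" and f :: "real \<Rightarrow> real"
  assumes [measurable]: "\<And>n. s n \<in> borel_measurable M" "\<And>n. Y n \<in> borel_measurable M"
      "V \<in> borel_measurable M"
    and s: "\<And>n w. w \<in> space M \<Longrightarrow> \<bar>s n w\<bar> \<le> 1"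
    and sY: "\<And>t. (\<lambda>n. \<integral>w. of_real (s n w) * (iexp (t * Y n w) - of_real (exp (- (t\<^sup>2 * max 0 (V w) / 2)))) \<partial>M) \<longlonglongrightarrow> 0"
    and Y: "\<And>t. (\<lambda>n. \<integral>w. iexp (t * Y n w) - of_real (exp (- (t\<^sup>2 * max 0 (V w) / 2))) \<partial>M) \<longlonglongrightarrow> 0"
    and f: "continuous_on UNIV f" and B: "\<And>x. \<bar>f x\<bar> \<le> B"
  shows "(\<lambda>n. 2 * (\<integral>w. f (Y n w) - (\<integral>x. f x \<partial>gauss 0 (V w)) \<partial>M)
    + (\<integral>w. s n w * (f (Y n w) - (\<integral>x. f x \<partial>gauss 0 (V w))) \<partial>M)) \<longlonglongrightarrow> 0"
proof -
  interpret N: prob_space std_normal_distribution by (rule prob_space_std_normal)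
  interpret P: pair_prob_space M std_normal_distribution ..
  have [measurable]: "f \<in> borel_measurable borel" using f by (rule borel_measurable_continuous_onI)
  have int_s [simp]: "integrable M (s n)" for n
    by (rule integrable_const_bound[where B = 1]) (use s in auto)
  define c where "c n = (\<integral>w. 2 + s n w \<partial>M)" for n
  have c1: "1 \<le> c n" for n
  proof -
    have "(\<integral>w. 1 \<partial>M) \<le> c n" unfolding c_def
    proof (rule integral_mono)
      show "1 \<le> 2 + s n w" if "w \<in> space M" for w using s[OF that, of n] by linarith
    qed auto
    then show ?thesis by (simp add: prob_space)
  qed
  have c3: "c n \<le> 3" for n
  proof -
    have "c n \<le> (\<integral>w. 3 \<partial>M)" unfolding c_def
    proof (rule integral_mono)
      show "2 + s n w \<le> 3" if "w \<in> space M" for w using s[OF that, of n] by linarith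
    qed auto
    then show ?thesis by (simp add: prob_space)
  qed
  define g where "g n w = (2 + s n w) / c n" for n w
  have [measurable]: "g n \<in> borel_measurable M" for n unfolding g_def by simp
  have g0: "0 \<le> g n w" and g3: "g n w \<le> 3" if "w \<in> space M" for n w
  proof -
    have "0 < c n" using c1[of n] by linarith
    then show "0 \<le> g n w" "g n w \<le> 3"
      using s[OF that, of n] c1[of n] by (auto simp: g_def pos_divide_le_eq abs_le_iff)
  qed
  have int_g: "(\<integral>w. g n w \<partial>M) = 1" for n
  proof -
    have "(\<integral>w. g n w \<partial>M) = c n / c n"
      unfolding g_def by (subst (2) c_def) simp
    with c1[of n] show ?thesis by simp
  qed
  have g_int [simp]: "integrable M (g n)" for n
    by (rule integrable_const_bound[where B = 3]) (use g0 g3 in auto)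
  define R where "R n = density M (g n)" for n
  \<comment> \<open>The tilted mixture: the density acts on the first factor only, so under
    \<open>Q n\<close> the second coordinate is still standard normal and independent of the
    first.\<close>
  define Q where "Q n = density (M \<Otimes>\<^sub>M std_normal_distribution) (\<lambda>p. g n (fst p))" for n
  have R: "prob_space (R n)" for n
  proof
    have "emeasure (R n) (space (R n)) = (\<integral>\<^sup>+w. ennreal (g n w) \<partial>M)"
      unfolding R_def by (subst emeasure_density) (auto intro!: nn_integral_cong)
    also have "\<dots> = ennreal (\<integral>w. g n w \<partial>M)"
      by (rule nn_integral_eq_integral) (use g0 in auto)
    finally show "emeasure (R n) (space (R n)) = 1" by (simp add: int_g)
  qed
  define S where "S p = sqrt (max 0 (V (fst p))) * snd p" for p
  have [measurable]: "S \<in> borel_measurable (M \<Otimes>\<^sub>M std_normal_distribution)"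
    unfolding S_def by measurable
  have Q: "prob_space (Q n)" for n
  proof
    have "emeasure (Q n) (space (Q n)) = (\<integral>\<^sup>+p. ennreal (g n (fst p)) \<partial>(M \<Otimes>\<^sub>M std_normal_distribution))"
      unfolding Q_def space_density
      by (subst emeasure_density[OF _ sets.top]) (auto intro!: nn_integral_cong)
    also have "\<dots> = (\<integral>\<^sup>+w. ennreal (g n w) \<partial>M)"
      using N.emeasure_space_1 by (subst N.nn_integral_fst[symmetric]) auto
    also have "\<dots> = ennreal (\<integral>w. g n w \<partial>M)"
      by (rule nn_integral_eq_integral) (use g0 in auto)
    finally show "emeasure (Q n) (space (Q n)) = 1" by (simp add: int_g)
  qed
  define \<mu> where "\<mu> n = distr (R n) borel (Y n)" for n
  define \<nu> where "\<nu> n = distr (Q n) borel S" for n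
  have YR [measurable]: "Y n \<in> borel_measurable (R n)" and SQ [measurable]: "S \<in> borel_measurable (Q n)" for n
    unfolding R_def Q_def by simp_all
  have \<mu>: "real_distribution (\<mu> n)" for n
    unfolding \<mu>_def by (intro prob_space.real_distribution_distr R) simp
  have \<nu>: "real_distribution (\<nu> n)" for n
    unfolding \<nu>_def by (intro prob_space.real_distribution_distr Q) simp
  have int_\<mu>: "(\<integral>x. h x \<partial>\<mu> n) = (\<integral>w. g n w *\<^sub>R h (Y n w) \<partial>M)"
    if [measurable]: "h \<in> borel_measurable borel" for h :: "real \<Rightarrow> 'c::{banach, second_countable_topology}" and n
  proof -
    have "(\<integral>x. h x \<partial>\<mu> n) = (\<integral>w. h (Y n w) \<partial>R n)"
      unfolding \<mu>_def by (rule integral_distr) auto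
    also have "\<dots> = (\<integral>w. g n w *\<^sub>R h (Y n w) \<partial>M)"
      unfolding R_def by (rule integral_density) (use g0 in auto)
    finally show ?thesis .
  qed
  have int_\<nu>: "(\<integral>x. h x \<partial>\<nu> n) = (\<integral>w. g n w *\<^sub>R (\<integral>x. h x \<partial>gauss 0 (V w)) \<partial>M)"
    if [measurable]: "h \<in> borel_measurable borel" and b: "\<And>x. norm (h x) \<le> D"
    for h :: "real \<Rightarrow> 'c::{banach, second_countable_topology}" and n D
  proof -
    have "(\<integral>x. h x \<partial>\<nu> n) = (\<integral>p. h (S p) \<partial>Q n)"
      unfolding \<nu>_def by (rule integral_distr) auto
    also have "\<dots> = (\<integral>p. g n (fst p) *\<^sub>R h (S p) \<partial>(M \<Otimes>\<^sub>M std_normal_distribution))"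
      unfolding Q_def by (rule integral_density) (use g0 in \<open>auto simp: space_pair_measure\<close>)
    also have "\<dots> = (\<integral>w. g n w *\<^sub>R (\<integral>x. h x \<partial>gauss 0 (V w)) \<partial>M)"
      unfolding S_def by (rule integral_mult_gauss[where B = D and C = 3]) (use b g0 g3 in auto)
    finally show ?thesis .
  qed
  \<comment> \<open>As the tilting density is at most 3, an interval that misses mass less than
    \<open>e / 3\<close> under the untilted mixture misses less than \<open>e\<close> for every
    \<open>n\<close> at once.\<close>
  have tight: "tight \<nu>"
    unfolding tight_def
  proof (intro conjI allI impI \<nu>)
    fix e :: real assume "e > 0"
    let ?D = "distr (M \<Otimes>\<^sub>M std_normal_distribution) borel S"
    have D: "real_distribution ?D" by (intro P.real_distribution_distr) simp
    obtain K where K: "K > 0" "measure ?D {-K<..K} > 1 - e / 3"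
      using measure_atLeast_tendsto_1[OF D, of "e / 3"] \<open>e > 0\<close> by auto
    interpret D: real_distribution ?D by fact
    have KD: "measure ?D (- {-K<..K}) < e / 3"
      using K(2) D.prob_compl[of "{-K<..K}"] by (simp add: Compl_eq_Diff_UNIV)
    have "measure (\<nu> n) {-K<..K} > 1 - e" for n
    proof -
      interpret nu: real_distribution "\<nu> n" by (rule \<nu>)
      have "measure (\<nu> n) (- {-K<..K}) = (\<integral>x. indicator (- {-K<..K}) x \<partial>\<nu> n)"
        by simp
      also have "\<dots> = (\<integral>p. indicator (- {-K<..K}) (S p) \<partial>Q n)"
        unfolding \<nu>_def by (rule integral_distr) auto
      also have "\<dots> = (\<integral>p. g n (fst p) *\<^sub>R indicator (- {-K<..K}) (S p) \<partial>(M \<Otimes>\<^sub>M std_normal_distribution))"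
        unfolding Q_def by (rule integral_density) (use g0 in \<open>auto simp: space_pair_measure\<close>)
      also have "\<dots> \<le> (\<integral>p. 3 * indicator (- {-K<..K}) (S p) \<partial>(M \<Otimes>\<^sub>M std_normal_distribution))"
      proof (rule integral_mono)
        show "integrable (M \<Otimes>\<^sub>M std_normal_distribution) (\<lambda>p. g n (fst p) *\<^sub>R indicator (- {-K<..K}) (S p) :: real)"
          by (rule P.integrable_const_bound[where B = 3])
             (use g0 g3 in \<open>auto simp: space_pair_measure indicator_def\<close>)
        show "integrable (M \<Otimes>\<^sub>M std_normal_distribution) (\<lambda>p. 3 * indicator (- {-K<..K}) (S p) :: real)"
          by (rule P.integrable_const_bound[where B = 3]) (auto simp: indicator_def)
        show "g n (fst p) *\<^sub>R indicator (- {-K<..K}) (S p) \<le> (3 * indicator (- {-K<..K}) (S p) :: real)"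
          if "p \<in> space (M \<Otimes>\<^sub>M std_normal_distribution)" for p
          using that g3[of "fst p" n] by (auto simp: space_pair_measure indicator_def)
      qed
      also have "\<dots> = 3 * (\<integral>p. indicator (- {-K<..K}) (S p) \<partial>(M \<Otimes>\<^sub>M std_normal_distribution))"
        by simp
      also have "(\<integral>p. indicator (- {-K<..K}) (S p) \<partial>(M \<Otimes>\<^sub>M std_normal_distribution)) = (\<integral>x. (indicator (- {-K<..K}) x :: real) \<partial>?D)"
        by (subst integral_distr) auto
      also have "\<dots> = measure ?D (- {-K<..K})"
        by simp
      finally have "measure (\<nu> n) (- {-K<..K}) < e" using KD by simp
      then show ?thesis using nu.prob_compl[of "{-K<..K}"] by (simp add: Compl_eq_Diff_UNIV)
    qed
    with K show "\<exists>a b. a < b \<and> (\<forall>n. 1 - e < measure (\<nu> n) {a<..b})"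
      by (intro exI[of _ "-K"] exI[of _ K]) auto
  qed
  \<comment> \<open>Both integrals carry the same density, so only \<open>a - b\<close> appears,
    once with factor 2 and once with \<open>s n\<close>, and the normalisation factors out. Stated
    for general values because it serves \<open>iexp\<close> as well as \<open>f\<close>.\<close>
  have key: "(\<integral>w. g n w *\<^sub>R a n w \<partial>M) - (\<integral>w. g n w *\<^sub>R b w \<partial>M)
      = (1 / c n) *\<^sub>R (2 *\<^sub>R (\<integral>w. a n w - b w \<partial>M) + (\<integral>w. s n w *\<^sub>R (a n w - b w) \<partial>M))"
    if [measurable]: "a n \<in> borel_measurable M" "b \<in> borel_measurable M"
      and a: "\<And>w. norm (a n w) \<le> D" and b: "\<And>w. norm (b w) \<le> D"
    for a :: "nat \<Rightarrow> 'a \<Rightarrow> 'c::{banach, second_countable_topology}" and b n and D :: real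
  proof -
    have "0 \<le> D" using a norm_ge_zero order_trans by blast
    have ia [simp]: "integrable M (a n)" "integrable M b"
      using a b by (auto intro!: integrable_const_bound[where B = D])
    have ig: "integrable M (\<lambda>w. g n w *\<^sub>R a n w)" "integrable M (\<lambda>w. g n w *\<^sub>R b w)"
      using a b g0 g3 \<open>0 \<le> D\<close>
      by (auto intro!: integrable_const_bound[where B = "3 * D"] AE_I2 mult_mono)
    have sD: "\<bar>s n w\<bar> * norm x \<le> D" if "norm x \<le> D" "w \<in> space M" for w and x :: 'c
      using mult_mono[OF s[OF that(2), of n] that(1)] by simp
    have sm: "integrable M (\<lambda>w. s n w *\<^sub>R a n w)" "integrable M (\<lambda>w. s n w *\<^sub>R b w)"
      using a b sD by (auto intro!: integrable_const_bound[where B = D] AE_I2)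
    have "(\<integral>w. g n w *\<^sub>R a n w \<partial>M) - (\<integral>w. g n w *\<^sub>R b w \<partial>M)
        = (\<integral>w. g n w *\<^sub>R a n w - g n w *\<^sub>R b w \<partial>M)"
      using ig by simp
    also have "\<dots> = (\<integral>w. (1 / c n) *\<^sub>R (2 *\<^sub>R (a n w - b w) + s n w *\<^sub>R (a n w - b w)) \<partial>M)"
      by (rule Bochner_Integration.integral_cong) (auto simp: g_def algebra_simps add_divide_distrib)
    also have "\<dots> = (1 / c n) *\<^sub>R (2 *\<^sub>R (\<integral>w. a n w - b w \<partial>M) + (\<integral>w. s n w *\<^sub>R (a n w - b w) \<partial>M))"
      using sm by (simp add: scaleR_diff_right)
    finally show ?thesis .
  qed
  have char: "(\<lambda>n. char (\<mu> n) t - char (\<nu> n) t) \<longlonglongrightarrow> 0" for t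
  proof -
    let ?b = "\<lambda>w. of_real (exp (- (t\<^sup>2 * max 0 (V w) / 2))) :: complex"
    have "char (\<mu> n) t = (\<integral>w. g n w *\<^sub>R iexp (t * Y n w) \<partial>M)" for n
      unfolding char_def by (rule int_\<mu>) simp
    moreover have "char (\<nu> n) t = (\<integral>w. g n w *\<^sub>R ?b w \<partial>M)" for n
      unfolding char_def char_gauss[symmetric] by (rule int_\<nu>[OF _ order_refl[THEN order_trans]]) auto
    moreover have "(\<integral>w. g n w *\<^sub>R iexp (t * Y n w) \<partial>M) - (\<integral>w. g n w *\<^sub>R ?b w \<partial>M)
        = (1 / c n) *\<^sub>R (2 *\<^sub>R (\<integral>w. iexp (t * Y n w) - ?b w \<partial>M)
            + (\<integral>w. s n w *\<^sub>R (iexp (t * Y n w) - ?b w) \<partial>M))" for n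
    proof (rule key)
      show "norm (iexp (t * Y n w)) \<le> 1" "norm (?b w) \<le> 1" for w by simp_all
    qed auto
    ultimately have "char (\<mu> n) t - char (\<nu> n) t
        = (1 / c n) *\<^sub>R (2 *\<^sub>R (\<integral>w. iexp (t * Y n w) - ?b w \<partial>M)
            + (\<integral>w. s n w *\<^sub>R (iexp (t * Y n w) - ?b w) \<partial>M))" for n by simp
    moreover have "(\<lambda>n. (1 / c n) *\<^sub>R (2 *\<^sub>R (\<integral>w. iexp (t * Y n w) - ?b w \<partial>M)
            + (\<integral>w. s n w *\<^sub>R (iexp (t * Y n w) - ?b w) \<partial>M))) \<longlonglongrightarrow> 0"
    proof (rule tendsto_0_le[where K = 1])
      show "(\<lambda>n. 2 *\<^sub>R (\<integral>w. iexp (t * Y n w) - ?b w \<partial>M)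
            + (\<integral>w. s n w *\<^sub>R (iexp (t * Y n w) - ?b w) \<partial>M)) \<longlonglongrightarrow> 0"
        using tendsto_add[OF tendsto_scaleR[OF tendsto_const Y[of t]] sY[of t], of 2]
        by (simp add: scaleR_conv_of_real)
      show "\<forall>\<^sub>F n in sequentially. norm ((1 / c n) *\<^sub>R x n) \<le> norm (x n) * 1" for x :: "nat \<Rightarrow> complex"
      proof (intro always_eventually allI)
        fix n
        have "1 / c n \<le> 1" "0 < c n" using c1[of n] by simp_all
        then show "norm ((1 / c n) *\<^sub>R x n) \<le> norm (x n) * 1"
          using mult_right_mono[of "1 / c n" 1 "norm (x n)"] by simp
      qed
    qed
    ultimately show ?thesis by simp
  qed
  let ?b = "\<lambda>w. \<integral>x. f x \<partial>gauss 0 (V w)"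
  have [measurable]: "?b \<in> borel_measurable M"
    by (rule measurable_compose[OF assms(3) borel_measurable_integral_gauss]) simp
  have fd: "(\<lambda>n. (\<integral>x. f x \<partial>\<mu> n) - (\<integral>x. f x \<partial>\<nu> n)) \<longlonglongrightarrow> 0"
    by (rule char_diff_imp_integral_diff[OF \<mu> tight char f B])
  have bB: "\<bar>?b w\<bar> \<le> B" for w by (rule abs_integral_gauss_le) (use B in auto)
  have "(\<integral>x. f x \<partial>\<mu> n) = (\<integral>w. g n w *\<^sub>R f (Y n w) \<partial>M)" for n
    by (rule int_\<mu>) simp
  moreover have "(\<integral>x. f x \<partial>\<nu> n) = (\<integral>w. g n w *\<^sub>R ?b w \<partial>M)" for n
    by (rule int_\<nu>) (use B in auto)
  moreover have "(\<integral>w. g n w *\<^sub>R f (Y n w) \<partial>M) - (\<integral>w. g n w *\<^sub>R ?b w \<partial>M)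
      = (1 / c n) *\<^sub>R (2 *\<^sub>R (\<integral>w. f (Y n w) - ?b w \<partial>M) + (\<integral>w. s n w *\<^sub>R (f (Y n w) - ?b w) \<partial>M))" for n
  proof (rule key)
    show "norm (f (Y n w)) \<le> B" "norm (?b w) \<le> B" for w using B bB by simp_all
  qed auto
  ultimately have "(\<integral>x. f x \<partial>\<mu> n) - (\<integral>x. f x \<partial>\<nu> n)
      = (1 / c n) *\<^sub>R (2 *\<^sub>R (\<integral>w. f (Y n w) - ?b w \<partial>M) + (\<integral>w. s n w *\<^sub>R (f (Y n w) - ?b w) \<partial>M))" for n
    by simp
  then have eq: "c n * ((\<integral>x. f x \<partial>\<mu> n) - (\<integral>x. f x \<partial>\<nu> n))
      = 2 * (\<integral>w. f (Y n w) - ?b w \<partial>M) + (\<integral>w. s n w * (f (Y n w) - ?b w) \<partial>M)" for n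
    using c1[of n] by (simp add: field_simps)
  have "(\<lambda>n. c n * ((\<integral>x. f x \<partial>\<mu> n) - (\<integral>x. f x \<partial>\<nu> n))) \<longlonglongrightarrow> 0"
  proof (rule tendsto_0_le[OF fd, where K = 3])
    show "\<forall>\<^sub>F n in sequentially. norm (c n * ((\<integral>x. f x \<partial>\<mu> n) - (\<integral>x. f x \<partial>\<nu> n)))
        \<le> norm ((\<integral>x. f x \<partial>\<mu> n) - (\<integral>x. f x \<partial>\<nu> n)) * 3"
    proof (intro always_eventually allI)
      fix n
      have "\<bar>c n\<bar> \<le> 3" using c1[of n] c3[of n] by simp
      then show "norm (c n * ((\<integral>x. f x \<partial>\<mu> n) - (\<integral>x. f x \<partial>\<nu> n)))
          \<le> norm ((\<integral>x. f x \<partial>\<mu> n) - (\<integral>x. f x \<partial>\<nu> n)) * 3"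
        using mult_right_mono[of "\<bar>c n\<bar>" 3 "\<bar>(\<integral>x. f x \<partial>\<mu> n) - (\<integral>x. f x \<partial>\<nu> n)\<bar>"]
        by (simp add: abs_mult mult.commute)
    qed
  qed
  then show ?thesis unfolding eq .
qed

text \<open>The zero weight isolates the doubled unweighted term of the auxiliary statement;
  subtracting it leaves the weighted one.\<close>

lemma (in prob_space) weighted_levy:
  fixes s Y :: "nat \<Rightarrow> 'a \<Rightarrow> real" and V :: "'a \<Rightarrow> real" and f :: "real \<Rightarrow> real"
  assumes meas: "\<And>n. s n \<in> borel_measurable M" "\<And>n. Y n \<in> borel_measurable M"
      "V \<in> borel_measurable M"
    and s: "\<And>n w. w \<in> space M \<Longrightarrow> \<bar>s n w\<bar> \<le> 1"
    and sY: "\<And>t. (\<lambda>n. \<integral>w. of_real (s n w) * (iexp (t * Y n w) - of_real (exp (- (t\<^sup>2 * max 0 (V w) / 2)))) \<partial>M) \<longlonglongrightarrow> 0"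
    and Y: "\<And>t. (\<lambda>n. \<integral>w. iexp (t * Y n w) - of_real (exp (- (t\<^sup>2 * max 0 (V w) / 2))) \<partial>M) \<longlonglongrightarrow> 0"
    and f: "continuous_on UNIV f" and B: "\<And>x. \<bar>f x\<bar> \<le> B"
  shows "(\<lambda>n. \<integral>w. s n w * (f (Y n w) - (\<integral>x. f x \<partial>gauss 0 (V w))) \<partial>M) \<longlonglongrightarrow> 0"
proof -
  have "(\<lambda>n. 2 * (\<integral>w. f (Y n w) - (\<integral>x. f x \<partial>gauss 0 (V w)) \<partial>M)) \<longlonglongrightarrow> 0"
    using weighted_levy_aux[where s = "\<lambda>_ _. 0", OF _ meas(2,3) _ _ Y f B] by simp
  from tendsto_diff[OF weighted_levy_aux[OF meas s sY Y f B] this] show ?thesis by simp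
qed

section \<open>Bounded martingale differences\<close>

lemma (in prob_space) integrable_bounded:
  fixes f :: "'a \<Rightarrow> 'b::{banach, second_countable_topology}"
  assumes "f \<in> borel_measurable M" and "\<And>w. w \<in> space M \<Longrightarrow> norm (f w) \<le> B"
  shows "integrable M f"
  by (rule integrable_const_bound[where B = B]) (use assms in auto)

lemma (in prob_space) abs_expectation_le:
  fixes f :: "'a \<Rightarrow> real"
  assumes "f \<in> borel_measurable M" and "\<And>w. w \<in> space M \<Longrightarrow> \<bar>f w\<bar> \<le> B"
  shows "expectation (\<lambda>w. \<bar>f w\<bar>) \<le> B"
proof -
  have "expectation (\<lambda>w. \<bar>f w\<bar>) \<le> expectation (\<lambda>_. B)"
    by (rule integral_mono) (use assms in \<open>auto intro!: integrable_bounded[where B = B]\<close>)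
  then show ?thesis using prob_space by simp
qed

lemma (in prob_space) expectation_abs_le_sqrt:
  fixes f :: "'a \<Rightarrow> real"
  assumes "integrable M f" "integrable M (\<lambda>w. (f w)\<^sup>2)"
  shows "expectation (\<lambda>w. \<bar>f w\<bar>) \<le> sqrt (expectation (\<lambda>w. (f w)\<^sup>2))"
proof (rule real_le_rsqrt)
  have "0 \<le> variance (\<lambda>w. \<bar>f w\<bar>)" by (rule variance_positive)
  also have "\<dots> = expectation (\<lambda>w. \<bar>f w\<bar>\<^sup>2) - (expectation (\<lambda>w. \<bar>f w\<bar>))\<^sup>2"
    by (rule variance_eq) (use assms in auto)
  finally show "(expectation (\<lambda>w. \<bar>f w\<bar>))\<^sup>2 \<le> expectation (\<lambda>w. (f w)\<^sup>2)" by simp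
qed

text \<open>The intersection lies in events of arbitrarily small probability. For the events that
  some \<open>k >= n\<close> is bad, this says that almost surely only finitely many
  \<open>k\<close> are bad.\<close>

lemma (in prob_space) AE_ex_notin:
  assumes [measurable]: "\<And>n::nat. A n \<in> sets M" and A: "\<And>e. e > 0 \<Longrightarrow> \<exists>n. prob (A n) \<le> e"
  shows "AE w in M. \<exists>n. w \<notin> A n"
proof -
  have "prob (\<Inter>n. A n) \<le> e" if e: "e > 0" for e
  proof -
    obtain n where n: "prob (A n) \<le> e" using A[OF e] by blast
    have "prob (\<Inter>n. A n) \<le> prob (A n)" by (intro finite_measure_mono) auto
    with n show ?thesis by simp
  qed
  then have "prob (\<Inter>n. A n) \<le> 0" by (rule field_le_epsilon[of _ 0, simplified])
  then have "prob (\<Inter>n. A n) = 0" using measure_nonneg[of M "\<Inter>n. A n"] by linarith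
  then have "(\<Inter>n. A n) \<in> null_sets M" by (auto simp: null_sets_def emeasure_eq_measure)
  then show ?thesis by (rule AE_I') auto
qed

lemma cesaro:
  fixes x :: "nat \<Rightarrow> real"
  assumes "x \<longlonglongrightarrow> L"
  shows "(\<lambda>n. (\<Sum>k<n. x k) / real n) \<longlonglongrightarrow> L"
proof (rule LIMSEQ_I)
  fix r :: real assume "r > 0"
  obtain N where N: "\<And>k. k \<ge> N \<Longrightarrow> \<bar>x k - L\<bar> < r / 2"
    using LIMSEQ_D[OF assms, of "r / 2"] \<open>r > 0\<close> by auto
  define D where "D = (\<Sum>k<N. \<bar>x k - L\<bar>)"
  obtain K :: nat where K: "2 * D / r < real K" using reals_Archimedean2 by blast
  have "\<bar>(\<Sum>k<n. x k) / real n - L\<bar> < r" if n: "n \<ge> max (Suc N) K" for n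
  proof -
    have n0: "real n > 0" "N \<le> n" using n by auto
    have "\<bar>\<Sum>k<n. x k - L\<bar> \<le> (\<Sum>k<n. \<bar>x k - L\<bar>)" by (rule sum_abs)
    also have "\<dots> = D + (\<Sum>k\<in>{N..<n}. \<bar>x k - L\<bar>)"
      using sum.atLeastLessThan_concat[of 0 N n "\<lambda>k. \<bar>x k - L\<bar>"] n0(2)
      by (simp add: D_def lessThan_atLeast0)
    also have "(\<Sum>k\<in>{N..<n}. \<bar>x k - L\<bar>) \<le> (\<Sum>k\<in>{N..<n}. r / 2)"
      by (rule sum_mono) (use N in \<open>auto intro: less_imp_le\<close>)
    also have "\<dots> \<le> real n * (r / 2)" using \<open>r > 0\<close> by (simp add: mult_right_mono)
    also have "D < real n * (r / 2)"
      using K n \<open>r > 0\<close> by (simp add: field_simps) (smt (verit) mult_left_mono of_nat_le_iff)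
    finally have "\<bar>\<Sum>k<n. x k - L\<bar> < real n * r" by (simp add: field_simps)
    moreover have "(\<Sum>k<n. x k) / real n - L = (\<Sum>k<n. x k - L) / real n"
      using n0 by (simp add: sum_subtractf field_simps)
    ultimately show ?thesis using n0 by (simp add: abs_divide pos_divide_less_eq mult.commute)
  qed
  then show "\<exists>no. \<forall>n\<ge>no. norm ((\<Sum>k<n. x k) / real n - L) < r"
    by (intro exI[of _ "max (Suc N) K"] allI impI) (simp only: real_norm_def)
qed

text \<open>Abel summation: with \<open>s\<close> the partial sums of \<open>c k / (k + 1)\<close>,
  the sum of the first \<open>n\<close> terms of \<open>c\<close> is \<open>n * s n\<close> minus
  the sum of the earlier values of \<open>s\<close>. Divided by \<open>n\<close>, both parts tend to
  the limit of \<open>s\<close>, the second one by Cesaro.\<close>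

lemma kronecker:
  fixes c :: "nat \<Rightarrow> real"
  assumes "convergent (\<lambda>n. \<Sum>k<n. c k / real (Suc k))"
  shows "(\<lambda>n. (\<Sum>k<n. c k) / real n) \<longlonglongrightarrow> 0"
proof -
  define s where "s n = (\<Sum>k<n. c k / real (Suc k))" for n
  obtain L where L: "s \<longlonglongrightarrow> L" using assms unfolding convergent_def s_def by blast
  have eq: "(\<Sum>k<n. c k) = real n * s n - (\<Sum>k<n. s k)" for n
  proof (induction n)
    case (Suc n)
    have "real (Suc n) * s (Suc n) = real (Suc n) * s n + c n"
      by (simp add: s_def distrib_left del: of_nat_Suc)
    with Suc show ?case by (simp add: algebra_simps)
  qed simp
  have "(\<lambda>n. s n - (\<Sum>k<n. s k) / real n) \<longlonglongrightarrow> L - L"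
    by (intro tendsto_diff L cesaro)
  moreover have "\<forall>\<^sub>F n in sequentially. s n - (\<Sum>k<n. s k) / real n = (\<Sum>k<n. c k) / real n"
    using eventually_gt_at_top[of 0] by eventually_elim (simp add: eq diff_divide_distrib)
  ultimately show ?thesis by (simp add: filterlim_cong)
qed

lemma square_le_of_abs_le: "\<bar>x\<bar> \<le> B \<Longrightarrow> x\<^sup>2 \<le> B\<^sup>2" for x B :: real
  using power_mono[of "\<bar>x\<bar>" B 2] by simp

section \<open>Filtrations, Ville's inequality and convergence of bounded martingale
  differences\<close>

locale filtered_prob_space = prob_space M for M :: "'w measure" +
  fixes F :: "nat \<Rightarrow> 'w measure"
  assumes subalg: "subalgebra M (F n)" and F_mono: "n \<le> k \<Longrightarrow> sets (F n) \<subseteq> sets (F k)"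
begin

lemma space_F [simp]: "space (F n) = space M"
  using subalg[of n] by (simp add: subalgebra_def)

lemma measurable_F [measurable_dest]: "f \<in> measurable (F n) N \<Longrightarrow> f \<in> measurable M N"
  by (rule measurable_from_subalg[OF subalg])

lemma sets_F: "A \<in> sets (F n) \<Longrightarrow> A \<in> sets M"
  using subalg[of n] by (auto simp: subalgebra_def)

lemma measurable_F_mono: "f \<in> measurable (F n) N \<Longrightarrow> n \<le> k \<Longrightarrow> f \<in> measurable (F k) N"
  by (rule measurable_from_subalg[of _ "F n"]) (use F_mono in \<open>auto simp: subalgebra_def\<close>)

text \<open>Supermartingales are described by integrals over events of \<open>F k\<close>, which
  avoids conditional expectations. The process is stopped at its first passage above
  \<open>e\<close>: \<open>A N\<close> is the event that no passage has occurred up to time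
  \<open>N\<close>.\<close>

lemma ville:
  assumes meas: "\<And>k. n \<le> k \<Longrightarrow> Y k \<in> borel_measurable (F k)"
    and int: "\<And>k. n \<le> k \<Longrightarrow> integrable M (Y k)"
    and nonneg: "\<And>k w. n \<le> k \<Longrightarrow> w \<in> space M \<Longrightarrow> (0::real) \<le> Y k w"
    and super: "\<And>k H. n \<le> k \<Longrightarrow> H \<in> sets (F k) \<Longrightarrow>
      (\<integral>w. indicator H w * Y (Suc k) w \<partial>M) \<le> (\<integral>w. indicator H w * Y k w \<partial>M)"
    and e: "e > 0"
  shows "prob {w\<in>space M. \<exists>k\<ge>n. e \<le> Y k w} \<le> expectation (Y n) / e"
proof -
  define A where "A N = {w\<in>space M. \<forall>k\<in>{n..N}. Y k w < e}" for N
  have A [measurable]: "A N \<in> sets (F N)" for N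
  proof -
    have [measurable]: "Y k \<in> borel_measurable (F N)" if "k \<in> {n..N}" for k
      using that by (intro measurable_F_mono[OF meas[of k]]) auto
    have "{w\<in>space (F N). \<forall>k\<in>{n..N}. Y k w < e} \<in> sets (F N)" by measurable
    then show ?thesis by (simp add: A_def)
  qed
  have AM [measurable]: "A N \<in> sets M" for N using A by (rule sets_F)
  have Y_int: "integrable M (\<lambda>w. indicator (A N) w * Y k w)" if "n \<le> k" for N k
    using integrable_mult_indicator[OF AM int[OF that]] by simp
  have I_int: "integrable M (\<lambda>w. e * (1 - indicator (A N) w))" for N
    by (rule integrable_bounded[where B = e]) (use e in \<open>auto simp: indicator_def\<close>)
  \<comment> \<open>Expectation of the process that is stopped with value \<open>e\<close> at the
    passage. Each step first replaces \<open>Y\<close> by \<open>e\<close> on the new passage event,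
    where \<open>Y\<close> is at least \<open>e\<close>, and then applies \<open>super\<close> to
    \<open>A N\<close>.\<close>
  have main: "n \<le> N \<Longrightarrow> (\<integral>w. e * (1 - indicator (A N) w) + indicator (A N) w * Y N w \<partial>M) \<le> expectation (Y n)" for N
  proof (induction N rule: dec_induct)
    case base
    show ?case
    proof (rule integral_mono)
      show "integrable M (\<lambda>w. e * (1 - indicator (A n) w) + indicator (A n) w * Y n w)"
        by (intro Bochner_Integration.integrable_add Y_int I_int order_refl)
      show "e * (1 - indicator (A n) w) + indicator (A n) w * Y n w \<le> Y n w" if "w \<in> space M" for w
        using that by (auto simp: A_def indicator_def)
    qed (rule int[OF order_refl])
  next
    case (step N)
    have AA: "A (Suc N) = {w \<in> A N. Y (Suc N) w < e}"
      using step(1) by (auto simp: A_def le_Suc_eq)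
    have "(\<integral>w. e * (1 - indicator (A (Suc N)) w) + indicator (A (Suc N)) w * Y (Suc N) w \<partial>M)
        \<le> (\<integral>w. e * (1 - indicator (A N) w) + indicator (A N) w * Y (Suc N) w \<partial>M)"
    proof (rule integral_mono)
      fix w assume "w \<in> space M"
      then show "e * (1 - indicator (A (Suc N)) w) + indicator (A (Suc N)) w * Y (Suc N) w
          \<le> e * (1 - indicator (A N) w) + indicator (A N) w * Y (Suc N) w"
        by (auto simp: AA indicator_def)
    qed (use step(1) Y_int I_int in auto)
    also have "\<dots> = (\<integral>w. e * (1 - indicator (A N) w) \<partial>M) + (\<integral>w. indicator (A N) w * Y (Suc N) w \<partial>M)"
      by (rule Bochner_Integration.integral_add) (use step(1) Y_int I_int in auto)
    also have "\<dots> \<le> (\<integral>w. e * (1 - indicator (A N) w) \<partial>M) + (\<integral>w. indicator (A N) w * Y N w \<partial>M)"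
      using super[of N "A N"] step(1) A by simp
    also have "\<dots> = (\<integral>w. e * (1 - indicator (A N) w) + indicator (A N) w * Y N w \<partial>M)"
      by (rule Bochner_Integration.integral_add[symmetric]) (use step(1) Y_int I_int in auto)
    also note step.IH
    finally show ?case .
  qed
  have le: "prob (space M - A N) \<le> expectation (Y n) / e" if "n \<le> N" for N
  proof -
    have "e * prob (space M - A N) = (\<integral>w. e * indicator (space M - A N) w \<partial>M)"
      by simp
    also have "\<dots> = (\<integral>w. e * (1 - indicator (A N) w) \<partial>M)"
      by (rule Bochner_Integration.integral_cong) (auto simp: indicator_def)
    also have "\<dots> \<le> (\<integral>w. e * (1 - indicator (A N) w) + indicator (A N) w * Y N w \<partial>M)"
      by (rule integral_mono) (use that Y_int I_int nonneg in \<open>auto simp: indicator_def\<close>)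
    also note main[OF that]
    finally show ?thesis using e by (simp add: pos_le_divide_eq mult.commute)
  qed
  have "(\<lambda>N. prob (space M - A N)) \<longlonglongrightarrow> prob (\<Union>N. space M - A N)"
  proof (rule finite_Lim_measure_incseq)
    show "incseq (\<lambda>N. space M - A N)" by (rule monoI) (force simp: A_def)
  qed auto
  moreover have "(\<Union>N. space M - A N) = {w\<in>space M. \<exists>k\<ge>n. e \<le> Y k w}"
  proof safe
    fix w k assume "w \<in> space M" "n \<le> k" "e \<le> Y k w"
    then have "w \<in> space M - A k" by (auto simp: A_def not_less intro!: bexI[of _ k])
    then show "w \<in> (\<Union>N. space M - A N)" by blast
  qed (auto simp: A_def not_less)
  ultimately have "(\<lambda>N. prob (space M - A N)) \<longlonglongrightarrow> prob {w\<in>space M. \<exists>k\<ge>n. e \<le> Y k w}" by simp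
  then show ?thesis
    by (rule LIMSEQ_le_const2) (use le in auto)
qed

text \<open>Vanishing conditional expectation given \<open>F n\<close>, expressed by orthogonality
  to all bounded \<open>F n\<close>-measurable weights. The bound \<open>C\<close> holds at every
  point, and the difference with index \<open>n\<close> becomes known at time
  \<open>Suc n\<close>.\<close>

definition mdiff :: "(nat \<Rightarrow> 'w \<Rightarrow> real) \<Rightarrow> real \<Rightarrow> bool" where
  "mdiff c C \<longleftrightarrow> (\<forall>n. c n \<in> borel_measurable (F (Suc n))) \<and> (\<forall>n. \<forall>w\<in>space M. \<bar>c n w\<bar> \<le> C) \<and>
     (\<forall>n W B. W \<in> borel_measurable (F n) \<longrightarrow> (\<forall>w\<in>space M. \<bar>W w\<bar> \<le> B) \<longrightarrow>
        expectation (\<lambda>w. W w * c n w) = 0)"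

lemma mdiffD:
  assumes "mdiff c C"
  shows "c n \<in> borel_measurable (F (Suc n))" "\<And>w. w \<in> space M \<Longrightarrow> \<bar>c n w\<bar> \<le> C"
    "c n \<in> borel_measurable M" "0 \<le> C" "n < k \<Longrightarrow> c n \<in> borel_measurable (F k)"
    "\<And>W B. W \<in> borel_measurable (F n) \<Longrightarrow> (\<And>w. w \<in> space M \<Longrightarrow> \<bar>W w\<bar> \<le> B) \<Longrightarrow>
        expectation (\<lambda>w. W w * c n w) = 0"
proof -
  show 1: "c n \<in> borel_measurable (F (Suc n))" using assms by (simp add: mdiff_def)
  show 2: "\<bar>c n w\<bar> \<le> C" if "w \<in> space M" for w using assms that by (auto simp: mdiff_def)
  show "c n \<in> borel_measurable M" using 1 by measurable
  obtain w where "w \<in> space M" using not_empty by blast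
  with 2[of w] show "0 \<le> C" by linarith
  show "n < k \<Longrightarrow> c n \<in> borel_measurable (F k)" using measurable_F_mono[OF 1, of k] by simp
  show "expectation (\<lambda>w. W w * c n w) = 0"
    if "W \<in> borel_measurable (F n)" "\<And>w. w \<in> space M \<Longrightarrow> \<bar>W w\<bar> \<le> B" for W B
    using assms that unfolding mdiff_def by blast
qed

lemma mdiff_sum:
  assumes c: "mdiff c C"
  shows "(\<lambda>w. \<Sum>k\<in>{l..<u}. a k * c k w) \<in> borel_measurable (F u)"
    and "w \<in> space M \<Longrightarrow> \<bar>\<Sum>k\<in>{l..<u}. a k * c k w\<bar> \<le> (\<Sum>k\<in>{l..<u}. \<bar>a k\<bar> * C)"
proof -
  have [measurable]: "c k \<in> borel_measurable (F u)" if "k \<in> {l..<u}" for k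
    using that by (intro mdiffD(5)[OF c]) simp
  show "(\<lambda>w. \<Sum>k\<in>{l..<u}. a k * c k w) \<in> borel_measurable (F u)" by measurable
  show "w \<in> space M \<Longrightarrow> \<bar>\<Sum>k\<in>{l..<u}. a k * c k w\<bar> \<le> (\<Sum>k\<in>{l..<u}. \<bar>a k\<bar> * C)"
    by (rule order_trans[OF sum_abs sum_mono]) (simp add: abs_mult mult_left_mono mdiffD(2)[OF c])
qed

text \<open>The cross term \<open>S * c k\<close> integrates to 0 because the indicator of
  \<open>H\<close> times \<open>S\<close> is an admissible weight. The event \<open>H\<close> is
  carried along so that one estimate gives both the second moments and a supermartingale property on
  events.\<close>

lemma mdiff_square_step:
  assumes c: "mdiff c C" and H [measurable]: "H \<in> sets (F k)"
    and S [measurable]: "S \<in> borel_measurable (F k)" and SB: "\<And>w. w \<in> space M \<Longrightarrow> \<bar>S w\<bar> \<le> B"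
  shows "(\<integral>w. indicator H w * (S w + x * c k w)\<^sup>2 \<partial>M)
    \<le> (\<integral>w. indicator H w * ((S w)\<^sup>2 + x\<^sup>2 * C\<^sup>2) \<partial>M)"
proof -
  note [measurable] = mdiffD(3)[OF c, of k] sets_F[OF H]
  have "0 \<le> B" using SB not_empty abs_ge_zero order_trans by blast
  have cC: "(c k w)\<^sup>2 \<le> C\<^sup>2" if "w \<in> space M" for w
    using mdiffD(2)[OF c that, of k] mdiffD(4)[OF c] by (simp add: abs_le_square_iff[symmetric])
  have S2: "(S w)\<^sup>2 \<le> B\<^sup>2" if "w \<in> space M" for w
    using SB[OF that] \<open>0 \<le> B\<close> by (simp add: abs_le_square_iff[symmetric])
  have i1: "integrable M (\<lambda>w. indicator H w * ((S w)\<^sup>2 + x\<^sup>2 * (c k w)\<^sup>2))"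
    by (rule integrable_bounded[where B = "B\<^sup>2 + x\<^sup>2 * C\<^sup>2"])
       (auto simp: indicator_def intro!: add_mono S2 mult_left_mono cC)
  have i2: "integrable M (\<lambda>w. 2 * x * ((indicator H w * S w) * c k w))"
    by (rule integrable_bounded[where B = "2 * \<bar>x\<bar> * (B * C)"])
       (use mdiffD(2,4)[OF c] SB \<open>0 \<le> B\<close> in \<open>auto simp: abs_mult indicator_def intro!: mult_left_mono mult_mono\<close>)
  have i3: "integrable M (\<lambda>w. indicator H w * ((S w)\<^sup>2 + x\<^sup>2 * C\<^sup>2))"
    by (rule integrable_bounded[where B = "B\<^sup>2 + x\<^sup>2 * C\<^sup>2"])
       (auto simp: indicator_def intro!: add_mono S2)
  have z: "(\<integral>w. (indicator H w * S w) * c k w \<partial>M) = 0"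
    by (rule mdiffD(6)[OF c, where B = B]) (use SB \<open>0 \<le> B\<close> in \<open>auto simp: indicator_def\<close>)
  have "(\<integral>w. indicator H w * (S w + x * c k w)\<^sup>2 \<partial>M)
     = (\<integral>w. indicator H w * ((S w)\<^sup>2 + x\<^sup>2 * (c k w)\<^sup>2) + 2 * x * ((indicator H w * S w) * c k w) \<partial>M)"
    by (rule Bochner_Integration.integral_cong) (auto simp: power2_eq_square algebra_simps)
  also have "\<dots> = (\<integral>w. indicator H w * ((S w)\<^sup>2 + x\<^sup>2 * (c k w)\<^sup>2) \<partial>M)"
    using i1 i2 z by simp
  also have "\<dots> \<le> (\<integral>w. indicator H w * ((S w)\<^sup>2 + x\<^sup>2 * C\<^sup>2) \<partial>M)"
    by (rule integral_mono[OF i1 i3]) (auto simp: indicator_def intro!: mult_left_mono cC)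
  finally show ?thesis .
qed

text \<open>Orthogonality of the increments: induction on the upper end, with the whole space as
  event in the one-step estimate.\<close>

lemma mdiff_second_moment:
  assumes c: "mdiff c C"
  shows "expectation (\<lambda>w. (\<Sum>k\<in>{l..<u}. a k * c k w)\<^sup>2) \<le> C\<^sup>2 * (\<Sum>k\<in>{l..<u}. (a k)\<^sup>2)"
proof (induction u)
  case (Suc u)
  let ?S = "\<lambda>w. \<Sum>k\<in>{l..<u}. a k * c k w"
  show ?case
  proof (cases "l \<le> u")
    case True
    have [measurable]: "?S \<in> borel_measurable M" using mdiff_sum(1)[OF c] by measurable
    have i: "integrable M (\<lambda>w. (?S w)\<^sup>2)"
      by (rule integrable_bounded[where B = "(\<Sum>k\<in>{l..<u}. \<bar>a k\<bar> * C)\<^sup>2"])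
         (simp_all add: square_le_of_abs_le[OF mdiff_sum(2)[OF c]])
    have "expectation (\<lambda>w. (\<Sum>k\<in>{l..<Suc u}. a k * c k w)\<^sup>2)
        = (\<integral>w. indicator (space M) w * (?S w + a u * c u w)\<^sup>2 \<partial>M)"
      by (rule Bochner_Integration.integral_cong) (use True in auto)
    also have "\<dots> \<le> (\<integral>w. indicator (space M) w * ((?S w)\<^sup>2 + (a u)\<^sup>2 * C\<^sup>2) \<partial>M)"
      by (rule mdiff_square_step[OF c _ mdiff_sum(1)[OF c] mdiff_sum(2)[OF c]])
         (use sets.top[of "F u"] in auto)
    also have "\<dots> = (\<integral>w. (?S w)\<^sup>2 + (a u)\<^sup>2 * C\<^sup>2 \<partial>M)"
      by (rule Bochner_Integration.integral_cong) auto
    also have "\<dots> = expectation (\<lambda>w. (?S w)\<^sup>2) + (a u)\<^sup>2 * C\<^sup>2" using i prob_space by simp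
    finally show ?thesis using Suc True by (simp add: algebra_simps)
  qed simp
qed simp

text \<open>The squared partial sum from \<open>n\<close> on, plus \<open>C^2\<close> times the
  squares still to come, is a nonnegative supermartingale. Ville's inequality bounds the probability
  of any later deviation by the tail of a convergent series, which makes the partial sums Cauchy
  almost surely.\<close>

lemma mdiff_AE_convergent:
  assumes c: "mdiff c C" and a: "summable (\<lambda>k. (a k)\<^sup>2)"
  shows "AE w in M. convergent (\<lambda>n. \<Sum>k<n. a k * c k w)"
proof -
  define T where "T n = (\<Sum>k. (a (k + n))\<^sup>2)" for n
  have T_Suc: "T n = (a n)\<^sup>2 + T (Suc n)" for n
    unfolding T_def using suminf_split_head[OF summable_ignore_initial_segment[OF a, of n]] by simp
  have T0: "0 \<le> T n" for n unfolding T_def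
    by (rule suminf_nonneg) (use summable_ignore_initial_segment[OF a] in auto)
  have T_lim: "T \<longlonglongrightarrow> 0" unfolding T_def by (rule suminf_exist_split2[OF a])
  define S where "S n k w = (\<Sum>i\<in>{n..<k}. a i * c i w)" for n k w
  have S_meas: "S n k \<in> borel_measurable (F k)" for n k
    unfolding S_def by (rule mdiff_sum(1)[OF c])
  have [measurable]: "S n k \<in> borel_measurable M" for n k
    using S_meas by (rule measurable_F)
  have S_bd: "\<exists>B. \<forall>w\<in>space M. \<bar>S n k w\<bar> \<le> B" for n k
    unfolding S_def using mdiff_sum(2)[OF c] by blast
  have max: "prob {w\<in>space M. \<exists>k\<ge>n. e \<le> \<bar>S n k w\<bar>} \<le> C\<^sup>2 * T n / e\<^sup>2" if e: "e > 0" for e n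
  proof -
    \<comment> \<open>The added tail pays in advance for all future growth of the second moment; at
      time \<open>n\<close> it is the entire expectation.\<close>
    define Y where "Y k w = (S n k w)\<^sup>2 + C\<^sup>2 * T k" for k w
    have [measurable]: "Y k \<in> borel_measurable (F k)" for k unfolding Y_def using S_meas by measurable
    have YM [measurable]: "Y k \<in> borel_measurable M" for k by measurable
    have Y_int: "integrable M (Y k)" for k
    proof -
      obtain B where B: "\<And>w. w \<in> space M \<Longrightarrow> \<bar>S n k w\<bar> \<le> B" using S_bd by blast
      have "(S n k w)\<^sup>2 \<le> B\<^sup>2" if "w \<in> space M" for w
        using power_mono[OF B[OF that], of 2] by simp
      then show ?thesis
        by (intro integrable_bounded[where B = "B\<^sup>2 + C\<^sup>2 * T k"]) (auto simp: Y_def T0)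
    qed
    have "prob {w\<in>space M. \<exists>k\<ge>n. e\<^sup>2 \<le> Y k w} \<le> expectation (Y n) / e\<^sup>2"
    proof (rule ville)
      fix k H assume k: "n \<le> k" and H: "H \<in> sets (F k)"
      have [measurable]: "H \<in> sets M" using H by (rule sets_F)
      obtain B where B: "\<And>w. w \<in> space M \<Longrightarrow> \<bar>S n k w\<bar> \<le> B" using S_bd by blast
      have *: "Y (Suc k) w = (S n k w + a k * c k w)\<^sup>2 + C\<^sup>2 * T (Suc k)" for w
        using k by (simp add: Y_def S_def)
      have iH: "integrable M (\<lambda>w. indicator H w * (C\<^sup>2 * T (Suc k)))"
        by (rule integrable_bounded[where B = "C\<^sup>2 * T (Suc k)"]) (auto simp: indicator_def T0)
      have i1: "integrable M (\<lambda>w. indicator H w * Y j w)" for j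
        using integrable_mult_indicator[OF _ Y_int, of H j] by simp
      have i2: "integrable M (\<lambda>w. indicator H w * (S n k w + a k * c k w)\<^sup>2)"
        using Bochner_Integration.integrable_diff[OF i1[of "Suc k"] iH] by (simp add: * algebra_simps)
      have i3: "integrable M (\<lambda>w. indicator H w * ((S n k w)\<^sup>2 + (a k)\<^sup>2 * C\<^sup>2))"
        using Bochner_Integration.integrable_diff[OF i1[of k] iH] by (simp add: Y_def T_Suc[of k] algebra_simps)
      have "(\<integral>w. indicator H w * Y (Suc k) w \<partial>M)
          = (\<integral>w. indicator H w * (S n k w + a k * c k w)\<^sup>2 + indicator H w * (C\<^sup>2 * T (Suc k)) \<partial>M)"
        by (simp add: * algebra_simps)
      also have "\<dots> = (\<integral>w. indicator H w * (S n k w + a k * c k w)\<^sup>2 \<partial>M) + (\<integral>w. indicator H w * (C\<^sup>2 * T (Suc k)) \<partial>M)"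
        by (rule Bochner_Integration.integral_add[OF i2 iH])
      also have "\<dots> \<le> (\<integral>w. indicator H w * ((S n k w)\<^sup>2 + (a k)\<^sup>2 * C\<^sup>2) \<partial>M) + (\<integral>w. indicator H w * (C\<^sup>2 * T (Suc k)) \<partial>M)"
        by (intro add_right_mono mdiff_square_step[OF c H S_meas B])
      also have "\<dots> = (\<integral>w. indicator H w * ((S n k w)\<^sup>2 + (a k)\<^sup>2 * C\<^sup>2) + indicator H w * (C\<^sup>2 * T (Suc k)) \<partial>M)"
        by (rule Bochner_Integration.integral_add[OF i3 iH, symmetric])
      also have "\<dots> = (\<integral>w. indicator H w * Y k w \<partial>M)"
        by (simp add: Y_def T_Suc[of k] algebra_simps)
      finally show "(\<integral>w. indicator H w * Y (Suc k) w \<partial>M) \<le> (\<integral>w. indicator H w * Y k w \<partial>M)" .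
    next
      show "0 \<le> Y k w" for k w using T0[of k] by (simp add: Y_def)
      show "0 < e\<^sup>2" using e by simp
    qed (simp_all add: Y_int)
    also have "expectation (Y n) = expectation (\<lambda>_. C\<^sup>2 * T n)"
      by (rule Bochner_Integration.integral_cong) (auto simp: Y_def S_def)
    also have "\<dots> = C\<^sup>2 * T n" using prob_space by simp
    finally have "prob {w\<in>space M. \<exists>k\<ge>n. e\<^sup>2 \<le> Y k w} \<le> C\<^sup>2 * T n / e\<^sup>2" .
    moreover have "prob {w\<in>space M. \<exists>k\<ge>n. e \<le> \<bar>S n k w\<bar>} \<le> prob {w\<in>space M. \<exists>k\<ge>n. e\<^sup>2 \<le> Y k w}"
    proof (rule finite_measure_mono)
      show "{w\<in>space M. \<exists>k\<ge>n. e \<le> \<bar>S n k w\<bar>} \<subseteq> {w\<in>space M. \<exists>k\<ge>n. e\<^sup>2 \<le> Y k w}"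
      proof safe
        fix w k assume "n \<le> k" "e \<le> \<bar>S n k w\<bar>"
        then have "e\<^sup>2 \<le> (S n k w)\<^sup>2" using power_mono[of e "\<bar>S n k w\<bar>" 2] e by simp
        then have "e\<^sup>2 \<le> Y k w" using T0[of k] by (simp add: Y_def add_increasing2)
        with \<open>n \<le> k\<close> show "\<exists>k\<ge>n. e\<^sup>2 \<le> Y k w" by blast
      qed
    qed measurable
    ultimately show ?thesis by simp
  qed
  have "AE w in M. \<exists>n. w \<notin> {w\<in>space M. \<exists>k\<ge>n. e \<le> \<bar>S n k w\<bar>}" if e: "e > 0" for e
  proof (rule AE_ex_notin)
    show "{w\<in>space M. \<exists>k\<ge>n. e \<le> \<bar>S n k w\<bar>} \<in> sets M" for n
      by measurable
    fix d :: real assume "d > 0"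
    have "(\<lambda>n. C\<^sup>2 * T n / e\<^sup>2) \<longlonglongrightarrow> C\<^sup>2 * 0 / e\<^sup>2" by (intro tendsto_intros T_lim) (use e in auto)
    then have "\<forall>\<^sub>F n in sequentially. C\<^sup>2 * T n / e\<^sup>2 < d" by (rule order_tendstoD) (use \<open>d > 0\<close> in simp)
    then obtain n where "C\<^sup>2 * T n / e\<^sup>2 < d" by (auto simp: eventually_sequentially)
    with max[OF e, of n] show "\<exists>n. prob {w\<in>space M. \<exists>k\<ge>n. e \<le> \<bar>S n k w\<bar>} \<le> d"
      by (intro exI[of _ n]) simp
  qed
  then have "AE w in M. \<forall>j::nat. \<exists>n. w \<notin> {w\<in>space M. \<exists>k\<ge>n. 1 / real (Suc j) \<le> \<bar>S n k w\<bar>}"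
    by (simp add: AE_all_countable)
  with AE_space show ?thesis
  proof (eventually_elim, goal_cases)
    case (1 w)
    have "Cauchy (\<lambda>n. \<Sum>k<n. a k * c k w)"
    proof (rule metric_CauchyI)
      fix e :: real assume "e > 0"
      then obtain j where j: "1 / real (Suc j) < e / 2" using reals_Archimedean[of "e / 2"]
        by (auto simp: inverse_eq_divide)
      obtain n where "w \<notin> {w\<in>space M. \<exists>k\<ge>n. 1 / real (Suc j) \<le> \<bar>S n k w\<bar>}"
        using 1(2) by blast
      with 1(1) have *: "\<not> (\<exists>k\<ge>n. 1 / real (Suc j) \<le> \<bar>S n k w\<bar>)" by blast
      have n: "\<bar>S n k w\<bar> < e / 2" if "k \<ge> n" for k
      proof -
        have "\<not> 1 / real (Suc j) \<le> \<bar>S n k w\<bar>" using * that by blast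
        with j show ?thesis by linarith
      qed
      have "dist (\<Sum>k<p. a k * c k w) (\<Sum>k<q. a k * c k w) < e" if "p \<ge> n" "q \<ge> n" for p q
      proof -
        have *: "(\<Sum>k<p. a k * c k w) = (\<Sum>k<n. a k * c k w) + S n p w" if "p \<ge> n" for p
          using sum.atLeastLessThan_concat[of 0 n p "\<lambda>k. a k * c k w"] that
          by (simp add: S_def lessThan_atLeast0)
        show ?thesis using *[OF that(1)] *[OF that(2)] n[OF that(1)] n[OF that(2)]
          by (simp add: dist_real_def)
      qed
      then show "\<exists>n. \<forall>p\<ge>n. \<forall>q\<ge>n. dist (\<Sum>k<p. a k * c k w) (\<Sum>k<q. a k * c k w) < e" by blast
    qed
    then show ?case by (rule real_Cauchy_convergent)
  qed
qed

lemma summable_inverse_Suc_square: "summable (\<lambda>k. (1 / real (Suc k))\<^sup>2)"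
  using inverse_power_summable[of 2, where ?'a = real] summable_Suc_iff[of "\<lambda>n. inverse (real n ^ 2)"]
  by (simp add: power_divide inverse_eq_divide)

text \<open>The weights \<open>1 / (k + 1)\<close> are square summable, and Kronecker's lemma turns
  the convergent weighted series into averages.\<close>

lemma mdiff_slln:
  assumes c: "mdiff c C"
  shows "AE w in M. (\<lambda>n. (\<Sum>k<n. c k w) / real n) \<longlonglongrightarrow> 0"
  using mdiff_AE_convergent[OF c summable_inverse_Suc_square]
  by eventually_elim (auto intro: kronecker)

end

section \<open>Conditional characteristic functions\<close>

lemma norm_iexp_diff_le: "cmod (iexp x - iexp y) \<le> \<bar>x - y\<bar>"
proof -
  have "iexp x - iexp y = iexp y * (iexp (x - y) - 1)"
    by (simp add: algebra_simps flip: exp_add)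
  then have "cmod (iexp x - iexp y) = cmod (iexp (x - y) - 1)"
    by (simp add: norm_mult)
  also have "\<dots> \<le> \<bar>x - y\<bar>" using iexp_approx1[of "x - y" 0] by simp
  finally show ?thesis .
qed

text \<open>The bound by \<open>min 1\<close> fits the later notion \<open>null\<close>: changing a
  sequence by a null sequence does not affect limits of characteristic functions.\<close>

lemma norm_iexp_diff_le_min: "cmod (iexp (t * x) - iexp (t * y)) \<le> (2 + \<bar>t\<bar>) * min 1 \<bar>x - y\<bar>"
proof (cases "\<bar>x - y\<bar> \<le> 1")
  case True
  have "cmod (iexp (t * x) - iexp (t * y)) \<le> \<bar>t * x - t * y\<bar>" by (rule norm_iexp_diff_le)
  also have "\<dots> = \<bar>t\<bar> * \<bar>x - y\<bar>" by (simp add: abs_mult flip: right_diff_distrib)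
  also have "\<dots> \<le> (2 + \<bar>t\<bar>) * \<bar>x - y\<bar>" by (intro mult_right_mono) auto
  finally show ?thesis using True by (simp add: min_def)
next
  case False
  have "cmod (iexp (t * x) - iexp (t * y)) \<le> 2"
    using norm_triangle_ineq4[of "iexp (t * x)" "iexp (t * y)"] by simp
  with False show ?thesis by (simp add: min_def)
qed

lemma exp_minus_bounds:
  fixes y :: real
  assumes "0 \<le> y"
  shows "\<bar>exp (- y) - (1 - y)\<bar> \<le> y\<^sup>2"
proof -
  have "1 + (- y) \<le> exp (- y)" by (rule exp_ge_add_one_self)
  moreover have "exp (- y) \<le> 1 - y + y\<^sup>2"
  proof -
    have "exp (- y) = 1 / exp y" by (simp add: exp_minus inverse_eq_divide)
    also have "\<dots> \<le> 1 / (1 + y)"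
      by (rule divide_left_mono) (use exp_ge_add_one_self[of y] assms in auto)
    also have "\<dots> \<le> 1 - y + y\<^sup>2"
    proof -
      have "1 \<le> (1 - y + y\<^sup>2) * (1 + y)"
        using assms by (simp add: power2_eq_square algebra_simps)
      then show ?thesis using assms by (simp add: pos_divide_le_eq)
    qed
    finally show ?thesis .
  qed
  ultimately show ?thesis by (simp add: abs_le_iff)
qed

lemma norm_iexp_taylor2: "cmod (iexp x - (1 + \<i> * of_real x - of_real (x\<^sup>2 / 2))) \<le> \<bar>x\<bar> ^ 3"
proof -
  have "(\<Sum>k\<le>2. (\<i> * of_real x) ^ k / fact k) = 1 + \<i> * of_real x - of_real (x\<^sup>2 / 2)"
  proof -
    have "\<i> * of_real x * (\<i> * of_real x) = - (of_real x * of_real x :: complex)"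
      by (metis i_squared mult.assoc mult.left_commute mult_minus1)
    then show ?thesis by (simp add: numeral_2_eq_2 power2_eq_square fact_Suc)
  qed
  then have "cmod (iexp x - (1 + \<i> * of_real x - of_real (x\<^sup>2 / 2))) \<le> \<bar>x\<bar> ^ 3 / fact 3"
    using iexp_approx1[of x 2] by (simp add: eval_nat_numeral)
  also have "\<dots> \<le> \<bar>x\<bar> ^ 3" by (simp add: fact_numeral)
  finally show ?thesis .
qed

lemma norm_integral_le:
  fixes f :: "'a \<Rightarrow> 'b::{banach, second_countable_topology}"
  assumes "integrable M f" "integrable M g" "\<And>w. w \<in> space M \<Longrightarrow> norm (f w) \<le> g w"
  shows "norm (integral\<^sup>L M f) \<le> integral\<^sup>L M g"
proof -
  have "norm (integral\<^sup>L M f) \<le> (\<integral>w. norm (f w) \<partial>M)" by (rule integral_norm_bound)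
  also have "\<dots> \<le> integral\<^sup>L M g" by (rule integral_mono) (use assms in auto)
  finally show ?thesis .
qed

section \<open>Convergence to zero in probability\<close>

context prob_space
begin

text \<open>Convergence to 0 in probability, metrised by the expectation of the truncated modulus.
  In this form it enters estimates of characteristic functions directly, without splitting into
  events.\<close>

definition null :: "(nat \<Rightarrow> 'a \<Rightarrow> real) \<Rightarrow> bool" where
  "null Z \<longleftrightarrow> (\<forall>n. Z n \<in> borel_measurable M) \<and> (\<lambda>n. expectation (\<lambda>w. min 1 \<bar>Z n w\<bar>)) \<longlonglongrightarrow> 0"

lemma nullD: "null Z \<Longrightarrow> Z n \<in> borel_measurable M"
  "null Z \<Longrightarrow> (\<lambda>n. expectation (\<lambda>w. min 1 \<bar>Z n w\<bar>)) \<longlonglongrightarrow> 0"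
  by (auto simp: null_def)

lemma integrable_min_abs [simp]:
  "Z \<in> borel_measurable M \<Longrightarrow> integrable M (\<lambda>w. min 1 \<bar>Z w\<bar> :: real)"
  by (rule integrable_bounded[where B = 1]) auto

lemma null_le:
  assumes "null Z" "\<And>n. Y n \<in> borel_measurable M" "\<And>n w. w \<in> space M \<Longrightarrow> \<bar>Y n w\<bar> \<le> \<bar>Z n w\<bar>"
  shows "null Y"
  unfolding null_def
proof (intro conjI allI)
  note [measurable] = nullD(1)[OF assms(1)] assms(2)
  show "(\<lambda>n. expectation (\<lambda>w. min 1 \<bar>Y n w\<bar>)) \<longlonglongrightarrow> 0"
  proof (rule tendsto_sandwich[OF _ _ tendsto_const nullD(2)[OF assms(1)]])
    show "\<forall>\<^sub>F n in sequentially. expectation (\<lambda>w. min 1 \<bar>Y n w\<bar>) \<le> expectation (\<lambda>w. min 1 \<bar>Z n w\<bar>)"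
      by (intro always_eventually allI integral_mono) (use assms(3) in \<open>auto intro: min.coboundedI2 min.mono\<close>)
  qed auto
qed (rule assms(2))

lemma null_AE:
  assumes [measurable]: "\<And>n. Z n \<in> borel_measurable M" and "AE w in M. (\<lambda>n. Z n w) \<longlonglongrightarrow> 0"
  shows "null Z"
  unfolding null_def
proof (intro conjI allI)
  have "(\<lambda>n. expectation (\<lambda>w. min 1 \<bar>Z n w\<bar>)) \<longlonglongrightarrow> expectation (\<lambda>w. 0)"
  proof (rule integral_dominated_convergence[where w = "\<lambda>_. 1"])
    show "AE w in M. (\<lambda>n. min 1 \<bar>Z n w\<bar>) \<longlonglongrightarrow> 0"
      using assms(2)
    proof eventually_elim
      case (elim w)
      have "(\<lambda>n. min 1 \<bar>Z n w\<bar>) \<longlonglongrightarrow> min 1 \<bar>0\<bar>" by (intro tendsto_intros elim)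
      then show ?case by simp
    qed
  qed auto
  then show "(\<lambda>n. expectation (\<lambda>w. min 1 \<bar>Z n w\<bar>)) \<longlonglongrightarrow> 0" by simp
qed measurable

lemma null_add:
  assumes "null Y" "null Z"
  shows "null (\<lambda>n w. Y n w + Z n w)"
  unfolding null_def
proof (intro conjI allI)
  note [measurable] = nullD(1)[OF assms(1)] nullD(1)[OF assms(2)]
  show "(\<lambda>w. Y n w + Z n w) \<in> borel_measurable M" for n by measurable
  have lim: "(\<lambda>n. expectation (\<lambda>w. min 1 \<bar>Y n w\<bar>) + expectation (\<lambda>w. min 1 \<bar>Z n w\<bar>)) \<longlonglongrightarrow> 0"
    using tendsto_add[OF nullD(2)[OF assms(1)] nullD(2)[OF assms(2)]] by simp
  show "(\<lambda>n. expectation (\<lambda>w. min 1 \<bar>Y n w + Z n w\<bar>)) \<longlonglongrightarrow> 0"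
  proof (rule tendsto_sandwich[OF _ _ tendsto_const lim])
    show "\<forall>\<^sub>F n in sequentially. expectation (\<lambda>w. min 1 \<bar>Y n w + Z n w\<bar>)
        \<le> expectation (\<lambda>w. min 1 \<bar>Y n w\<bar>) + expectation (\<lambda>w. min 1 \<bar>Z n w\<bar>)"
    proof (intro always_eventually allI)
      fix n
      have "expectation (\<lambda>w. min 1 \<bar>Y n w + Z n w\<bar>) \<le> expectation (\<lambda>w. min 1 \<bar>Y n w\<bar> + min 1 \<bar>Z n w\<bar>)"
      proof (rule integral_mono)
        show "min 1 \<bar>Y n w + Z n w\<bar> \<le> min 1 \<bar>Y n w\<bar> + min 1 \<bar>Z n w\<bar>" for w
          by (auto simp: min_def)
      qed auto
      then show "expectation (\<lambda>w. min 1 \<bar>Y n w + Z n w\<bar>)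
        \<le> expectation (\<lambda>w. min 1 \<bar>Y n w\<bar>) + expectation (\<lambda>w. min 1 \<bar>Z n w\<bar>)" by simp
    qed
  qed auto
qed

lemma null_minus: "null Z \<Longrightarrow> null (\<lambda>n w. - Z n w)"
  by (simp add: null_def)

lemma null_L2:
  assumes [measurable]: "\<And>n. Z n \<in> borel_measurable M" and i: "\<And>n. integrable M (\<lambda>w. (Z n w)\<^sup>2)"
    and le: "\<And>n. expectation (\<lambda>w. (Z n w)\<^sup>2) \<le> b n" and b: "b \<longlonglongrightarrow> 0"
  shows "null Z"
  unfolding null_def
proof (intro conjI allI)
  have "(\<lambda>n. sqrt (b n)) \<longlonglongrightarrow> sqrt 0" by (intro tendsto_intros b)
  then have lim: "(\<lambda>n. sqrt (b n)) \<longlonglongrightarrow> 0" by simp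
  show "(\<lambda>n. expectation (\<lambda>w. min 1 \<bar>Z n w\<bar>)) \<longlonglongrightarrow> 0"
  proof (rule tendsto_sandwich[OF _ _ tendsto_const lim])
    show "\<forall>\<^sub>F n in sequentially. expectation (\<lambda>w. min 1 \<bar>Z n w\<bar>) \<le> sqrt (b n)"
    proof (intro always_eventually allI)
      fix n
      have m2: "(min 1 \<bar>x\<bar>)\<^sup>2 \<le> x\<^sup>2" for x :: real
        using power_mono[of "min 1 \<bar>x\<bar>" "\<bar>x\<bar>" 2] by simp
      have mi: "integrable M (\<lambda>w. (min 1 \<bar>Z n w\<bar>)\<^sup>2)"
        by (rule integrable_bounded[where B = 1]) (auto simp: power_le_one)
      have "expectation (\<lambda>w. \<bar>min 1 \<bar>Z n w\<bar>\<bar>) \<le> sqrt (expectation (\<lambda>w. (min 1 \<bar>Z n w\<bar>)\<^sup>2))"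
        by (rule expectation_abs_le_sqrt) (use mi in auto)
      also have "\<dots> \<le> sqrt (b n)"
      proof (rule real_sqrt_le_mono)
        have "expectation (\<lambda>w. (min 1 \<bar>Z n w\<bar>)\<^sup>2) \<le> expectation (\<lambda>w. (Z n w)\<^sup>2)"
          by (rule integral_mono[OF mi i]) (rule m2)
        with le[of n] show "expectation (\<lambda>w. (min 1 \<bar>Z n w\<bar>)\<^sup>2) \<le> b n" by simp
      qed
      finally show "expectation (\<lambda>w. min 1 \<bar>Z n w\<bar>) \<le> sqrt (b n)" by simp
    qed
  qed auto
qed measurable

text \<open>A null factor against an \<open>L1\<close>-bounded one. Where \<open>|a n| <= d\<close>
  the product is at most \<open>d * |Z n|\<close>; elsewhere the truncated modulus of
  \<open>a n\<close>, divided by \<open>d\<close>, is at least 1 and dominates.\<close>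

lemma null_mult:
  assumes a: "null a" and [measurable]: "\<And>n. Z n \<in> borel_measurable M"
    and i: "\<And>n. integrable M (Z n)" and K: "\<And>n. expectation (\<lambda>w. \<bar>Z n w\<bar>) \<le> K"
  shows "null (\<lambda>n w. a n w * Z n w)"
  unfolding null_def
proof (intro conjI allI)
  note [measurable] = nullD(1)[OF a]
  show "(\<lambda>w. a n w * Z n w) \<in> borel_measurable M" for n by measurable
  have K0: "0 \<le> K" by (rule order_trans[OF _ K[of 0]]) simp
  show "(\<lambda>n. expectation (\<lambda>w. min 1 \<bar>a n w * Z n w\<bar>)) \<longlonglongrightarrow> 0"
  proof (rule LIMSEQ_I)
    fix r :: real assume r: "r > 0"
    \<comment> \<open>Chosen so that \<open>d * K < r\<close>, with \<open>K + 1\<close> covering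
      \<open>K = 0\<close>. The cap \<open>d <= 1\<close> ensures that \<open>min 1 |x|\<close>
      exceeds or equals \<open>d\<close> as soon as \<open>|x|\<close> exceeds
      \<open>d\<close>.\<close>
    define d where "d = min 1 (r / (2 * (K + 1)))"
    have d: "0 < d" "d \<le> 1" "d * K < r"
    proof -
      show "0 < d" "d \<le> 1" unfolding d_def using r K0 by auto
      have "d * K \<le> (r / (2 * (K + 1))) * K" unfolding d_def using K0 by (intro mult_right_mono) auto
      also have "\<dots> < r"
      proof -
        have "r * K < r * (2 * (K + 1))" using r K0 by (intro mult_strict_left_mono) auto
        then show ?thesis using K0 by (simp add: pos_divide_less_eq)
      qed
      finally show "d * K < r" .
    qed
    have "(\<lambda>n. expectation (\<lambda>w. min 1 \<bar>a n w\<bar>) / d + d * K) \<longlonglongrightarrow> 0 / d + d * K"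
      by (intro tendsto_intros nullD(2)[OF a]) (use d in auto)
    then have "\<forall>\<^sub>F n in sequentially. expectation (\<lambda>w. min 1 \<bar>a n w\<bar>) / d + d * K < r"
      by (rule order_tendstoD) (use d in simp)
    then obtain N where N: "\<And>n. n \<ge> N \<Longrightarrow> expectation (\<lambda>w. min 1 \<bar>a n w\<bar>) / d + d * K < r"
      by (auto simp: eventually_sequentially)
    have pw: "min 1 \<bar>x * z\<bar> \<le> min 1 \<bar>x\<bar> / d + d * \<bar>z\<bar>" for x z :: real
    proof (cases "\<bar>x\<bar> \<le> d")
      case True
      have "\<bar>x * z\<bar> \<le> d * \<bar>z\<bar>" using True by (simp add: abs_mult mult_right_mono)
      moreover have "0 \<le> min 1 \<bar>x\<bar> / d" using d by simp
      ultimately show ?thesis by linarith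
    next
      case False
      then have "1 \<le> min 1 \<bar>x\<bar> / d" using d by (simp add: min_def pos_le_divide_eq)
      moreover have "0 \<le> d * \<bar>z\<bar>" using d by simp
      ultimately show ?thesis by linarith
    qed
    have "norm (expectation (\<lambda>w. min 1 \<bar>a n w * Z n w\<bar>) - 0) < r" if "n \<ge> N" for n
    proof -
      have "expectation (\<lambda>w. min 1 \<bar>a n w * Z n w\<bar>) \<le> expectation (\<lambda>w. min 1 \<bar>a n w\<bar> / d + d * \<bar>Z n w\<bar>)"
        by (rule integral_mono) (use i pw in auto)
      also have "\<dots> = expectation (\<lambda>w. min 1 \<bar>a n w\<bar>) / d + d * expectation (\<lambda>w. \<bar>Z n w\<bar>)"
        using i by simp
      also have "\<dots> \<le> expectation (\<lambda>w. min 1 \<bar>a n w\<bar>) / d + d * K"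
        using K d by (intro add_left_mono mult_left_mono) auto
      also note N[OF that]
      finally have "expectation (\<lambda>w. min 1 \<bar>a n w * Z n w\<bar>) < r" .
      moreover have "0 \<le> expectation (\<lambda>w. min 1 \<bar>a n w * Z n w\<bar>)" by simp
      ultimately show ?thesis by simp
    qed
    then show "\<exists>no. \<forall>n\<ge>no. norm (expectation (\<lambda>w. min 1 \<bar>a n w * Z n w\<bar>) - 0) < r" by blast
  qed
qed

end

section \<open>Characteristic functions of martingale blocks with frozen variance\<close>

context filtered_prob_space
begin

text \<open>Orthogonality is given for real weights; real and imaginary parts carry it over to the
  complex weights that characteristic functions produce.\<close>

lemma expectation_complex_mult_eq_0:
  fixes W :: "'w \<Rightarrow> complex" and x :: "'w \<Rightarrow> real"
  assumes x [measurable]: "x \<in> borel_measurable M" and xC: "\<And>w. w \<in> space M \<Longrightarrow> \<bar>x w\<bar> \<le> C"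
    and orth: "\<And>W B'. W \<in> borel_measurable (F n) \<Longrightarrow> (\<And>w. w \<in> space M \<Longrightarrow> \<bar>W w\<bar> \<le> B') \<Longrightarrow>
        expectation (\<lambda>w. W w * x w) = 0"
    and W [measurable]: "W \<in> borel_measurable (F n)" and B: "\<And>w. w \<in> space M \<Longrightarrow> cmod (W w) \<le> B"
  shows "expectation (\<lambda>w. W w * of_real (x w)) = 0"
proof -
  have [measurable]: "W \<in> borel_measurable M" using W by measurable
  have "0 \<le> B" using B not_empty norm_ge_zero order_trans by blast
  have i: "integrable M (\<lambda>w. W w * of_real (x w))"
    by (rule integrable_bounded[where B = "B * C"])
       (use B xC \<open>0 \<le> B\<close> in \<open>auto simp: norm_mult intro!: mult_mono\<close>)
  have "Re (expectation (\<lambda>w. W w * of_real (x w))) = expectation (\<lambda>w. Re (W w) * x w)"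
    using i by (subst integral_Re[symmetric]) auto
  also have "\<dots> = 0"
  proof (rule orth)
    show "(\<lambda>w. Re (W w)) \<in> borel_measurable (F n)" by measurable
    show "\<bar>Re (W w)\<bar> \<le> B" if "w \<in> space M" for w
      using B[OF that] abs_Re_le_cmod[of "W w"] by linarith
  qed
  moreover have "Im (expectation (\<lambda>w. W w * of_real (x w))) = expectation (\<lambda>w. Im (W w) * x w)"
    using i by (subst integral_Im[symmetric]) auto
  moreover have "expectation (\<lambda>w. Im (W w) * x w) = 0"
  proof (rule orth)
    show "(\<lambda>w. Im (W w)) \<in> borel_measurable (F n)" by measurable
    show "\<bar>Im (W w)\<bar> \<le> B" if "w \<in> space M" for w
      using B[OF that] abs_Im_le_cmod[of "W w"] by linarith
  qed
  ultimately show ?thesis by (simp add: complex_eq_iff)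
qed

text \<open>\<open>v n\<close> is a version of the conditional second moment of \<open>c n\<close>
  given \<open>F n\<close>, with bounds that hold at every point; again expressed by bounded test
  weights.\<close>

definition cvar :: "(nat \<Rightarrow> 'w \<Rightarrow> real) \<Rightarrow> (nat \<Rightarrow> 'w \<Rightarrow> real) \<Rightarrow> real \<Rightarrow> bool" where
  "cvar c v D \<longleftrightarrow> (\<forall>n. v n \<in> borel_measurable (F n)) \<and> (\<forall>n. \<forall>w\<in>space M. 0 \<le> v n w \<and> v n w \<le> D) \<and>
     (\<forall>n W B. W \<in> borel_measurable (F n) \<longrightarrow> (\<forall>w\<in>space M. \<bar>W w\<bar> \<le> B) \<longrightarrow>
        expectation (\<lambda>w. W w * ((c n w)\<^sup>2 - v n w)) = 0)"

lemma cvarD: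
  assumes "cvar c v D"
  shows "v n \<in> borel_measurable (F n)" "v n \<in> borel_measurable M"
    "\<And>w. w \<in> space M \<Longrightarrow> 0 \<le> v n w" "\<And>w. w \<in> space M \<Longrightarrow> v n w \<le> D"
    "\<And>W B. W \<in> borel_measurable (F n) \<Longrightarrow> (\<And>w. w \<in> space M \<Longrightarrow> \<bar>W w\<bar> \<le> B) \<Longrightarrow>
        expectation (\<lambda>w. W w * ((c n w)\<^sup>2 - v n w)) = 0"
proof -
  show 1: "v n \<in> borel_measurable (F n)" using assms by (simp add: cvar_def)
  then show "v n \<in> borel_measurable M" by (rule measurable_F)
  show "0 \<le> v n w" "v n w \<le> D" if "w \<in> space M" for w using assms that by (auto simp: cvar_def)
  show "expectation (\<lambda>w. W w * ((c n w)\<^sup>2 - v n w)) = 0"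
    if "W \<in> borel_measurable (F n)" "\<And>w. w \<in> space M \<Longrightarrow> \<bar>W w\<bar> \<le> B" for W B
    using assms that unfolding cvar_def by blast
qed

lemma char_step:
  assumes c: "mdiff c C" and v: "cvar c v D" and lk: "l \<le> k"
    and P: "P \<in> borel_measurable (F k)" and P1: "\<And>w. w \<in> space M \<Longrightarrow> cmod (P w) \<le> 1"
  shows "cmod (expectation (\<lambda>w. P w * (iexp (x * c k w) - of_real (exp (- (x\<^sup>2 * v l w / 2))))))
    \<le> \<bar>x\<bar> ^ 3 * C ^ 3 + x\<^sup>2 * expectation (\<lambda>w. \<bar>v k w - v l w\<bar>) + x ^ 4 * D\<^sup>2"
proof -
  note [measurable] = mdiffD(3)[OF c] cvarD(2)[OF v] measurable_F[OF P]
  have C0: "0 \<le> C" by (rule mdiffD(4)[OF c])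
  have D0: "0 \<le> D" using cvarD(3,4)[OF v] not_empty order_trans by blast
  define R1 where "R1 w = iexp (x * c k w) - (1 + \<i> * of_real (x * c k w) - of_real ((x * c k w)\<^sup>2 / 2))" for w
  define R2 where "R2 w = exp (- (x\<^sup>2 * v l w / 2)) - (1 - x\<^sup>2 * v l w / 2)" for w
  have [measurable]: "R1 \<in> borel_measurable M" "R2 \<in> borel_measurable M"
    unfolding R1_def R2_def by measurable
  have R1: "cmod (R1 w) \<le> \<bar>x\<bar> ^ 3 * C ^ 3" if w: "w \<in> space M" for w
  proof -
    have "cmod (R1 w) \<le> \<bar>x * c k w\<bar> ^ 3" unfolding R1_def by (rule norm_iexp_taylor2)
    also have "\<dots> \<le> (\<bar>x\<bar> * C) ^ 3"
      using mdiffD(2)[OF c w] by (intro power_mono) (auto simp: abs_mult mult_left_mono)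
    finally show ?thesis by (simp add: power_mult_distrib)
  qed
  have R2: "\<bar>R2 w\<bar> \<le> x ^ 4 * D\<^sup>2" if w: "w \<in> space M" for w
  proof -
    have "\<bar>R2 w\<bar> \<le> (x\<^sup>2 * v l w / 2)\<^sup>2"
      unfolding R2_def by (rule exp_minus_bounds) (use cvarD(3)[OF v w] in simp)
    also have "\<dots> \<le> (x\<^sup>2 * D)\<^sup>2"
    proof (rule power_mono)
      have "x\<^sup>2 * v l w \<le> x\<^sup>2 * D" using cvarD(4)[OF v w] by (intro mult_left_mono) auto
      moreover have "0 \<le> x\<^sup>2 * v l w" using cvarD(3)[OF v w] by simp
      ultimately show "x\<^sup>2 * v l w / 2 \<le> x\<^sup>2 * D" by linarith
    qed (use cvarD(3)[OF v w] in simp)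
    finally show ?thesis by (simp add: power_mult_distrib flip: power_mult)
  qed
  have vd: "\<bar>v i w - v j w\<bar> \<le> D" if w: "w \<in> space M" for i j w
    using cvarD(3,4)[OF v w, of i] cvarD(3,4)[OF v w, of j] by (simp add: abs_le_iff)
  have cC2: "(c k w)\<^sup>2 \<le> C\<^sup>2" if "w \<in> space M" for w
    by (rule square_le_of_abs_le[OF mdiffD(2)[OF c that]])
  have cv: "\<bar>(c k w)\<^sup>2 - v k w\<bar> \<le> C\<^sup>2 + D" if w: "w \<in> space M" for w
    using cC2[OF w] cvarD(3,4)[OF v w, of k] zero_le_power2[of "c k w"] zero_le_power2[of C]
    unfolding abs_le_iff by linarith
  \<comment> \<open>An exact identity: the five terms are the two Taylor remainders, the two terms
    killed by orthogonality, and the change of variance from \<open>l\<close> to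
    \<open>k\<close>.\<close>
  have eq: "P w * (iexp (x * c k w) - of_real (exp (- (x\<^sup>2 * v l w / 2))))
     = P w * R1 w + (\<i> * of_real x) * (P w * of_real (c k w)) - of_real (x\<^sup>2 / 2) * (P w * of_real ((c k w)\<^sup>2 - v k w))
       - of_real (x\<^sup>2 / 2) * (P w * of_real (v k w - v l w)) - P w * of_real (R2 w)" for w
  proof -
    have a: "iexp (x * c k w) = R1 w + (1 + \<i> * of_real x * of_real (c k w) - of_real (x\<^sup>2 / 2) * of_real ((c k w)\<^sup>2))"
      by (simp add: R1_def power_mult_distrib)
    have b: "of_real (exp (- (x\<^sup>2 * v l w / 2))) = of_real (R2 w) + (1 - of_real (x\<^sup>2 / 2) * of_real (v l w) :: complex)"
      by (simp add: R2_def)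
    show ?thesis unfolding a b of_real_diff by algebra
  qed
  have i1: "integrable M (\<lambda>w. P w * R1 w)"
    by (rule integrable_bounded[where B = "1 * (\<bar>x\<bar> ^ 3 * C ^ 3)"], measurable)
       (use P1 R1 in \<open>simp only: norm_mult, intro mult_mono, auto\<close>)
  have i2: "integrable M (\<lambda>w. P w * of_real (c k w))"
    by (rule integrable_bounded[where B = "1 * C"], measurable)
       (use P1 mdiffD(2)[OF c] in \<open>simp only: norm_mult norm_of_real, intro mult_mono, auto\<close>)
  have i3: "integrable M (\<lambda>w. P w * of_real ((c k w)\<^sup>2 - v k w))"
    by (rule integrable_bounded[where B = "1 * (C\<^sup>2 + D)"], measurable)
       (use P1 cv in \<open>simp only: norm_mult norm_of_real, intro mult_mono, auto\<close>)
  have i4: "integrable M (\<lambda>w. P w * of_real (v k w - v l w))"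
    by (rule integrable_bounded[where B = "1 * D"], measurable)
       (use P1 vd in \<open>simp only: norm_mult norm_of_real, intro mult_mono, auto\<close>)
  have i5: "integrable M (\<lambda>w. P w * of_real (R2 w))"
    by (rule integrable_bounded[where B = "1 * (x ^ 4 * D\<^sup>2)"], measurable)
       (use P1 R2 in \<open>simp only: norm_mult norm_of_real, intro mult_mono, auto\<close>)
  have z1: "expectation (\<lambda>w. P w * of_real (c k w)) = 0"
    by (rule expectation_complex_mult_eq_0[OF mdiffD(3)[OF c] mdiffD(2)[OF c] mdiffD(6)[OF c] P P1])
  have z2: "expectation (\<lambda>w. P w * of_real ((c k w)\<^sup>2 - v k w)) = 0"
    by (rule expectation_complex_mult_eq_0[OF _ cv cvarD(5)[OF v] P P1]) measurable
  have "expectation (\<lambda>w. P w * (iexp (x * c k w) - of_real (exp (- (x\<^sup>2 * v l w / 2)))))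
     = expectation (\<lambda>w. P w * R1 w) - of_real (x\<^sup>2 / 2) * expectation (\<lambda>w. P w * of_real (v k w - v l w))
       - expectation (\<lambda>w. P w * of_real (R2 w))"
    unfolding eq using i1 i2 i3 i4 i5 z1 z2
    by (simp del: of_real_diff of_real_divide of_real_power)
  also have "cmod \<dots> \<le> cmod (expectation (\<lambda>w. P w * R1 w))
      + cmod (of_real (x\<^sup>2 / 2) * expectation (\<lambda>w. P w * of_real (v k w - v l w)))
      + cmod (expectation (\<lambda>w. P w * of_real (R2 w)))"
    by (rule order_trans[OF norm_triangle_ineq4 add_right_mono[OF norm_triangle_ineq4]])
  also have "\<dots> \<le> \<bar>x\<bar> ^ 3 * C ^ 3 + x\<^sup>2 * expectation (\<lambda>w. \<bar>v k w - v l w\<bar>) + x ^ 4 * D\<^sup>2"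
  proof (intro add_mono)
    show "cmod (expectation (\<lambda>w. P w * R1 w)) \<le> \<bar>x\<bar> ^ 3 * C ^ 3"
    proof -
      have "cmod (expectation (\<lambda>w. P w * R1 w)) \<le> expectation (\<lambda>w. \<bar>x\<bar> ^ 3 * C ^ 3)"
        by (rule norm_integral_le[OF i1])
          (use mult_mono[OF P1 R1] in \<open>auto simp: norm_mult simp del: mult_1\<close>)
      then show ?thesis using prob_space by simp
    qed
    show "cmod (expectation (\<lambda>w. P w * of_real (R2 w))) \<le> x ^ 4 * D\<^sup>2"
    proof -
      have "cmod (expectation (\<lambda>w. P w * of_real (R2 w))) \<le> expectation (\<lambda>w. x ^ 4 * D\<^sup>2)"
        by (rule norm_integral_le[OF i5])
          (use mult_mono[OF P1 R2] in \<open>auto simp: norm_mult\<close>)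
      then show ?thesis using prob_space by simp
    qed
    have "cmod (expectation (\<lambda>w. P w * of_real (v k w - v l w))) \<le> expectation (\<lambda>w. \<bar>v k w - v l w\<bar>)"
    proof (rule norm_integral_le[OF i4])
      show "integrable M (\<lambda>w. \<bar>v k w - v l w\<bar>)"
        by (rule integrable_bounded[where B = D]) (use vd in auto)
      show "cmod (P w * of_real (v k w - v l w)) \<le> \<bar>v k w - v l w\<bar>" if "w \<in> space M" for w
        using mult_right_mono[OF P1[OF that], of "\<bar>v k w - v l w\<bar>"]
        by (simp add: norm_mult del: of_real_diff)
    qed
    then have "(x\<^sup>2 / 2) * cmod (expectation (\<lambda>w. P w * of_real (v k w - v l w))) \<le> x\<^sup>2 * expectation (\<lambda>w. \<bar>v k w - v l w\<bar>)"
      by (intro mult_mono) auto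
    then show "cmod (of_real (x\<^sup>2 / 2) * expectation (\<lambda>w. P w * of_real (v k w - v l w)))
        \<le> x\<^sup>2 * expectation (\<lambda>w. \<bar>v k w - v l w\<bar>)"
      by (simp add: norm_mult norm_divide norm_power del: of_real_diff)
  qed
  finally show ?thesis .
qed

lemma char_telescope:
  assumes c: "mdiff c C" and v: "cvar c v D" and lu: "l \<le> u"
    and s: "s \<in> borel_measurable (F l)" and s1: "\<And>w. w \<in> space M \<Longrightarrow> \<bar>s w\<bar> \<le> 1"
  shows "cmod (expectation (\<lambda>w. of_real (s w) * (iexp (t * (\<Sum>k\<in>{l..<u}. a k * c k w))
      - of_real (exp (- (t\<^sup>2 * v l w * (\<Sum>k\<in>{l..<u}. (a k)\<^sup>2) / 2))))))
    \<le> (\<Sum>k\<in>{l..<u}. \<bar>t * a k\<bar> ^ 3 * C ^ 3 + (t * a k)\<^sup>2 * expectation (\<lambda>w. \<bar>v k w - v l w\<bar>) + (t * a k) ^ 4 * D\<^sup>2)"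
proof -
  define S where "S k w = (\<Sum>i\<in>{l..<k}. a i * c i w)" for k w
  define r where "r k = (\<Sum>i\<in>{k..<u}. (a i)\<^sup>2)" for k
  \<comment> \<open>Interpolation between the two ends: \<open>Q l\<close> is the Gaussian factor of
    the whole block, and \<open>Q u\<close> is the exponential of the whole sum.\<close>
  define Q where "Q k w = iexp (t * S k w) * of_real (exp (- (t\<^sup>2 * v l w * r k / 2)))" for k w
  have S_meas: "S k \<in> borel_measurable (F k)" for k unfolding S_def by (rule mdiff_sum(1)[OF c])
  have [measurable]: "S k \<in> borel_measurable M" for k using S_meas by (rule measurable_F)
  note [measurable] = cvarD(2)[OF v] measurable_F[OF s] mdiffD(3)[OF c]
  have r0: "0 \<le> r k" for k unfolding r_def by (rule sum_nonneg) simp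
  have e1: "exp (- (t\<^sup>2 * v l w * r k / 2)) \<le> 1" if "w \<in> space M" for w k
    using cvarD(3)[OF v that, of l] r0[of k] by simp
  \<comment> \<open>The common part of \<open>Q k\<close> and \<open>Q (Suc k)\<close>, times the
    weight; the index \<open>Suc k\<close> in \<open>r\<close> leaves out exactly the Gaussian
    factor of step \<open>k\<close>.\<close>
  define P where "P k w = of_real (s w) * (iexp (t * S k w) * of_real (exp (- (t\<^sup>2 * v l w * r (Suc k) / 2))))" for k w
  have P_meas: "P k \<in> borel_measurable (F k)" if "l \<le> k" for k
  proof -
    note [measurable] = S_meas[of k] measurable_F_mono[OF s that] measurable_F_mono[OF cvarD(1)[OF v, of l] that]
    show ?thesis unfolding P_def by measurable
  qed
  have P1: "cmod (P k w) \<le> 1" if "w \<in> space M" for k w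
    unfolding P_def using s1[OF that] e1[OF that, of "Suc k"]
    by (simp add: norm_mult mult_le_one)
  have step: "of_real (s w) * Q (Suc k) w - of_real (s w) * Q k w
      = P k w * (iexp ((t * a k) * c k w) - of_real (exp (- ((t * a k)\<^sup>2 * v l w / 2))))"
    if "k \<in> {l..<u}" for k w
  proof -
    have 1: "S (Suc k) w = S k w + a k * c k w" using that by (simp add: S_def)
    have 2: "r k = (a k)\<^sup>2 + r (Suc k)" using that by (simp add: r_def sum.atLeast_Suc_lessThan)
    have 3: "iexp (t * S (Suc k) w) = iexp (t * S k w) * iexp ((t * a k) * c k w)"
      by (simp add: 1 algebra_simps flip: exp_add)
    have 4: "exp (- (t\<^sup>2 * v l w * r k / 2)) = exp (- (t\<^sup>2 * v l w * r (Suc k) / 2)) * exp (- ((t * a k)\<^sup>2 * v l w / 2))"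
      by (simp add: 2 power_mult_distrib add_divide_distrib algebra_simps flip: exp_add)
    show ?thesis unfolding Q_def P_def 3 4 by (simp add: algebra_simps del: of_real_exp)
  qed
  have i: "integrable M (\<lambda>w. P k w * (iexp ((t * a k) * c k w) - of_real (exp (- ((t * a k)\<^sup>2 * v l w / 2)))))"
    if "k \<in> {l..<u}" for k
  proof (rule integrable_bounded[where B = "1 * (1 + 1)"])
    have [measurable]: "P k \<in> borel_measurable M" using P_meas that by (intro measurable_F) auto
    show "(\<lambda>w. P k w * (iexp ((t * a k) * c k w) - of_real (exp (- ((t * a k)\<^sup>2 * v l w / 2))))) \<in> borel_measurable M"
      by measurable
    fix w assume w: "w \<in> space M"
    have "exp (- ((t * a k)\<^sup>2 * v l w / 2)) \<le> 1" using cvarD(3)[OF v w, of l] by simp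
    then have "cmod (iexp ((t * a k) * c k w) - of_real (exp (- ((t * a k)\<^sup>2 * v l w / 2)))) \<le> 1 + 1"
      by - (rule order_trans[OF norm_triangle_ineq4 add_mono], auto simp del: of_real_exp)
    then show "cmod (P k w * (iexp ((t * a k) * c k w) - of_real (exp (- ((t * a k)\<^sup>2 * v l w / 2))))) \<le> 1 * (1 + 1)"
      unfolding norm_mult by (intro mult_mono P1[OF w]) auto
  qed
  have "of_real (s w) * (iexp (t * (\<Sum>k\<in>{l..<u}. a k * c k w))
      - of_real (exp (- (t\<^sup>2 * v l w * (\<Sum>k\<in>{l..<u}. (a k)\<^sup>2) / 2))))
      = (\<Sum>k\<in>{l..<u}. P k w * (iexp ((t * a k) * c k w) - of_real (exp (- ((t * a k)\<^sup>2 * v l w / 2)))))" for w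
  proof -
    have "(\<Sum>k\<in>{l..<u}. P k w * (iexp ((t * a k) * c k w) - of_real (exp (- ((t * a k)\<^sup>2 * v l w / 2)))))
        = (\<Sum>k\<in>{l..<u}. of_real (s w) * Q (Suc k) w - of_real (s w) * Q k w)"
      by (rule sum.cong) (simp_all add: step)
    also have "\<dots> = of_real (s w) * Q u w - of_real (s w) * Q l w"
      by (rule sum_Suc_diff'[OF lu])
    also have "\<dots> = of_real (s w) * (iexp (t * (\<Sum>k\<in>{l..<u}. a k * c k w))
      - of_real (exp (- (t\<^sup>2 * v l w * (\<Sum>k\<in>{l..<u}. (a k)\<^sup>2) / 2))))"
      by (simp add: Q_def S_def r_def right_diff_distrib)
    finally show ?thesis by simp
  qed
  then have "expectation (\<lambda>w. of_real (s w) * (iexp (t * (\<Sum>k\<in>{l..<u}. a k * c k w))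
      - of_real (exp (- (t\<^sup>2 * v l w * (\<Sum>k\<in>{l..<u}. (a k)\<^sup>2) / 2)))))
      = (\<Sum>k\<in>{l..<u}. expectation (\<lambda>w. P k w * (iexp ((t * a k) * c k w) - of_real (exp (- ((t * a k)\<^sup>2 * v l w / 2))))))"
    using i by simp
  also have "cmod \<dots> \<le> (\<Sum>k\<in>{l..<u}. cmod (expectation (\<lambda>w. P k w * (iexp ((t * a k) * c k w) - of_real (exp (- ((t * a k)\<^sup>2 * v l w / 2)))))))"
    by (rule norm_sum)
  also have "\<dots> \<le> (\<Sum>k\<in>{l..<u}. \<bar>t * a k\<bar> ^ 3 * C ^ 3 + (t * a k)\<^sup>2 * expectation (\<lambda>w. \<bar>v k w - v l w\<bar>) + (t * a k) ^ 4 * D\<^sup>2)"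
  proof (rule sum_mono)
    fix k assume "k \<in> {l..<u}"
    then have lk: "l \<le> k" by simp
    show "cmod (expectation (\<lambda>w. P k w * (iexp ((t * a k) * c k w) - of_real (exp (- ((t * a k)\<^sup>2 * v l w / 2))))))
      \<le> \<bar>t * a k\<bar> ^ 3 * C ^ 3 + (t * a k)\<^sup>2 * expectation (\<lambda>w. \<bar>v k w - v l w\<bar>) + (t * a k) ^ 4 * D\<^sup>2"
      by (rule char_step[OF c v lk P_meas[OF lk] P1])
  qed
  finally show ?thesis .
qed

end

section \<open>A conditional central limit theorem\<close>

context prob_space
begin

text \<open>Lets a limit variance be replaced by approximations \<open>v n\<close> at a vanishing
  \<open>L1\<close> cost; continuity in the variance and boundedness of \<open>f\<close> allow
  dominated convergence.\<close>

lemma integral_gauss_L1_tendsto: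
  fixes f :: "real \<Rightarrow> real"
  assumes f: "continuous_on UNIV f" "\<And>x. \<bar>f x\<bar> \<le> B"
    and [measurable]: "\<And>n. v n \<in> borel_measurable M" "V \<in> borel_measurable M"
    and lim: "AE w in M. (\<lambda>n. v n w) \<longlonglongrightarrow> V w"
  shows "(\<lambda>n. expectation (\<lambda>w. \<bar>(\<integral>x. f x \<partial>gauss 0 (v n w)) - (\<integral>x. f x \<partial>gauss 0 (V w))\<bar>)) \<longlonglongrightarrow> 0"
proof -
  have [measurable]: "f \<in> borel_measurable borel" using f(1) by (rule borel_measurable_continuous_onI)
  note [measurable] = measurable_compose[OF _ borel_measurable_integral_gauss[of f]]
  have "(\<lambda>n. expectation (\<lambda>w. \<bar>(\<integral>x. f x \<partial>gauss 0 (v n w)) - (\<integral>x. f x \<partial>gauss 0 (V w))\<bar>))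
      \<longlonglongrightarrow> expectation (\<lambda>w. 0)"
  proof (rule integral_dominated_convergence[where w = "\<lambda>_. 2 * B"])
    show "AE w in M. (\<lambda>n. \<bar>(\<integral>x. f x \<partial>gauss 0 (v n w)) - (\<integral>x. f x \<partial>gauss 0 (V w))\<bar>) \<longlonglongrightarrow> 0"
      using lim
    proof eventually_elim
      case (elim w)
      have "(\<lambda>n. \<integral>x. f x \<partial>gauss 0 (v n w)) \<longlonglongrightarrow> (\<integral>x. f x \<partial>gauss 0 (V w))"
        by (rule isCont_tendsto_compose[OF isCont_integral_gauss[OF f] elim])
      then show ?case by (simp add: LIM_zero_iff tendsto_rabs_zero_iff)
    qed
    have "\<bar>(\<integral>x. f x \<partial>gauss 0 u) - (\<integral>x. f x \<partial>gauss 0 u')\<bar> \<le> 2 * B" for u u'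
      using abs_integral_gauss_le[of f B u] abs_integral_gauss_le[of f B u'] f(2) by fastforce
    then show "AE w in M. norm \<bar>(\<integral>x. f x \<partial>gauss 0 (v n w)) - (\<integral>x. f x \<partial>gauss 0 (V w))\<bar> \<le> 2 * B" for n
      by simp
  qed auto
  then show ?thesis by simp
qed

end

context filtered_prob_space
begin

text \<open>The common form of both limit theorems. Weights may vary with \<open>n\<close> as long
  as they are measurable at time \<open>l n\<close>; since signs are allowed, the case
  \<open>l n = n\<close> controls conditional expectations given \<open>F n\<close> in
  \<open>L1\<close>.\<close>

definition strong_conv :: "(nat \<Rightarrow> nat) \<Rightarrow> (nat \<Rightarrow> 'w \<Rightarrow> real) \<Rightarrow> ('w \<Rightarrow> real) \<Rightarrow> bool" where
  "strong_conv l Y V \<longleftrightarrow> (\<forall>s f B. (\<forall>n. s n \<in> borel_measurable (F (l n))) \<longrightarrow>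
     (\<forall>n. \<forall>w\<in>space M. \<bar>s n w\<bar> \<le> 1) \<longrightarrow> continuous_on UNIV f \<longrightarrow> (\<forall>x. \<bar>f x\<bar> \<le> B) \<longrightarrow>
     (\<lambda>n. expectation (\<lambda>w. s n w * (f (Y n w) - (\<integral>x. f x \<partial>gauss 0 (V w))))) \<longlonglongrightarrow> (0::real))"

lemma strong_convD:
  assumes sc: "strong_conv l Y V" and s: "\<And>n. s n \<in> borel_measurable (F (l n))"
    and K: "\<And>n w. w \<in> space M \<Longrightarrow> \<bar>s n w\<bar> \<le> K"
    and f: "continuous_on UNIV f" "\<And>x. \<bar>f x\<bar> \<le> B"
  shows "(\<lambda>n. expectation (\<lambda>w. s n w * (f (Y n w) - (\<integral>x. f x \<partial>gauss 0 (V w))))) \<longlonglongrightarrow> (0::real)"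
proof -
  \<comment> \<open>Rescaling to weights bounded by 1; the shift keeps the divisor positive.\<close>
  let ?K = "\<bar>K\<bar> + 1"
  have "(\<lambda>n. expectation (\<lambda>w. s n w / ?K * (f (Y n w) - (\<integral>x. f x \<partial>gauss 0 (V w))))) \<longlonglongrightarrow> (0::real)"
  proof -
    have "\<forall>n. (\<lambda>w. s n w / ?K) \<in> borel_measurable (F (l n))"
      using s by (intro allI borel_measurable_divide) auto
    moreover have "\<forall>n. \<forall>w\<in>space M. \<bar>s n w / ?K\<bar> \<le> 1"
    proof (intro allI ballI)
      fix n w assume "w \<in> space M"
      from K[OF this, of n] have "\<bar>s n w\<bar> \<le> ?K" by linarith
      then show "\<bar>s n w / ?K\<bar> \<le> 1" by (simp add: abs_divide)
    qed
    ultimately show ?thesis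
    proof (intro sc[unfolded strong_conv_def, rule_format])
      show "\<bar>f x\<bar> \<le> B" for x by (rule f(2))
    qed (auto intro: f(1))
  qed
  moreover have "expectation (\<lambda>w. s n w / ?K * (f (Y n w) - (\<integral>x. f x \<partial>gauss 0 (V w))))
      = expectation (\<lambda>w. s n w * (f (Y n w) - (\<integral>x. f x \<partial>gauss 0 (V w)))) / ?K" for n by simp
  ultimately have "(\<lambda>n. expectation (\<lambda>w. s n w * (f (Y n w) - (\<integral>x. f x \<partial>gauss 0 (V w)))) / ?K) \<longlonglongrightarrow> 0"
    by simp
  from tendsto_mult[OF this tendsto_const[of ?K]] show ?thesis by simp
qed

lemma mdiff_strong_conv:
  assumes c: "mdiff c C" and v: "cvar c v D" and V [measurable]: "V \<in> borel_measurable M"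
    and vV: "AE w in M. (\<lambda>n. v n w) \<longlonglongrightarrow> V w"
    and l: "filterlim l at_top sequentially" and lu: "\<And>n. l n \<le> u n"
    and a2: "(\<lambda>n. \<Sum>k\<in>{l n..<u n}. (a n k)\<^sup>2) \<longlonglongrightarrow> 1"
    and ab: "\<And>n k. k \<in> {l n..<u n} \<Longrightarrow> \<bar>a n k\<bar> \<le> b n" and b: "b \<longlonglongrightarrow> 0"
    and Y [measurable]: "\<And>n. Y n \<in> borel_measurable M"
    and nul: "null (\<lambda>n w. Y n w - (\<Sum>k\<in>{l n..<u n}. a n k * c k w))"
  shows "strong_conv l Y V"
proof -
  define S where "S n w = (\<Sum>k\<in>{l n..<u n}. a n k * c k w)" for n w
  define q where "q n = (\<Sum>k\<in>{l n..<u n}. (a n k)\<^sup>2)" for n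
  note [measurable] = mdiffD(3)[OF c] cvarD(2)[OF v]
  have [measurable]: "S n \<in> borel_measurable M" for n unfolding S_def by measurable
  have C0: "0 \<le> C" by (rule mdiffD(4)[OF c])
  have D0: "0 \<le> D" using cvarD(3,4)[OF v] not_empty order_trans by blast
  have q0: "0 \<le> q n" for n unfolding q_def by (rule sum_nonneg) simp
  \<comment> \<open>The bounds of \<open>v\<close> pass to the limit, so \<open>max 0 (V w)\<close>
    is \<open>V w\<close> almost surely.\<close>
  have V0: "AE w in M. 0 \<le> V w \<and> V w \<le> D"
    using vV AE_space
  proof eventually_elim
    case (elim w)
    show ?case using LIMSEQ_le_const[OF elim(1), of 0] LIMSEQ_le_const2[OF elim(1), of D]
        cvarD(3,4)[OF v elim(2)] by blast
  qed
  define e where "e m = expectation (\<lambda>w. \<bar>v m w - V w\<bar>)" for m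
  have vV_int: "integrable M (\<lambda>w. \<bar>v m w - V w\<bar>)" for m
  proof (rule integrable_const_bound[where B = D])
    show "AE w in M. norm \<bar>v m w - V w\<bar> \<le> D"
      using V0 AE_space by eventually_elim (use cvarD(3,4)[OF v, of _ m] in \<open>fastforce simp: abs_le_iff\<close>)
  qed measurable
  have e0: "e \<longlonglongrightarrow> 0"
  proof -
    have "e \<longlonglongrightarrow> expectation (\<lambda>w. 0)"
      unfolding e_def
    proof (rule integral_dominated_convergence[where w = "\<lambda>_. D"])
      show "AE w in M. (\<lambda>n. \<bar>v n w - V w\<bar>) \<longlonglongrightarrow> 0"
        using vV by eventually_elim (simp add: LIM_zero_iff tendsto_rabs_zero_iff)
      show "AE w in M. norm \<bar>v n w - V w\<bar> \<le> D" for n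
        using V0 AE_space by eventually_elim (use cvarD(3,4)[OF v, of _ n] in \<open>fastforce simp: abs_le_iff\<close>)
    qed auto
    then show ?thesis by simp
  qed
  have ee: "expectation (\<lambda>w. \<bar>v k w - v j w\<bar>) \<le> e k + e j" for k j
  proof -
    have "expectation (\<lambda>w. \<bar>v k w - v j w\<bar>) \<le> expectation (\<lambda>w. \<bar>v k w - V w\<bar> + \<bar>v j w - V w\<bar>)"
    proof (rule integral_mono)
      have "\<bar>v k w - v j w\<bar> \<le> D" if "w \<in> space M" for w
        using cvarD(3,4)[OF v that, of k] cvarD(3,4)[OF v that, of j] by (simp add: abs_le_iff)
      then show "integrable M (\<lambda>w. \<bar>v k w - v j w\<bar>)"
        by (intro integrable_bounded[where B = D]) auto
    qed (use vV_int in auto)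
    then show ?thesis using vV_int by (simp add: e_def)
  qed
  have char: "(\<lambda>n. \<integral>w. of_real (s n w) * (iexp (t * Y n w) - of_real (exp (- (t\<^sup>2 * max 0 (V w) / 2)))) \<partial>M) \<longlonglongrightarrow> 0"
    if s: "\<And>n. s n \<in> borel_measurable (F (l n))" and s1: "\<And>n w. w \<in> space M \<Longrightarrow> \<bar>s n w\<bar> \<le> 1" for s t
  proof -
    have sM [measurable]: "s n \<in> borel_measurable M" for n using s by (rule measurable_F)
    define E1 where "E1 n w = of_real (s n w) * (iexp (t * Y n w) - iexp (t * S n w))" for n w
    define E2 where "E2 n w = of_real (s n w) * (iexp (t * S n w) - of_real (exp (- (t\<^sup>2 * v (l n) w * q n / 2))))" for n w
    define E3 where "E3 n w = s n w * (exp (- (t\<^sup>2 * v (l n) w * q n / 2)) - exp (- (t\<^sup>2 * max 0 (V w) / 2)))" for n w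
    have [measurable]: "E1 n \<in> borel_measurable M" "E2 n \<in> borel_measurable M" "E3 n \<in> borel_measurable M" for n
      unfolding E1_def E2_def E3_def by measurable
    have le1: "exp (- (t\<^sup>2 * v j w * q n / 2)) \<le> 1" "exp (- (t\<^sup>2 * max 0 (V w) / 2)) \<le> 1" if "w \<in> space M" for j n w
      using cvarD(3)[OF v that, of j] q0[of n] by simp_all
    have E1_bd: "cmod (E1 n w) \<le> (2 + \<bar>t\<bar>) * min 1 \<bar>Y n w - S n w\<bar>" if w: "w \<in> space M" for n w
    proof -
      have "cmod (E1 n w) = \<bar>s n w\<bar> * cmod (iexp (t * Y n w) - iexp (t * S n w))"
        by (simp add: E1_def norm_mult)
      also have "\<dots> \<le> 1 * ((2 + \<bar>t\<bar>) * min 1 \<bar>Y n w - S n w\<bar>)"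
        by (rule mult_mono[OF s1[OF w] norm_iexp_diff_le_min]) auto
      finally show ?thesis by simp
    qed
    have E2_bd: "cmod (E2 n w) \<le> 1 * (1 + 1)" if w: "w \<in> space M" for n w
    proof -
      have "cmod (iexp (t * S n w) - of_real (exp (- (t\<^sup>2 * v (l n) w * q n / 2)))) \<le> 1 + 1"
        using le1(1)[OF w, of "l n" n] by - (rule order_trans[OF norm_triangle_ineq4 add_mono], auto simp del: of_real_exp)
      then show ?thesis unfolding E2_def norm_mult norm_of_real by (intro mult_mono s1[OF w]) auto
    qed
    have E3_bd': "\<bar>E3 n w\<bar> \<le> \<bar>exp (- (t\<^sup>2 * v (l n) w * q n / 2)) - exp (- (t\<^sup>2 * max 0 (V w) / 2))\<bar>" if w: "w \<in> space M" for n w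
      unfolding E3_def abs_mult using mult_right_mono[OF s1[OF w]] by fastforce
    have E3_bd: "\<bar>E3 n w\<bar> \<le> 1" if w: "w \<in> space M" for n w
    proof -
      have "\<bar>exp (- (t\<^sup>2 * v (l n) w * q n / 2)) - exp (- (t\<^sup>2 * max 0 (V w) / 2))\<bar> \<le> 1"
        using le1(1)[OF w, of "l n" n] le1(2)[OF w] exp_gt_zero[of "- (t\<^sup>2 * v (l n) w * q n / 2)"] exp_gt_zero[of "- (t\<^sup>2 * max 0 (V w) / 2)"]
        unfolding abs_le_iff by linarith
      with E3_bd'[OF w, of n] show ?thesis by linarith
    qed
    have i1: "integrable M (E1 n)" for n
    proof (rule integrable_bounded[where B = "2 + \<bar>t\<bar>"])
      show "cmod (E1 n w) \<le> 2 + \<bar>t\<bar>" if "w \<in> space M" for w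
        by (rule order_trans[OF E1_bd[OF that]]) (simp add: mult_left_le)
    qed simp
    have i2: "integrable M (E2 n)" for n by (rule integrable_bounded[OF _ E2_bd]) auto
    have i3: "integrable M (E3 n)" for n by (rule integrable_bounded[where B = 1]) (use E3_bd in auto)
    have L1: "(\<lambda>n. expectation (E1 n)) \<longlonglongrightarrow> 0"
    proof (rule Lim_null_comparison)
      show "\<forall>\<^sub>F n in sequentially. cmod (expectation (E1 n)) \<le> (2 + \<bar>t\<bar>) * expectation (\<lambda>w. min 1 \<bar>Y n w - S n w\<bar>)"
      proof (intro always_eventually allI)
        fix n
        have "cmod (expectation (E1 n)) \<le> expectation (\<lambda>w. (2 + \<bar>t\<bar>) * min 1 \<bar>Y n w - S n w\<bar>)"
          by (rule norm_integral_le[OF i1 _ E1_bd]) auto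
        then show "cmod (expectation (E1 n)) \<le> (2 + \<bar>t\<bar>) * expectation (\<lambda>w. min 1 \<bar>Y n w - S n w\<bar>)" by simp
      qed
      show "(\<lambda>n. (2 + \<bar>t\<bar>) * expectation (\<lambda>w. min 1 \<bar>Y n w - S n w\<bar>)) \<longlonglongrightarrow> 0"
        using tendsto_mult[OF tendsto_const nullD(2)[OF nul], of "2 + \<bar>t\<bar>"] by (simp add: S_def)
    qed
    have L2: "(\<lambda>n. expectation (E2 n)) \<longlonglongrightarrow> 0"
    proof (rule LIMSEQ_I)
      fix r :: real assume r: "r > 0"
      \<comment> \<open>The variance drift contributes \<open>t^2 * d\<close> in the limit, which
        must stay below \<open>r\<close>; the 1 in the denominator covers
        \<open>t = 0\<close>.\<close>
      define d where "d = r / (2 * (t\<^sup>2 + 1))"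
      have t1: "t\<^sup>2 + 1 > 0" by (rule add_nonneg_pos) auto
      have d: "d > 0" unfolding d_def using r t1 by simp
      have td: "t\<^sup>2 * d < r"
      proof -
        have "r * t\<^sup>2 < r * (2 * (t\<^sup>2 + 1))" using r t1 by (intro mult_strict_left_mono) auto
        then show ?thesis unfolding d_def using t1 by (simp add: pos_divide_less_eq mult.commute)
      qed
      have "\<forall>\<^sub>F m in sequentially. e m < d / 2" using e0 d by (intro order_tendstoD) auto
      then obtain N where N: "\<And>m. m \<ge> N \<Longrightarrow> e m < d / 2" by (auto simp: eventually_sequentially)
      have "\<forall>\<^sub>F n in sequentially. N \<le> l n" using l by (simp add: filterlim_at_top)
      moreover have "(\<lambda>n. q n * (\<bar>t\<bar> ^ 3 * C ^ 3 * b n + t\<^sup>2 * d + t ^ 4 * D\<^sup>2 * (b n)\<^sup>2))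
          \<longlonglongrightarrow> 1 * (\<bar>t\<bar> ^ 3 * C ^ 3 * 0 + t\<^sup>2 * d + t ^ 4 * D\<^sup>2 * 0\<^sup>2)"
        unfolding q_def by (intro tendsto_intros a2 b)
      then have "\<forall>\<^sub>F n in sequentially. q n * (\<bar>t\<bar> ^ 3 * C ^ 3 * b n + t\<^sup>2 * d + t ^ 4 * D\<^sup>2 * (b n)\<^sup>2) < r"
        by (rule order_tendstoD) (use td in simp)
      ultimately have "\<forall>\<^sub>F n in sequentially. norm (expectation (E2 n) - 0) < r"
      proof eventually_elim
        case (elim n)
        have "cmod (expectation (E2 n)) \<le> (\<Sum>k\<in>{l n..<u n}. \<bar>t * a n k\<bar> ^ 3 * C ^ 3
            + (t * a n k)\<^sup>2 * expectation (\<lambda>w. \<bar>v k w - v (l n) w\<bar>) + (t * a n k) ^ 4 * D\<^sup>2)"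
          unfolding E2_def S_def q_def by (rule char_telescope[OF c v lu s s1])
        \<comment> \<open>One factor \<open>(a n k)^2\<close> is split off from each Taylor error;
          what remains is small uniformly over the block, and the split factors sum to
          \<open>q n\<close>.\<close>
        also have "\<dots> \<le> (\<Sum>k\<in>{l n..<u n}. (a n k)\<^sup>2 * (\<bar>t\<bar> ^ 3 * C ^ 3 * b n + t\<^sup>2 * d + t ^ 4 * D\<^sup>2 * (b n)\<^sup>2))"
        proof (rule sum_mono)
          fix k assume k: "k \<in> {l n..<u n}"
          have "\<bar>a n k\<bar> ^ 3 = (a n k)\<^sup>2 * \<bar>a n k\<bar>"
            by (simp add: power3_eq_cube power2_eq_square)
          then have "\<bar>t * a n k\<bar> ^ 3 * C ^ 3 = (a n k)\<^sup>2 * (\<bar>t\<bar> ^ 3 * C ^ 3 * \<bar>a n k\<bar>)"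
            by (simp add: abs_mult power_mult_distrib)
          also have "\<dots> \<le> (a n k)\<^sup>2 * (\<bar>t\<bar> ^ 3 * C ^ 3 * b n)"
            using C0 by (intro mult_left_mono ab k) auto
          finally have 1: "\<bar>t * a n k\<bar> ^ 3 * C ^ 3 \<le> (a n k)\<^sup>2 * (\<bar>t\<bar> ^ 3 * C ^ 3 * b n)" .
          have "expectation (\<lambda>w. \<bar>v k w - v (l n) w\<bar>) \<le> d"
            using ee[of k "l n"] N[of k] N[of "l n"] elim(1) k by simp
          then have 2: "(t * a n k)\<^sup>2 * expectation (\<lambda>w. \<bar>v k w - v (l n) w\<bar>) \<le> (a n k)\<^sup>2 * (t\<^sup>2 * d)"
            by (simp add: power_mult_distrib mult.assoc mult.left_commute mult_left_mono)
          have "(t * a n k) ^ 4 * D\<^sup>2 = (a n k)\<^sup>2 * (t ^ 4 * D\<^sup>2 * (a n k)\<^sup>2)"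
            by (simp add: power_mult_distrib power4_eq_xxxx power2_eq_square)
          also have "\<dots> \<le> (a n k)\<^sup>2 * (t ^ 4 * D\<^sup>2 * (b n)\<^sup>2)"
            by (intro mult_left_mono square_le_of_abs_le ab k) auto
          finally show "\<bar>t * a n k\<bar> ^ 3 * C ^ 3
            + (t * a n k)\<^sup>2 * expectation (\<lambda>w. \<bar>v k w - v (l n) w\<bar>) + (t * a n k) ^ 4 * D\<^sup>2
            \<le> (a n k)\<^sup>2 * (\<bar>t\<bar> ^ 3 * C ^ 3 * b n + t\<^sup>2 * d + t ^ 4 * D\<^sup>2 * (b n)\<^sup>2)"
            using 1 2 by (simp add: distrib_left)
        qed
        also have "\<dots> = q n * (\<bar>t\<bar> ^ 3 * C ^ 3 * b n + t\<^sup>2 * d + t ^ 4 * D\<^sup>2 * (b n)\<^sup>2)"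
          by (simp add: q_def sum_distrib_right)
        finally show ?case using elim(2) by simp
      qed
      then show "\<exists>no. \<forall>n\<ge>no. norm (expectation (E2 n) - 0) < r" by (simp add: eventually_sequentially)
    qed
    have L3: "(\<lambda>n. expectation (E3 n)) \<longlonglongrightarrow> 0"
    proof -
      have "(\<lambda>n. expectation (E3 n)) \<longlonglongrightarrow> expectation (\<lambda>w. 0)"
      proof (rule integral_dominated_convergence[where w = "\<lambda>_. 1"])
        show "AE w in M. (\<lambda>n. E3 n w) \<longlonglongrightarrow> 0"
          using vV V0 AE_space
        proof eventually_elim
          case (elim w)
          show ?case
          proof (rule Lim_null_comparison)
            show "\<forall>\<^sub>F n in sequentially. norm (E3 n w) \<le> \<bar>exp (- (t\<^sup>2 * v (l n) w * q n / 2)) - exp (- (t\<^sup>2 * max 0 (V w) / 2))\<bar>"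
              using E3_bd'[OF elim(3)] by simp
            have "(\<lambda>n. v (l n) w) \<longlonglongrightarrow> V w" by (rule filterlim_compose[OF elim(1) l])
            then have "(\<lambda>n. \<bar>exp (- (t\<^sup>2 * v (l n) w * q n / 2)) - exp (- (t\<^sup>2 * max 0 (V w) / 2))\<bar>)
                \<longlonglongrightarrow> \<bar>exp (- (t\<^sup>2 * V w * 1 / 2)) - exp (- (t\<^sup>2 * max 0 (V w) / 2))\<bar>"
              unfolding q_def by (intro tendsto_intros a2) auto
            then show "(\<lambda>n. \<bar>exp (- (t\<^sup>2 * v (l n) w * q n / 2)) - exp (- (t\<^sup>2 * max 0 (V w) / 2))\<bar>) \<longlonglongrightarrow> 0"
              using elim(2) by (simp add: max_def)
          qed
        qed
        show "AE w in M. norm (E3 n w) \<le> 1" for n using E3_bd by (intro AE_I2) simp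
      qed auto
      then show ?thesis by simp
    qed
    have "(\<integral>w. of_real (s n w) * (iexp (t * Y n w) - of_real (exp (- (t\<^sup>2 * max 0 (V w) / 2)))) \<partial>M)
        = expectation (E1 n) + expectation (E2 n) + of_real (expectation (E3 n))" for n
    proof -
      have "(\<integral>w. of_real (s n w) * (iexp (t * Y n w) - of_real (exp (- (t\<^sup>2 * max 0 (V w) / 2)))) \<partial>M)
          = (\<integral>w. E1 n w + E2 n w + of_real (E3 n w) \<partial>M)"
        by (rule Bochner_Integration.integral_cong)
           (simp_all add: E1_def E2_def E3_def right_diff_distrib del: of_real_exp)
      then show ?thesis using i1[of n] i2[of n] i3[of n] by simp
    qed
    moreover have "(\<lambda>n. expectation (E1 n) + expectation (E2 n) + of_real (expectation (E3 n))) \<longlonglongrightarrow> 0 + 0 + of_real 0"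
      by (intro tendsto_intros L1 L2 L3)
    ultimately show ?thesis by simp
  qed
  show ?thesis
    unfolding strong_conv_def
  proof (intro allI impI)
    fix s :: "nat \<Rightarrow> 'w \<Rightarrow> real" and f :: "real \<Rightarrow> real" and B :: real
    assume s: "\<forall>n. s n \<in> borel_measurable (F (l n))" and s1: "\<forall>n. \<forall>w\<in>space M. \<bar>s n w\<bar> \<le> (1::real)"
      and f: "continuous_on UNIV f" and B: "\<forall>x. \<bar>f x\<bar> \<le> B"
    \<comment> \<open>Constant weights give the unweighted convergence that the tilting argument
      also asks for.\<close>
    have 1: "(\<lambda>n. \<integral>w. iexp (t * Y n w) - of_real (exp (- (t\<^sup>2 * max 0 (V w) / 2))) \<partial>M) \<longlonglongrightarrow> 0" for t
      using char[of "\<lambda>_ _. 1" t] by simp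
    show "(\<lambda>n. expectation (\<lambda>w. s n w * (f (Y n w) - (\<integral>x. f x \<partial>gauss 0 (V w))))) \<longlonglongrightarrow> 0"
      by (rule weighted_levy[OF measurable_F Y V _ char 1 f]) (use s s1 B in auto)
  qed
qed

section \<open>Adapted approximation and passage to arbitrary weights\<close>

lemma bounded_cond_exp:
  fixes h :: "'w \<Rightarrow> real"
  assumes h [measurable]: "h \<in> borel_measurable M" and hB: "\<And>w. w \<in> space M \<Longrightarrow> \<bar>h w\<bar> \<le> B"
  obtains g where "g \<in> borel_measurable (F n)" "\<And>w. \<bar>g w\<bar> \<le> B"
    "\<And>W D. W \<in> borel_measurable (F n) \<Longrightarrow> (\<And>w. w \<in> space M \<Longrightarrow> \<bar>W w\<bar> \<le> D) \<Longrightarrow>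
       expectation (\<lambda>w. W w * g w) = expectation (\<lambda>w. W w * h w)"
proof -
  interpret S: sigma_finite_subalgebra M "F n"
    by (rule finite_measure_subalgebra_is_sigma_finite)
       (use subalg finite_measure_axioms in \<open>auto simp: finite_measure_subalgebra_def finite_measure_subalgebra_axioms_def\<close>)
  have B0: "0 \<le> B" using hB not_empty abs_ge_zero order_trans by blast
  have hi: "integrable M h" by (rule integrable_bounded[where B = B]) (use hB in auto)
  \<comment> \<open>A conditional expectation is bounded by \<open>B\<close> only almost everywhere;
    clamping makes the bound hold at every point, as it must for an admissible weight.\<close>
  define g where "g w = max (- B) (min B (real_cond_exp M (F n) h w))" for w
  have "AE w in M. real_cond_exp M (F n) h w \<le> B"
    by (rule S.real_cond_exp_le_c[OF hi]) (use hB in \<open>auto simp: abs_le_iff\<close>)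
  moreover have "AE w in M. real_cond_exp M (F n) h w \<ge> - B"
    by (rule S.real_cond_exp_ge_c[OF hi], rule AE_I2) (use hB in \<open>force simp: abs_le_iff\<close>)
  ultimately have eq: "AE w in M. g w = real_cond_exp M (F n) h w"
    by eventually_elim (auto simp: g_def)
  have g_meas: "g \<in> borel_measurable (F n)" unfolding g_def by measurable
  have gM [measurable]: "g \<in> borel_measurable M" using g_meas by (rule measurable_F)
  show thesis
  proof (rule that[of g])
    show "\<bar>g w\<bar> \<le> B" for w using B0 by (auto simp: g_def)
    fix W :: "'w \<Rightarrow> real" and D :: real
    assume W: "W \<in> borel_measurable (F n)" and D: "\<And>w. w \<in> space M \<Longrightarrow> \<bar>W w\<bar> \<le> D"
    have [measurable]: "W \<in> borel_measurable M" using W by (rule measurable_F)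
    have "0 \<le> D" using D not_empty abs_ge_zero order_trans by blast
    have Wh: "integrable M (\<lambda>w. W w * h w)"
      by (rule integrable_bounded[where B = "D * B"])
         (use D hB \<open>0 \<le> D\<close> in \<open>auto simp: abs_mult intro!: mult_mono\<close>)
    have "expectation (\<lambda>w. W w * g w) = expectation (\<lambda>w. W w * real_cond_exp M (F n) h w)"
      by (rule integral_cong_AE) (use eq in auto)
    also have "\<dots> = expectation (\<lambda>w. W w * h w)"
      by (rule S.real_cond_exp_intg(2)[OF Wh W h])
    finally show "expectation (\<lambda>w. W w * g w) = expectation (\<lambda>w. W w * h w)" .
  qed (rule g_meas)
qed

text \<open>Almost sure limits of adapted variables, a substitute for measurability with respect to
  the completed limit field. The limit variances and D* belong to this class, although in general
  they are not measurable at any finite time.\<close>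

definition F_limit :: "('w \<Rightarrow> real) \<Rightarrow> bool" where
  "F_limit W \<longleftrightarrow> (\<exists>G. (\<forall>N. G N \<in> borel_measurable (F N)) \<and> (AE w in M. (\<lambda>N. G N w) \<longlonglongrightarrow> W w))"

lemma F_limit_of_measurable:
  assumes "W \<in> borel_measurable (F n)"
  shows "F_limit W"
  unfolding F_limit_def
proof (intro exI conjI allI)
  show "(\<lambda>w. if n \<le> N then W w else 0) \<in> borel_measurable (F N)" for N
    using measurable_F_mono[OF assms, of N] by (cases "n \<le> N") auto
  show "AE w in M. (\<lambda>N. if n \<le> N then W w else 0) \<longlonglongrightarrow> W w"
  proof (intro AE_I2 tendsto_eventually)
    show "\<forall>\<^sub>F N in sequentially. (if n \<le> N then W w else 0) = W w" for w
      using eventually_ge_at_top[of n] by eventually_elim simp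
  qed
qed

lemma F_limit_compose:
  assumes "F_limit W" and f: "\<And>x. isCont f x"
  shows "F_limit (\<lambda>w. f (W w))"
proof -
  obtain G where G: "\<And>N. G N \<in> borel_measurable (F N)" "AE w in M. (\<lambda>N. G N w) \<longlonglongrightarrow> W w"
    using assms(1) unfolding F_limit_def by blast
  have [measurable]: "f \<in> borel_measurable borel"
    using f by (intro borel_measurable_continuous_onI continuous_at_imp_continuous_on) auto
  show ?thesis unfolding F_limit_def
  proof (intro exI conjI allI)
    show "(\<lambda>w. f (G N w)) \<in> borel_measurable (F N)" for N using G(1)[of N] by measurable
    show "AE w in M. (\<lambda>N. f (G N w)) \<longlonglongrightarrow> f (W w)"
      using G(2) by eventually_elim (rule isCont_tendsto_compose[OF f])
  qed
qed

lemma F_limit_binop: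
  assumes "F_limit W" "F_limit W'"
  shows "F_limit (\<lambda>w. W w * W' w)" "F_limit (\<lambda>w. W w - W' w)" "F_limit (\<lambda>w. W w + W' w)"
proof -
  obtain G where G: "\<And>N. G N \<in> borel_measurable (F N)" "AE w in M. (\<lambda>N. G N w) \<longlonglongrightarrow> W w"
    using assms(1) unfolding F_limit_def by blast
  obtain G' where G': "\<And>N. G' N \<in> borel_measurable (F N)" "AE w in M. (\<lambda>N. G' N w) \<longlonglongrightarrow> W' w"
    using assms(2) unfolding F_limit_def by blast
  note [measurable] = G(1) G'(1)
  show "F_limit (\<lambda>w. W w * W' w)" unfolding F_limit_def
  proof (intro exI conjI allI)
    show "AE w in M. (\<lambda>N. G N w * G' N w) \<longlonglongrightarrow> W w * W' w"
      using G(2) G'(2) by eventually_elim (rule tendsto_mult)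
  qed measurable
  show "F_limit (\<lambda>w. W w - W' w)" unfolding F_limit_def
  proof (intro exI conjI allI)
    show "AE w in M. (\<lambda>N. G N w - G' N w) \<longlonglongrightarrow> W w - W' w"
      using G(2) G'(2) by eventually_elim (rule tendsto_diff)
  qed measurable
  show "F_limit (\<lambda>w. W w + W' w)" unfolding F_limit_def
  proof (intro exI conjI allI)
    show "AE w in M. (\<lambda>N. G N w + G' N w) \<longlonglongrightarrow> W w + W' w"
      using G(2) G'(2) by eventually_elim (rule tendsto_add)
  qed measurable
qed

text \<open>The conditional expectations \<open>g n\<close> of \<open>h\<close> form a bounded martingale, so they are Cauchy in
  \<open>L\<^sup>2\<close>; testing against asymptotically measurable \<open>W n\<close> only sees their limit.\<close>

lemma cond_approx:
  fixes h :: "'w \<Rightarrow> real"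
  assumes h [measurable]: "h \<in> borel_measurable M" and hB: "\<And>w. w \<in> space M \<Longrightarrow> \<bar>h w\<bar> \<le> B"
  shows "\<exists>g. (\<forall>n. g n \<in> borel_measurable (F n)) \<and> (\<forall>n w. \<bar>g n w\<bar> \<le> B) \<and>
    (\<forall>l W D. filterlim l at_top sequentially \<longrightarrow> (\<forall>n. W n \<in> borel_measurable M) \<longrightarrow>
       (\<forall>n. \<forall>w\<in>space M. \<bar>W n w\<bar> \<le> D) \<longrightarrow> (\<forall>n. F_limit (W n)) \<longrightarrow>
       (\<lambda>n. expectation (\<lambda>w. W n w * h w) - expectation (\<lambda>w. W n w * g (l n) w)) \<longlonglongrightarrow> (0::real))"
proof -
  have "\<forall>n. \<exists>g. g \<in> borel_measurable (F n) \<and> (\<forall>w. \<bar>g w\<bar> \<le> B) \<and>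
    (\<forall>W D. W \<in> borel_measurable (F n) \<longrightarrow> (\<forall>w\<in>space M. \<bar>W w\<bar> \<le> D) \<longrightarrow>
       expectation (\<lambda>w. W w * g w) = expectation (\<lambda>w. W w * h w))"
  proof
    fix n show "\<exists>g. g \<in> borel_measurable (F n) \<and> (\<forall>w. \<bar>g w\<bar> \<le> B) \<and>
    (\<forall>W D. W \<in> borel_measurable (F n) \<longrightarrow> (\<forall>w\<in>space M. \<bar>W w\<bar> \<le> D) \<longrightarrow>
       expectation (\<lambda>w. W w * g w) = expectation (\<lambda>w. W w * h w))"
      by (rule bounded_cond_exp[OF h hB, of n]) blast+
  qed
  then obtain g where g: "\<And>n. g n \<in> borel_measurable (F n)" and gB: "\<And>n w. \<bar>g n w\<bar> \<le> B"
    and gW: "\<And>n W D. W \<in> borel_measurable (F n) \<Longrightarrow> (\<And>w. w \<in> space M \<Longrightarrow> \<bar>W w\<bar> \<le> D) \<Longrightarrow>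
       expectation (\<lambda>w. W w * g n w) = expectation (\<lambda>w. W w * h w)" by metis
  have [measurable]: "g n \<in> borel_measurable M" for n using g by (rule measurable_F)
  have B0: "0 \<le> B" using gB[of 0] abs_ge_zero order_trans by blast
  have gi: "integrable M (\<lambda>w. g n w * g k w)" for n k
    by (rule integrable_bounded[where B = "B * B"])
       (use gB B0 in \<open>auto simp: abs_mult intro!: mult_mono\<close>)
  \<comment> \<open>Squared \<open>L2\<close> norms. By the martingale property their differences
    are the squared distances, so a bounded increasing sequence controls the Cauchy
    property.\<close>
  define \<alpha> where "\<alpha> n = expectation (\<lambda>w. g n w * g n w)" for n
  have gg: "expectation (\<lambda>w. g n w * g k w) = \<alpha> n" if "n \<le> k" for n k
  proof -
    have "expectation (\<lambda>w. g n w * g k w) = expectation (\<lambda>w. g n w * h w)"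
      by (rule gW[OF measurable_F_mono[OF g that] gB])
    also have "\<dots> = \<alpha> n" unfolding \<alpha>_def by (rule gW[OF g gB, symmetric])
    finally show ?thesis .
  qed
  have diff: "expectation (\<lambda>w. (g k w - g n w)\<^sup>2) = \<alpha> k - \<alpha> n" if "n \<le> k" for n k
  proof -
    have "expectation (\<lambda>w. (g k w - g n w)\<^sup>2) = expectation (\<lambda>w. g k w * g k w - 2 * (g n w * g k w) + g n w * g n w)"
      by (rule Bochner_Integration.integral_cong) (auto simp: power2_eq_square algebra_simps)
    also have "\<dots> = \<alpha> k - 2 * \<alpha> n + \<alpha> n" using gi gg[OF that] by (simp add: \<alpha>_def)
    finally show ?thesis by simp
  qed
  have "incseq \<alpha>"
  proof (rule monoI)
    fix n k :: nat assume "n \<le> k"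
    have "0 \<le> expectation (\<lambda>w. (g k w - g n w)\<^sup>2)" by simp
    with diff[OF \<open>n \<le> k\<close>] show "\<alpha> n \<le> \<alpha> k" by simp
  qed
  moreover have "\<alpha> n \<le> B * B" for n
  proof -
    have "\<alpha> n \<le> expectation (\<lambda>_. B * B)" unfolding \<alpha>_def
    proof (rule integral_mono)
      show "g n w * g n w \<le> B * B" for w
        using square_le_of_abs_le[OF gB[of n w]] by (simp add: power2_eq_square)
    qed (use gi in auto)
    then show ?thesis using prob_space by simp
  qed
  ultimately obtain L where "\<alpha> \<longlonglongrightarrow> L" using incseq_convergent[of \<alpha> "B * B"] by blast
  then have Cau: "Cauchy \<alpha>" by (rule LIMSEQ_imp_Cauchy)
  have L1: "\<exists>n0. \<forall>n\<ge>n0. \<forall>k\<ge>n. expectation (\<lambda>w. \<bar>g k w - g n w\<bar>) \<le> e" if e: "e > 0" for e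
  proof -
    obtain n0 where n0: "\<And>m n. m \<ge> n0 \<Longrightarrow> n \<ge> n0 \<Longrightarrow> dist (\<alpha> m) (\<alpha> n) < e\<^sup>2"
      using metric_CauchyD[OF Cau, of "e\<^sup>2"] e by auto
    have "expectation (\<lambda>w. \<bar>g k w - g n w\<bar>) \<le> e" if "n \<ge> n0" "k \<ge> n" for n k
    proof -
      have b2: "\<bar>g k w - g n w\<bar> \<le> 2 * B" for w using gB[of k w] gB[of n w] by linarith
      have "expectation (\<lambda>w. \<bar>g k w - g n w\<bar>) \<le> sqrt (expectation (\<lambda>w. (g k w - g n w)\<^sup>2))"
      proof (rule expectation_abs_le_sqrt)
        show "integrable M (\<lambda>w. g k w - g n w)"
          by (rule integrable_bounded[where B = "2 * B"]) (simp_all add: b2)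
        show "integrable M (\<lambda>w. (g k w - g n w)\<^sup>2)"
          by (rule integrable_bounded[where B = "(2 * B)\<^sup>2"], measurable)
             (simp only: real_norm_def abs_power2 square_le_of_abs_le[OF b2])
      qed
      also have "\<dots> \<le> sqrt (e\<^sup>2)"
        unfolding diff[OF that(2)] using n0[of k n] that by (intro real_sqrt_le_mono) (auto simp: dist_real_def)
      finally show ?thesis using e by simp
    qed
    then show ?thesis by blast
  qed
  \<comment> \<open>\<open>W\<close> is approximated by adapted \<open>G N\<close>, clamped to keep
    the bound \<open>D\<close>. Tested against \<open>G N\<close>, the variable \<open>h\<close> may
    be replaced by \<open>g N\<close>, and for \<open>N >= n\<close> this is within \<open>e\<close>
    of \<open>g n\<close> in \<open>L1\<close>.\<close>
  have swap: "\<bar>expectation (\<lambda>w. W w * h w) - expectation (\<lambda>w. W w * g n w)\<bar> \<le> D * e"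
    if W [measurable]: "W \<in> borel_measurable M" and D: "\<And>w. w \<in> space M \<Longrightarrow> \<bar>W w\<bar> \<le> D"
      and lim: "F_limit W" and e: "\<And>k. k \<ge> n \<Longrightarrow> expectation (\<lambda>w. \<bar>g k w - g n w\<bar>) \<le> e" for W D n e
  proof -
    have D0: "0 \<le> D" using D not_empty abs_ge_zero order_trans by blast
    obtain G' where G': "\<And>N. G' N \<in> borel_measurable (F N)" "AE w in M. (\<lambda>N. G' N w) \<longlonglongrightarrow> W w"
      using lim unfolding F_limit_def by blast
    define G where "G N w = max (- D) (min D (G' N w))" for N w
    have G: "G N \<in> borel_measurable (F N)" for N unfolding G_def using G'(1)[of N] by measurable
    have [measurable]: "G N \<in> borel_measurable M" for N using G by (rule measurable_F)
    have GD: "\<bar>G N w\<bar> \<le> D" for N w using D0 by (auto simp: G_def)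
    have Glim: "AE w in M. (\<lambda>N. G N w) \<longlonglongrightarrow> W w"
      using G'(2) AE_space
    proof eventually_elim
      case (elim w)
      have "(\<lambda>N. G N w) \<longlonglongrightarrow> max (- D) (min D (W w))"
        unfolding G_def by (intro tendsto_intros elim)
      then show ?case using D[OF elim(2)] by (auto simp: abs_le_iff max_def min_def split: if_splits)
    qed
    have conv: "(\<lambda>N. expectation (\<lambda>w. G N w * x w)) \<longlonglongrightarrow> expectation (\<lambda>w. W w * x w)"
      if [measurable]: "x \<in> borel_measurable M" and x: "\<And>w. w \<in> space M \<Longrightarrow> \<bar>x w\<bar> \<le> B" for x
    proof (rule integral_dominated_convergence[where w = "\<lambda>_. D * B"])
      show "AE w in M. (\<lambda>N. G N w * x w) \<longlonglongrightarrow> W w * x w"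
        using Glim by eventually_elim (intro tendsto_intros)
      show "AE w in M. norm (G N w * x w) \<le> D * B" for N
        using GD x D0 by (intro AE_I2) (auto simp: abs_mult intro!: mult_mono)
    qed auto
    have "(\<lambda>N. \<bar>expectation (\<lambda>w. G N w * h w) - expectation (\<lambda>w. G N w * g n w)\<bar>)
        \<longlonglongrightarrow> \<bar>expectation (\<lambda>w. W w * h w) - expectation (\<lambda>w. W w * g n w)\<bar>"
      by (intro tendsto_intros conv hB gB) auto
    moreover have "\<bar>expectation (\<lambda>w. G N w * h w) - expectation (\<lambda>w. G N w * g n w)\<bar> \<le> D * e" if "N \<ge> n" for N
    proof -
      have ii: "integrable M (\<lambda>w. G N w * g k w)" for k
        by (rule integrable_bounded[where B = "D * B"])
           (use GD gB D0 in \<open>auto simp: abs_mult intro!: mult_mono\<close>)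
      have gd: "integrable M (\<lambda>w. \<bar>g N w - g n w\<bar>)"
      proof (rule integrable_bounded[where B = "2 * B"])
        show "norm \<bar>g N w - g n w\<bar> \<le> 2 * B" for w using gB[of N w] gB[of n w] by simp
      qed measurable
      have "expectation (\<lambda>w. G N w * h w) = expectation (\<lambda>w. G N w * g N w)"
        by (rule gW[OF G GD, symmetric])
      then have "expectation (\<lambda>w. G N w * h w) - expectation (\<lambda>w. G N w * g n w)
          = expectation (\<lambda>w. G N w * g N w - G N w * g n w)" using ii by simp
      also have "\<bar>\<dots>\<bar> \<le> expectation (\<lambda>w. D * \<bar>g N w - g n w\<bar>)"
      proof (rule norm_integral_le[where 'b = real, unfolded real_norm_def])
        show "\<bar>G N w * g N w - G N w * g n w\<bar> \<le> D * \<bar>g N w - g n w\<bar>" for w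
          using mult_right_mono[OF GD[of N w], of "\<bar>g N w - g n w\<bar>"]
          by (simp add: abs_mult flip: right_diff_distrib)
      qed (use ii gd in auto)
      also have "\<dots> = D * expectation (\<lambda>w. \<bar>g N w - g n w\<bar>)" by simp
      also have "\<dots> \<le> D * e" by (rule mult_left_mono[OF e[OF that] D0])
      finally show ?thesis .
    qed
    ultimately show ?thesis by (intro LIMSEQ_le_const2) auto
  qed
  show ?thesis
  proof (intro exI[of _ g] conjI allI impI)
    fix l :: "nat \<Rightarrow> nat" and W :: "nat \<Rightarrow> 'w \<Rightarrow> real" and D
    assume l: "filterlim l at_top sequentially" and W: "\<forall>n. W n \<in> borel_measurable M"
      and D: "\<forall>n. \<forall>w\<in>space M. \<bar>W n w\<bar> \<le> D" and lim: "\<forall>n. F_limit (W n)"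
    have D0: "0 \<le> D" using D not_empty abs_ge_zero order_trans by blast
    show "(\<lambda>n. expectation (\<lambda>w. W n w * h w) - expectation (\<lambda>w. W n w * g (l n) w)) \<longlonglongrightarrow> 0"
    proof (rule LIMSEQ_I)
      fix r :: real assume r: "r > 0"
      have rD: "r / (D + 1) > 0" using r D0 by simp
      obtain n0 where n0: "\<And>n k. n \<ge> n0 \<Longrightarrow> k \<ge> n \<Longrightarrow> expectation (\<lambda>w. \<bar>g k w - g n w\<bar>) \<le> r / (D + 1)"
        using L1[OF rD] by blast
      have "\<forall>\<^sub>F n in sequentially. n0 \<le> l n" using l by (simp add: filterlim_at_top)
      then obtain no where no: "\<And>n. n \<ge> no \<Longrightarrow> n0 \<le> l n" by (auto simp: eventually_sequentially)
      have "D * (r / (D + 1)) < r" using r D0 by (simp add: pos_divide_less_eq)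
      then have "norm (expectation (\<lambda>w. W n w * h w) - expectation (\<lambda>w. W n w * g (l n) w) - 0) < r" if "n \<ge> no" for n
        using swap[OF W[rule_format] D[rule_format] lim[rule_format] n0[OF no[OF that]], of n] by simp
      then show "\<exists>no. \<forall>n\<ge>no. norm (expectation (\<lambda>w. W n w * h w) - expectation (\<lambda>w. W n w * g (l n) w) - 0) < r"
        by blast
    qed
  qed (use g gB in auto)
qed

lemma F_limit_gauss:
  assumes "F_limit V" and f: "continuous_on UNIV f" "\<And>x. \<bar>f x\<bar> \<le> B"
  shows "F_limit (\<lambda>w. \<integral>x. f x \<partial>gauss 0 (V w))"
  by (rule F_limit_compose[OF assms(1) isCont_integral_gauss[OF f]])

text \<open>An arbitrary bounded \<open>h\<close> is not an admissible weight. Since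
  \<open>f (Y n)\<close> and the Gaussian integral are limits of adapted variables, \<open>h\<close>
  may be traded for a version of its conditional expectation at time \<open>l n\<close>, which is
  admissible.\<close>

lemma stable_of_strong:
  fixes h :: "'w \<Rightarrow> real"
  assumes sc: "strong_conv l Y V" and l: "filterlim l at_top sequentially"
    and [measurable]: "\<And>n. Y n \<in> borel_measurable M" "V \<in> borel_measurable M" "h \<in> borel_measurable M"
    and Y: "\<And>n. F_limit (Y n)" and V: "F_limit V"
    and h: "\<And>w. w \<in> space M \<Longrightarrow> \<bar>h w\<bar> \<le> B" and f: "continuous_on UNIV f" "\<And>x. \<bar>f x\<bar> \<le> D"
  shows "(\<lambda>n. expectation (\<lambda>w. h w * f (Y n w))) \<longlonglongrightarrow> expectation (\<lambda>w. h w * (\<integral>x. f x \<partial>gauss 0 (V w)))"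
proof -
  have fM [measurable]: "f \<in> borel_measurable borel" using f(1) by (rule borel_measurable_continuous_onI)
  note [measurable] = measurable_compose[OF _ borel_measurable_integral_gauss[of f]]
  have fc: "isCont f x" for x using f(1) continuous_on_eq_continuous_at by blast
  have hM: "h \<in> borel_measurable M" by measurable
  obtain g where g: "\<forall>n. g n \<in> borel_measurable (F n)" "\<forall>n w. \<bar>g n w\<bar> \<le> B"
    "\<forall>l W D. filterlim l at_top sequentially \<longrightarrow> (\<forall>n. W n \<in> borel_measurable M) \<longrightarrow>
       (\<forall>n. \<forall>w\<in>space M. \<bar>W n w\<bar> \<le> D) \<longrightarrow> (\<forall>n. F_limit (W n)) \<longrightarrow>
       (\<lambda>n. expectation (\<lambda>w. W n w * h w) - expectation (\<lambda>w. W n w * g (l n) w)) \<longlonglongrightarrow> (0::real)"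
    using cond_approx[OF hM h] by blast
  define W where "W n w = f (Y n w) - (\<integral>x. f x \<partial>gauss 0 (V w))" for n w
  have Kf: "\<bar>\<integral>x. f x \<partial>gauss 0 v\<bar> \<le> D" for v by (rule abs_integral_gauss_le[OF fM f(2)])
  have [measurable]: "W n \<in> borel_measurable M" for n unfolding W_def by measurable
  have WD: "\<bar>W n w\<bar> \<le> 2 * D" for n w unfolding W_def using f(2)[of "Y n w"] Kf[of "V w"] by linarith
  have Wl: "F_limit (W n)" for n
    unfolding W_def by (intro F_limit_binop F_limit_compose[OF Y fc] F_limit_gauss[OF V f])
  have 1: "(\<lambda>n. expectation (\<lambda>w. W n w * h w) - expectation (\<lambda>w. W n w * g (l n) w)) \<longlonglongrightarrow> 0"
    using g(3)[rule_format, OF l, of W "2 * D"] WD Wl by simp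
  have 2: "(\<lambda>n. expectation (\<lambda>w. g (l n) w * W n w)) \<longlonglongrightarrow> 0"
    unfolding W_def by (rule strong_convD[OF sc g(1)[rule_format] g(2)[rule_format] f])
  have "(\<lambda>n. expectation (\<lambda>w. W n w * h w)) \<longlonglongrightarrow> 0"
    using tendsto_add[OF 1 2] by (simp add: mult.commute)
  moreover have "expectation (\<lambda>w. W n w * h w)
      = expectation (\<lambda>w. h w * f (Y n w)) - expectation (\<lambda>w. h w * (\<integral>x. f x \<partial>gauss 0 (V w)))" for n
  proof -
    have "0 \<le> B" using h not_empty abs_ge_zero order_trans by blast
    then have i: "integrable M (\<lambda>w. h w * f (Y n w))" "integrable M (\<lambda>w. h w * (\<integral>x. f x \<partial>gauss 0 (V w)))"
      using h f(2) Kf by (auto intro!: integrable_bounded[where B = "B * D"] mult_mono simp: abs_mult)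
    have "expectation (\<lambda>w. W n w * h w) = expectation (\<lambda>w. h w * f (Y n w) - h w * (\<integral>x. f x \<partial>gauss 0 (V w)))"
      by (rule Bochner_Integration.integral_cong) (auto simp: W_def algebra_simps)
    with i show ?thesis by simp
  qed
  ultimately show ?thesis by (simp add: LIM_zero_iff)
qed

text \<open>Two replacements. \<open>f (Y n)\<close> is known at time \<open>n\<close> and joins the
  weight, so \<open>k (Z n)\<close> turns into its Gaussian integral \<open>kV\<close>. That
  integral does not depend on \<open>n\<close> and joins \<open>h\<close>, so the statement for a
  single sequence handles \<open>f (Y n)\<close>.\<close>

lemma stable_product:
  fixes h :: "'w \<Rightarrow> real"
  assumes sC: "strong_conv l Y U" and l: "filterlim l at_top sequentially"
    and sD: "strong_conv (\<lambda>n. n) Z V"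
    and Yn: "\<And>n. Y n \<in> borel_measurable (F n)"
    and [measurable]: "\<And>n. Z n \<in> borel_measurable M" "U \<in> borel_measurable M" "V \<in> borel_measurable M" "h \<in> borel_measurable M"
    and Z: "\<And>n. F_limit (Z n)" and U: "F_limit U" and V: "F_limit V"
    and h: "\<And>w. w \<in> space M \<Longrightarrow> \<bar>h w\<bar> \<le> B" and f: "continuous_on UNIV f" "\<And>x. \<bar>f x\<bar> \<le> D"
    and k: "continuous_on UNIV k" "\<And>x. \<bar>k x\<bar> \<le> E"
  shows "(\<lambda>n. expectation (\<lambda>w. h w * (f (Y n w) * k (Z n w))))
    \<longlonglongrightarrow> expectation (\<lambda>w. h w * ((\<integral>x. f x \<partial>gauss 0 (U w)) * (\<integral>x. k x \<partial>gauss 0 (V w))))"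
proof -
  have fM [measurable]: "f \<in> borel_measurable borel" using f(1) by (rule borel_measurable_continuous_onI)
  have kM [measurable]: "k \<in> borel_measurable borel" using k(1) by (rule borel_measurable_continuous_onI)
  note [measurable] = measurable_compose[OF _ borel_measurable_integral_gauss[of f]]
    measurable_compose[OF _ borel_measurable_integral_gauss[of k]] measurable_F[OF Yn]
  have fc: "isCont f x" for x using f(1) continuous_on_eq_continuous_at by blast
  have kc: "isCont k x" for x using k(1) continuous_on_eq_continuous_at by blast
  have Yl: "F_limit (Y n)" for n using Yn by (rule F_limit_of_measurable)
  have hM: "h \<in> borel_measurable M" by measurable
  obtain g where g: "\<forall>n. g n \<in> borel_measurable (F n)" "\<forall>n w. \<bar>g n w\<bar> \<le> B"
    "\<forall>l W D. filterlim l at_top sequentially \<longrightarrow> (\<forall>n. W n \<in> borel_measurable M) \<longrightarrow>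
       (\<forall>n. \<forall>w\<in>space M. \<bar>W n w\<bar> \<le> D) \<longrightarrow> (\<forall>n. F_limit (W n)) \<longrightarrow>
       (\<lambda>n. expectation (\<lambda>w. W n w * h w) - expectation (\<lambda>w. W n w * g (l n) w)) \<longlonglongrightarrow> (0::real)"
    using cond_approx[OF hM h] by blast
  define kV where "kV w = (\<integral>x. k x \<partial>gauss 0 (V w))" for w
  have [measurable]: "kV \<in> borel_measurable M" unfolding kV_def by measurable
  have kVE: "\<bar>kV w\<bar> \<le> E" for w unfolding kV_def by (rule abs_integral_gauss_le[OF kM k(2)])
  have kVl: "F_limit kV" unfolding kV_def by (rule F_limit_gauss[OF V k])
  have B0: "0 \<le> B" using h not_empty abs_ge_zero order_trans by blast
  have D0: "0 \<le> D" using f(2)[of 0] by linarith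
  have E0: "0 \<le> E" using k(2)[of 0] by linarith
  define W where "W n w = f (Y n w) * (k (Z n w) - kV w)" for n w
  have [measurable]: "W n \<in> borel_measurable M" for n unfolding W_def by measurable
  have WD: "\<bar>W n w\<bar> \<le> D * (2 * E)" for n w
  proof -
    have "\<bar>k (Z n w) - kV w\<bar> \<le> 2 * E" using k(2)[of "Z n w"] kVE[of w] by linarith
    then show ?thesis unfolding W_def abs_mult by (intro mult_mono f(2)) (use D0 in auto)
  qed
  have Wl: "F_limit (W n)" for n
    unfolding W_def by (intro F_limit_binop F_limit_compose[OF Yl fc] F_limit_compose[OF Z kc] kVl)
  have 1: "(\<lambda>n. expectation (\<lambda>w. W n w * h w) - expectation (\<lambda>w. W n w * g n w)) \<longlonglongrightarrow> 0"
    using g(3)[rule_format, OF filterlim_ident, of W "D * (2 * E)"] WD Wl by simp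
  have "(\<lambda>n. expectation (\<lambda>w. (g n w * f (Y n w)) * (k (Z n w) - kV w))) \<longlonglongrightarrow> 0"
    unfolding kV_def
  proof (rule strong_convD[OF sD _ _ k])
    show "(\<lambda>w. g n w * f (Y n w)) \<in> borel_measurable (F n)" for n
    proof -
      note [measurable] = g(1)[rule_format, of n] Yn[of n]
      show ?thesis by measurable
    qed
    show "\<bar>g n w * f (Y n w)\<bar> \<le> B * D" for n w
      unfolding abs_mult by (intro mult_mono g(2)[rule_format] f(2)) (use B0 in auto)
  qed
  then have 2: "(\<lambda>n. expectation (\<lambda>w. W n w * g n w)) \<longlonglongrightarrow> 0"
    by (simp add: W_def mult.assoc mult.left_commute mult.commute)
  have 3: "(\<lambda>n. expectation (\<lambda>w. W n w * h w)) \<longlonglongrightarrow> 0"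
    using tendsto_add[OF 1 2] by simp
  have 4: "(\<lambda>n. expectation (\<lambda>w. (h w * kV w) * f (Y n w)))
      \<longlonglongrightarrow> expectation (\<lambda>w. (h w * kV w) * (\<integral>x. f x \<partial>gauss 0 (U w)))"
  proof (rule stable_of_strong[OF sC l _ _ _ Yl U _ f])
    show "\<bar>h w * kV w\<bar> \<le> B * E" if "w \<in> space M" for w
      unfolding abs_mult by (intro mult_mono h[OF that] kVE) (use B0 in auto)
  qed measurable
  have eq: "expectation (\<lambda>w. h w * (f (Y n w) * k (Z n w)))
      = expectation (\<lambda>w. W n w * h w) + expectation (\<lambda>w. (h w * kV w) * f (Y n w))" for n
  proof -
    have "integrable M (\<lambda>w. W n w * h w)"
      by (rule integrable_bounded[where B = "(D * (2 * E)) * B"])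
         (use WD h D0 E0 in \<open>auto simp: abs_mult[of "W n _"] intro!: mult_mono\<close>)
    moreover have "integrable M (\<lambda>w. (h w * kV w) * f (Y n w))"
      by (rule integrable_bounded[where B = "(B * E) * D"])
         (use h kVE f(2) B0 E0 in \<open>auto simp: abs_mult intro!: mult_mono\<close>)
    moreover have "expectation (\<lambda>w. h w * (f (Y n w) * k (Z n w)))
      = expectation (\<lambda>w. W n w * h w + (h w * kV w) * f (Y n w))"
      by (rule Bochner_Integration.integral_cong) (auto simp: W_def algebra_simps)
    ultimately show ?thesis by simp
  qed
  show ?thesis
    unfolding eq using tendsto_add[OF 3 4] by (simp add: kV_def mult.assoc mult.left_commute mult.commute)
qed

end

section \<open>From weighted to stable convergence\<close>

lemma bounded_rangeE:
  fixes f :: "'a \<Rightarrow> real"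
  assumes "bounded (range f)"
  obtains B where "\<And>x. \<bar>f x\<bar> \<le> B"
  using assms unfolding bounded_iff by auto

section \<open>Gaussian kernels on the line and on the plane\<close>

lemma is_kernel_gauss_kernel:
  assumes L [measurable]: "L \<in> borel_measurable M"
  shows "is_kernel M (gauss_kernel L)"
  unfolding is_kernel_def gauss_kernel_def
proof (intro conjI ballI allI impI)
  fix f :: "real \<Rightarrow> real" assume "f \<in> borel_measurable borel \<and> bounded (range f)"
  then have "f \<in> borel_measurable borel" by simp
  from measurable_compose[OF L borel_measurable_integral_gauss[OF this]]
  show "(\<lambda>w. \<integral>x. f x \<partial>gauss 0 (L w)) \<in> borel_measurable M" .
qed (auto intro: prob_space_gauss)

text \<open>Besides representing all products on one fixed space, this shows them to be measures on
  the Borel sets of the plane, as kernels on a metric space require.\<close>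

lemma gauss_pair_eq_distr:
  "gauss 0 u \<Otimes>\<^sub>M gauss 0 v = distr (std_normal_distribution \<Otimes>\<^sub>M std_normal_distribution) borel
     (\<lambda>p. (sqrt (max 0 u) * fst p, sqrt (max 0 v) * snd p))"
proof -
  interpret V: prob_space "gauss 0 v" by (rule prob_space_gauss)
  have "gauss 0 u \<Otimes>\<^sub>M gauss 0 v
    = distr (std_normal_distribution \<Otimes>\<^sub>M std_normal_distribution) (borel \<Otimes>\<^sub>M borel)
       (\<lambda>(x, y). (sqrt (max 0 u) * x, sqrt (max 0 v) * y))"
    using V.sigma_finite_measure_axioms unfolding gauss_zero_eq_distr
    by (intro pair_measure_distr) auto
  then show ?thesis by (simp add: borel_prod case_prod_beta')
qed

lemma sets_gauss_pair: "sets (gauss 0 u \<Otimes>\<^sub>M gauss 0 v) = sets borel"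
  unfolding gauss_pair_eq_distr by simp

lemma prob_space_gauss_pair: "prob_space (gauss 0 u \<Otimes>\<^sub>M gauss 0 v)"
proof -
  interpret U: prob_space "gauss 0 u" by (rule prob_space_gauss)
  interpret V: prob_space "gauss 0 v" by (rule prob_space_gauss)
  interpret P: pair_prob_space "gauss 0 u" "gauss 0 v" ..
  show ?thesis by (rule P.prob_space_axioms)
qed

lemma integral_gauss_pair:
  fixes f :: "real \<times> real \<Rightarrow> real"
  assumes f: "f \<in> borel_measurable borel"
  shows "(\<integral>p. f p \<partial>(gauss 0 u \<Otimes>\<^sub>M gauss 0 v))
    = (\<integral>p. f (sqrt (max 0 u) * fst p, sqrt (max 0 v) * snd p) \<partial>(std_normal_distribution \<Otimes>\<^sub>M std_normal_distribution))"
proof -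
  have "(\<lambda>p. (sqrt (max 0 u) * fst p, sqrt (max 0 v) * snd p)) \<in> borel_measurable (std_normal_distribution \<Otimes>\<^sub>M std_normal_distribution)"
    unfolding borel_prod[symmetric] by measurable
  then show ?thesis unfolding gauss_pair_eq_distr by (rule integral_distr) (rule f)
qed

lemma abs_integral_gauss_pair_le:
  fixes f :: "real \<times> real \<Rightarrow> real"
  assumes "f \<in> borel_measurable borel" and B: "\<And>x. \<bar>f x\<bar> \<le> B"
  shows "\<bar>\<integral>p. f p \<partial>(gauss 0 u \<Otimes>\<^sub>M gauss 0 v)\<bar> \<le> B"
    and "integrable (gauss 0 u \<Otimes>\<^sub>M gauss 0 v) f"
proof -
  interpret prob_space "gauss 0 u \<Otimes>\<^sub>M gauss 0 v" by (rule prob_space_gauss_pair)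
  have m: "f \<in> borel_measurable (gauss 0 u \<Otimes>\<^sub>M gauss 0 v)"
    unfolding measurable_cong_sets[OF sets_gauss_pair refl] by (rule assms(1))
  show i: "integrable (gauss 0 u \<Otimes>\<^sub>M gauss 0 v) f"
    by (rule integrable_bounded[OF m]) (use B in simp)
  have "\<bar>\<integral>p. f p \<partial>(gauss 0 u \<Otimes>\<^sub>M gauss 0 v)\<bar> \<le> expectation (\<lambda>p. \<bar>f p\<bar>)" by (rule integral_abs_bound)
  also have "\<dots> \<le> B" by (rule abs_expectation_le[OF m B])
  finally show "\<bar>\<integral>p. f p \<partial>(gauss 0 u \<Otimes>\<^sub>M gauss 0 v)\<bar> \<le> B" .
qed

lemma borel_measurable_integral_gauss_pair:
  fixes f :: "real \<times> real \<Rightarrow> real"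
  assumes f: "f \<in> borel_measurable borel" and U [measurable]: "U \<in> borel_measurable M" and V [measurable]: "V \<in> borel_measurable M"
  shows "(\<lambda>w. \<integral>p. f p \<partial>(gauss 0 (U w) \<Otimes>\<^sub>M gauss 0 (V w))) \<in> borel_measurable M"
proof -
  interpret N: prob_space std_normal_distribution by (rule prob_space_std_normal)
  interpret P: pair_prob_space std_normal_distribution std_normal_distribution ..
  have [measurable]: "f \<in> borel_measurable (borel \<Otimes>\<^sub>M borel)" unfolding borel_prod by (rule f)
  show ?thesis
    unfolding integral_gauss_pair[OF f] by measurable
qed

lemma is_kernel_gauss_pair:
  assumes "U \<in> borel_measurable M" "V \<in> borel_measurable M"
  shows "is_kernel M (kernel_prod (gauss_kernel U) (gauss_kernel V))"
  unfolding is_kernel_def kernel_prod_def gauss_kernel_def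
  using assms borel_measurable_integral_gauss_pair prob_space_gauss_pair sets_gauss_pair by blast

lemma (in prob_space) integral_uniform_measure:
  fixes f :: "'a \<Rightarrow> real"
  assumes H [measurable]: "H \<in> sets M" and pos: "0 < prob H" and [measurable]: "f \<in> borel_measurable M"
  shows "(\<integral>w. f w \<partial>uniform_measure M H) = expectation (\<lambda>w. indicator H w * f w) / prob H"
proof -
  have "uniform_measure M H = density M (\<lambda>w. ennreal (indicator H w / prob H))"
    unfolding uniform_measure_def
    by (rule density_cong) (use pos in \<open>auto simp: emeasure_eq_measure divide_ennreal ennreal_indicator[symmetric]\<close>)
  then have "(\<integral>w. f w \<partial>uniform_measure M H) = expectation (\<lambda>w. (indicator H w / prob H) *\<^sub>R f w)"
    by (simp add: integral_density)
  then show ?thesis by simp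
qed

text \<open>Links kernels, which are defined through integrals of bounded functions, to measurable
  maps into the space of subprobability measures, so that integrals over the averaged law unfold as
  integrals over a bind.\<close>

lemma is_kernel_measurable:
  fixes N :: "'w \<Rightarrow> 's::metric_space measure"
  assumes "is_kernel M N"
  shows "N \<in> measurable M (subprob_algebra borel)"
proof (rule measurable_subprob_algebra)
  fix w assume w: "w \<in> space M"
  then have "prob_space (N w)" "sets (N w) = sets borel" using assms by (auto simp: is_kernel_def)
  then show "subprob_space (N w)" "sets (N w) = sets borel" by (auto intro: prob_space_imp_subprob_space)
next
  fix A :: "'s set" assume A: "A \<in> sets borel"
  have "(indicator A :: 's \<Rightarrow> real) \<in> borel_measurable borel" using A by measurable
  moreover have "bounded (range (indicator A :: 's \<Rightarrow> real))"
    unfolding bounded_iff by (rule exI[of _ 1]) (auto simp: indicator_def)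
  moreover have "\<forall>f :: 's \<Rightarrow> real. f \<in> borel_measurable borel \<and> bounded (range f) \<longrightarrow>
      (\<lambda>w. \<integral>x. f x \<partial>N w) \<in> borel_measurable M"
    using assms unfolding is_kernel_def by blast
  ultimately have "(\<lambda>w. \<integral>x. indicator A x \<partial>N w :: real) \<in> borel_measurable M"
    by (meson conjI)
  then have "(\<lambda>w. ennreal (\<integral>x. indicator A x \<partial>N w)) \<in> borel_measurable M" by measurable
  moreover have "emeasure (N w) A = ennreal (\<integral>x. indicator A x \<partial>N w)" if "w \<in> space M" for w
  proof -
    interpret prob_space "N w" using assms that by (auto simp: is_kernel_def)
    have "sets (N w) = sets borel" using assms that by (auto simp: is_kernel_def)
    then have "A \<subseteq> space (N w)" using A sets.sets_into_space by blast
    then show ?thesis using A by (simp add: emeasure_eq_measure Int_absorb2)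
  qed
  ultimately show "(\<lambda>w. emeasure (N w) A) \<in> borel_measurable M"
    by (simp cong: measurable_cong)
qed

text \<open>Multiplication by \<open>P(H)\<close> turns conditional laws into weighted expectations
  with the indicator of \<open>H\<close> as weight, on both sides of the limit.\<close>

lemma (in prob_space) converges_stablyI:
  fixes Y :: "nat \<Rightarrow> 'a \<Rightarrow> 's::metric_space"
  assumes Y [measurable]: "\<And>n. Y n \<in> borel_measurable M" and N: "is_kernel M N"
    and conv: "\<And>H f. H \<in> sets M \<Longrightarrow> continuous_on UNIV f \<Longrightarrow> bounded (range f) \<Longrightarrow>
      (\<lambda>n. expectation (\<lambda>w. indicator H w * f (Y n w)))
        \<longlonglongrightarrow> expectation (\<lambda>w. indicator H w * (\<integral>x. f x \<partial>N w) :: real)"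
  shows "converges_stably M Y N"
  unfolding converges_stably_def weakly_converges_def
proof (intro conjI allI ballI impI Y N)
  fix H and f :: "'s \<Rightarrow> real"
  assume H [measurable]: "H \<in> sets M" and pos: "0 < prob H" and f: "continuous_on UNIV f \<and> bounded (range f)"
  have [measurable]: "f \<in> borel_measurable borel" using f by (intro borel_measurable_continuous_onI) simp
  obtain B where B: "\<And>x. \<bar>f x\<bar> \<le> B" using f bounded_rangeE[of f] by metis
  let ?Q = "uniform_measure M H"
  have Q: "prob_space ?Q" using pos by (intro prob_space_uniform_measure) (auto simp: emeasure_eq_measure)
  have NQ: "N \<in> measurable ?Q (subprob_algebra borel)"
    using is_kernel_measurable[OF N] by (simp cong: measurable_cong_sets)
  have Nf: "(\<lambda>w. \<integral>x. f x \<partial>N w) \<in> borel_measurable M"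
    using N f unfolding is_kernel_def by simp
  have "(\<integral>x. f x \<partial>distr ?Q borel (Y n)) = expectation (\<lambda>w. indicator H w * f (Y n w)) / prob H" for n
    by (subst integral_distr) (auto intro!: integral_uniform_measure pos)
  moreover have "(\<integral>x. f x \<partial>(?Q \<bind> N)) = expectation (\<lambda>w. indicator H w * (\<integral>x. f x \<partial>N w)) / prob H"
  proof -
    have "(\<integral>x. f x \<partial>(?Q \<bind> N)) = (\<integral>w. (\<integral>x. f x \<partial>N w) \<partial>?Q)"
    proof (rule integral_bind[OF _ _ NQ])
      show "finite_measure ?Q" using Q by (rule prob_space.finite_measure)
      show "AE w in ?Q. emeasure (N w) (space (N w)) \<le> ennreal 1"
        using N by (intro AE_I2) (auto simp: is_kernel_def prob_space.emeasure_space_1)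
    qed (use B in auto)
    also have "\<dots> = expectation (\<lambda>w. indicator H w * (\<integral>x. f x \<partial>N w)) / prob H"
      by (rule integral_uniform_measure[OF H pos Nf])
    finally show ?thesis .
  qed
  moreover have "(\<lambda>n. expectation (\<lambda>w. indicator H w * f (Y n w)) / prob H)
      \<longlonglongrightarrow> expectation (\<lambda>w. indicator H w * (\<integral>x. f x \<partial>N w)) / prob H"
    by (intro tendsto_intros conv H) (use f pos in auto)
  ultimately show "(\<lambda>n. \<integral>x. f x \<partial>distr ?Q borel (Y n)) \<longlonglongrightarrow> (\<integral>x. f x \<partial>(?Q \<bind> N))" by simp
qed

text \<open>Finite sums of products of bounded continuous functions of one coordinate each: an
  algebra to which factorised limits extend by linearity.\<close>

inductive tensor :: "(real \<times> real \<Rightarrow> real) \<Rightarrow> bool" where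
  tensor_prod: "continuous_on UNIV f \<Longrightarrow> continuous_on UNIV g \<Longrightarrow> (\<And>x. \<bar>f x\<bar> \<le> a) \<Longrightarrow> (\<And>x. \<bar>g x\<bar> \<le> b)
    \<Longrightarrow> tensor (\<lambda>p. f (fst p) * g (snd p))"
| tensor_add: "tensor F \<Longrightarrow> tensor G \<Longrightarrow> tensor (\<lambda>p. F p + G p)"

lemma tensor_mult_prod:
  assumes "tensor G" and f: "continuous_on UNIV f" "\<And>x. \<bar>f x\<bar> \<le> a" and g: "continuous_on UNIV g" "\<And>x. \<bar>g x\<bar> \<le> b"
  shows "tensor (\<lambda>p. (f (fst p) * g (snd p)) * G p)"
  using assms(1)
proof induction
  case (tensor_prod f' g' a' b')
  have "0 \<le> a" using f(2)[of 0] by linarith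
  have "0 \<le> b" using g(2)[of 0] by linarith
  have "tensor (\<lambda>p. (\<lambda>x. f x * f' x) (fst p) * (\<lambda>y. g y * g' y) (snd p))"
    by (rule tensor.tensor_prod[where a = "a * a'" and b = "b * b'"])
       (use f g tensor_prod \<open>0 \<le> a\<close> \<open>0 \<le> b\<close> in \<open>auto simp: abs_mult intro!: continuous_on_mult mult_mono\<close>)
  then show ?case by (simp add: mult_ac)
next
  case (tensor_add F G)
  from tensor.tensor_add[OF tensor_add.IH] show ?case by (simp add: distrib_left)
qed

lemma tensor_mult: "tensor F \<Longrightarrow> tensor G \<Longrightarrow> tensor (\<lambda>p. F p * G p)"
proof (induction rule: tensor.induct)
  case (tensor_prod f g a b)
  show ?case by (rule tensor_mult_prod[OF tensor_prod(5,1,3,2,4)])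
next
  case (tensor_add F F')
  from tensor.tensor_add[OF tensor_add.IH(1)[OF tensor_add.prems] tensor_add.IH(2)[OF tensor_add.prems]]
  show ?case by (simp add: distrib_right)
qed

text \<open>Polynomials are in general unbounded on the plane. After clamping both coordinates to
  \<open>[-R, R]\<close>, every linear function is a sum of bounded products, and closure under sums
  and products does the rest.\<close>

lemma tensor_clamped_polynomial:
  fixes g :: "real \<times> real \<Rightarrow> real"
  assumes "real_polynomial_function g" and R: "0 \<le> R"
  defines "\<phi> \<equiv> \<lambda>x::real. max (- R) (min R x)"
  shows "tensor (\<lambda>p. g (\<phi> (fst p), \<phi> (snd p)))"
proof -
  have c: "continuous_on UNIV \<phi>" unfolding \<phi>_def by (intro continuous_intros)
  have b: "\<bar>\<phi> x\<bar> \<le> R" for x using R unfolding \<phi>_def by auto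
  have k: "continuous_on UNIV (\<lambda>_::real. k)" for k :: real by simp
  show ?thesis
    using assms(1)
  proof induction
    case (linear f)
    then interpret f: bounded_linear f .
    have 1: "f (x, y) = f (1, 0) * x + f (0, 1) * y" for x y
    proof -
      have "f (x, y) = f (x *\<^sub>R (1, 0) + y *\<^sub>R (0, 1))" by simp
      also have "\<dots> = x *\<^sub>R f (1, 0) + y *\<^sub>R f (0, 1)" by (simp only: f.add f.scaleR)
      finally show ?thesis by (simp add: mult.commute)
    qed
    have "tensor (\<lambda>p. (\<lambda>x. f (1, 0) * \<phi> x) (fst p) * (\<lambda>_. 1) (snd p) + (\<lambda>_. f (0, 1)) (fst p) * \<phi> (snd p))"
    proof (intro tensor_add)
      show "tensor (\<lambda>p. (\<lambda>x. f (1, 0) * \<phi> x) (fst p) * (\<lambda>_. 1) (snd p))"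
        by (rule tensor_prod[where a = "\<bar>f (1, 0)\<bar> * R" and b = 1])
           (use c b in \<open>auto simp: abs_mult intro!: continuous_on_mult mult_left_mono\<close>)
      show "tensor (\<lambda>p. (\<lambda>_. f (0, 1)) (fst p) * \<phi> (snd p))"
        by (rule tensor_prod[OF k c order_refl b])
    qed
    moreover have "f (\<phi> (fst p), \<phi> (snd p)) = f (1, 0) * \<phi> (fst p) * 1 + f (0, 1) * \<phi> (snd p)" for p
      by (subst 1) simp
    ultimately show ?case by simp
  next
    case (const l)
    have "tensor (\<lambda>p. (\<lambda>_. l) (fst p) * (\<lambda>_. 1) (snd p))"
      by (rule tensor_prod[OF k k order_refl order_refl])
    then show ?case by simp
  next
    case (add f g)
    from tensor_add[OF add.IH] show ?case .
  next
    case (mult f g)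
    from tensor_mult[OF mult.IH] show ?case .
  qed
qed

lemma tensor_bounded: "tensor F \<Longrightarrow> \<exists>B. \<forall>p. \<bar>F p\<bar> \<le> B"
proof (induction rule: tensor.induct)
  case (tensor_prod f g a b)
  have "0 \<le> a" using tensor_prod(3)[of 0] by linarith
  have "\<bar>f (fst p) * g (snd p)\<bar> \<le> a * b" for p
    unfolding abs_mult by (intro mult_mono tensor_prod) (use \<open>0 \<le> a\<close> in auto)
  then show ?case by blast
next
  case (tensor_add F G)
  then obtain B B' where B: "\<And>p. \<bar>F p\<bar> \<le> B" "\<And>p. \<bar>G p\<bar> \<le> B'" by blast
  have "\<bar>F p + G p\<bar> \<le> B + B'" for p using B[of p] by linarith
  then show ?case by blast
qed

lemma tensor_continuous: "tensor F \<Longrightarrow> continuous_on UNIV F"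
proof (induction rule: tensor.induct)
  case (tensor_prod f g a b)
  have "continuous_on UNIV (\<lambda>p. f (fst p))" "continuous_on UNIV (\<lambda>p. g (snd p))"
    using continuous_on_compose2[OF tensor_prod(1) continuous_on_fst[OF continuous_on_id]]
      continuous_on_compose2[OF tensor_prod(2) continuous_on_snd[OF continuous_on_id]] by auto
  then show ?case by (rule continuous_on_mult)
qed (rule continuous_on_add)

lemma integral_gauss_pair_prod:
  fixes f g :: "real \<Rightarrow> real"
  assumes [measurable]: "f \<in> borel_measurable borel" "g \<in> borel_measurable borel"
    and f: "\<And>x. \<bar>f x\<bar> \<le> a" and g: "\<And>x. \<bar>g x\<bar> \<le> b"
  shows "(\<integral>p. f (fst p) * g (snd p) \<partial>(gauss 0 u \<Otimes>\<^sub>M gauss 0 v)) = (\<integral>x. f x \<partial>gauss 0 u) * (\<integral>x. g x \<partial>gauss 0 v)"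
proof -
  interpret U: prob_space "gauss 0 u" by (rule prob_space_gauss)
  interpret V: prob_space "gauss 0 v" by (rule prob_space_gauss)
  interpret P: pair_prob_space "gauss 0 u" "gauss 0 v" ..
  have "0 \<le> a" using f[of 0] by linarith
  have "integrable (gauss 0 u \<Otimes>\<^sub>M gauss 0 v) (\<lambda>p. f (fst p) * g (snd p))"
    by (rule P.integrable_const_bound[where B = "a * b"])
       (use f g \<open>0 \<le> a\<close> in \<open>auto simp: abs_mult intro!: mult_mono\<close>)
  from P.integral_fst'[OF this] show ?thesis by simp
qed

text \<open>The tail function \<open>\<tau>\<close> vanishes on \<open>[-R+1, R-1]\<close> and is \<open>1\<close> outside \<open>[-R, R]\<close>; it measures
  the error of replacing \<open>F\<close> by its clamped version, to which Stone--Weierstrass applies.\<close>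

lemma (in prob_space) weighted_conv_pair:
  fixes h U V :: "'a \<Rightarrow> real" and Y Z :: "nat \<Rightarrow> 'a \<Rightarrow> real" and F :: "real \<times> real \<Rightarrow> real"
  assumes [measurable]: "\<And>n. Y n \<in> borel_measurable M" "\<And>n. Z n \<in> borel_measurable M"
      "U \<in> borel_measurable M" "V \<in> borel_measurable M" "h \<in> borel_measurable M"
    and h: "\<And>w. w \<in> space M \<Longrightarrow> 0 \<le> h w" "\<And>w. w \<in> space M \<Longrightarrow> h w \<le> 1"
    and prod: "\<And>f g a b. continuous_on UNIV f \<Longrightarrow> continuous_on UNIV g \<Longrightarrow> (\<And>x. \<bar>f x\<bar> \<le> a) \<Longrightarrow> (\<And>x. \<bar>g x\<bar> \<le> b) \<Longrightarrow>
      (\<lambda>n. expectation (\<lambda>w. h w * (f (Y n w) * g (Z n w))))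
        \<longlonglongrightarrow> expectation (\<lambda>w. h w * ((\<integral>x. f x \<partial>gauss 0 (U w)) * (\<integral>x. g x \<partial>gauss 0 (V w))) :: real)"
    and F: "continuous_on UNIV F" "\<And>p. \<bar>F p\<bar> \<le> B"
  shows "(\<lambda>n. expectation (\<lambda>w. h w * F (Y n w, Z n w)))
    \<longlonglongrightarrow> expectation (\<lambda>w. h w * (\<integral>p. F p \<partial>(gauss 0 (U w) \<Otimes>\<^sub>M gauss 0 (V w))))"
proof -
  have B0: "0 \<le> B" using F(2)[of 0] by linarith
  have YZ: "(\<lambda>w. G (Y n w, Z n w)) \<in> borel_measurable M" if "continuous_on UNIV G" for G :: "real \<times> real \<Rightarrow> real" and n
  proof -
    have [measurable]: "G \<in> borel_measurable (borel \<Otimes>\<^sub>M borel)"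
      unfolding borel_prod by (rule borel_measurable_continuous_onI[OF that])
    show ?thesis by measurable
  qed
  have gp: "(\<lambda>w. \<integral>p. G p \<partial>(gauss 0 (U w) \<Otimes>\<^sub>M gauss 0 (V w))) \<in> borel_measurable M"
    if "continuous_on UNIV G" for G :: "real \<times> real \<Rightarrow> real"
    by (rule borel_measurable_integral_gauss_pair[OF borel_measurable_continuous_onI[OF that]]) measurable
  have i1: "integrable M (\<lambda>w. h w * G (Y n w, Z n w))"
    and i2: "integrable M (\<lambda>w. h w * (\<integral>p. G p \<partial>(gauss 0 (U w) \<Otimes>\<^sub>M gauss 0 (V w))))"
    if G: "continuous_on UNIV G" "\<And>p. \<bar>G p\<bar> \<le> K" for G :: "real \<times> real \<Rightarrow> real" and K n
  proof -
    note [measurable] = YZ[OF G(1)] gp[OF G(1)]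
    show "integrable M (\<lambda>w. h w * G (Y n w, Z n w))"
      by (rule integrable_bounded[where B = "1 * K"], measurable)
         (use h G(2) in \<open>simp only: real_norm_def abs_mult, intro mult_mono, auto\<close>)
    have "\<bar>\<integral>p. G p \<partial>(gauss 0 u \<Otimes>\<^sub>M gauss 0 v)\<bar> \<le> K" for u v
      by (rule abs_integral_gauss_pair_le[OF borel_measurable_continuous_onI[OF G(1)] G(2)])
    then show "integrable M (\<lambda>w. h w * (\<integral>p. G p \<partial>(gauss 0 (U w) \<Otimes>\<^sub>M gauss 0 (V w))))"
      by (intro integrable_bounded[where B = "1 * K"], measurable)
         (use h in \<open>simp only: real_norm_def abs_mult, intro mult_mono, auto\<close>)
  qed
  have tensor: "(\<lambda>n. expectation (\<lambda>w. h w * G (Y n w, Z n w)))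
      \<longlonglongrightarrow> expectation (\<lambda>w. h w * (\<integral>p. G p \<partial>(gauss 0 (U w) \<Otimes>\<^sub>M gauss 0 (V w))))"
    if "tensor G" for G
    using that
  proof induction
    case (tensor_prod f g a b)
    have "(\<integral>p. f (fst p) * g (snd p) \<partial>(gauss 0 u \<Otimes>\<^sub>M gauss 0 v)) = (\<integral>x. f x \<partial>gauss 0 u) * (\<integral>x. g x \<partial>gauss 0 v)" for u v
      by (rule integral_gauss_pair_prod) (use tensor_prod in \<open>auto intro: borel_measurable_continuous_onI\<close>)
    with prod[OF tensor_prod] show ?case by simp
  next
    case (tensor_add G G')
    obtain K where K: "\<And>p. \<bar>G p\<bar> \<le> K" using tensor_bounded[OF tensor_add.hyps(1)] by blast
    obtain K' where K': "\<And>p. \<bar>G' p\<bar> \<le> K'" using tensor_bounded[OF tensor_add.hyps(2)] by blast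
    note c = tensor_continuous[OF tensor_add.hyps(1)] tensor_continuous[OF tensor_add.hyps(2)]
    have e1: "expectation (\<lambda>w. h w * (G (Y n w, Z n w) + G' (Y n w, Z n w)))
       = expectation (\<lambda>w. h w * G (Y n w, Z n w)) + expectation (\<lambda>w. h w * G' (Y n w, Z n w))" for n
      using i1[OF c(1) K] i1[OF c(2) K'] by (simp add: distrib_left)
    have "(\<integral>p. G p + G' p \<partial>(gauss 0 u \<Otimes>\<^sub>M gauss 0 v))
       = (\<integral>p. G p \<partial>(gauss 0 u \<Otimes>\<^sub>M gauss 0 v)) + (\<integral>p. G' p \<partial>(gauss 0 u \<Otimes>\<^sub>M gauss 0 v))" for u v
      using abs_integral_gauss_pair_le(2)[OF borel_measurable_continuous_onI[OF c(1)] K]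
        abs_integral_gauss_pair_le(2)[OF borel_measurable_continuous_onI[OF c(2)] K']
      by (rule Bochner_Integration.integral_add)
    then have e2: "expectation (\<lambda>w. h w * (\<integral>p. G p + G' p \<partial>(gauss 0 (U w) \<Otimes>\<^sub>M gauss 0 (V w))))
      = expectation (\<lambda>w. h w * (\<integral>p. G p \<partial>(gauss 0 (U w) \<Otimes>\<^sub>M gauss 0 (V w))))
       + expectation (\<lambda>w. h w * (\<integral>p. G' p \<partial>(gauss 0 (U w) \<Otimes>\<^sub>M gauss 0 (V w))))"
      using i2[OF c(1) K] i2[OF c(2) K'] by (simp add: distrib_left)
    show ?case unfolding e1 e2 by (rule tendsto_add[OF tensor_add.IH])
  qed
  define \<tau> where "\<tau> R x = min 1 (max 0 (\<bar>x\<bar> - R + 1))" for R x :: real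
  have \<tau>c: "continuous_on UNIV (\<tau> R)" for R unfolding \<tau>_def by (intro continuous_intros)
  have \<tau>1: "\<bar>\<tau> R x\<bar> \<le> 1" "0 \<le> \<tau> R x" "\<tau> R x \<le> 1" for R x unfolding \<tau>_def by auto
  have \<tau>M [measurable]: "\<tau> R \<in> borel_measurable borel" for R by (rule borel_measurable_continuous_onI[OF \<tau>c])
  define T where "T R W = expectation (\<lambda>w. h w * (\<integral>x. \<tau> R x \<partial>gauss 0 (W w)))" for R and W :: "'a \<Rightarrow> real"
  have T0: "(\<lambda>R. T (real R) W) \<longlonglongrightarrow> 0" if [measurable]: "W \<in> borel_measurable M" for W
  proof -
    interpret N: prob_space std_normal_distribution by (rule prob_space_std_normal)
    have inner: "(\<lambda>R. \<integral>x. \<tau> (real R) x \<partial>gauss 0 v) \<longlonglongrightarrow> 0" for v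
    proof -
      interpret G: prob_space "gauss 0 v" by (rule prob_space_gauss)
      have "(\<lambda>R. \<integral>x. \<tau> (real R) x \<partial>gauss 0 v) \<longlonglongrightarrow> (\<integral>x. 0 \<partial>gauss 0 v)"
      proof (rule integral_dominated_convergence[where w = "\<lambda>_. 1"])
        show "AE x in gauss 0 v. (\<lambda>R. \<tau> (real R) x) \<longlonglongrightarrow> 0"
        proof (intro AE_I2 tendsto_eventually)
          fix x :: real
          obtain n :: nat where n: "\<bar>x\<bar> + 1 \<le> real n" using real_arch_simple by blast
          show "\<forall>\<^sub>F R in sequentially. \<tau> (real R) x = 0"
            using eventually_ge_at_top[of n]
          proof eventually_elim
            case (elim R)
            then have "real n \<le> real R" by simp
            with n show ?case by (simp add: \<tau>_def)
          qed
        qed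
      qed (use \<tau>1 in auto)
      then show ?thesis by simp
    qed
    note [measurable] = measurable_compose[OF _ borel_measurable_integral_gauss[OF \<tau>M]]
    have "(\<lambda>R. T (real R) W) \<longlonglongrightarrow> expectation (\<lambda>w. 0)"
      unfolding T_def
    proof (rule integral_dominated_convergence[where w = "\<lambda>_. 1 * 1"])
      show "AE w in M. (\<lambda>R. h w * (\<integral>x. \<tau> (real R) x \<partial>gauss 0 (W w))) \<longlonglongrightarrow> 0"
        using tendsto_mult[OF tendsto_const inner] by (intro AE_I2) simp
      have "\<bar>h w * (\<integral>x. \<tau> (real R) x \<partial>gauss 0 (W w))\<bar> \<le> 1 * 1" if "w \<in> space M" for w R
        unfolding abs_mult by (intro mult_mono abs_integral_gauss_le \<tau>1 \<tau>M) (use h that in auto)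
      then show "AE w in M. norm (h w * (\<integral>x. \<tau> (real R) x \<partial>gauss 0 (W w))) \<le> 1 * 1" for R
        by (intro AE_I2) simp
    qed auto
    then show ?thesis by simp
  qed
  have gp1: "(\<integral>p. f (fst p) \<partial>(gauss 0 u \<Otimes>\<^sub>M gauss 0 v)) = (\<integral>x. f x \<partial>gauss 0 u)"
    and gp2: "(\<integral>p. f (snd p) \<partial>(gauss 0 u \<Otimes>\<^sub>M gauss 0 v)) = (\<integral>x. f x \<partial>gauss 0 v)"
    if "f \<in> borel_measurable borel" "\<And>x. \<bar>f x\<bar> \<le> 1" for f :: "real \<Rightarrow> real" and u v
  proof -
    interpret U: prob_space "gauss 0 u" by (rule prob_space_gauss)
    interpret V: prob_space "gauss 0 v" by (rule prob_space_gauss)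
    show "(\<integral>p. f (fst p) \<partial>(gauss 0 u \<Otimes>\<^sub>M gauss 0 v)) = (\<integral>x. f x \<partial>gauss 0 u)"
      using integral_gauss_pair_prod[OF that(1) _ that(2), of "\<lambda>_. 1" 1 u v] V.prob_space by simp
    show "(\<integral>p. f (snd p) \<partial>(gauss 0 u \<Otimes>\<^sub>M gauss 0 v)) = (\<integral>x. f x \<partial>gauss 0 v)"
      using integral_gauss_pair_prod[OF _ that(1) _ that(2), of "\<lambda>_. 1" 1 u v] U.prob_space by simp
  qed
  show ?thesis
  proof (rule LIMSEQ_I)
    fix r :: real assume r: "r > 0"
    \<comment> \<open>The errors below add up to at most \<open>8 * B * e + 4 * e\<close>; the 1
      added to \<open>B\<close> covers \<open>B = 0\<close>.\<close>
    define e where "e = r / (8 * (B + 1))"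
    have e: "e > 0" "8 * B * e + 8 * e = r"
    proof -
      show "e > 0" using r B0 by (simp add: e_def)
      have "e * (8 * (B + 1)) = r" using B0 by (simp add: e_def)
      then show "8 * B * e + 8 * e = r" by (simp add: algebra_simps)
    qed
    have "\<forall>\<^sub>F R in sequentially. T (real R) U < e \<and> T (real R) V < e"
      using order_tendstoD(2)[OF T0[of U], of e] order_tendstoD(2)[OF T0[of V], of e] e
      by (intro eventually_conj) auto
    then obtain R' :: nat where R': "T (real R') U < e" "T (real R') V < e" by (auto simp: eventually_sequentially)
    \<comment> \<open>The radius is chosen from the limit laws alone, hence before \<open>n\<close>
      is let go to infinity.\<close>
    define R where "R = real R'"
    have R: "0 \<le> R" "T R U < e" "T R V < e" using R' by (auto simp: R_def)
    define \<phi> where "\<phi> x = max (- R) (min R x)" for x :: real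
    have \<phi>R: "\<phi> x \<in> {-R..R}" for x using R(1) by (auto simp: \<phi>_def)
    have \<phi>id: "\<phi> x = x" if "\<bar>x\<bar> \<le> R" for x using that by (auto simp: \<phi>_def)
    obtain g where g: "real_polynomial_function g" "\<And>p. p \<in> {-R..R} \<times> {-R..R} \<Longrightarrow> \<bar>F p - g p\<bar> < e"
    proof (rule Stone_Weierstrass_real_polynomial_function)
      show "compact ({-R..R} \<times> {-R..R})" by (intro compact_Times compact_Icc)
      show "continuous_on ({-R..R} \<times> {-R..R}) F" using F(1) by (rule continuous_on_subset) simp
    qed (use e in auto)
    define G where "G p = g (\<phi> (fst p), \<phi> (snd p))" for p
    have tG: "tensor G"
      unfolding G_def \<phi>_def by (rule tensor_clamped_polynomial[OF g(1) R(1)])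
    obtain K where K: "\<And>p. \<bar>G p\<bar> \<le> K" using tensor_bounded[OF tG] by blast
    have Gc: "continuous_on UNIV G" by (rule tensor_continuous[OF tG])
    have FG: "\<bar>F p - G p\<bar> \<le> 2 * B * (\<tau> R (fst p) + \<tau> R (snd p)) + e" for p
    proof -
      have a: "\<bar>F (\<phi> (fst p), \<phi> (snd p)) - G p\<bar> < e" unfolding G_def by (rule g(2)) (use \<phi>R in auto)
      show ?thesis
      proof (cases "\<bar>fst p\<bar> \<le> R \<and> \<bar>snd p\<bar> \<le> R")
        case True
        then have "F (\<phi> (fst p), \<phi> (snd p)) = F p" by (simp add: \<phi>id)
        moreover have "0 \<le> 2 * B * (\<tau> R (fst p) + \<tau> R (snd p))" using B0 \<tau>1 by simp
        ultimately show ?thesis using a by linarith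
      next
        case False
        then have "\<tau> R (fst p) = 1 \<or> \<tau> R (snd p) = 1" by (auto simp: \<tau>_def)
        then have "1 \<le> \<tau> R (fst p) + \<tau> R (snd p)" using \<tau>1(2)[of R "fst p"] \<tau>1(2)[of R "snd p"] by linarith
        then have "2 * B * 1 \<le> 2 * B * (\<tau> R (fst p) + \<tau> R (snd p))" using B0 by (intro mult_left_mono) auto
        then show ?thesis using a F(2)[of p] F(2)[of "(\<phi> (fst p), \<phi> (snd p))"] by linarith
      qed
    qed
    \<comment> \<open>This dominating function is itself a tensor, so its weighted expectation along
      the pair converges. That replaces a separate proof of tightness for the pair.\<close>
    define Q where "Q p = 2 * B * (\<tau> R (fst p) + \<tau> R (snd p)) + e" for p
    have Qc: "continuous_on UNIV Q"
    proof -
      have "continuous_on UNIV (\<lambda>p::real\<times>real. \<tau> R (fst p))" "continuous_on UNIV (\<lambda>p::real\<times>real. \<tau> R (snd p))"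
        using continuous_on_compose2[OF \<tau>c continuous_on_fst[OF continuous_on_id]]
          continuous_on_compose2[OF \<tau>c continuous_on_snd[OF continuous_on_id]] by auto
      then show ?thesis unfolding Q_def by (intro continuous_intros)
    qed
    have QB: "\<bar>Q p\<bar> \<le> 4 * B + e" for p
    proof -
      have "2 * B * (\<tau> R (fst p) + \<tau> R (snd p)) \<le> 2 * B * 2"
        using \<tau>1(1)[of R "fst p"] \<tau>1(1)[of R "snd p"] B0 by (intro mult_left_mono) auto
      moreover have "0 \<le> 2 * B * (\<tau> R (fst p) + \<tau> R (snd p))" using B0 \<tau>1 by simp
      ultimately show ?thesis using e(1) unfolding Q_def by linarith
    qed
    have EQ: "expectation (\<lambda>w. h w * (\<integral>p. Q p \<partial>(gauss 0 (U w) \<Otimes>\<^sub>M gauss 0 (V w)))) \<le> 4 * B * e + e"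
    proof -
      have ih: "integrable M h" by (rule integrable_bounded[where B = 1]) (use h in auto)
      have ti: "integrable M (\<lambda>w. h w * (\<integral>x. \<tau> R x \<partial>gauss 0 (W w)))" if [measurable]: "W \<in> borel_measurable M" for W
      proof -
        note [measurable] = measurable_compose[OF _ borel_measurable_integral_gauss[OF \<tau>M]]
        have "\<bar>h w * (\<integral>x. \<tau> R x \<partial>gauss 0 (W w))\<bar> \<le> 1 * 1" if "w \<in> space M" for w
          unfolding abs_mult by (intro mult_mono abs_integral_gauss_le \<tau>1 \<tau>M) (use h that in auto)
        then show ?thesis by (intro integrable_bounded[where B = "1 * 1"]) auto
      qed
      have "(\<integral>p. Q p \<partial>(gauss 0 u \<Otimes>\<^sub>M gauss 0 v))
          = 2 * B * ((\<integral>x. \<tau> R x \<partial>gauss 0 u) + (\<integral>x. \<tau> R x \<partial>gauss 0 v)) + e" for u v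
      proof -
        interpret P: prob_space "gauss 0 u \<Otimes>\<^sub>M gauss 0 v" by (rule prob_space_gauss_pair)
        have i: "integrable (gauss 0 u \<Otimes>\<^sub>M gauss 0 v) (\<lambda>p. \<tau> R (fst p))" "integrable (gauss 0 u \<Otimes>\<^sub>M gauss 0 v) (\<lambda>p. \<tau> R (snd p))"
          by (auto intro!: P.integrable_const_bound[where B = 1] simp: \<tau>1)
        show ?thesis unfolding Q_def using i P.prob_space
          by (simp add: gp1[OF \<tau>M \<tau>1(1)] gp2[OF \<tau>M \<tau>1(1)])
      qed
      then have "expectation (\<lambda>w. h w * (\<integral>p. Q p \<partial>(gauss 0 (U w) \<Otimes>\<^sub>M gauss 0 (V w))))
         = expectation (\<lambda>w. 2 * B * (h w * (\<integral>x. \<tau> R x \<partial>gauss 0 (U w))) + 2 * B * (h w * (\<integral>x. \<tau> R x \<partial>gauss 0 (V w))) + e * h w)"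
        by (intro Bochner_Integration.integral_cong) (auto simp: algebra_simps)
      also have "\<dots> = 2 * B * T R U + 2 * B * T R V + e * expectation h"
        using ti[of U] ti[of V] ih by (simp add: T_def)
      also have "\<dots> \<le> 2 * B * e + 2 * B * e + e * 1"
      proof (intro add_mono mult_left_mono)
        have "expectation h \<le> expectation (\<lambda>_. 1)" by (rule integral_mono) (use ih h in auto)
        then show "expectation h \<le> 1" using prob_space by simp
      qed (use R B0 e in auto)
      finally show ?thesis by simp
    qed
    let ?l = "\<lambda>G. expectation (\<lambda>w. h w * (\<integral>p. G p \<partial>(gauss 0 (U w) \<Otimes>\<^sub>M gauss 0 (V w))))"
    let ?a = "\<lambda>G n. expectation (\<lambda>w. h w * G (Y n w, Z n w))"
    have d1: "\<bar>?a F n - ?a G n\<bar> \<le> ?a Q n" for n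
    proof -
      have "?a F n - ?a G n = expectation (\<lambda>w. h w * F (Y n w, Z n w) - h w * G (Y n w, Z n w))"
        using i1[OF F] i1[OF Gc K] by simp
      also have "\<bar>\<dots>\<bar> \<le> ?a Q n"
      proof (rule norm_integral_le[where 'b = real, unfolded real_norm_def])
        show "\<bar>h w * F (Y n w, Z n w) - h w * G (Y n w, Z n w)\<bar> \<le> h w * Q (Y n w, Z n w)" if "w \<in> space M" for w
          using mult_left_mono[OF FG[of "(Y n w, Z n w)"] h(1)[OF that]] h(1)[OF that]
          unfolding right_diff_distrib[symmetric] abs_mult Q_def by simp
      qed (use i1[OF F] i1[OF Gc K] i1[OF Qc QB] in auto)
      finally show ?thesis .
    qed
    have d2: "\<bar>?l F - ?l G\<bar> \<le> ?l Q"
    proof -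
      have "?l F - ?l G = expectation (\<lambda>w. h w * (\<integral>p. F p \<partial>(gauss 0 (U w) \<Otimes>\<^sub>M gauss 0 (V w)))
          - h w * (\<integral>p. G p \<partial>(gauss 0 (U w) \<Otimes>\<^sub>M gauss 0 (V w))))"
        using i2[OF F] i2[OF Gc K] by simp
      also have "\<bar>\<dots>\<bar> \<le> ?l Q"
      proof (rule norm_integral_le[where 'b = real, unfolded real_norm_def])
        fix w assume w: "w \<in> space M"
        let ?g = "gauss 0 (U w) \<Otimes>\<^sub>M gauss 0 (V w)"
        note iF = abs_integral_gauss_pair_le(2)[OF borel_measurable_continuous_onI[OF F(1)] F(2), of "U w" "V w"]
        note iG = abs_integral_gauss_pair_le(2)[OF borel_measurable_continuous_onI[OF Gc] K, of "U w" "V w"]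
        note iQ = abs_integral_gauss_pair_le(2)[OF borel_measurable_continuous_onI[OF Qc] QB, of "U w" "V w"]
        have "\<bar>\<integral>p. F p - G p \<partial>?g\<bar> \<le> (\<integral>p. Q p \<partial>?g)"
        proof (rule norm_integral_le[where 'b = real, unfolded real_norm_def])
          show "integrable ?g (\<lambda>p. F p - G p)" using iF iG by (rule Bochner_Integration.integrable_diff)
          show "\<bar>F p - G p\<bar> \<le> Q p" for p using FG unfolding Q_def .
        qed (rule iQ)
        then have "\<bar>(\<integral>p. F p \<partial>?g) - (\<integral>p. G p \<partial>?g)\<bar> \<le> (\<integral>p. Q p \<partial>?g)" using iF iG by simp
        from mult_left_mono[OF this h(1)[OF w]] h(1)[OF w]
        show "\<bar>h w * (\<integral>p. F p \<partial>?g) - h w * (\<integral>p. G p \<partial>?g)\<bar> \<le> h w * (\<integral>p. Q p \<partial>?g)"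
          unfolding right_diff_distrib[symmetric] abs_mult by simp
      next
        show "integrable M (\<lambda>w. h w * (\<integral>p. F p \<partial>(gauss 0 (U w) \<Otimes>\<^sub>M gauss 0 (V w)))
          - h w * (\<integral>p. G p \<partial>(gauss 0 (U w) \<Otimes>\<^sub>M gauss 0 (V w))))"
          by (rule Bochner_Integration.integrable_diff[OF i2[OF F] i2[OF Gc K]])
      qed (rule i2[OF Qc QB])
      finally show ?thesis .
    qed
    have tQ: "tensor Q"
    proof -
      have "tensor (\<lambda>p. (\<lambda>x. 2 * B * \<tau> R x) (fst p) * (\<lambda>_. 1) (snd p) + (\<lambda>_. 1) (fst p) * (\<lambda>x. 2 * B * \<tau> R x + e) (snd p))"
      proof (intro tensor_add)
        show "tensor (\<lambda>p. (\<lambda>x. 2 * B * \<tau> R x) (fst p) * (\<lambda>_. 1) (snd p))"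
          by (rule tensor_prod[where a = "2 * B * 1" and b = 1])
             (use \<tau>c \<tau>1 B0 in \<open>auto simp: abs_mult intro!: continuous_on_mult mult_left_le\<close>)
        have "\<bar>2 * B * \<tau> R x + e\<bar> \<le> 2 * B + e" for x
        proof -
          have "2 * B * \<tau> R x \<le> 2 * B * 1" using \<tau>1(1)[of R x] B0 by (intro mult_left_mono) auto
          moreover have "0 \<le> 2 * B * \<tau> R x" using B0 \<tau>1 by simp
          ultimately show ?thesis using e by simp
        qed
        then show "tensor (\<lambda>p. (\<lambda>_. 1) (fst p) * (\<lambda>x. 2 * B * \<tau> R x + e) (snd p))"
          by (intro tensor_prod[where a = 1 and b = "2 * B + e"])
             (use \<tau>c in \<open>auto intro!: continuous_on_add continuous_on_mult\<close>)
      qed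
      then show ?thesis unfolding Q_def by (simp add: algebra_simps)
    qed
    have "\<forall>\<^sub>F n in sequentially. \<bar>?a Q n - ?l Q\<bar> < e"
      using tensor[OF tQ] e(1) by (auto simp: tendsto_iff dist_real_def)
    moreover have "\<forall>\<^sub>F n in sequentially. \<bar>?a G n - ?l G\<bar> < e"
      using tensor[OF tG] e(1) by (auto simp: tendsto_iff dist_real_def)
    ultimately have "\<forall>\<^sub>F n in sequentially. norm (?a F n - ?l F) < r"
    proof eventually_elim
      case (elim n)
      have "\<bar>?a F n - ?l F\<bar> \<le> 8 * B * e + 4 * e"
        using d1[of n] d2 EQ elim by linarith
      with e show ?case by simp
    qed
    then show "\<exists>no. \<forall>n\<ge>no. norm (?a F n - ?l F) < r" by (simp add: eventually_sequentially)
  qed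
qed

section \<open>Criteria for convergence in the strong and in the stable sense\<close>

context filtered_prob_space
begin

lemma sigma_finite_subalgebra_F: "sigma_finite_subalgebra M (F n)"
  by (rule finite_measure_subalgebra_is_sigma_finite)
     (use subalg finite_measure_axioms in \<open>auto simp: finite_measure_subalgebra_def finite_measure_subalgebra_axioms_def\<close>)

text \<open>The weight is the sign of the difference between the conditional expectation and an
  adapted approximation of the Gaussian integral, so testing against it computes an
  \<open>L1\<close> distance. Markov's inequality then gives convergence in probability.\<close>

lemma converges_stably_strongI:
  assumes sD: "strong_conv (\<lambda>n. n) D V" and D [measurable]: "\<And>n. D n \<in> borel_measurable M"
    and V [measurable]: "V \<in> borel_measurable M" and FV: "F_limit V"
  shows "converges_stably_strong M F D (gauss_kernel V)"
  unfolding converges_stably_strong_def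
proof (intro conjI allI impI subalg D is_kernel_gauss_kernel V)
  fix f :: "real \<Rightarrow> real" assume f: "continuous_on UNIV f \<and> bounded (range f)"
  then obtain B where B: "\<And>x. \<bar>f x\<bar> \<le> B" using bounded_rangeE[of f] by metis
  have fc: "continuous_on UNIV f" using f by simp
  have fM [measurable]: "f \<in> borel_measurable borel" using fc by (rule borel_measurable_continuous_onI)
  define k where "k v = (\<integral>x. f x \<partial>gauss 0 v)" for v
  have [measurable]: "k \<in> borel_measurable borel"
    unfolding k_def by (rule borel_measurable_integral_gauss[OF fM])
  have kB: "\<bar>k v\<bar> \<le> B" for v unfolding k_def by (rule abs_integral_gauss_le[OF fM B])
  obtain v where vF: "\<And>n. v n \<in> borel_measurable (F n)" and vlim: "AE w in M. (\<lambda>n. v n w) \<longlonglongrightarrow> V w"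
    using FV unfolding F_limit_def by blast
  have [measurable]: "v n \<in> borel_measurable M" for n using vF by (rule measurable_F)
  define g where "g n = real_cond_exp M (F n) (\<lambda>w. f (D n w))" for n
  have gF: "g n \<in> borel_measurable (F n)" for n unfolding g_def by (rule borel_measurable_cond_exp)
  have [measurable]: "g n \<in> borel_measurable M" for n using gF by (rule measurable_F)
  have fD: "integrable M (\<lambda>w. f (D n w))" for n by (rule integrable_bounded[where B = B]) (use B in auto)
  have gi: "integrable M (g n)" for n
    unfolding g_def by (rule sigma_finite_subalgebra.real_cond_exp_int(1)[OF sigma_finite_subalgebra_F fD])
  have ki: "integrable M (\<lambda>w. k (u w))" if [measurable]: "u \<in> borel_measurable M" for u
    by (rule integrable_bounded[where B = B]) (use kB in auto)
  \<comment> \<open>\<open>V\<close> is in general not \<open>F n\<close>-measurable, hence the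
    adapted \<open>v n\<close> inside the sign. Exchanging the two is paid for twice, once in each
    direction, which explains the factor 2 in \<open>bound\<close>.\<close>
  define s where "s n w = sgn (g n w - k (v n w))" for n w
  have sF: "s n \<in> borel_measurable (F n)" for n
  proof -
    note [measurable] = gF[of n] vF[of n]
    show ?thesis unfolding s_def by measurable
  qed
  have [measurable]: "s n \<in> borel_measurable M" for n using sF by (rule measurable_F)
  have s1: "\<bar>s n w\<bar> \<le> 1" for n w by (simp add: s_def sgn_if)
  have si: "integrable M (\<lambda>w. s n w * x w)" if "integrable M x" for n and x :: "'w \<Rightarrow> real"
  proof (rule Bochner_Integration.integrable_bound[OF that])
    show "AE w in M. norm (s n w * x w) \<le> norm (x w)"
      using s1 by (intro AE_I2) (simp add: abs_mult mult_left_le_one_le)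
  qed (use that in measurable)
  have A: "(\<lambda>n. expectation (\<lambda>w. s n w * (f (D n w) - k (V w)))) \<longlonglongrightarrow> 0"
    unfolding k_def by (rule strong_convD[OF sD sF s1 fc B])
  have K: "(\<lambda>n. expectation (\<lambda>w. \<bar>k (v n w) - k (V w)\<bar>)) \<longlonglongrightarrow> 0"
    unfolding k_def by (rule integral_gauss_L1_tendsto[OF fc B _ V vlim]) simp
  have bound: "expectation (\<lambda>w. \<bar>g n w - k (V w)\<bar>)
      \<le> expectation (\<lambda>w. s n w * (f (D n w) - k (V w))) + 2 * expectation (\<lambda>w. \<bar>k (v n w) - k (V w)\<bar>)" for n
  proof -
    note i = fD[of n] gi[of n] ki[of "v n"] ki[of V]
    have "expectation (\<lambda>w. s n w * g n w) = expectation (\<lambda>w. s n w * f (D n w))"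
      unfolding g_def
      by (rule sigma_finite_subalgebra.real_cond_exp_intg(2)[OF sigma_finite_subalgebra_F si[OF fD] sF]) simp
    then have 1: "expectation (\<lambda>w. s n w * (g n w - k (v n w))) = expectation (\<lambda>w. s n w * (f (D n w) - k (v n w)))"
      using si i by (simp add: right_diff_distrib)
    have "expectation (\<lambda>w. \<bar>g n w - k (V w)\<bar>)
        \<le> expectation (\<lambda>w. s n w * (g n w - k (v n w)) + \<bar>k (v n w) - k (V w)\<bar>)"
    proof (rule integral_mono)
      fix w
      have "\<bar>g n w - k (v n w)\<bar> = s n w * (g n w - k (v n w))"
        by (simp add: s_def abs_sgn mult.commute)
      then show "\<bar>g n w - k (V w)\<bar> \<le> s n w * (g n w - k (v n w)) + \<bar>k (v n w) - k (V w)\<bar>"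
        by linarith
    qed (use si i in auto)
    also have "\<dots> = expectation (\<lambda>w. s n w * (f (D n w) - k (v n w))) + expectation (\<lambda>w. \<bar>k (v n w) - k (V w)\<bar>)"
      using si i 1 by simp
    also have "expectation (\<lambda>w. s n w * (f (D n w) - k (v n w)))
        \<le> expectation (\<lambda>w. s n w * (f (D n w) - k (V w)) + \<bar>k (v n w) - k (V w)\<bar>)"
    proof (rule integral_mono)
      fix w
      have "s n w * (k (V w) - k (v n w)) \<le> \<bar>s n w\<bar> * \<bar>k (V w) - k (v n w)\<bar>"
        by (simp flip: abs_mult)
      also have "\<dots> \<le> \<bar>k (v n w) - k (V w)\<bar>" using s1[of n w] by (simp add: mult_left_le_one_le abs_minus_commute)
      finally show "s n w * (f (D n w) - k (v n w)) \<le> s n w * (f (D n w) - k (V w)) + \<bar>k (v n w) - k (V w)\<bar>"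
        by (simp add: right_diff_distrib)
    qed (use si i in auto)
    also have "\<dots> = expectation (\<lambda>w. s n w * (f (D n w) - k (V w))) + expectation (\<lambda>w. \<bar>k (v n w) - k (V w)\<bar>)"
      using si i by simp
    finally show ?thesis by simp
  qed
  have lim: "(\<lambda>n. expectation (\<lambda>w. \<bar>g n w - k (V w)\<bar>)) \<longlonglongrightarrow> 0"
  proof (rule tendsto_sandwich[OF _ _ tendsto_const])
    show "(\<lambda>n. expectation (\<lambda>w. s n w * (f (D n w) - k (V w))) + 2 * expectation (\<lambda>w. \<bar>k (v n w) - k (V w)\<bar>)) \<longlonglongrightarrow> 0"
      using tendsto_add[OF A tendsto_mult[OF tendsto_const K, of 2]] by simp
  qed (use bound in auto)
  show "converges_in_prob M (\<lambda>n. real_cond_exp M (F n) (\<lambda>w. f (D n w))) (\<lambda>w. \<integral>x. f x \<partial>gauss_kernel V w)"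
    unfolding converges_in_prob_def gauss_kernel_def g_def[symmetric] k_def[symmetric]
  proof (intro allI impI)
    fix e :: real assume e: "e > 0"
    have "(\<lambda>n. expectation (\<lambda>w. \<bar>g n w - k (V w)\<bar>) / e) \<longlonglongrightarrow> 0 / e"
      by (intro tendsto_divide lim) (use e in auto)
    then have l: "(\<lambda>n. expectation (\<lambda>w. \<bar>g n w - k (V w)\<bar>) / e) \<longlonglongrightarrow> 0" by simp
    show "(\<lambda>n. prob {w \<in> space M. e < \<bar>g n w - k (V w)\<bar>}) \<longlonglongrightarrow> 0"
    proof (rule tendsto_sandwich[OF _ _ tendsto_const l])
      show "\<forall>\<^sub>F n in sequentially. prob {w \<in> space M. e < \<bar>g n w - k (V w)\<bar>} \<le> expectation (\<lambda>w. \<bar>g n w - k (V w)\<bar>) / e"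
      proof (intro always_eventually allI)
        fix n
        have "prob {w \<in> space M. e < \<bar>g n w - k (V w)\<bar>} \<le> prob {w \<in> space M. e \<le> \<bar>g n w - k (V w)\<bar>}"
          by (rule finite_measure_mono) auto
        also have "\<dots> \<le> expectation (\<lambda>w. \<bar>g n w - k (V w)\<bar>) / e"
          by (rule integral_Markov_inequality_measure[where A = "{}"]) (use e gi ki in auto)
        finally show "prob {w \<in> space M. e < \<bar>g n w - k (V w)\<bar>} \<le> expectation (\<lambda>w. \<bar>g n w - k (V w)\<bar>) / e" .
      qed
    qed auto
  qed
qed

theorem converges_stably_pairI:
  assumes sC: "strong_conv l C U" and l: "filterlim l at_top sequentially"
    and sD: "strong_conv (\<lambda>n. n) D V"
    and Cn: "\<And>n. C n \<in> borel_measurable (F n)"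
    and D [measurable]: "\<And>n. D n \<in> borel_measurable M"
    and U [measurable]: "U \<in> borel_measurable M" and V [measurable]: "V \<in> borel_measurable M"
    and FD: "\<And>n. F_limit (D n)" and FU: "F_limit U" and FV: "F_limit V"
  shows "converges_stably M C (gauss_kernel U)"
    and "converges_stably M (\<lambda>n w. (C n w, D n w)) (kernel_prod (gauss_kernel U) (gauss_kernel V))"
proof -
  have C [measurable]: "C n \<in> borel_measurable M" for n using Cn by (rule measurable_F)
  have FC: "F_limit (C n)" for n using Cn by (rule F_limit_of_measurable)
  show "converges_stably M C (gauss_kernel U)"
  proof (rule converges_stablyI[OF C is_kernel_gauss_kernel[OF U]])
    fix H and f :: "real \<Rightarrow> real"
    assume H [measurable]: "H \<in> sets M" and f: "continuous_on UNIV f" "bounded (range f)"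
    obtain B where B: "\<And>x. \<bar>f x\<bar> \<le> B" using f(2) bounded_rangeE[of f] by metis
    show "(\<lambda>n. expectation (\<lambda>w. indicator H w * f (C n w)))
        \<longlonglongrightarrow> expectation (\<lambda>w. indicator H w * (\<integral>x. f x \<partial>gauss_kernel U w))"
      unfolding gauss_kernel_def
      by (rule stable_of_strong[OF sC l C U _ FC FU _ f(1) B, where B = 1]) (auto simp: indicator_def)
  qed
  show "converges_stably M (\<lambda>n w. (C n w, D n w)) (kernel_prod (gauss_kernel U) (gauss_kernel V))"
  proof (rule converges_stablyI[OF _ is_kernel_gauss_pair[OF U V]])
    show "(\<lambda>w. (C n w, D n w)) \<in> borel_measurable M" for n
      unfolding borel_prod[symmetric] by measurable
    fix H and f :: "real \<times> real \<Rightarrow> real"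
    assume H [measurable]: "H \<in> sets M" and f: "continuous_on UNIV f" "bounded (range f)"
    obtain B where B: "\<And>x. \<bar>f x\<bar> \<le> B" using f(2) bounded_rangeE[of f] by metis
    show "(\<lambda>n. expectation (\<lambda>w. indicator H w * f (C n w, D n w)))
        \<longlonglongrightarrow> expectation (\<lambda>w. indicator H w * (\<integral>x. f x \<partial>kernel_prod (gauss_kernel U) (gauss_kernel V) w))"
      unfolding gauss_kernel_def kernel_prod_def
    proof (rule weighted_conv_pair[OF C D U V _ _ _ _ f(1) B])
      fix f g :: "real \<Rightarrow> real" and a b
      assume fg: "continuous_on UNIV f" "continuous_on UNIV g" "\<And>x. \<bar>f x\<bar> \<le> a" "\<And>x. \<bar>g x\<bar> \<le> b"
      show "(\<lambda>n. expectation (\<lambda>w. indicator H w * (f (C n w) * g (D n w))))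
        \<longlonglongrightarrow> expectation (\<lambda>w. indicator H w * ((\<integral>x. f x \<partial>gauss 0 (U w)) * (\<integral>x. g x \<partial>gauss 0 (V w))))"
        by (rule stable_product[OF sC l sD Cn D U V _ FD FU FV _ fg(1,3,2,4), where B = 1])
           (auto simp: indicator_def)
    qed (auto simp: indicator_def)
  qed
qed

end

section \<open>The urn process\<close>

lemma sets_sigma_gen: "sets (sigma_gen M Fs) = sigma_sets (space M) {f -` B \<inter> space M | f B. f \<in> Fs \<and> B \<in> sets borel}"
  unfolding sigma_gen_def by (rule sets_measure_of) auto

lemma space_sigma_gen [simp]: "space (sigma_gen M Fs) = space M"
  unfolding sigma_gen_def by (rule space_measure_of) auto

lemma measurable_sigma_gen: "f \<in> Fs \<Longrightarrow> f \<in> borel_measurable (sigma_gen M Fs)"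
  by (rule measurableI) (auto simp: sets_sigma_gen intro!: sigma_sets.Basic)

lemma sets_sigma_gen_mono: "Fs \<subseteq> Gs \<Longrightarrow> sets (sigma_gen M Fs) \<subseteq> sets (sigma_gen M Gs)"
  unfolding sets_sigma_gen by (rule sigma_sets_mono') blast

lemma subalgebra_sigma_gen:
  assumes "\<And>f. f \<in> Fs \<Longrightarrow> f \<in> borel_measurable M"
  shows "subalgebra M (sigma_gen M Fs)"
  unfolding subalgebra_def sets_sigma_gen
  using assms by (auto intro!: sets.sigma_sets_subset simp: measurable_sets)

lemma sigma_join_sets:
  assumes "sets F1 \<subseteq> sets M" "sets F2 \<subseteq> sets M"
  shows "sets F1 \<subseteq> sets (sigma_join M F1 F2)" "sets F2 \<subseteq> sets (sigma_join M F1 F2)"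
    and "space (sigma_join M F1 F2) = space M"
proof -
  have *: "sets F1 \<union> sets F2 \<subseteq> Pow (space M)" using assms sets.sets_into_space by blast
  have "sets (sigma_join M F1 F2) = sigma_sets (space M) (sets F1 \<union> sets F2)"
    unfolding sigma_join_def by (rule sets_measure_of[OF *])
  then show "sets F1 \<subseteq> sets (sigma_join M F1 F2)" "sets F2 \<subseteq> sets (sigma_join M F1 F2)"
    by auto
  show "space (sigma_join M F1 F2) = space M"
    unfolding sigma_join_def by (rule space_measure_of[OF *])
qed

text \<open>The fields generated by the two variables lie inside the given independent fields, so
  the variables are independent and expectations multiply.\<close>

lemma (in prob_space) expectation_mult_indep_set:
  fixes x y :: "'a \<Rightarrow> real"
  assumes ind: "indep_set (sets F1) (sets F2)"
    and sub: "subalgebra M F1" "subalgebra M F2"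
    and x: "x \<in> borel_measurable F1" "integrable M x" and y: "y \<in> borel_measurable F2" "integrable M y"
  shows "expectation (\<lambda>w. x w * y w) = expectation x * expectation y"
proof (rule indep_var_lebesgue_integral[OF _ x(2) y(2)])
  have s: "sigma_sets (space M) {f -` A \<inter> space M | A. A \<in> sets borel} \<subseteq> sets F"
    if "f \<in> borel_measurable F" "subalgebra M F" for f :: "'a \<Rightarrow> real" and F
  proof -
    have sp: "space F = space M" using that(2) by (simp add: subalgebra_def)
    have "{f -` A \<inter> space M | A. A \<in> sets borel} \<subseteq> sets F"
      using measurable_sets[OF that(1)] sp by auto
    then show ?thesis using sets.sigma_sets_subset[of _ F] sp by auto
  qed
  have "indep_set (sigma_sets (space M) {x -` A \<inter> space M | A. A \<in> sets borel})
     (sigma_sets (space M) {y -` A \<inter> space M | A. A \<in> sets borel})"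
    unfolding indep_set_def
    by (rule indep_sets_mono_sets[OF ind[unfolded indep_set_def]])
       (use s[OF x(1) sub(1)] s[OF y(1) sub(2)] in \<open>auto split: bool.split\<close>)
  then show "indep_var borel x borel y"
    unfolding indep_var_eq using x(2) y(2) by auto
qed

text \<open>A positive limit \<open>L\<close> of the eventually decreasing sequence would force
  decrements of at least \<open>L * c / (n + 1)\<close>. Their sum is finite by telescoping, against
  the divergence of the harmonic series.\<close>

lemma decay_to_zero:
  fixes u :: "nat \<Rightarrow> real"
  assumes u0: "\<And>n. n \<ge> n0 \<Longrightarrow> 0 \<le> u n" and c: "c > 0"
    and step: "\<And>n. n \<ge> n0 \<Longrightarrow> u (Suc n) \<le> u n - u n * (c / real (Suc n))"
  shows "u \<longlonglongrightarrow> 0"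
proof -
  define v where "v n = u (n + n0)" for n
  have v0: "0 \<le> v n" for n using u0 by (simp add: v_def)
  have dec: "v (Suc n) \<le> v n - v n * (c / real (Suc (n + n0)))" for n
    using step[of "n + n0"] by (simp add: v_def)
  have "decseq v"
  proof (rule decseq_SucI)
    fix n
    have "0 \<le> v n * (c / real (Suc (n + n0)))" using v0 c by simp
    with dec[of n] show "v (Suc n) \<le> v n" by linarith
  qed
  then obtain L where L: "v \<longlonglongrightarrow> L" "\<And>n. L \<le> v n"
    using decseq_convergent[of v 0] v0 by blast
  have L0: "0 \<le> L" by (rule LIMSEQ_le_const[OF L(1)]) (use v0 in blast)
  have "L = 0"
  proof (rule ccontr)
    assume "L \<noteq> 0"
    with L0 have Lp: "L > 0" by simp
    have "summable (\<lambda>n. v n - v (Suc n))" using telescope_summable'[OF L(1)] .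
    then have "summable (\<lambda>n. (L * c) * inverse (real (Suc (n + n0))))"
    proof (rule summable_comparison_test'[where N = 0])
      fix n
      have "L * c * inverse (real (Suc (n + n0))) = L * (c / real (Suc (n + n0)))" by (simp add: field_simps)
      also have "\<dots> \<le> v n * (c / real (Suc (n + n0)))" using L(2)[of n] c by (intro mult_right_mono) auto
      also have "\<dots> \<le> v n - v (Suc n)" using dec[of n] by linarith
      finally show "norm (L * c * inverse (real (Suc (n + n0)))) \<le> v n - v (Suc n)"
        using Lp c by simp
    qed
    then have "summable (\<lambda>n. inverse (real (Suc (n + n0))))" using Lp c by (simp add: summable_cmult_iff)
    then have "summable (\<lambda>n. inverse (real (n + Suc n0)))" by simp
    then have "summable (\<lambda>n. inverse (real n))"
      using summable_iff_shift[of "\<lambda>n. inverse (real n)" "Suc n0"] by blast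
    then show False using not_summable_harmonic[where 'a = real] by (simp add: inverse_eq_divide)
  qed
  with L(1) have "(\<lambda>n. u (n + n0)) \<longlonglongrightarrow> 0" by (simp add: v_def[abs_def])
  then show ?thesis by (rule LIMSEQ_offset)
qed

text \<open>The assumptions unfolded into rules, with the draw at \<open>Suc n\<close> set against
  the past of index \<open>n\<close> and a strictly positive bound \<beta>. The color
  \<open>j\<close> is a parameter, so the processes attached to it carry no color argument; other
  colors are reached by further instances.\<close>

locale multicolor_urn = prob_space M for M :: "'w measure" +
  fixes X A :: "nat \<Rightarrow> nat \<Rightarrow> 'w \<Rightarrow> real" and a q :: "nat \<Rightarrow> real" and m \<beta> :: real and d d0 j :: nat
  assumes d0: "1 \<le> d0" "d0 \<le> d" and j: "j \<in> {1..d0}"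
    and X_M: "\<And>n i. n \<ge> 1 \<Longrightarrow> i \<in> {1..d} \<Longrightarrow> X n i \<in> borel_measurable M"
    and A_M: "\<And>n i. n \<ge> 1 \<Longrightarrow> i \<in> {1..d} \<Longrightarrow> A n i \<in> borel_measurable M"
    and a_pos: "\<And>i. i \<in> {1..d} \<Longrightarrow> 0 < a i"
    and X01: "\<And>n i w. n \<ge> 1 \<Longrightarrow> i \<in> {1..d} \<Longrightarrow> w \<in> space M \<Longrightarrow> X n i w \<in> {0, 1}"
    and X_sum: "\<And>n w. n \<ge> 1 \<Longrightarrow> w \<in> space M \<Longrightarrow> (\<Sum>i=1..d. X n i w) = 1"
    and \<beta>: "0 < \<beta>"
    and A0: "\<And>n i w. n \<ge> 1 \<Longrightarrow> i \<in> {1..d} \<Longrightarrow> w \<in> space M \<Longrightarrow> 0 \<le> A n i w"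
    and A\<beta>: "\<And>n i w. n \<ge> 1 \<Longrightarrow> i \<in> {1..d} \<Longrightarrow> w \<in> space M \<Longrightarrow> A n i w \<le> \<beta>"
    and indep: "\<And>n. indep_set (sets (sigma_gen M {A (Suc n) i | i. i \<in> {1..d}}))
        (sets (sigma_join M (urn_G M X A d n) (sigma_gen M {X (Suc n) i | i. i \<in> {1..d}})))"
    and Z_cond: "\<And>n i. i \<in> {1..d} \<Longrightarrow> AE w in M. urn_Z X A a d n i w
          = real_cond_exp M (urn_G M X A d n) (indicator {v \<in> space M. X (Suc n) i v = 1}) w"
    and mean_eq: "\<And>n i. i \<in> {1..d0} \<Longrightarrow> expectation (A (Suc n) i) = expectation (A (Suc n) 1)"
    and mean_lim: "(\<lambda>n. expectation (A n 1)) \<longlonglongrightarrow> m"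
    and lambda_less: "lambda0 M A d d0 < ereal m"
    and second_lim: "\<And>i. i \<in> {1..d0} \<Longrightarrow> (\<lambda>n. expectation (\<lambda>w. (A n i w)\<^sup>2)) \<longlonglongrightarrow> q i"
begin

declare One_nat_def [simp del]

abbreviation F :: "nat \<Rightarrow> 'w measure" where "F \<equiv> urn_G M X A d"

lemma in_d: "i \<in> {1..d0} \<Longrightarrow> i \<in> {1..d}" using d0 by auto

sublocale filtered_prob_space M F
proof
  show "subalgebra M (F n)" for n
    unfolding urn_G_def by (rule subalgebra_sigma_gen) (auto intro: X_M A_M)
  show "sets (F n) \<subseteq> sets (F k)" if "n \<le> k" for n k
  proof -
    have "{1..n} \<subseteq> {1..k}" using that by auto
    then show ?thesis unfolding urn_G_def by (intro sets_sigma_gen_mono) blast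
  qed
qed

lemma X_F [measurable (raw)]: "1 \<le> k \<Longrightarrow> k \<le> n \<Longrightarrow> i \<in> {1..d} \<Longrightarrow> X k i \<in> borel_measurable (F n)"
  unfolding urn_G_def by (rule measurable_sigma_gen) auto

lemma A_F [measurable (raw)]: "1 \<le> k \<Longrightarrow> k \<le> n \<Longrightarrow> i \<in> {1..d} \<Longrightarrow> A k i \<in> borel_measurable (F n)"
  unfolding urn_G_def by (rule measurable_sigma_gen) auto

abbreviation N :: "nat \<Rightarrow> nat \<Rightarrow> 'w \<Rightarrow> real" where "N \<equiv> urn_N X A a"
abbreviation Z :: "nat \<Rightarrow> nat \<Rightarrow> 'w \<Rightarrow> real" where "Z \<equiv> urn_Z X A a d"

definition S :: "nat \<Rightarrow> 'w \<Rightarrow> real" where "S n w = (\<Sum>i=1..d0. N n i w)"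
definition T :: "nat \<Rightarrow> 'w \<Rightarrow> real" where "T n w = (\<Sum>i=1..d. N n i w)"
definition R :: "nat \<Rightarrow> 'w \<Rightarrow> real" where "R n w = (\<Sum>i\<in>{d0<..d}. N n i w)"

lemma N_Suc: "N (Suc n) i w = N n i w + X (Suc n) i w * A (Suc n) i w"
  by (simp add: urn_N_def)

lemma N_0: "N 0 i w = a i" by (simp add: urn_N_def)

lemma XA_nonneg: "i \<in> {1..d} \<Longrightarrow> w \<in> space M \<Longrightarrow> 0 \<le> X (Suc n) i w * A (Suc n) i w"
  using X01[of "Suc n" i w] A0[of "Suc n" i w] by auto

lemma N_mono: "i \<in> {1..d} \<Longrightarrow> w \<in> space M \<Longrightarrow> N n i w \<le> N (Suc n) i w"
  using XA_nonneg by (simp add: N_Suc)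

lemma N_ge: "i \<in> {1..d} \<Longrightarrow> w \<in> space M \<Longrightarrow> a i \<le> N n i w"
proof (induction n)
  case (Suc n)
  then show ?case using N_mono[of i w n] by linarith
qed (simp add: N_0)

lemma N_pos: "i \<in> {1..d} \<Longrightarrow> w \<in> space M \<Longrightarrow> 0 < N n i w"
  using N_ge[of i w n] a_pos[of i] by linarith

lemma N_F [measurable (raw)]: "i \<in> {1..d} \<Longrightarrow> N n i \<in> borel_measurable (F n)"
  unfolding urn_N_def
  by (intro borel_measurable_add borel_measurable_sum borel_measurable_times borel_measurable_const X_F A_F) auto

lemma S_F: "S n \<in> borel_measurable (F n)"
  unfolding S_def by (intro borel_measurable_sum N_F in_d)

lemma T_F: "T n \<in> borel_measurable (F n)"
  unfolding T_def by (intro borel_measurable_sum N_F)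

lemma R_F: "R n \<in> borel_measurable (F n)"
  unfolding R_def by (intro borel_measurable_sum N_F) auto

lemma Z_eq: "Z n i w = N n i w / T n w" by (simp add: urn_Z_def T_def)

lemma Z_F: "i \<in> {1..d} \<Longrightarrow> Z n i \<in> borel_measurable (F n)"
  unfolding Z_eq by (intro borel_measurable_divide N_F T_F)

lemma T_eq: "T n w = S n w + R n w"
proof -
  have "{1..d} = {1..d0} \<union> {d0<..d}" "{1..d0} \<inter> {d0<..d} = {}" using d0 by auto
  then show ?thesis unfolding T_def S_def R_def by (simp add: sum.union_disjoint)
qed

lemma S_ge: "w \<in> space M \<Longrightarrow> N n 1 w \<le> S n w"
  unfolding S_def using d0 by (intro member_le_sum) (auto intro!: less_imp_le[OF N_pos])

lemma S_pos: "w \<in> space M \<Longrightarrow> 0 < S n w"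
  using S_ge[of w n] N_pos[of 1 w n] d0 by fastforce

lemma R_nonneg: "w \<in> space M \<Longrightarrow> 0 \<le> R n w"
  unfolding R_def by (rule sum_nonneg) (auto intro!: less_imp_le[OF N_pos])

lemma T_pos: "w \<in> space M \<Longrightarrow> 0 < T n w"
  using S_pos R_nonneg unfolding T_eq by (simp add: add_pos_nonneg)

lemma Z_nonneg: "i \<in> {1..d} \<Longrightarrow> w \<in> space M \<Longrightarrow> 0 \<le> Z n i w"
  unfolding Z_eq using N_pos T_pos by (simp add: less_imp_le)

lemma Z_sum: "w \<in> space M \<Longrightarrow> (\<Sum>i=1..d. Z n i w) = 1"
  using T_pos[of w n] unfolding Z_eq by (simp add: T_def flip: sum_divide_distrib)

lemma Z_le_1: "i \<in> {1..d} \<Longrightarrow> w \<in> space M \<Longrightarrow> Z n i w \<le> 1"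
  unfolding Z_sum[of w n, symmetric] by (rule member_le_sum) (auto intro: Z_nonneg)

text \<open>The indicators are 0 or 1 and add up to 1, so every sum over drawn colors collapses to
  at most one summand. This bounds the increments and, later, removes the cross terms when a sum is
  squared.\<close>

lemma color_drawn:
  assumes "w \<in> space M"
  obtains i0 where "i0 \<in> {1..d}" "\<And>f :: nat \<Rightarrow> real. \<And>I. I \<subseteq> {1..d} \<Longrightarrow> (\<Sum>i\<in>I. X (Suc n) i w * f i) = (if i0 \<in> I then f i0 else 0)"
proof -
  have x: "X (Suc n) i w \<in> {0, 1}" if "i \<in> {1..d}" for i using X01 that assms by simp
  have s: "(\<Sum>i=1..d. X (Suc n) i w) = 1" using X_sum assms by simp
  obtain i0 where i0: "i0 \<in> {1..d}" "X (Suc n) i0 w = 1"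
  proof -
    have "\<exists>i0\<in>{1..d}. X (Suc n) i0 w \<noteq> 0" using s by (metis sum.neutral zero_neq_one)
    then show ?thesis using that x by blast
  qed
  have "X (Suc n) i w = 0" if "i \<in> {1..d}" "i \<noteq> i0" for i
  proof -
    have "(\<Sum>i\<in>{1..d} - {i0}. X (Suc n) i w) = 0"
      using s i0 sum.remove[of "{1..d}" i0 "\<lambda>i. X (Suc n) i w"] by simp
    then have "\<forall>i\<in>{1..d} - {i0}. X (Suc n) i w = 0"
      by (subst (asm) sum_nonneg_eq_0_iff) (use x in force)+
    with that show ?thesis by simp
  qed
  note other = this
  show ?thesis
  proof (rule that[OF i0(1)])
    fix f :: "nat \<Rightarrow> real" and I assume I: "I \<subseteq> {1..d}"
    have "(\<Sum>i\<in>I. X (Suc n) i w * f i) = (\<Sum>i\<in>I. if i = i0 then f i0 else 0)"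
      by (rule sum.cong) (use I other i0 in auto)
    also have "\<dots> = (if i0 \<in> I then f i0 else 0)"
      using finite_subset[OF I] by (simp add: sum.delta)
    finally show "(\<Sum>i\<in>I. X (Suc n) i w * f i) = (if i0 \<in> I then f i0 else 0)" .
  qed
qed

lemma sum_XA_bounds:
  assumes "w \<in> space M" "I \<subseteq> {1..d}"
  shows "0 \<le> (\<Sum>i\<in>I. X (Suc n) i w * A (Suc n) i w)" "(\<Sum>i\<in>I. X (Suc n) i w * A (Suc n) i w) \<le> \<beta>"
proof -
  obtain i0 where "i0 \<in> {1..d}" and
    *: "\<And>f :: nat \<Rightarrow> real. \<And>I. I \<subseteq> {1..d} \<Longrightarrow> (\<Sum>i\<in>I. X (Suc n) i w * f i) = (if i0 \<in> I then f i0 else 0)"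
    using color_drawn[OF assms(1)] by blast
  then show "0 \<le> (\<Sum>i\<in>I. X (Suc n) i w * A (Suc n) i w)" "(\<Sum>i\<in>I. X (Suc n) i w * A (Suc n) i w) \<le> \<beta>"
    using *[OF assms(2), of "\<lambda>i. A (Suc n) i w"] A0[of "Suc n" i0 w] A\<beta>[of "Suc n" i0 w] \<beta> assms(1) by auto
qed

definition \<alpha> :: real where "\<alpha> = (\<Sum>i=1..d. a i)"

lemma \<alpha>_pos: "0 < \<alpha>"
  unfolding \<alpha>_def by (rule sum_pos) (use a_pos d0 in auto)

lemma T_le: "w \<in> space M \<Longrightarrow> T n w \<le> (\<alpha> + \<beta>) * real (Suc n)"
proof -
  assume w: "w \<in> space M"
  have "T n w \<le> \<alpha> + \<beta> * real n"
  proof (induction n)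
    case (Suc n)
    have "T (Suc n) w = T n w + (\<Sum>i=1..d. X (Suc n) i w * A (Suc n) i w)"
      unfolding T_def N_Suc by (rule sum.distrib)
    with sum_XA_bounds(2)[OF w, of "{1..d}" n] Suc show ?case by (simp add: algebra_simps)
  qed (simp add: T_def N_0 \<alpha>_def)
  also have "\<dots> \<le> (\<alpha> + \<beta>) * real (Suc n)" using \<alpha>_pos \<beta> by (simp add: algebra_simps)
  finally show ?thesis .
qed

text \<open>The reinforcement is independent of the past together with the draw, so
  \<open>g (A (Suc n) i)\<close> factors out; the draw itself is replaced by its conditional
  probability \<open>Z n i\<close>.\<close>

lemma draw:
  assumes W: "W \<in> borel_measurable (F n)" and B: "\<And>w. w \<in> space M \<Longrightarrow> \<bar>W w\<bar> \<le> B"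
    and i: "i \<in> {1..d}" and g [measurable]: "g \<in> borel_measurable borel" and C: "\<And>x. 0 \<le> x \<Longrightarrow> x \<le> \<beta> \<Longrightarrow> \<bar>g x\<bar> \<le> C"
  shows "expectation (\<lambda>w. W w * (X (Suc n) i w * g (A (Suc n) i w)))
    = expectation (\<lambda>w. W w * Z n i w) * expectation (\<lambda>w. g (A (Suc n) i w))"
proof -
  let ?X = "X (Suc n) i" and ?A = "A (Suc n) i"
  let ?GA = "sigma_gen M {A (Suc n) i | i. i \<in> {1..d}}" and ?GX = "sigma_gen M {X (Suc n) i | i. i \<in> {1..d}}"
  let ?J = "sigma_join M (F n) ?GX"
  have WM [measurable]: "W \<in> borel_measurable M" using W by (rule measurable_F)
  have [measurable]: "?X \<in> borel_measurable M" "?A \<in> borel_measurable M" using X_M A_M i by auto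
  have B0: "0 \<le> B" using B not_empty abs_ge_zero order_trans by blast
  have subGA: "subalgebra M ?GA" by (rule subalgebra_sigma_gen) (auto intro: A_M)
  have subGX: "subalgebra M ?GX" by (rule subalgebra_sigma_gen) (auto intro: X_M)
  have sM: "sets (F n) \<subseteq> sets M" "sets ?GX \<subseteq> sets M" using subalg subGX by (auto simp: subalgebra_def)
  note Js = sigma_join_sets[OF sM]
  have subJ: "subalgebra M ?J"
    unfolding subalgebra_def
  proof
    show "space ?J = space M" by (rule Js(3))
    have *: "sets (F n) \<union> sets ?GX \<subseteq> Pow (space M)" using sM sets.sets_into_space by blast
    show "sets ?J \<subseteq> sets M"
      unfolding sigma_join_def sets_measure_of[OF *] using sM by (intro sets.sigma_sets_subset) auto
  qed
  have WJ: "W \<in> borel_measurable ?J"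
    by (rule measurable_from_subalg[OF _ W]) (use Js in \<open>auto simp: subalgebra_def\<close>)
  have "?X \<in> borel_measurable ?GX" by (rule measurable_sigma_gen) (use i in auto)
  then have XJ: "?X \<in> borel_measurable ?J"
    by (rule measurable_from_subalg[rotated]) (use Js in \<open>auto simp: subalgebra_def\<close>)
  have AG: "?A \<in> borel_measurable ?GA" by (rule measurable_sigma_gen) (use i in auto)
  have gAG: "(\<lambda>w. g (?A w)) \<in> borel_measurable ?GA" using AG by measurable
  have X1: "\<bar>?X w\<bar> \<le> 1" if "w \<in> space M" for w using X01[of "Suc n" i w] i that by auto
  have iWX: "integrable M (\<lambda>w. W w * ?X w)"
    by (rule integrable_bounded[where B = "B * 1"], measurable)
       (use B X1 B0 in \<open>simp only: real_norm_def abs_mult, intro mult_mono, auto\<close>)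
  have igA: "integrable M (\<lambda>w. g (?A w))"
    by (rule integrable_bounded[where B = C]) (use C A0[of "Suc n" i] A\<beta>[of "Suc n" i] i in auto)
  have "expectation (\<lambda>w. g (?A w) * (W w * ?X w)) = expectation (\<lambda>w. g (?A w)) * expectation (\<lambda>w. W w * ?X w)"
    by (rule expectation_mult_indep_set[OF indep[of n] subGA subJ gAG igA _ iWX])
       (intro borel_measurable_times WJ XJ)
  moreover have "expectation (\<lambda>w. W w * ?X w) = expectation (\<lambda>w. W w * Z n i w)"
  proof -
    let ?I = "indicator {v \<in> space M. ?X v = 1} :: 'w \<Rightarrow> real"
    have XI: "?X w = ?I w" if "w \<in> space M" for w
      using X01[of "Suc n" i w] i that by (auto simp: indicator_def)
    have iWI: "integrable M (\<lambda>w. W w * ?I w)"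
    proof (rule integrable_bounded[where B = "B * 1"])
      show "norm (W w * ?I w) \<le> B * 1" if "w \<in> space M" for w
        unfolding real_norm_def abs_mult by (intro mult_mono B that B0) (simp_all add: indicator_def)
    qed measurable
    have "expectation (\<lambda>w. W w * ?X w) = expectation (\<lambda>w. W w * ?I w)"
    proof (rule Bochner_Integration.integral_cong[OF refl])
      show "W w * ?X w = W w * ?I w" if "w \<in> space M" for w by (subst XI[OF that]) (rule refl)
    qed
    also have "\<dots> = expectation (\<lambda>w. W w * real_cond_exp M (F n) ?I w)"
      by (rule sigma_finite_subalgebra.real_cond_exp_intg(2)[OF sigma_finite_subalgebra_F iWI W, symmetric]) measurable
    also have "\<dots> = expectation (\<lambda>w. W w * Z n i w)"
    proof (rule integral_cong_AE)
      show "AE w in M. W w * real_cond_exp M (F n) ?I w = W w * Z n i w"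
        using Z_cond[OF i, of n] by eventually_elim simp
      have [measurable]: "Z n i \<in> borel_measurable M" by (rule measurable_F[OF Z_F[OF i]])
      show "(\<lambda>w. W w * Z n i w) \<in> borel_measurable M" by measurable
    qed measurable
    finally show ?thesis .
  qed
  ultimately show ?thesis by (simp add: mult_ac)
qed

section \<open>Means of the reinforcements and growth of the weight of color 1\<close>

definition \<mu> :: "nat \<Rightarrow> real" where "\<mu> n = expectation (A (Suc n) 1)"

lemma \<mu>_lim: "\<mu> \<longlonglongrightarrow> m"
  unfolding \<mu>_def using LIMSEQ_Suc[OF mean_lim] .

lemma A_int: "i \<in> {1..d} \<Longrightarrow> integrable M (A (Suc n) i)"
  by (rule integrable_bounded[where B = \<beta>]) (use A_M A0 A\<beta> in auto)

lemma mean_bounds: "i \<in> {1..d} \<Longrightarrow> 0 \<le> expectation (A (Suc n) i)" "i \<in> {1..d} \<Longrightarrow> expectation (A (Suc n) i) \<le> \<beta>"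
proof -
  assume i: "i \<in> {1..d}"
  show "0 \<le> expectation (A (Suc n) i)" by (rule integral_nonneg_AE) (use A0 i in auto)
  have "expectation (A (Suc n) i) \<le> expectation (\<lambda>_. \<beta>)"
    by (rule integral_mono) (use A_int[OF i] A\<beta> i in auto)
  then show "expectation (A (Suc n) i) \<le> \<beta>" using prob_space by simp
qed

text \<open>Density gives a real \<open>l\<close> strictly between the largest limsup and
  \<open>m\<close>; it is nonnegative because the reinforcements are. If \<open>d0 = d\<close> there
  are no other colors, and \<open>l = 0\<close> works because the assumption then says
  \<open>m > 0\<close>.\<close>

lemma lambda_gap: "\<exists>l n0. 0 \<le> l \<and> l < m \<and> (\<forall>n\<ge>n0. \<forall>i\<in>{d0<..d}. expectation (A (Suc n) i) \<le> l)"
proof (cases "d0 = d")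
  case True
  then have "0 < m" using lambda_less by (simp add: lambda0_def)
  with True show ?thesis by (intro exI[of _ 0] exI[of _ 0]) auto
next
  case False
  let ?L = "\<lambda>i. limsup (\<lambda>n. ereal (expectation (A n i)))"
  have ne: "{d0<..d} \<noteq> {}" using False d0 by auto
  have lam: "Max (?L ` {d0<..d}) < ereal m" using lambda_less False by (simp add: lambda0_def)
  have Li: "?L i < ereal m" if "i \<in> {d0<..d}" for i
    using that lam by (subst (asm) Max_less_iff) auto
  have Lpos: "0 \<le> ?L i" if "i \<in> {d0<..d}" for i
  proof -
    have "0 \<le> ereal (expectation (A n i))" if "n \<ge> 1" for n
      using mean_bounds(1)[of i "n - 1"] \<open>i \<in> {d0<..d}\<close> that by simp
    then have "\<forall>\<^sub>F n in sequentially. (0::ereal) \<le> ereal (expectation (A n i))"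
      unfolding eventually_sequentially by blast
    then show ?thesis using Limsup_mono[of "\<lambda>_. 0::ereal" _ sequentially] by (simp add: Limsup_const)
  qed
  obtain i1 where "i1 \<in> {d0<..d}" using ne by blast
  then have "0 < m" using Li[of i1] Lpos[of i1] by (metis ereal_less(2) order_le_less_trans)
  have mx: "0 \<le> Max (?L ` {d0<..d})"
    using Lpos ne by (subst Max_ge_iff) auto
  obtain l where l: "Max (?L ` {d0<..d}) < ereal l" "l < m"
  proof -
    obtain z where "Max (?L ` {d0<..d}) < z" "z < ereal m" using dense[OF lam] by blast
    moreover then have "z \<noteq> \<infinity>" "z \<noteq> -\<infinity>" using mx by auto
    ultimately show ?thesis using that[of "real_of_ereal z"] by (cases z) auto
  qed
  have l0: "0 \<le> l" using mx l(1) by (metis ereal_less_eq(5) less_imp_le order_trans)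
  have "\<forall>i\<in>{d0<..d}. \<forall>\<^sub>F n in sequentially. expectation (A n i) \<le> l"
  proof
    fix i assume i: "i \<in> {d0<..d}"
    then have "?L i \<le> Max (?L ` {d0<..d})" by (intro Max_ge) auto
    then have "?L i < ereal l" using l(1) by (rule order_le_less_trans)
    then have "\<forall>\<^sub>F n in sequentially. ereal (expectation (A n i)) < ereal l" by (rule Limsup_lessD)
    then show "\<forall>\<^sub>F n in sequentially. expectation (A n i) \<le> l" by eventually_elim simp
  qed
  then have "\<forall>\<^sub>F n in sequentially. \<forall>i\<in>{d0<..d}. expectation (A n i) \<le> l"
    by (simp add: eventually_ball_finite)
  then obtain n0 where "\<forall>n\<ge>n0. \<forall>i\<in>{d0<..d}. expectation (A n i) \<le> l" by (auto simp: eventually_sequentially)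
  then show ?thesis using l0 l(2) by (intro exI[of _ l] exI[of _ n0]) auto
qed

lemma m_pos: "0 < m" using lambda_gap by force

text \<open>The total weight grows at most linearly, so the proportion of color 1 is at least of
  order \<open>1 / n\<close>. Hence the expectation of \<open>exp (- N)\<close> loses a fraction of
  order \<open>1 / n\<close> at each step, and the harmonic series diverges.\<close>

lemma exp_N_to_0: "(\<lambda>n. expectation (\<lambda>w. exp (- N n 1 w))) \<longlonglongrightarrow> 0"
proof -
  have 1: "1 \<in> {1..d}" using d0 by auto
  define u where "u n = expectation (\<lambda>w. exp (- N n 1 w))" for n
  \<comment> \<open>\<open>a 1 / ((\<alpha> + \<beta>) * Suc n)\<close> bounds the proportion
    \<open>Z\<close> from below. The factor \<open>exp (- \<beta>) * (m / 2)\<close> bounds the mean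
    of \<open>1 - exp (- A)\<close>, because \<open>1 - exp (- x) >= x * exp (- x)\<close>,
    reinforcements are at most \<beta>, and their means eventually exceed
    \<open>m / 2\<close>.\<close>
  define c where "c = a 1 * (exp (- \<beta>) * (m / 2)) / (\<alpha> + \<beta>)"
  have c: "c > 0" unfolding c_def using a_pos[OF 1] m_pos \<alpha>_pos \<beta> by simp
  have "\<forall>\<^sub>F n in sequentially. m / 2 < \<mu> n" using \<mu>_lim by (rule order_tendstoD) (use m_pos in simp)
  then obtain n0 where n0: "\<And>n. n \<ge> n0 \<Longrightarrow> m / 2 < \<mu> n" by (auto simp: eventually_sequentially)
  have e1: "exp (- N n 1 w) \<le> 1" "0 \<le> exp (- N n 1 w)" if "w \<in> space M" for n w using N_pos[OF 1 that, of n] by auto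
  have NF: "(\<lambda>w. exp (- N n 1 w)) \<in> borel_measurable (F n)" for n
    using N_F[OF 1, of n] by measurable
  have NM [measurable]: "(\<lambda>w. exp (- N n 1 w)) \<in> borel_measurable M" "Z n 1 \<in> borel_measurable M" for n
    using measurable_F[OF NF] measurable_F[OF Z_F[OF 1]] by auto
  have step: "u (Suc n) \<le> u n - u n * (c / real (Suc n))" if "n \<ge> n0" for n
  proof -
    let ?g = "\<lambda>x. 1 - exp (- x) :: real"
    note [measurable] = A_M[of "Suc n" 1] X_M[of "Suc n" 1]
    have x1: "X (Suc n) 1 w = 0 \<or> X (Suc n) 1 w = 1" if "w \<in> space M" for w using X01[of "Suc n" 1 w] 1 that by auto
    have eq: "exp (- N (Suc n) 1 w) = exp (- N n 1 w) - exp (- N n 1 w) * (X (Suc n) 1 w * ?g (A (Suc n) 1 w))" if "w \<in> space M" for w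
      using x1[OF that] by (auto simp: N_Suc algebra_simps simp flip: exp_add)
    have gb: "\<bar>?g x\<bar> \<le> 1" if "0 \<le> x" for x using that by (simp add: abs_le_iff)
    have gA: "\<bar>?g (A (Suc n) 1 w)\<bar> \<le> 1" if "w \<in> space M" for w using gb A0[of "Suc n" 1 w] 1 that by auto
    have i1: "integrable M (\<lambda>w. exp (- N n 1 w))" by (rule integrable_bounded[where B = 1]) (use e1 in auto)
    have i2: "integrable M (\<lambda>w. exp (- N n 1 w) * (X (Suc n) 1 w * ?g (A (Suc n) 1 w)))"
    proof (rule integrable_bounded[where B = "1 * (1 * 1)"])
      show "norm (exp (- N n 1 w) * (X (Suc n) 1 w * ?g (A (Suc n) 1 w))) \<le> 1 * (1 * 1)" if "w \<in> space M" for w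
        unfolding real_norm_def abs_mult by (intro mult_mono gA[OF that]) (use e1[OF that] x1[OF that] in auto)
      show "(\<lambda>w. exp (- N n 1 w) * (X (Suc n) 1 w * ?g (A (Suc n) 1 w))) \<in> borel_measurable M"
        using 1 by measurable
    qed
    have "u (Suc n) = expectation (\<lambda>w. exp (- N n 1 w) - exp (- N n 1 w) * (X (Suc n) 1 w * ?g (A (Suc n) 1 w)))"
      unfolding u_def by (rule Bochner_Integration.integral_cong) (simp_all add: eq)
    also have "\<dots> = u n - expectation (\<lambda>w. exp (- N n 1 w) * (X (Suc n) 1 w * ?g (A (Suc n) 1 w)))"
      using i1 i2 by (simp add: u_def)
    also have "expectation (\<lambda>w. exp (- N n 1 w) * (X (Suc n) 1 w * ?g (A (Suc n) 1 w)))
        = expectation (\<lambda>w. exp (- N n 1 w) * Z n 1 w) * expectation (\<lambda>w. ?g (A (Suc n) 1 w))"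
      by (rule draw[OF NF _ 1, where B = 1 and C = 1]) (use e1 gb in auto)
    finally have u: "u (Suc n) = u n - expectation (\<lambda>w. exp (- N n 1 w) * Z n 1 w) * expectation (\<lambda>w. ?g (A (Suc n) 1 w))" .
    have E1: "u n * (a 1 / ((\<alpha> + \<beta>) * real (Suc n))) \<le> expectation (\<lambda>w. exp (- N n 1 w) * Z n 1 w)"
    proof -
      have "expectation (\<lambda>w. exp (- N n 1 w) * (a 1 / ((\<alpha> + \<beta>) * real (Suc n)))) \<le> expectation (\<lambda>w. exp (- N n 1 w) * Z n 1 w)"
      proof (rule integral_mono)
        show "integrable M (\<lambda>w. exp (- N n 1 w) * Z n 1 w)"
          by (rule integrable_bounded[where B = "1 * 1"], measurable)
             (use e1 Z_le_1[OF 1] Z_nonneg[OF 1] in \<open>simp only: real_norm_def abs_mult, intro mult_mono, auto\<close>)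
        fix w assume w: "w \<in> space M"
        have "a 1 / ((\<alpha> + \<beta>) * real (Suc n)) \<le> Z n 1 w"
          unfolding Z_eq using N_ge[OF 1 w, of n] T_le[OF w, of n] T_pos[OF w, of n] a_pos[OF 1]
          by (intro frac_le) auto
        then show "exp (- N n 1 w) * (a 1 / ((\<alpha> + \<beta>) * real (Suc n))) \<le> exp (- N n 1 w) * Z n 1 w"
          by (intro mult_left_mono) auto
      qed (use i1 in simp)
      then show ?thesis by (simp add: u_def)
    qed
    have E2: "exp (- \<beta>) * (m / 2) \<le> expectation (\<lambda>w. ?g (A (Suc n) 1 w))"
    proof -
      have "exp (- \<beta>) * (m / 2) \<le> exp (- \<beta>) * \<mu> n" using n0[OF that] by simp
      also have "\<dots> = expectation (\<lambda>w. exp (- \<beta>) * A (Suc n) 1 w)" by (simp add: \<mu>_def)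
      also have "\<dots> \<le> expectation (\<lambda>w. ?g (A (Suc n) 1 w))"
      proof (rule integral_mono)
        show "integrable M (\<lambda>w. ?g (A (Suc n) 1 w))"
          by (rule integrable_bounded[where B = 1]) (use gA 1 in auto)
        fix w assume w: "w \<in> space M"
        have x: "0 \<le> A (Suc n) 1 w" "A (Suc n) 1 w \<le> \<beta>" using A0[of "Suc n" 1 w] A\<beta>[of "Suc n" 1 w] 1 w by auto
        let ?x = "A (Suc n) 1 w"
        have "exp (- ?x) * (1 + ?x) \<le> exp (- ?x) * exp ?x" by (intro mult_left_mono exp_ge_add_one_self) auto
        then have "exp (- ?x) * ?x \<le> 1 - exp (- ?x)" by (simp add: algebra_simps flip: exp_add)
        moreover have "exp (- \<beta>) * ?x \<le> exp (- ?x) * ?x" using x by (intro mult_right_mono) auto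
        ultimately show "exp (- \<beta>) * ?x \<le> 1 - exp (- ?x)" by linarith
      qed (use A_int[OF 1] in simp)
      finally show ?thesis .
    qed
    have "u n * (c / real (Suc n)) = u n * (a 1 / ((\<alpha> + \<beta>) * real (Suc n))) * (exp (- \<beta>) * (m / 2))"
      by (simp only: c_def divide_inverse inverse_mult_distrib mult_ac)
    also have "\<dots> \<le> expectation (\<lambda>w. exp (- N n 1 w) * Z n 1 w) * expectation (\<lambda>w. ?g (A (Suc n) 1 w))"
    proof (rule mult_mono[OF E1 E2])
      show "0 \<le> expectation (\<lambda>w. exp (- N n 1 w) * Z n 1 w)"
        by (rule integral_nonneg_AE) (use Z_nonneg[OF 1] in auto)
      show "0 \<le> exp (- \<beta>) * (m / 2)" using m_pos by simp
    qed
    finally show ?thesis using u by linarith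
  qed
  have "u \<longlonglongrightarrow> 0"
  proof (rule decay_to_zero[of n0 u c])
    show "0 \<le> u n" for n by (simp add: u_def)
    show "u (Suc n) \<le> u n - u n * (c / real (Suc n))" if "n \<ge> n0" for n by (rule step[OF that])
  qed (rule c)
  then show ?thesis by (simp add: u_def[abs_def])
qed

text \<open>\<open>S\<close> dominates the weight of color 1, and Markov's inequality is applied to
  \<open>exp (- N)\<close>.\<close>

lemma S_small_prob: "(\<lambda>n. prob {w \<in> space M. S n w < s}) \<longlonglongrightarrow> 0"
proof (rule tendsto_sandwich[OF _ _ tendsto_const])
  have 1: "1 \<in> {1..d}" using d0 by auto
  have [measurable]: "S n \<in> borel_measurable M" "N n 1 \<in> borel_measurable M" for n
    using measurable_F[OF S_F] measurable_F[OF N_F[OF 1]] by auto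
  show "\<forall>\<^sub>F n in sequentially. prob {w \<in> space M. S n w < s} \<le> expectation (\<lambda>w. exp (- N n 1 w)) / exp (- s)"
  proof (intro always_eventually allI)
    fix n
    have "prob {w \<in> space M. S n w < s} \<le> prob {w \<in> space M. exp (- s) \<le> exp (- N n 1 w)}"
      by (rule finite_measure_mono) (use S_ge[of _ n] in fastforce)+
    also have "\<dots> \<le> expectation (\<lambda>w. exp (- N n 1 w)) / exp (- s)"
    proof (rule integral_Markov_inequality_measure[where A = "{}"])
      show "integrable M (\<lambda>w. exp (- N n 1 w))"
        by (rule integrable_bounded[where B = 1]) (use N_pos[OF 1] less_imp_le in auto)
    qed auto
    finally show "prob {w \<in> space M. S n w < s} \<le> expectation (\<lambda>w. exp (- N n 1 w)) / exp (- s)" .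
  qed
  show "(\<lambda>n. expectation (\<lambda>w. exp (- N n 1 w)) / exp (- s)) \<longlonglongrightarrow> 0"
    using tendsto_divide[OF exp_N_to_0 tendsto_const, of "exp (- s)"] by simp
qed auto

section \<open>Dominance of the first \<open>d0\<close> colors\<close>

definition good_inc :: "nat \<Rightarrow> 'w \<Rightarrow> real" where
  "good_inc n w = (\<Sum>i=1..d0. X (Suc n) i w * A (Suc n) i w)"

definition bad_inc :: "nat \<Rightarrow> 'w \<Rightarrow> real" where
  "bad_inc n w = (\<Sum>i\<in>{d0<..d}. X (Suc n) i w * A (Suc n) i w)"

lemma S_Suc: "S (Suc n) w = S n w + good_inc n w"
  unfolding S_def good_inc_def N_Suc by (rule sum.distrib)

lemma R_Suc: "R (Suc n) w = R n w + bad_inc n w"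
  unfolding R_def bad_inc_def N_Suc by (rule sum.distrib)

lemma good_inc_bounds: "w \<in> space M \<Longrightarrow> 0 \<le> good_inc n w" "w \<in> space M \<Longrightarrow> good_inc n w \<le> \<beta>"
  unfolding good_inc_def using d0 by (auto intro!: sum_XA_bounds)

lemma bad_inc_bounds: "w \<in> space M \<Longrightarrow> 0 \<le> bad_inc n w" "w \<in> space M \<Longrightarrow> bad_inc n w \<le> \<beta>"
  unfolding bad_inc_def by (auto intro!: sum_XA_bounds)

lemma S_ge_a1: "w \<in> space M \<Longrightarrow> a 1 \<le> S n w"
  using S_ge[of w n] N_ge[of 1 w n] d0 by fastforce

lemma a1_pos: "0 < a 1" using a_pos[of 1] d0 by auto

lemma S_incr: "w \<in> space M \<Longrightarrow> n \<le> k \<Longrightarrow> S n w \<le> S k w"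
  by (rule lift_Suc_mono_le[of "\<lambda>n. S n w"]) (auto simp: S_Suc intro: good_inc_bounds)

lemma M_meas [measurable]: "S n \<in> borel_measurable M" "T n \<in> borel_measurable M" "R n \<in> borel_measurable M"
  using measurable_F[OF S_F] measurable_F[OF T_F] measurable_F[OF R_F] by auto

lemma Z_M: "i \<in> {1..d} \<Longrightarrow> Z n i \<in> borel_measurable M"
  by (rule measurable_F[OF Z_F])

lemma XA_M: "i \<in> {1..d} \<Longrightarrow> (\<lambda>w. X (Suc n) i w * A (Suc n) i w) \<in> borel_measurable M"
  using X_M[of "Suc n" i] A_M[of "Suc n" i] by simp

lemma inc_M [measurable]: "good_inc n \<in> borel_measurable M" "bad_inc n \<in> borel_measurable M"
proof -
  show "good_inc n \<in> borel_measurable M"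
    unfolding good_inc_def by (intro borel_measurable_sum XA_M in_d)
  show "bad_inc n \<in> borel_measurable M"
    unfolding bad_inc_def by (intro borel_measurable_sum XA_M) auto
qed

lemma expectation_inc:
  assumes W: "W \<in> borel_measurable (F n)" and B: "\<And>w. w \<in> space M \<Longrightarrow> \<bar>W w\<bar> \<le> B" and I: "I \<subseteq> {1..d}"
  shows "expectation (\<lambda>w. W w * (\<Sum>i\<in>I. X (Suc n) i w * A (Suc n) i w))
     = (\<Sum>i\<in>I. expectation (\<lambda>w. W w * Z n i w) * expectation (A (Suc n) i))"
proof -
  have WM [measurable]: "W \<in> borel_measurable M" using W by (rule measurable_F)
  have B0: "0 \<le> B" using B not_empty abs_ge_zero order_trans by blast
  have i: "integrable M (\<lambda>w. W w * (X (Suc n) i w * A (Suc n) i w))" if "i \<in> I" for i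
  proof (rule integrable_bounded[where B = "B * (1 * \<beta>)"])
    have i: "i \<in> {1..d}" using that I by auto
    show "(\<lambda>w. W w * (X (Suc n) i w * A (Suc n) i w)) \<in> borel_measurable M"
      using XA_M[OF i, of n] by simp
    fix w assume w: "w \<in> space M"
    have "X (Suc n) i w \<in> {0, 1}" "0 \<le> A (Suc n) i w" "A (Suc n) i w \<le> \<beta>"
      using X01[of "Suc n" i w] A0[of "Suc n" i w] A\<beta>[of "Suc n" i w] i w by auto
    then show "norm (W w * (X (Suc n) i w * A (Suc n) i w)) \<le> B * (1 * \<beta>)"
      unfolding real_norm_def abs_mult by (intro mult_mono B[OF w] B0) auto
  qed
  have "expectation (\<lambda>w. W w * (\<Sum>i\<in>I. X (Suc n) i w * A (Suc n) i w))
     = (\<Sum>i\<in>I. expectation (\<lambda>w. W w * (X (Suc n) i w * A (Suc n) i w)))"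
    unfolding sum_distrib_left by (rule Bochner_Integration.integral_sum) (rule i)
  also have "\<dots> = (\<Sum>i\<in>I. expectation (\<lambda>w. W w * Z n i w) * expectation (A (Suc n) i))"
  proof (rule sum.cong[OF refl])
    fix i assume "i \<in> I"
    then have "i \<in> {1..d}" using I by auto
    from draw[OF W B this, of "\<lambda>x. x" \<beta>]
    show "expectation (\<lambda>w. W w * (X (Suc n) i w * A (Suc n) i w)) = expectation (\<lambda>w. W w * Z n i w) * expectation (A (Suc n) i)"
      by simp
  qed
  finally show ?thesis .
qed

lemma WZ_integrable:
  assumes W: "W \<in> borel_measurable (F n)" and B: "\<And>w. w \<in> space M \<Longrightarrow> \<bar>W w\<bar> \<le> B" and i: "i \<in> {1..d}"
  shows "integrable M (\<lambda>w. W w * Z n i w)"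
proof (rule integrable_bounded[where B = "B * 1"])
  have B0: "0 \<le> B" using B not_empty abs_ge_zero order_trans by blast
  show "(\<lambda>w. W w * Z n i w) \<in> borel_measurable M"
    using measurable_F[OF W] Z_M[OF i, of n] by simp
  show "norm (W w * Z n i w) \<le> B * 1" if "w \<in> space M" for w
    unfolding real_norm_def abs_mult
    by (intro mult_mono B[OF that] B0) (use Z_nonneg[OF i that] Z_le_1[OF i that] in auto)
qed

lemma sum_Z_good: "(\<Sum>i=1..d0. Z n i w) = S n w / T n w"
  unfolding Z_eq S_def by (simp add: sum_divide_distrib)

lemma sum_Z_bad: "(\<Sum>i\<in>{d0<..d}. Z n i w) = R n w / T n w"
  unfolding Z_eq R_def by (simp add: sum_divide_distrib)

text \<open>The first \<open>d0\<close> colors share the mean \<open>\<mu> n\<close>, so it factors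
  out of the sum, and their proportions add up to \<open>S / T\<close>.\<close>

lemma expectation_good_inc:
  assumes W: "W \<in> borel_measurable (F n)" and B: "\<And>w. w \<in> space M \<Longrightarrow> \<bar>W w\<bar> \<le> B"
  shows "expectation (\<lambda>w. W w * good_inc n w) = \<mu> n * expectation (\<lambda>w. W w * (S n w / T n w))"
proof -
  have "expectation (\<lambda>w. W w * good_inc n w) = (\<Sum>i=1..d0. expectation (\<lambda>w. W w * Z n i w) * expectation (A (Suc n) i))"
    unfolding good_inc_def by (rule expectation_inc[OF W B]) (use d0 in auto)
  also have "\<dots> = (\<Sum>i=1..d0. expectation (\<lambda>w. W w * Z n i w) * \<mu> n)"
    by (rule sum.cong[OF refl]) (simp only: \<mu>_def mean_eq)
  also have "\<dots> = \<mu> n * expectation (\<lambda>w. \<Sum>i=1..d0. W w * Z n i w)"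
    using WZ_integrable[OF W B in_d] by (simp add: sum_distrib_left mult.commute Bochner_Integration.integral_sum)
  finally show ?thesis by (simp only: sum_distrib_left[symmetric] sum_Z_good)
qed

lemma expectation_bad_inc:
  assumes W: "W \<in> borel_measurable (F n)" and B: "\<And>w. w \<in> space M \<Longrightarrow> \<bar>W w\<bar> \<le> B"
    and W0: "\<And>w. w \<in> space M \<Longrightarrow> 0 \<le> W w" and l: "\<And>i. i \<in> {d0<..d} \<Longrightarrow> expectation (A (Suc n) i) \<le> l"
  shows "expectation (\<lambda>w. W w * bad_inc n w) \<le> l * expectation (\<lambda>w. W w * (R n w / T n w))"
proof -
  have "expectation (\<lambda>w. W w * bad_inc n w) = (\<Sum>i\<in>{d0<..d}. expectation (\<lambda>w. W w * Z n i w) * expectation (A (Suc n) i))"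
    unfolding bad_inc_def by (rule expectation_inc[OF W B]) auto
  also have "\<dots> \<le> (\<Sum>i\<in>{d0<..d}. expectation (\<lambda>w. W w * Z n i w) * l)"
  proof (rule sum_mono)
    fix i assume i: "i \<in> {d0<..d}"
    have "0 \<le> expectation (\<lambda>w. W w * Z n i w)"
      by (rule integral_nonneg_AE) (use W0 Z_nonneg[of i] i in auto)
    then show "expectation (\<lambda>w. W w * Z n i w) * expectation (A (Suc n) i) \<le> expectation (\<lambda>w. W w * Z n i w) * l"
      using l[OF i] by (rule mult_left_mono[rotated])
  qed
  also have "\<dots> = l * expectation (\<lambda>w. \<Sum>i\<in>{d0<..d}. W w * Z n i w)"
    using WZ_integrable[OF W B] by (subst Bochner_Integration.integral_sum) (auto simp: sum_distrib_left mult.commute)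
  finally show ?thesis by (simp only: sum_distrib_left[symmetric] sum_Z_bad)
qed

text \<open>Once \<open>S n \<ge> s\<close> the ratio \<open>R / S\<close> is a supermartingale whose drift is at most \<open>- \<delta> / T\<close>
  times itself: the expected increments of \<open>R\<close> and \<open>S\<close> are at most \<open>l R / T\<close> and about \<open>m S / T\<close>.\<close>

lemma ratio_drift:
  assumes l: "0 \<le> l" and lk: "\<And>i. i \<in> {d0<..d} \<Longrightarrow> expectation (A (Suc k) i) \<le> l"
    and s: "0 < s" "\<beta> \<le> s" and \<delta>: "l + \<delta> \<le> (1 - \<beta> / s) * \<mu> k"
    and H: "H \<in> sets (F k)" and HS: "\<And>w. w \<in> H \<Longrightarrow> s \<le> S k w"
  shows "expectation (\<lambda>w. indicator H w * (R (Suc k) w / S (Suc k) w))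
    \<le> expectation (\<lambda>w. indicator H w * (R k w / S k w)) - \<delta> * expectation (\<lambda>w. indicator H w * (R k w / S k w / T k w))"
proof -
  have HM [measurable]: "H \<in> sets M" by (rule sets_F[OF H])
  \<comment> \<open>Lower bound for \<open>S / (S + g)\<close> once \<open>S >= s\<close> and the
    good increment \<open>g\<close> is at most \<beta>; it is the loss incurred when
    \<open>1 / (S + g)\<close> is linearised.\<close>
  define \<eta> where "\<eta> = 1 - \<beta> / s"
  have \<eta>0: "0 \<le> \<eta>" using s by (simp add: \<eta>_def)
  \<comment> \<open>\<open>W1\<close> and \<open>W2\<close> are, up to sign, the coefficients of the
    increments of \<open>R\<close> and of \<open>S\<close> in the first-order expansion of
    \<open>R / S\<close>.\<close>
  define W1 where "W1 w = indicator H w / S k w" for w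
  define W2 where "W2 w = indicator H w * (R k w / (S k w)\<^sup>2)" for w
  have W1F: "W1 \<in> borel_measurable (F k)" and W2F: "W2 \<in> borel_measurable (F k)"
  proof -
    note [measurable] = H S_F[of k] R_F[of k]
    show "W1 \<in> borel_measurable (F k)" "W2 \<in> borel_measurable (F k)" unfolding W1_def W2_def by measurable
  qed
  have [measurable]: "W1 \<in> borel_measurable M" "W2 \<in> borel_measurable M"
    using W1F W2F by (auto intro: measurable_F)
  define D where "D = (\<alpha> + \<beta>) * real (Suc k)"
  have RD: "R k w \<le> D" if "w \<in> space M" for w
    using T_le[OF that, of k] S_pos[OF that, of k] by (simp add: T_eq D_def)
  have D0: "0 \<le> D" unfolding D_def using \<alpha>_pos \<beta> by simp
  have W1B: "\<bar>W1 w\<bar> \<le> 1 / a 1" if "w \<in> space M" for w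
    unfolding W1_def using S_ge_a1[OF that, of k] S_pos[OF that, of k] a1_pos
    by (auto simp: indicator_def divide_simps)
  have W2B: "\<bar>W2 w\<bar> \<le> D / (a 1)\<^sup>2" if w: "w \<in> space M" for w
  proof -
    have "R k w / (S k w)\<^sup>2 \<le> D / (a 1)\<^sup>2"
      using RD[OF w] R_nonneg[OF w, of k] S_ge_a1[OF w, of k] a1_pos by (intro frac_le power_mono) auto
    moreover have "0 \<le> R k w / (S k w)\<^sup>2" using R_nonneg[OF w] by simp
    ultimately show ?thesis using D0 by (auto simp: W2_def indicator_def)
  qed
  have W10: "0 \<le> W1 w" if "w \<in> space M" for w
    unfolding W1_def using S_pos[OF that, of k] by (simp add: indicator_def)
  have W20: "0 \<le> W2 w" if "w \<in> space M" for w
    unfolding W2_def using R_nonneg[OF that, of k] by (simp add: indicator_def)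
  have i0: "integrable M (\<lambda>w. indicator H w * (R k w / S k w))"
  proof (rule integrable_bounded[where B = "D / a 1"])
    fix w assume w: "w \<in> space M"
    have "R k w / S k w \<le> D / a 1"
      using RD[OF w] R_nonneg[OF w, of k] S_ge_a1[OF w, of k] a1_pos by (intro frac_le) auto
    moreover have "0 \<le> R k w / S k w" using R_nonneg[OF w] S_pos[OF w] by (simp add: less_imp_le)
    ultimately show "norm (indicator H w * (R k w / S k w)) \<le> D / a 1" using D0 a1_pos by (auto simp: indicator_def)
  qed measurable
  have i1: "integrable M (\<lambda>w. W1 w * bad_inc k w)"
    by (rule integrable_bounded[where B = "1 / a 1 * \<beta>"], measurable)
       (use W1B bad_inc_bounds a1_pos in \<open>simp only: real_norm_def abs_mult, intro mult_mono, auto\<close>)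
  have i2: "integrable M (\<lambda>w. W2 w * good_inc k w)"
    by (rule integrable_bounded[where B = "D / (a 1)\<^sup>2 * \<beta>"], measurable)
       (use W2B good_inc_bounds D0 in \<open>simp only: real_norm_def abs_mult, intro mult_mono, auto\<close>)
  \<comment> \<open>The bad increment is estimated with the old denominator; the gain from the good
    increment is kept up to the factor \<eta>.\<close>
  have pw: "indicator H w * (R (Suc k) w / S (Suc k) w)
      \<le> indicator H w * (R k w / S k w) + W1 w * bad_inc k w - \<eta> * (W2 w * good_inc k w)" if w: "w \<in> space M" for w
  proof (cases "w \<in> H")
    case True
    define r where "r = R k w"
    define S' where "S' = S k w"
    define g where "g = good_inc k w"
    define b where "b = bad_inc k w"
    have f: "0 \<le> r" "0 < S'" "s \<le> S'" "0 \<le> g" "g \<le> \<beta>" "0 \<le> b"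
      using R_nonneg[OF w] S_pos[OF w] HS[OF True] good_inc_bounds[OF w] bad_inc_bounds[OF w]
      by (auto simp: r_def S'_def g_def b_def)
    have 1: "b / (S' + g) \<le> b / S'" using f by (intro divide_left_mono) auto
    have 2: "r / (S' + g) \<le> r / S' - \<eta> * (r / S'\<^sup>2 * g)"
    proof -
      have "\<eta> \<le> 1 - g / S'"
      proof -
        have "g / S' \<le> \<beta> / s" using f s \<beta> by (intro frac_le) auto
        then show ?thesis by (simp add: \<eta>_def)
      qed
      then have "\<eta> * (S' + g) \<le> (1 - g / S') * (S' + g)" using f by (intro mult_right_mono) auto
      also have "\<dots> = S' - g * g / S'" using f by (simp add: field_simps)
      also have "\<dots> \<le> S'" using f by simp
      finally have le: "\<eta> * (S' + g) \<le> S'" .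
      have "1 / S' - 1 / (S' + g) = g / (S' * (S' + g))" using f by (simp add: field_simps)
      also have "\<dots> \<ge> \<eta> * (g / S'\<^sup>2)"
      proof -
        have "\<eta> * (g / S'\<^sup>2) * (S' * (S' + g)) = (g / S') * (\<eta> * (S' + g))"
          using f by (simp add: power2_eq_square field_simps)
        also have "\<dots> \<le> (g / S') * S'" using le f by (intro mult_left_mono) auto
        also have "\<dots> = g" using f by simp
        finally show ?thesis using f by (simp add: pos_le_divide_eq)
      qed
      finally have "\<eta> * (g / S'\<^sup>2) \<le> 1 / S' - 1 / (S' + g)" .
      from mult_left_mono[OF this f(1)] show ?thesis by (simp add: algebra_simps)
    qed
    have "(r + b) / (S' + g) \<le> r / S' + b / S' - \<eta> * (r / S'\<^sup>2 * g)"
      unfolding add_divide_distrib using 1 2 by linarith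
    then show ?thesis using True
      by (simp add: W1_def W2_def R_Suc S_Suc r_def S'_def g_def b_def)
  qed (simp add: W1_def W2_def)
  have iS: "integrable M (\<lambda>w. indicator H w * (R (Suc k) w / S (Suc k) w))"
  proof (rule integrable_bounded[where B = "(D + \<beta>) / a 1"])
    fix w assume w: "w \<in> space M"
    have "R (Suc k) w \<le> D + \<beta>" using RD[OF w] bad_inc_bounds[OF w] by (simp add: R_Suc add_mono)
    then have "R (Suc k) w / S (Suc k) w \<le> (D + \<beta>) / a 1"
      using R_nonneg[OF w, of "Suc k"] S_ge_a1[OF w, of "Suc k"] a1_pos by (intro frac_le) auto
    moreover have "0 \<le> R (Suc k) w / S (Suc k) w" using R_nonneg[OF w] S_pos[OF w] by (simp add: less_imp_le)
    ultimately show "norm (indicator H w * (R (Suc k) w / S (Suc k) w)) \<le> (D + \<beta>) / a 1"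
      using D0 a1_pos \<beta> by (auto simp: indicator_def)
  qed measurable
  define E where "E = expectation (\<lambda>w. indicator H w * (R k w / S k w / T k w))"
  have E0: "0 \<le> E" unfolding E_def
  proof (intro integral_nonneg_AE AE_I2)
    fix w assume w: "w \<in> space M"
    show "0 \<le> indicator H w * (R k w / S k w / T k w)"
      using R_nonneg[OF w, of k] S_pos[OF w, of k] T_pos[OF w, of k] by (simp add: indicator_def)
  qed
  have b1: "expectation (\<lambda>w. W1 w * bad_inc k w) \<le> l * E"
  proof -
    have "expectation (\<lambda>w. W1 w * bad_inc k w) \<le> l * expectation (\<lambda>w. W1 w * (R k w / T k w))"
      by (rule expectation_bad_inc[OF W1F W1B W10 lk])
    also have "expectation (\<lambda>w. W1 w * (R k w / T k w)) = E"
      unfolding E_def W1_def by (rule Bochner_Integration.integral_cong) (auto simp: field_simps)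
    finally show ?thesis .
  qed
  have b2: "expectation (\<lambda>w. W2 w * good_inc k w) = \<mu> k * E"
  proof -
    have "expectation (\<lambda>w. W2 w * good_inc k w) = \<mu> k * expectation (\<lambda>w. W2 w * (S k w / T k w))"
      by (rule expectation_good_inc[OF W2F W2B])
    also have "expectation (\<lambda>w. W2 w * (S k w / T k w)) = E"
      unfolding E_def W2_def
      by (rule Bochner_Integration.integral_cong) (auto simp: power2_eq_square S_pos less_imp_neq[symmetric])
    finally show ?thesis .
  qed
  have "expectation (\<lambda>w. indicator H w * (R (Suc k) w / S (Suc k) w))
    \<le> expectation (\<lambda>w. indicator H w * (R k w / S k w) + W1 w * bad_inc k w - \<eta> * (W2 w * good_inc k w))"
    by (rule integral_mono[OF iS _ pw]) (use i0 i1 i2 in auto)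
  also have "\<dots> = expectation (\<lambda>w. indicator H w * (R k w / S k w)) + expectation (\<lambda>w. W1 w * bad_inc k w) - \<eta> * (\<mu> k * E)"
    using i0 i1 i2 b2 by simp
  also have "\<dots> \<le> expectation (\<lambda>w. indicator H w * (R k w / S k w)) + l * E - \<eta> * (\<mu> k * E)"
    using b1 by simp
  also have "\<dots> \<le> expectation (\<lambda>w. indicator H w * (R k w / S k w)) - \<delta> * E"
  proof -
    have "(l + \<delta>) * E \<le> (\<eta> * \<mu> k) * E" using \<delta> E0 by (intro mult_right_mono) (auto simp: \<eta>_def)
    then show ?thesis by (simp add: algebra_simps)
  qed
  finally show ?thesis by (simp add: E_def)
qed

text \<open>The drift estimate requires \<open>S >= s\<close>. The process is therefore restricted
  to the event that \<open>S\<close> has reached \<open>s\<close> by time \<open>n0\<close>, which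
  is known at \<open>n0\<close> and persists because \<open>S\<close> increases. There its
  expectation decays to 0, and Ville's inequality turns this into a bound on the whole
  future.\<close>

lemma dominated_ratio: "AE w in M. (\<lambda>n. R n w / S n w) \<longlonglongrightarrow> 0"
proof -
  obtain l N0 where l: "0 \<le> l" "l < m" and lN: "\<And>n i. n \<ge> N0 \<Longrightarrow> i \<in> {d0<..d} \<Longrightarrow> expectation (A (Suc n) i) \<le> l"
    using lambda_gap by blast
  \<comment> \<open>A quarter of the gap: as \<open>s\<close> grows, the requirement tends to
    \<open>l + \<delta> < m - \<delta>\<close>, which holds with half of the gap to spare.\<close>
  define \<delta> where "\<delta> = (m - l) / 4"
  have \<delta>: "\<delta> > 0" using l by (simp add: \<delta>_def)
  have "((\<lambda>s. (1 - \<beta> / s) * (m - \<delta>)) \<longlongrightarrow> (1 - 0) * (m - \<delta>)) at_top"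
    by (intro tendsto_intros tendsto_divide_0[OF tendsto_const] filterlim_at_top_imp_at_infinity filterlim_ident)
  then have "\<forall>\<^sub>F s in at_top. l + \<delta> < (1 - \<beta> / s) * (m - \<delta>)"
    by (rule order_tendstoD) (use \<delta> in \<open>simp add: \<delta>_def field_simps\<close>)
  moreover have "\<forall>\<^sub>F s in at_top. \<beta> \<le> (s::real)" by (rule eventually_ge_at_top)
  ultimately have "\<forall>\<^sub>F s in at_top. l + \<delta> < (1 - \<beta> / s) * (m - \<delta>) \<and> \<beta> \<le> s" by eventually_elim auto
  then obtain s where s: "l + \<delta> < (1 - \<beta> / s) * (m - \<delta>)" "\<beta> \<le> s" by (auto simp: eventually_at_top_linorder)
  have s0: "0 < s" using s \<beta> by simp
  have "\<forall>\<^sub>F n in sequentially. m - \<delta> < \<mu> n" using \<mu>_lim by (rule order_tendstoD) (use \<delta> in simp)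
  then obtain N1 where N1: "\<And>n. n \<ge> N1 \<Longrightarrow> m - \<delta> < \<mu> n" by (auto simp: eventually_sequentially)
  define n1 where "n1 = max N0 N1"
  have \<mu>k: "l + \<delta> \<le> (1 - \<beta> / s) * \<mu> k" if "k \<ge> n1" for k
  proof -
    have "(1 - \<beta> / s) * (m - \<delta>) \<le> (1 - \<beta> / s) * \<mu> k"
      using N1[of k] that s s0 by (intro mult_left_mono) (auto simp: n1_def)
    with s show ?thesis by linarith
  qed
  define Y where "Y n w = R n w / S n w" for n w
  have Y0: "0 \<le> Y n w" if "w \<in> space M" for n w
    using R_nonneg[OF that] S_pos[OF that] by (simp add: Y_def less_imp_le)
  have YF: "Y n \<in> borel_measurable (F n)" for n unfolding Y_def by (intro borel_measurable_divide S_F R_F)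
  have [measurable]: "Y n \<in> borel_measurable M" for n using YF by (rule measurable_F)
  have YB: "Y n w \<le> (\<alpha> + \<beta>) * real (Suc n) / a 1" if w: "w \<in> space M" for n w
    unfolding Y_def using T_le[OF w, of n] S_pos[OF w, of n] R_nonneg[OF w, of n] S_ge_a1[OF w, of n] a1_pos
    by (intro frac_le) (auto simp: T_eq)
  have exc: "\<exists>n. prob {w \<in> space M. \<exists>k\<ge>n. e \<le> Y k w} \<le> p" if e: "e > 0" and p: "p > 0" for e p
  proof -
    have "\<forall>\<^sub>F n in sequentially. prob {w \<in> space M. S n w < s} < p / 2"
      using S_small_prob[of s] by (rule order_tendstoD) (use p in simp)
    then obtain N2 where N2: "\<And>n. n \<ge> N2 \<Longrightarrow> prob {w \<in> space M. S n w < s} < p / 2" by (auto simp: eventually_sequentially)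
    define n0 where "n0 = max n1 N2"
    \<comment> \<open>The complement has probability below \<open>p / 2\<close>; on the event itself
      \<open>V\<close> agrees with \<open>Y\<close>, and the drift estimate is available from
      \<open>n0\<close> on.\<close>
    define G where "G = {w \<in> space M. s \<le> S n0 w}"
    have GF: "G \<in> sets (F n)" if "n0 \<le> n" for n
    proof -
      have "{w \<in> space (F n0). s \<le> S n0 w} \<in> sets (F n0)" using S_F[of n0] by measurable
      then show ?thesis using F_mono[OF that] by (auto simp: G_def)
    qed
    have GM [measurable]: "G \<in> sets M" unfolding G_def by measurable
    have GS: "s \<le> S k w" if "w \<in> G" "n0 \<le> k" for w k
      using that S_incr[of w n0 k] by (auto simp: G_def)
    define V where "V n w = indicator G w * Y n w" for n w
    have Vi: "integrable M (V n)" for n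
      by (rule integrable_bounded[where B = "(\<alpha> + \<beta>) * real (Suc n) / a 1"])
         (use Y0 YB \<alpha>_pos \<beta> a1_pos in \<open>auto simp: V_def[abs_def] indicator_def\<close>)
    have drift: "expectation (\<lambda>w. indicator H w * V (Suc k) w)
      \<le> expectation (\<lambda>w. indicator H w * V k w) - \<delta> * expectation (\<lambda>w. indicator H w * (V k w / T k w))"
      if k: "n0 \<le> k" and H: "H \<in> sets (F k)" for k H
    proof -
      have HG: "H \<inter> G \<in> sets (F k)" using H GF[OF k] by auto
      have "expectation (\<lambda>w. indicator (H \<inter> G) w * (R (Suc k) w / S (Suc k) w))
        \<le> expectation (\<lambda>w. indicator (H \<inter> G) w * (R k w / S k w)) - \<delta> * expectation (\<lambda>w. indicator (H \<inter> G) w * (R k w / S k w / T k w))"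
        by (rule ratio_drift[OF l(1) lN s0 s(2) \<mu>k HG]) (use k GS in \<open>auto simp: n0_def n1_def\<close>)
      then show ?thesis by (simp add: V_def Y_def indicator_inter_arith mult.assoc)
    qed
    \<comment> \<open>The drift carries the factor \<open>1 / T\<close>, and \<open>T\<close> grows
      at most linearly, so the relative decay per step is at least of harmonic order.\<close>
    have EV: "(\<lambda>n. expectation (V n)) \<longlonglongrightarrow> 0"
    proof (rule decay_to_zero[of n0 _ "\<delta> / (\<alpha> + \<beta>)"])
      show "0 \<le> expectation (V n)" for n
        by (rule integral_nonneg_AE) (use Y0 in \<open>auto simp: V_def indicator_def\<close>)
      show "0 < \<delta> / (\<alpha> + \<beta>)" using \<delta> \<alpha>_pos \<beta> by simp
      fix k assume k: "n0 \<le> k"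
      let ?c = "1 / ((\<alpha> + \<beta>) * real (Suc k))"
      have "expectation (V (Suc k)) \<le> expectation (V k) - \<delta> * expectation (\<lambda>w. V k w / T k w)"
      proof -
        have e: "expectation (\<lambda>w. indicator (space M) w * x w) = expectation x" for x :: "'w \<Rightarrow> real"
          by (rule Bochner_Integration.integral_cong) auto
        have "space M \<in> sets (F k)" using sets.top[of "F k"] by simp
        from drift[OF k this] show ?thesis unfolding e .
      qed
      also have "\<dots> \<le> expectation (V k) - \<delta> * (expectation (V k) * ?c)"
      proof -
        have "expectation (\<lambda>w. V k w * ?c) \<le> expectation (\<lambda>w. V k w / T k w)"
        proof (rule integral_mono)
          fix w assume w: "w \<in> space M"
          have "?c \<le> 1 / T k w" using T_le[OF w, of k] T_pos[OF w, of k] by (intro divide_left_mono) (auto intro!: mult_pos_pos)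
          moreover have "0 \<le> V k w" using Y0[OF w] by (simp add: V_def indicator_def)
          ultimately have "V k w * ?c \<le> V k w * (1 / T k w)" by (rule mult_left_mono)
          then show "V k w * ?c \<le> V k w / T k w" by simp
        next
          show "integrable M (\<lambda>w. V k w / T k w)"
          proof (rule Bochner_Integration.integrable_bound[where f = "\<lambda>w. V k w / a 1"])
            show "AE w in M. norm (V k w / T k w) \<le> norm (V k w / a 1)"
            proof (rule AE_I2)
              fix w assume w: "w \<in> space M"
              have "a 1 \<le> T k w" using S_ge_a1[OF w, of k] R_nonneg[OF w, of k] by (simp add: T_eq)
              then show "norm (V k w / T k w) \<le> norm (V k w / a 1)"
                using a1_pos by (simp add: abs_divide divide_left_mono)
            qed
          qed (use Vi in \<open>auto simp: V_def[abs_def]\<close>)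
        qed (use Vi in simp)
        then have "expectation (V k) * ?c \<le> expectation (\<lambda>w. V k w / T k w)" using Vi by simp
        then show ?thesis using \<delta> by (intro diff_left_mono mult_left_mono) auto
      qed
      also have "\<dots> = expectation (V k) - expectation (V k) * (\<delta> / (\<alpha> + \<beta>) / real (Suc k))"
        by simp
      finally show "expectation (V (Suc k)) \<le> expectation (V k) - expectation (V k) * (\<delta> / (\<alpha> + \<beta>) / real (Suc k))" .
    qed
    have "\<forall>\<^sub>F n in sequentially. expectation (V n) < p / 2 * e" using EV by (rule order_tendstoD) (use p e in simp)
    then obtain N3 where N3: "\<And>n. n \<ge> N3 \<Longrightarrow> expectation (V n) < p / 2 * e" by (auto simp: eventually_sequentially)
    define n where "n = max n0 N3"
    have ville: "prob {w \<in> space M. \<exists>k\<ge>n. e \<le> V k w} \<le> expectation (V n) / e"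
    proof (rule ville[OF _ Vi])
      show "V k \<in> borel_measurable (F k)" if "n \<le> k" for k
      proof -
        have [measurable]: "G \<in> sets (F k)" using GF that by (simp add: n_def)
        show ?thesis unfolding V_def using YF[of k] by measurable
      qed
      show "0 \<le> V k w" if "w \<in> space M" for k w using Y0[OF that] by (simp add: V_def indicator_def)
      fix k H assume k: "n \<le> k" and H: "H \<in> sets (F k)"
      have "0 \<le> expectation (\<lambda>w. indicator H w * (V k w / T k w))"
      proof (intro integral_nonneg_AE AE_I2)
        fix w assume w: "w \<in> space M"
        show "0 \<le> indicator H w * (V k w / T k w)"
          using Y0[OF w, of k] T_pos[OF w, of k] by (simp add: V_def indicator_def)
      qed
      then have "0 \<le> \<delta> * expectation (\<lambda>w. indicator H w * (V k w / T k w))" using \<delta> by simp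
      with drift[of k H] k H show "expectation (\<lambda>w. indicator H w * V (Suc k) w) \<le> expectation (\<lambda>w. indicator H w * V k w)"
        by (simp add: n_def)
    qed (rule e)
    have [measurable]: "V k \<in> borel_measurable M" for k unfolding V_def by measurable
    have "prob {w \<in> space M. \<exists>k\<ge>n. e \<le> Y k w}
      \<le> prob ({w \<in> space M. \<exists>k\<ge>n. e \<le> V k w} \<union> {w \<in> space M. S n0 w < s})"
      by (rule finite_measure_mono) (auto simp: V_def G_def)
    also have "\<dots> \<le> prob {w \<in> space M. \<exists>k\<ge>n. e \<le> V k w} + prob {w \<in> space M. S n0 w < s}"
      by (rule measure_Un_le) measurable
    also have "\<dots> \<le> expectation (V n) / e + p / 2"
      using ville N2[of n0] by (intro add_mono) (auto simp: n0_def)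
    also have "expectation (V n) / e \<le> p / 2"
      using N3[of n] e by (simp add: n_def pos_divide_le_eq)
    finally show ?thesis by (intro exI[of _ n]) simp
  qed
  have "AE w in M. \<exists>n. w \<notin> {w \<in> space M. \<exists>k\<ge>n. e \<le> Y k w}" if "e > 0" for e
    by (rule AE_ex_notin) (use exc[OF that] in auto)
  then have "AE w in M. \<forall>i::nat. \<exists>n. w \<notin> {w \<in> space M. \<exists>k\<ge>n. 1 / real (Suc i) \<le> Y k w}"
    by (simp add: AE_all_countable)
  with AE_space have "AE w in M. (\<lambda>n. Y n w) \<longlonglongrightarrow> 0"
  proof eventually_elim
    case (elim w)
    show ?case
    proof (rule LIMSEQ_I)
      fix r :: real assume "r > 0"
      then obtain i where i: "1 / real (Suc i) < r" using reals_Archimedean[of r] by (auto simp: inverse_eq_divide)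
      obtain n where n: "w \<notin> {w \<in> space M. \<exists>k\<ge>n. 1 / real (Suc i) \<le> Y k w}" using elim(2) by blast
      have "norm (Y k w - 0) < r" if "k \<ge> n" for k
      proof -
        have "\<not> 1 / real (Suc i) \<le> Y k w" using n elim(1) that by blast
        with i Y0[OF elim(1), of k] show ?thesis by simp
      qed
      then show "\<exists>no. \<forall>n\<ge>no. norm (Y n w - 0) < r" by blast
    qed
  qed
  then show ?thesis by (simp add: Y_def)
qed

section \<open>Conditional probability \<open>p\<close> of drawing a dominant color; linear growth
  of \<open>S\<close> and \<open>K\<close>\<close>

definition p :: "nat \<Rightarrow> 'w \<Rightarrow> real" where "p n w = S n w / T n w"

lemma p_bounds: "w \<in> space M \<Longrightarrow> 0 \<le> p n w" "w \<in> space M \<Longrightarrow> p n w \<le> 1"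
  unfolding p_def using S_pos[of w n] T_pos[of w n] R_nonneg[of w n] by (auto simp: T_eq)

lemma p_F: "p n \<in> borel_measurable (F n)"
  unfolding p_def by (intro borel_measurable_divide S_F T_F)

lemma p_lim: "AE w in M. (\<lambda>n. p n w) \<longlonglongrightarrow> 1"
  using dominated_ratio AE_space
proof eventually_elim
  case (elim w)
  have "(\<lambda>n. 1 / (1 + R n w / S n w)) \<longlonglongrightarrow> 1 / (1 + 0)"
    by (intro tendsto_intros elim) simp
  moreover have "1 / (1 + R n w / S n w) = p n w" for n
    using S_pos[OF elim(2), of n] T_pos[OF elim(2), of n] by (simp add: p_def T_eq field_simps)
  ultimately show ?case by simp
qed

text \<open>Good increments minus their conditional means \<open>p * \<mu>\<close> are martingale
  differences, so their averages vanish. The means themselves tend to \<open>1 * m\<close>, and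
  Cesaro gives the limit.\<close>

lemma S_lim: "AE w in M. (\<lambda>n. S n w / real n) \<longlonglongrightarrow> m"
proof -
  have \<mu>b: "0 \<le> \<mu> n" "\<mu> n \<le> \<beta>" for n using mean_bounds[of 1 n] d0 by (auto simp: \<mu>_def)
  have md: "mdiff (\<lambda>n w. good_inc n w - p n w * \<mu> n) \<beta>"
    unfolding mdiff_def
  proof (intro conjI allI ballI impI)
    fix n
    have "good_inc n \<in> borel_measurable (F (Suc n))"
      unfolding good_inc_def by (intro borel_measurable_sum borel_measurable_times X_F A_F in_d) auto
    then show "(\<lambda>w. good_inc n w - p n w * \<mu> n) \<in> borel_measurable (F (Suc n))"
      using measurable_F_mono[OF p_F, of n "Suc n"] by simp
    show "\<bar>good_inc n w - p n w * \<mu> n\<bar> \<le> \<beta>" if w: "w \<in> space M" for w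
    proof -
      have "p n w * \<mu> n \<le> 1 * \<beta>" using p_bounds[OF w] \<mu>b by (intro mult_mono) auto
      moreover have "0 \<le> p n w * \<mu> n" using p_bounds[OF w] \<mu>b by simp
      ultimately show ?thesis using good_inc_bounds[OF w, of n] by (simp add: abs_le_iff)
    qed
    fix W :: "'w \<Rightarrow> real" and B assume W: "W \<in> borel_measurable (F n)" and "\<forall>w\<in>space M. \<bar>W w\<bar> \<le> B"
    then have B: "\<And>w. w \<in> space M \<Longrightarrow> \<bar>W w\<bar> \<le> B" by simp
    have [measurable]: "W \<in> borel_measurable M" "p n \<in> borel_measurable M" using W p_F by (auto intro: measurable_F)
    have B0: "0 \<le> B" using B not_empty abs_ge_zero order_trans by blast
    have i1: "integrable M (\<lambda>w. W w * good_inc n w)"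
      by (rule integrable_bounded[where B = "B * \<beta>"], measurable)
         (use B B0 good_inc_bounds in \<open>simp only: real_norm_def abs_mult, intro mult_mono, auto\<close>)
    have i2: "integrable M (\<lambda>w. \<mu> n * (W w * p n w))"
      by (intro integrable_mult_right, rule integrable_bounded[where B = "B * 1"], measurable)
         (use B B0 p_bounds in \<open>simp only: real_norm_def abs_mult, intro mult_mono, auto\<close>)
    have "expectation (\<lambda>w. W w * (good_inc n w - p n w * \<mu> n)) = expectation (\<lambda>w. W w * good_inc n w - \<mu> n * (W w * p n w))"
      by (rule Bochner_Integration.integral_cong) (auto simp: algebra_simps)
    also have "\<dots> = 0" using i1 i2 expectation_good_inc[OF W B, folded p_def] by simp
    finally show "expectation (\<lambda>w. W w * (good_inc n w - p n w * \<mu> n)) = 0" .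
  qed
  show ?thesis
    using mdiff_slln[OF md] p_lim
  proof eventually_elim
    case (elim w)
    have 1: "(\<lambda>n. (\<Sum>k<n. p k w * \<mu> k) / real n) \<longlonglongrightarrow> 1 * m"
      by (intro cesaro tendsto_mult elim \<mu>_lim)
    have 2: "(\<lambda>n. S 0 w / real n) \<longlonglongrightarrow> 0" by (rule lim_const_over_n)
    have S: "S n w = S 0 w + (\<Sum>k<n. good_inc k w)" for n by (induction n) (auto simp: S_Suc)
    have "S n w / real n = (\<Sum>k<n. good_inc k w - p k w * \<mu> k) / real n + (\<Sum>k<n. p k w * \<mu> k) / real n + S 0 w / real n" for n
      by (simp add: S[of n] sum_subtractf diff_divide_distrib add_divide_distrib)
    then show ?case using tendsto_add[OF tendsto_add[OF elim(1) 1] 2] by simp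
  qed
qed

text \<open>Indicator that the draw at time \<open>Suc n\<close> is among the first
  \<open>d0\<close> colors.\<close>

definition Y :: "nat \<Rightarrow> 'w \<Rightarrow> real" where "Y n w = (\<Sum>i=1..d0. X (Suc n) i w)"
text \<open>The denominator of \<open>Mstar\<close>, and at the same time the random scale on which
  C* is a martingale up to small errors.\<close>

definition K :: "nat \<Rightarrow> 'w \<Rightarrow> real" where "K n w = 1 + (\<Sum>k=1..n. \<Sum>i=1..d0. X k i w)"

lemma K_Suc: "K (Suc n) w = K n w + Y n w" by (simp add: K_def Y_def)

lemma K_0: "K 0 w = 1" by (simp add: K_def)

lemma Y01: "w \<in> space M \<Longrightarrow> Y n w \<in> {0, 1}"
proof -
  assume w: "w \<in> space M"
  obtain i0 where
    *: "\<And>f :: nat \<Rightarrow> real. \<And>I. I \<subseteq> {1..d} \<Longrightarrow> (\<Sum>i\<in>I. X (Suc n) i w * f i) = (if i0 \<in> I then f i0 else 0)"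
    using color_drawn[OF w] by blast
  show "Y n w \<in> {0, 1}" using *[of "{1..d0}" "\<lambda>_. 1"] d0 by (auto simp: Y_def)
qed

lemma K_bounds: "w \<in> space M \<Longrightarrow> 1 \<le> K n w" "w \<in> space M \<Longrightarrow> K n w \<le> 1 + real n"
proof -
  assume w: "w \<in> space M"
  have Y: "0 \<le> Y n w" "Y n w \<le> 1" for n using Y01[OF w, of n] by auto
  show "1 \<le> K n w" by (induction n) (auto simp: K_0 K_Suc intro: add_increasing2 Y)
  show "K n w \<le> 1 + real n"
  proof (induction n)
    case (Suc n)
    with Y(2)[of n] show ?case by (simp add: K_Suc)
  qed (simp add: K_0)
qed

lemma K_F: "K n \<in> borel_measurable (F n)"
  unfolding K_def by (intro borel_measurable_add borel_measurable_const borel_measurable_sum X_F in_d) auto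

text \<open>As for \<open>S\<close>, with draws in place of weights: \<open>Y\<close> centred by
  \<open>p\<close> averages to 0, and \<open>p\<close> tends to 1.\<close>

lemma K_lim: "AE w in M. (\<lambda>n. K n w / real n) \<longlonglongrightarrow> 1"
proof -
  have md: "mdiff (\<lambda>n w. Y n w - p n w) 1"
    unfolding mdiff_def
  proof (intro conjI allI ballI impI)
    fix n
    have YF: "Y n \<in> borel_measurable (F (Suc n))"
      unfolding Y_def by (intro borel_measurable_sum X_F in_d) auto
    then show "(\<lambda>w. Y n w - p n w) \<in> borel_measurable (F (Suc n))"
      using measurable_F_mono[OF p_F, of n "Suc n"] by simp
    show "\<bar>Y n w - p n w\<bar> \<le> 1" if w: "w \<in> space M" for w
      using Y01[OF w, of n] p_bounds[OF w, of n] by auto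
    fix W :: "'w \<Rightarrow> real" and B assume W: "W \<in> borel_measurable (F n)" and "\<forall>w\<in>space M. \<bar>W w\<bar> \<le> B"
    then have B: "\<And>w. w \<in> space M \<Longrightarrow> \<bar>W w\<bar> \<le> B" by simp
    have [measurable]: "W \<in> borel_measurable M" using W by (rule measurable_F)
    have B0: "0 \<le> B" using B not_empty abs_ge_zero order_trans by blast
    have i: "integrable M (\<lambda>w. W w * X (Suc n) i w)" if "i \<in> {1..d0}" for i
    proof (rule integrable_bounded[where B = "B * 1"])
      show "(\<lambda>w. W w * X (Suc n) i w) \<in> borel_measurable M" using X_M[of "Suc n" i] in_d[OF that] by simp
      show "norm (W w * X (Suc n) i w) \<le> B * 1" if w: "w \<in> space M" for w
        unfolding real_norm_def abs_mult
        by (intro mult_mono B[OF w] B0) (use X01[of "Suc n" i w] in_d[OF \<open>i \<in> {1..d0}\<close>] w in auto)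
    qed
    have wz: "integrable M (\<lambda>w. W w * Z n i w)" if "i \<in> {1..d0}" for i
      by (rule WZ_integrable[OF W B in_d[OF that]])
    have "expectation (\<lambda>w. W w * (Y n w - p n w))
      = expectation (\<lambda>w. (\<Sum>i=1..d0. W w * X (Suc n) i w) - (\<Sum>i=1..d0. W w * Z n i w))"
      by (simp only: p_def Y_def sum_Z_good[symmetric] sum_distrib_left[symmetric] right_diff_distrib)
    also have "\<dots> = (\<Sum>i=1..d0. expectation (\<lambda>w. W w * X (Suc n) i w)) - (\<Sum>i=1..d0. expectation (\<lambda>w. W w * Z n i w))"
      using i wz by (subst Bochner_Integration.integral_diff) (auto intro!: Bochner_Integration.integrable_sum simp: Bochner_Integration.integral_sum)
    also have "\<dots> = 0"
    proof -
      have "expectation (\<lambda>w. W w * X (Suc n) i w) = expectation (\<lambda>w. W w * Z n i w)" if "i \<in> {1..d0}" for i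
        using draw[OF W B in_d[OF that], of "\<lambda>_. 1" 1] prob_space by simp
      then show ?thesis by simp
    qed
    finally show "expectation (\<lambda>w. W w * (Y n w - p n w)) = 0" .
  qed
  show ?thesis
    using mdiff_slln[OF md] p_lim
  proof eventually_elim
    case (elim w)
    have 1: "(\<lambda>n. (\<Sum>k<n. p k w) / real n) \<longlonglongrightarrow> 1" by (intro cesaro elim)
    have 2: "(\<lambda>n. 1 / real n) \<longlonglongrightarrow> 0" by (rule lim_const_over_n)
    have S: "K n w = 1 + (\<Sum>k<n. Y k w)" for n by (induction n) (auto simp: K_Suc K_0)
    have "K n w / real n = (\<Sum>k<n. Y k w - p k w) / real n + (\<Sum>k<n. p k w) / real n + 1 / real n" for n
      by (simp add: S[of n] sum_subtractf diff_divide_distrib add_divide_distrib)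
    then show ?case using tendsto_add[OF tendsto_add[OF elim(1) 1] 2] by simp
  qed
qed

section \<open>Martingale differences of the proportions\<close>

text \<open>The process \<open>Zstar\<close> for the fixed color \<open>j\<close>, expressed through
  \<open>S\<close>.\<close>

definition Zs :: "nat \<Rightarrow> 'w \<Rightarrow> real" where "Zs n w = N n j w / S n w"

text \<open>The derivative of \<open>Zs\<close> with respect to the weight of color
  \<open>i\<close>, multiplied by \<open>S\<close>.\<close>

definition del :: "nat \<Rightarrow> nat \<Rightarrow> 'w \<Rightarrow> real" where "del i n w = (if i = j then 1 else 0) - Zs n w"

definition Q :: "nat \<Rightarrow> nat \<Rightarrow> real" where "Q n i = expectation (\<lambda>w. (A (Suc n) i w)\<^sup>2)"

lemma Zs_bounds: "w \<in> space M \<Longrightarrow> 0 \<le> Zs n w" "w \<in> space M \<Longrightarrow> Zs n w \<le> 1"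
proof -
  assume w: "w \<in> space M"
  have "N n j w \<le> S n w" unfolding S_def
    using j by (intro member_le_sum) (auto intro!: less_imp_le[OF N_pos[OF in_d w]])
  then show "0 \<le> Zs n w" "Zs n w \<le> 1"
    using N_pos[OF in_d[OF j] w, of n] S_pos[OF w, of n] by (simp_all add: Zs_def)
qed

lemma Zs_F: "Zs n \<in> borel_measurable (F n)"
  unfolding Zs_def by (intro borel_measurable_divide N_F S_F in_d j)

lemma del_F: "del i n \<in> borel_measurable (F n)"
  unfolding del_def by (intro borel_measurable_diff borel_measurable_const Zs_F)

lemma del_bound: "w \<in> space M \<Longrightarrow> \<bar>del i n w\<bar> \<le> 1"
  using Zs_bounds[of w n] by (auto simp: del_def)

lemma Z_eq_Zs: "w \<in> space M \<Longrightarrow> Z n j w = Zs n w * p n w"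
  using S_pos[of w n] by (simp add: Z_eq Zs_def p_def)

text \<open>\<open>Zs\<close> is the average of the indicator of \<open>j\<close> under the
  proportions restricted to the first \<open>d0\<close> colors, so deviations from it average to 0.
  This centres both martingale difference sequences.\<close>

lemma sum_Z_del: "w \<in> space M \<Longrightarrow> (\<Sum>i=1..d0. Z n i w * del i n w) = 0"
proof -
  assume w: "w \<in> space M"
  have "(\<Sum>i=1..d0. Z n i w * del i n w) = (\<Sum>i=1..d0. (if i = j then Z n j w else 0) - Z n i w * Zs n w)"
    by (rule sum.cong) (auto simp: del_def algebra_simps)
  also have "\<dots> = Z n j w - (\<Sum>i=1..d0. Z n i w) * Zs n w"
    using j by (simp add: sum_subtractf sum_distrib_right)
  also have "\<dots> = 0" using Z_eq_Zs[OF w, of n] by (simp add: sum_Z_good p_def mult.commute)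
  finally show ?thesis .
qed

text \<open>The second bound is nonnegativity of a variance; it makes the conditional variances
  \<open>V\<close> nonnegative summand by summand.\<close>

lemma Q_bounds: "i \<in> {1..d} \<Longrightarrow> Q n i \<le> \<beta>\<^sup>2" "i \<in> {1..d0} \<Longrightarrow> (\<mu> n)\<^sup>2 \<le> Q n i"
proof -
  have i2: "integrable M (\<lambda>w. (A (Suc n) i w)\<^sup>2)" if "i \<in> {1..d}" for i
    by (rule integrable_bounded[where B = "\<beta>\<^sup>2"])
       (use that A_M A0 A\<beta> in \<open>auto intro!: power_mono\<close>)
  show "Q n i \<le> \<beta>\<^sup>2" if i: "i \<in> {1..d}"
  proof -
    have "Q n i \<le> expectation (\<lambda>_. \<beta>\<^sup>2)" unfolding Q_def
      by (rule integral_mono) (use i2[OF i] i A0 A\<beta> in \<open>auto intro!: power_mono\<close>)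
    then show ?thesis using prob_space by simp
  qed
  show "(\<mu> n)\<^sup>2 \<le> Q n i" if i: "i \<in> {1..d0}"
  proof -
    have "0 \<le> variance (A (Suc n) i)" by (rule variance_positive)
    also have "\<dots> = Q n i - (\<mu> n)\<^sup>2"
      unfolding Q_def \<mu>_def mean_eq[OF i, symmetric]
      by (rule variance_eq[OF A_int[OF in_d[OF i]] i2[OF in_d[OF i]]])
    finally show ?thesis by simp
  qed
qed

lemma mu_bounds: "0 \<le> \<mu> n" "\<mu> n \<le> \<beta>"
  using mean_bounds[of 1 n] d0 by (auto simp: \<mu>_def)

text \<open>Serves the mean and the second moment of \<open>G\<close> alike: both are quadratic in
  the reinforcement of the drawn color, with coefficients known at time \<open>n\<close>, so
  conditioning replaces the draw by \<open>Z\<close> and the powers by \<mu> and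
  \<open>Q\<close>.\<close>

lemma draw_quadratic:
  assumes g: "g0 \<in> borel_measurable (F n)" "g1 \<in> borel_measurable (F n)" "g2 \<in> borel_measurable (F n)"
    and B: "\<And>w. w \<in> space M \<Longrightarrow> \<bar>g0 w\<bar> \<le> B" "\<And>w. w \<in> space M \<Longrightarrow> \<bar>g1 w\<bar> \<le> B" "\<And>w. w \<in> space M \<Longrightarrow> \<bar>g2 w\<bar> \<le> B"
    and i: "i \<in> {1..d0}"
  shows "expectation (\<lambda>w. X (Suc n) i w * (g0 w + g1 w * A (Suc n) i w + g2 w * (A (Suc n) i w)\<^sup>2))
      = expectation (\<lambda>w. Z n i w * (g0 w + g1 w * \<mu> n + g2 w * Q n i))"
    and "integrable M (\<lambda>w. X (Suc n) i w * (g0 w + g1 w * A (Suc n) i w + g2 w * (A (Suc n) i w)\<^sup>2))"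
    and "integrable M (\<lambda>w. Z n i w * (g0 w + g1 w * \<mu> n + g2 w * Q n i))"
proof -
  note id = in_d[OF i]
  have B0: "0 \<le> B" using B(1) not_empty abs_ge_zero order_trans by blast
  have [measurable]: "X (Suc n) i \<in> borel_measurable M" "A (Suc n) i \<in> borel_measurable M" using X_M A_M id by auto
  have I: "integrable M (\<lambda>w. g w * (X (Suc n) i w * h (A (Suc n) i w)))"
    if "g \<in> borel_measurable (F n)" and gB: "\<And>w. w \<in> space M \<Longrightarrow> \<bar>g w\<bar> \<le> B"
      and [measurable]: "h \<in> borel_measurable borel" and h: "\<And>x. 0 \<le> x \<Longrightarrow> x \<le> \<beta> \<Longrightarrow> \<bar>h x\<bar> \<le> D" for g h D
  proof (rule integrable_bounded[where B = "B * (1 * D)"])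
    have [measurable]: "g \<in> borel_measurable M" using that(1) by (rule measurable_F)
    show "(\<lambda>w. g w * (X (Suc n) i w * h (A (Suc n) i w))) \<in> borel_measurable M" by measurable
    fix w assume w: "w \<in> space M"
    have hA: "\<bar>h (A (Suc n) i w)\<bar> \<le> D" using h A0[of "Suc n" i w] A\<beta>[of "Suc n" i w] id w by simp
    have "\<bar>X (Suc n) i w\<bar> \<le> 1" using X01[of "Suc n" i w] id w by auto
    then show "norm (g w * (X (Suc n) i w * h (A (Suc n) i w))) \<le> B * (1 * D)"
      unfolding real_norm_def abs_mult by (intro mult_mono gB[OF w] hA B0) auto
  qed
  have h: "\<bar>1::real\<bar> \<le> 1" "0 \<le> x \<Longrightarrow> x \<le> \<beta> \<Longrightarrow> \<bar>x\<bar> \<le> \<beta>" "0 \<le> x \<Longrightarrow> x \<le> \<beta> \<Longrightarrow> \<bar>x\<^sup>2\<bar> \<le> \<beta>\<^sup>2" for x :: real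
    by (auto intro!: power_mono)
  note J = I[OF g(1) B(1), of "\<lambda>_. 1" 1] I[OF g(2) B(2), of "\<lambda>x. x" \<beta>] I[OF g(3) B(3), of "\<lambda>x. x\<^sup>2" "\<beta>\<^sup>2"]
  note E = draw[OF g(1) B(1) id, of "\<lambda>_. 1" 1] draw[OF g(2) B(2) id, of "\<lambda>x. x" \<beta>] draw[OF g(3) B(3) id, of "\<lambda>x. x\<^sup>2" "\<beta>\<^sup>2"]
  note WZ = WZ_integrable[OF g(1) B(1) id] WZ_integrable[OF g(2) B(2) id] WZ_integrable[OF g(3) B(3) id]
  have e1: "X (Suc n) i w * (g0 w + g1 w * A (Suc n) i w + g2 w * (A (Suc n) i w)\<^sup>2)
      = g0 w * (X (Suc n) i w * 1) + g1 w * (X (Suc n) i w * A (Suc n) i w) + g2 w * (X (Suc n) i w * (A (Suc n) i w)\<^sup>2)" for w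
    by (simp add: algebra_simps)
  have e2: "Z n i w * (g0 w + g1 w * \<mu> n + g2 w * Q n i) = g0 w * Z n i w + \<mu> n * (g1 w * Z n i w) + Q n i * (g2 w * Z n i w)" for w
    by (simp add: algebra_simps)
  have mi: "expectation (A (Suc n) i) = \<mu> n" by (simp only: \<mu>_def mean_eq[OF i])
  show "integrable M (\<lambda>w. X (Suc n) i w * (g0 w + g1 w * A (Suc n) i w + g2 w * (A (Suc n) i w)\<^sup>2))"
    unfolding e1 by (intro Bochner_Integration.integrable_add J h) auto
  show "integrable M (\<lambda>w. Z n i w * (g0 w + g1 w * \<mu> n + g2 w * Q n i))"
    unfolding e2 by (intro Bochner_Integration.integrable_add integrable_mult_right WZ)
  have "expectation (\<lambda>w. X (Suc n) i w * (g0 w + g1 w * A (Suc n) i w + g2 w * (A (Suc n) i w)\<^sup>2))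
    = expectation (\<lambda>w. g0 w * (X (Suc n) i w * 1)) + expectation (\<lambda>w. g1 w * (X (Suc n) i w * A (Suc n) i w))
      + expectation (\<lambda>w. g2 w * (X (Suc n) i w * (A (Suc n) i w)\<^sup>2))"
    unfolding e1 using J h by (subst Bochner_Integration.integral_add, (intro Bochner_Integration.integrable_add)?, auto)+
  also have "\<dots> = expectation (\<lambda>w. g0 w * Z n i w) + expectation (\<lambda>w. g1 w * Z n i w) * \<mu> n + expectation (\<lambda>w. g2 w * Z n i w) * Q n i"
    using E h prob_space by (simp add: mi Q_def)
  also have "\<dots> = expectation (\<lambda>w. Z n i w * (g0 w + g1 w * \<mu> n + g2 w * Q n i))"
    unfolding e2 using WZ by (simp add: mult.commute)
  finally show "expectation (\<lambda>w. X (Suc n) i w * (g0 w + g1 w * A (Suc n) i w + g2 w * (A (Suc n) i w)\<^sup>2))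
      = expectation (\<lambda>w. Z n i w * (g0 w + g1 w * \<mu> n + g2 w * Q n i))" .
qed

text \<open>Both martingale difference sequences of the proof are of this form: \<open>b = 1\<close> for \<open>C\<^sup>*\<close> and
  \<open>b = 0\<close> for \<open>D\<^sup>*\<close>.\<close>

definition G :: "real \<Rightarrow> (nat \<Rightarrow> 'w \<Rightarrow> real) \<Rightarrow> nat \<Rightarrow> 'w \<Rightarrow> real" where
  "G b \<rho> n w = (\<Sum>i=1..d0. X (Suc n) i w * (del i n w * (b - \<rho> n w * A (Suc n) i w)))"

text \<open>The conditional second moment of \<open>G b \<rho> n\<close> given the past.\<close>

definition V :: "real \<Rightarrow> (nat \<Rightarrow> 'w \<Rightarrow> real) \<Rightarrow> nat \<Rightarrow> 'w \<Rightarrow> real" where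
  "V b \<rho> n w = (\<Sum>i=1..d0. Z n i w * ((del i n w)\<^sup>2 * (b\<^sup>2 - 2 * b * \<rho> n w * \<mu> n + (\<rho> n w)\<^sup>2 * Q n i)))"

context
  fixes b \<kappa> :: real and \<rho> :: "nat \<Rightarrow> 'w \<Rightarrow> real"
  assumes \<rho>F: "\<And>n. \<rho> n \<in> borel_measurable (F n)" and \<rho>\<kappa>: "\<And>n w. w \<in> space M \<Longrightarrow> \<bar>\<rho> n w\<bar> \<le> \<kappa>"
begin

lemma \<kappa>0: "0 \<le> \<kappa>" using \<rho>\<kappa> not_empty abs_ge_zero order_trans by blast

lemma G_bound: "w \<in> space M \<Longrightarrow> \<bar>G b \<rho> n w\<bar> \<le> \<bar>b\<bar> + \<kappa> * \<beta>"
proof -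
  assume w: "w \<in> space M"
  obtain i0 where i0: "i0 \<in> {1..d}" and
    *: "\<And>f :: nat \<Rightarrow> real. \<And>I. I \<subseteq> {1..d} \<Longrightarrow> (\<Sum>i\<in>I. X (Suc n) i w * f i) = (if i0 \<in> I then f i0 else 0)"
    using color_drawn[OF w] by blast
  have "\<bar>\<rho> n w * A (Suc n) i0 w\<bar> \<le> \<kappa> * \<beta>"
    unfolding abs_mult using \<rho>\<kappa>[OF w, of n] A0[of "Suc n" i0 w] A\<beta>[of "Suc n" i0 w] i0 w \<kappa>0
    by (intro mult_mono) auto
  then have "\<bar>b - \<rho> n w * A (Suc n) i0 w\<bar> \<le> \<bar>b\<bar> + \<kappa> * \<beta>" by linarith
  then have "\<bar>del i0 n w\<bar> * \<bar>b - \<rho> n w * A (Suc n) i0 w\<bar> \<le> 1 * (\<bar>b\<bar> + \<kappa> * \<beta>)"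
    by (intro mult_mono del_bound[OF w]) auto
  then show ?thesis
    using *[of "{1..d0}" "\<lambda>i. del i n w * (b - \<rho> n w * A (Suc n) i w)"] d0 \<kappa>0 \<beta>
    by (simp add: G_def abs_mult)
qed

text \<open>At most one of the summands is active, so squaring the sum produces no cross
  terms.\<close>

lemma G_square: "w \<in> space M \<Longrightarrow> (G b \<rho> n w)\<^sup>2
   = (\<Sum>i=1..d0. X (Suc n) i w * ((del i n w)\<^sup>2 * b\<^sup>2 + (- 2 * b * \<rho> n w * (del i n w)\<^sup>2) * A (Suc n) i w
        + ((\<rho> n w)\<^sup>2 * (del i n w)\<^sup>2) * (A (Suc n) i w)\<^sup>2))"
proof -
  assume w: "w \<in> space M"
  obtain i0 where i0: "i0 \<in> {1..d}" and
    *: "\<And>f :: nat \<Rightarrow> real. \<And>I. I \<subseteq> {1..d} \<Longrightarrow> (\<Sum>i\<in>I. X (Suc n) i w * f i) = (if i0 \<in> I then f i0 else 0)"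
    using color_drawn[OF w] by blast
  have "{1..d0} \<subseteq> {1..d}" using d0 by auto
  show ?thesis
    unfolding G_def *[OF \<open>{1..d0} \<subseteq> {1..d}\<close>] by (simp add: power2_eq_square algebra_simps)
qed

lemma G_F: "G b \<rho> n \<in> borel_measurable (F (Suc n))"
proof -
  have "\<rho> n \<in> borel_measurable (F (Suc n))" "del i n \<in> borel_measurable (F (Suc n))" for i
    by (rule measurable_F_mono[OF \<rho>F], simp) (rule measurable_F_mono[OF del_F], simp)
  then show ?thesis unfolding G_def
    by (intro borel_measurable_sum borel_measurable_times borel_measurable_diff borel_measurable_const X_F A_F in_d) auto
qed

text \<open>Because the first \<open>d0\<close> colors share the mean \<mu>, taking conditional
  means leaves the common factor \<open>b - \<rho> * \<mu>\<close> in front of a sum that vanishes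
  by \<open>sum_Z_del\<close>.\<close>

lemma G_mdiff: "mdiff (G b \<rho>) (\<bar>b\<bar> + \<kappa> * \<beta>)"
  unfolding mdiff_def
proof (intro conjI allI ballI impI G_F G_bound)
  fix n and W :: "'w \<Rightarrow> real" and B
  assume W: "W \<in> borel_measurable (F n)" and "\<forall>w\<in>space M. \<bar>W w\<bar> \<le> B"
  then have B: "\<And>w. w \<in> space M \<Longrightarrow> \<bar>W w\<bar> \<le> B" by simp
  have B0: "0 \<le> B" using B not_empty abs_ge_zero order_trans by blast
  define g0 where "g0 i w = W w * del i n w * b" for i w
  define g1 where "g1 i w = - (W w * del i n w * \<rho> n w)" for i w
  define D where "D = B * \<bar>b\<bar> + B * \<kappa>"
  have gF: "g0 i \<in> borel_measurable (F n)" "g1 i \<in> borel_measurable (F n)" for i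
    unfolding g0_def g1_def
    by (intro borel_measurable_times borel_measurable_uminus borel_measurable_const W del_F \<rho>F)+
  have Wd: "\<bar>W w * del i n w\<bar> \<le> B" if w: "w \<in> space M" for w i
    using mult_mono[OF B[OF w] del_bound[OF w, of i n] B0] by (simp add: abs_mult)
  have g0D: "\<bar>g0 i w\<bar> \<le> D" if w: "w \<in> space M" for i w
  proof -
    have "\<bar>g0 i w\<bar> \<le> B * \<bar>b\<bar>" unfolding g0_def abs_mult[of _ b] by (intro mult_right_mono Wd[OF w]) auto
    then show ?thesis using B0 \<kappa>0 unfolding D_def by (simp add: add_increasing2)
  qed
  have g1D: "\<bar>g1 i w\<bar> \<le> D" if w: "w \<in> space M" for i w
  proof -
    have "\<bar>g1 i w\<bar> \<le> B * \<kappa>" unfolding g1_def abs_minus_cancel abs_mult[of _ "\<rho> n w"]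
      by (intro mult_mono Wd[OF w] \<rho>\<kappa>[OF w] B0) auto
    then show ?thesis using B0 unfolding D_def by (simp add: add_increasing)
  qed
  have D0: "0 \<le> D" using B0 \<kappa>0 by (simp add: D_def)
  note dq = draw_quadratic[OF gF(1) gF(2) _ g0D g1D, of "\<lambda>_. 0"]
  have "expectation (\<lambda>w. W w * G b \<rho> n w)
     = expectation (\<lambda>w. \<Sum>i=1..d0. X (Suc n) i w * (g0 i w + g1 i w * A (Suc n) i w + 0 * (A (Suc n) i w)\<^sup>2))"
    by (rule Bochner_Integration.integral_cong[OF refl])
       (simp add: G_def g0_def g1_def sum_distrib_left algebra_simps)
  also have "\<dots> = (\<Sum>i=1..d0. expectation (\<lambda>w. X (Suc n) i w * (g0 i w + g1 i w * A (Suc n) i w + 0 * (A (Suc n) i w)\<^sup>2)))"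
    by (rule Bochner_Integration.integral_sum) (rule dq(2), use D0 in auto)
  also have "\<dots> = (\<Sum>i=1..d0. expectation (\<lambda>w. Z n i w * (g0 i w + g1 i w * \<mu> n + 0 * Q n i)))"
    by (rule sum.cong[OF refl], rule dq(1)) (use D0 in auto)
  also have "\<dots> = expectation (\<lambda>w. \<Sum>i=1..d0. Z n i w * (g0 i w + g1 i w * \<mu> n + 0 * Q n i))"
    by (rule Bochner_Integration.integral_sum[symmetric], rule dq(3)) (use D0 in auto)
  also have "\<dots> = expectation (\<lambda>w. 0)"
  proof (rule Bochner_Integration.integral_cong[OF refl])
    fix w assume w: "w \<in> space M"
    have "(\<Sum>i=1..d0. Z n i w * (g0 i w + g1 i w * \<mu> n + 0 * Q n i)) = (W w * (b - \<rho> n w * \<mu> n)) * (\<Sum>i=1..d0. Z n i w * del i n w)"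
      unfolding sum_distrib_left by (rule sum.cong) (auto simp: g0_def g1_def algebra_simps)
    then show "(\<Sum>i=1..d0. Z n i w * (g0 i w + g1 i w * \<mu> n + 0 * Q n i)) = 0"
      by (simp add: sum_Z_del[OF w])
  qed
  finally show "expectation (\<lambda>w. W w * G b \<rho> n w) = 0" by simp
qed

lemma V_F: "V b \<rho> n \<in> borel_measurable (F n)"
  unfolding V_def
  by (intro borel_measurable_sum borel_measurable_times borel_measurable_power borel_measurable_add
      borel_measurable_diff borel_measurable_const del_F \<rho>F Z_F in_d)

lemma V_factor:
  assumes w: "w \<in> space M" and i: "i \<in> {1..d0}"
  shows "0 \<le> b\<^sup>2 - 2 * b * \<rho> n w * \<mu> n + (\<rho> n w)\<^sup>2 * Q n i"
    and "b\<^sup>2 - 2 * b * \<rho> n w * \<mu> n + (\<rho> n w)\<^sup>2 * Q n i \<le> (\<bar>b\<bar> + \<kappa> * \<beta>)\<^sup>2"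
proof -
  \<comment> \<open>Completing the square separates the squared mean from \<rho>^2 times the
    variance of the reinforcement.\<close>
  have "b\<^sup>2 - 2 * b * \<rho> n w * \<mu> n + (\<rho> n w)\<^sup>2 * Q n i = (b - \<rho> n w * \<mu> n)\<^sup>2 + (\<rho> n w)\<^sup>2 * (Q n i - (\<mu> n)\<^sup>2)"
    by (simp add: power2_eq_square algebra_simps)
  then show "0 \<le> b\<^sup>2 - 2 * b * \<rho> n w * \<mu> n + (\<rho> n w)\<^sup>2 * Q n i"
    using Q_bounds(2)[OF i, of n] by simp
  have "(\<rho> n w)\<^sup>2 * Q n i \<le> \<kappa>\<^sup>2 * \<beta>\<^sup>2"
  proof (rule mult_mono)
    show "0 \<le> Q n i" using Q_bounds(2)[OF i, of n] zero_le_power2[of "\<mu> n"] by linarith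
  qed (use square_le_of_abs_le[OF \<rho>\<kappa>[OF w]] Q_bounds(1)[OF in_d[OF i]] in auto)
  moreover have "- (2 * b * \<rho> n w * \<mu> n) \<le> 2 * \<bar>b\<bar> * \<kappa> * \<beta>"
  proof -
    have "\<bar>2 * b * \<rho> n w * \<mu> n\<bar> \<le> 2 * \<bar>b\<bar> * \<kappa> * \<beta>"
      unfolding abs_mult using \<rho>\<kappa>[OF w, of n] mu_bounds[of n] \<kappa>0 by (intro mult_mono) auto
    then show ?thesis by linarith
  qed
  moreover have "(\<bar>b\<bar> + \<kappa> * \<beta>)\<^sup>2 = b\<^sup>2 + 2 * \<bar>b\<bar> * \<kappa> * \<beta> + \<kappa>\<^sup>2 * \<beta>\<^sup>2"
    by (simp add: power2_sum power_mult_distrib)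
  ultimately show "b\<^sup>2 - 2 * b * \<rho> n w * \<mu> n + (\<rho> n w)\<^sup>2 * Q n i \<le> (\<bar>b\<bar> + \<kappa> * \<beta>)\<^sup>2"
    by linarith
qed

lemma V_bounds: "w \<in> space M \<Longrightarrow> 0 \<le> V b \<rho> n w" "w \<in> space M \<Longrightarrow> V b \<rho> n w \<le> (\<bar>b\<bar> + \<kappa> * \<beta>)\<^sup>2"
proof -
  assume w: "w \<in> space M"
  let ?D = "(\<bar>b\<bar> + \<kappa> * \<beta>)\<^sup>2"
  show "0 \<le> V b \<rho> n w"
    unfolding V_def by (intro sum_nonneg mult_nonneg_nonneg Z_nonneg w V_factor in_d) auto
  have "V b \<rho> n w \<le> (\<Sum>i=1..d0. Z n i w * (1 * ?D))"
    unfolding V_def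
  proof (intro sum_mono mult_left_mono mult_mono)
    fix i assume i: "i \<in> {1..d0}"
    show "(del i n w)\<^sup>2 \<le> 1" using square_le_of_abs_le[OF del_bound[OF w]] by simp
    show "b\<^sup>2 - 2 * b * \<rho> n w * \<mu> n + (\<rho> n w)\<^sup>2 * Q n i \<le> ?D"
      "0 \<le> b\<^sup>2 - 2 * b * \<rho> n w * \<mu> n + (\<rho> n w)\<^sup>2 * Q n i" using V_factor[OF w i] by auto
    show "0 \<le> Z n i w" by (rule Z_nonneg[OF in_d[OF i] w])
  qed auto
  also have "\<dots> = p n w * ?D" by (simp add: p_def sum_Z_good flip: sum_distrib_right)
  also have "\<dots> \<le> 1 * ?D" by (rule mult_right_mono[OF p_bounds(2)[OF w]]) simp
  finally show "V b \<rho> n w \<le> ?D" by simp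
qed

lemma G_cvar: "cvar (G b \<rho>) (V b \<rho>) ((\<bar>b\<bar> + \<kappa> * \<beta>)\<^sup>2)"
  unfolding cvar_def
proof (intro conjI allI ballI impI V_F V_bounds)
  fix n and W :: "'w \<Rightarrow> real" and B
  assume W: "W \<in> borel_measurable (F n)" and "\<forall>w\<in>space M. \<bar>W w\<bar> \<le> B"
  then have B: "\<And>w. w \<in> space M \<Longrightarrow> \<bar>W w\<bar> \<le> B" by simp
  have B0: "0 \<le> B" using B not_empty abs_ge_zero order_trans by blast
  define g0 where "g0 i w = W w * (del i n w)\<^sup>2 * b\<^sup>2" for i w
  define g1 where "g1 i w = W w * (del i n w)\<^sup>2 * (- 2 * b * \<rho> n w)" for i w
  define g2 where "g2 i w = W w * (del i n w)\<^sup>2 * (\<rho> n w)\<^sup>2" for i w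
  define D where "D = B * (b\<^sup>2 + 2 * \<bar>b\<bar> * \<kappa> + \<kappa>\<^sup>2)"
  have gF: "g0 i \<in> borel_measurable (F n)" "g1 i \<in> borel_measurable (F n)" "g2 i \<in> borel_measurable (F n)" for i
    unfolding g0_def g1_def g2_def
    by (intro borel_measurable_times borel_measurable_power borel_measurable_const W del_F \<rho>F)+
  have gen: "\<bar>W w * (del i n w)\<^sup>2 * x\<bar> \<le> D" if w: "w \<in> space M" and x: "\<bar>x\<bar> \<le> b\<^sup>2 + 2 * \<bar>b\<bar> * \<kappa> + \<kappa>\<^sup>2" for w i x
  proof -
    have d2: "(del i n w)\<^sup>2 \<le> 1" using square_le_of_abs_le[OF del_bound[OF w]] by simp
    have "\<bar>W w\<bar> * (del i n w)\<^sup>2 \<le> B * 1" by (intro mult_mono B[OF w] d2 B0) auto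
    then have "\<bar>W w\<bar> * (del i n w)\<^sup>2 * \<bar>x\<bar> \<le> B * 1 * (b\<^sup>2 + 2 * \<bar>b\<bar> * \<kappa> + \<kappa>\<^sup>2)"
      by (rule mult_mono[OF _ x]) (use B0 in auto)
    then show ?thesis by (simp add: abs_mult D_def)
  qed
  have gD: "\<bar>g0 i w\<bar> \<le> D" "\<bar>g1 i w\<bar> \<le> D" "\<bar>g2 i w\<bar> \<le> D" if w: "w \<in> space M" for i w
  proof -
    have r: "\<bar>\<rho> n w\<bar> \<le> \<kappa>" "(\<rho> n w)\<^sup>2 \<le> \<kappa>\<^sup>2" using \<rho>\<kappa>[OF w, of n] square_le_of_abs_le by auto
    have bk: "0 \<le> 2 * \<bar>b\<bar> * \<kappa>" using \<kappa>0 by simp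
    show "\<bar>g0 i w\<bar> \<le> D" unfolding g0_def by (rule gen[OF w]) (use bk in simp)
    have "\<bar>- 2 * b * \<rho> n w\<bar> \<le> 2 * \<bar>b\<bar> * \<kappa>"
      using mult_left_mono[OF r(1), of "2 * \<bar>b\<bar>"] by (simp add: abs_mult)
    then show "\<bar>g1 i w\<bar> \<le> D" unfolding g1_def
      by (intro gen[OF w]) (use zero_le_power2[of b] zero_le_power2[of \<kappa>] in linarith)
    have "0 \<le> b\<^sup>2 + 2 * \<bar>b\<bar> * \<kappa>" using bk by (intro add_nonneg_nonneg) auto
    with r(2) have "\<bar>(\<rho> n w)\<^sup>2\<bar> \<le> b\<^sup>2 + 2 * \<bar>b\<bar> * \<kappa> + \<kappa>\<^sup>2" by simp
    then show "\<bar>g2 i w\<bar> \<le> D" unfolding g2_def by (rule gen[OF w])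
  qed
  note dq = draw_quadratic[OF gF gD]
  let ?x = "\<lambda>i w. X (Suc n) i w * (g0 i w + g1 i w * A (Suc n) i w + g2 i w * (A (Suc n) i w)\<^sup>2)"
  let ?z = "\<lambda>i w. Z n i w * (g0 i w + g1 i w * \<mu> n + g2 i w * Q n i)"
  have ex: "W w * (G b \<rho> n w)\<^sup>2 = (\<Sum>i=1..d0. ?x i w)" if w: "w \<in> space M" for w
    unfolding G_square[OF w] sum_distrib_left
    by (rule sum.cong) (auto simp: g0_def g1_def g2_def algebra_simps)
  have ez: "W w * V b \<rho> n w = (\<Sum>i=1..d0. ?z i w)" for w
    unfolding V_def sum_distrib_left
    by (rule sum.cong) (auto simp: g0_def g1_def g2_def algebra_simps)
  have "expectation (\<lambda>w. W w * ((G b \<rho> n w)\<^sup>2 - V b \<rho> n w)) = expectation (\<lambda>w. (\<Sum>i=1..d0. ?x i w) - (\<Sum>i=1..d0. ?z i w))"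
    by (rule Bochner_Integration.integral_cong[OF refl]) (simp only: right_diff_distrib ex ez)
  also have "\<dots> = expectation (\<lambda>w. \<Sum>i=1..d0. ?x i w) - expectation (\<lambda>w. \<Sum>i=1..d0. ?z i w)"
    by (intro Bochner_Integration.integral_diff Bochner_Integration.integrable_sum dq(2,3)) auto
  also have "\<dots> = (\<Sum>i=1..d0. expectation (?x i)) - (\<Sum>i=1..d0. expectation (?z i))"
    by (intro arg_cong2[where f = "(-)"] Bochner_Integration.integral_sum dq(2,3)) auto
  also have "(\<Sum>i=1..d0. expectation (?x i)) = (\<Sum>i=1..d0. expectation (?z i))"
    by (rule sum.cong[OF refl], rule dq(1)) auto
  finally show "expectation (\<lambda>w. W w * ((G b \<rho> n w)\<^sup>2 - V b \<rho> n w)) = 0" by simp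
qed

lemma V_lim:
  assumes Z: "\<And>i. i \<in> {1..d0} \<Longrightarrow> (\<lambda>n. Z n i w) \<longlonglongrightarrow> L i" and Zs: "(\<lambda>n. Zs n w) \<longlonglongrightarrow> L j"
    and r: "(\<lambda>n. \<rho> n w) \<longlonglongrightarrow> r"
  shows "(\<lambda>n. V b \<rho> n w) \<longlonglongrightarrow> (\<Sum>i=1..d0. L i * (((if i = j then 1 else 0) - L j)\<^sup>2 * (b\<^sup>2 - 2 * b * r * m + r\<^sup>2 * q i)))"
proof -
  have Qlim: "(\<lambda>n. Q n i) \<longlonglongrightarrow> q i" if "i \<in> {1..d0}" for i
    unfolding Q_def using LIMSEQ_Suc[OF second_lim[OF that]] .
  show ?thesis unfolding V_def del_def
    by (intro tendsto_sum tendsto_intros Z Zs r \<mu>_lim Qlim)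
qed

end

text \<open>The numerator of the increment of \<open>Zs\<close>, whose denominator is the new weight
  \<open>S (Suc n)\<close>.\<close>

definition Rinc :: "nat \<Rightarrow> 'w \<Rightarrow> real" where
  "Rinc n w = X (Suc n) j w * A (Suc n) j w - Zs n w * good_inc n w"

text \<open>With the sum over colors carried out, the part with \<open>b\<close> is the centred draw
  of \<open>j\<close>, and the part with \<rho> is the numerator of the increment of
  \<open>Zs\<close>.\<close>

lemma G_eq: "G b \<rho> n w = b * (X (Suc n) j w - Zs n w * Y n w) - \<rho> n w * Rinc n w"
proof -
  have d: "(\<Sum>i=1..d0. x i * del i n w) = x j - Zs n w * (\<Sum>i=1..d0. x i)" for x :: "nat \<Rightarrow> real"
  proof -
    have "(\<Sum>i=1..d0. x i * del i n w) = (\<Sum>i=1..d0. (if i = j then x j else 0) - Zs n w * x i)"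
      by (rule sum.cong) (auto simp: del_def algebra_simps)
    then show ?thesis using j by (simp add: sum_subtractf sum_distrib_left)
  qed
  have "G b \<rho> n w = b * (\<Sum>i=1..d0. X (Suc n) i w * del i n w) - \<rho> n w * (\<Sum>i=1..d0. (X (Suc n) i w * A (Suc n) i w) * del i n w)"
    unfolding G_def sum_distrib_left sum_subtractf[symmetric] by (rule sum.cong) (auto simp: algebra_simps)
  then show ?thesis unfolding d by (simp add: Rinc_def good_inc_def Y_def)
qed

text \<open>The bound on \<open>G\<close> for \<open>b = 0\<close> and \<rho> constantly 1, where
  \<open>G\<close> is \<open>- Rinc\<close>.\<close>

lemma Rinc_bound: "w \<in> space M \<Longrightarrow> \<bar>Rinc n w\<bar> \<le> \<beta>"
  using G_bound[of "\<lambda>_ _. 1" 1 w 0 n] by (simp add: G_eq)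

text \<open>\<open>Rinc\<close> vanishes unless one of the first \<open>d0\<close> colors is drawn,
  and then \<open>Y\<close> is 1. In products with \<open>Rinc\<close> this allows
  \<open>K (Suc n)\<close> to be replaced by \<open>K n + 1\<close>, which is known at time
  \<open>n\<close>.\<close>

lemma Rinc_Y: "w \<in> space M \<Longrightarrow> Rinc n w * Y n w = Rinc n w"
proof -
  assume w: "w \<in> space M"
  obtain i0 where i0: "i0 \<in> {1..d}" and
    *: "\<And>f :: nat \<Rightarrow> real. \<And>I. I \<subseteq> {1..d} \<Longrightarrow> (\<Sum>i\<in>I. X (Suc n) i w * f i) = (if i0 \<in> I then f i0 else 0)"
    using color_drawn[OF w] by blast
  have sub: "{1..d0} \<subseteq> {1..d}" using d0 by auto
  have "Rinc n w = G 0 (\<lambda>_ _. - 1) n w" by (simp add: G_eq)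
  also have "\<dots> = (if i0 \<in> {1..d0} then del i0 n w * (0 - - 1 * A (Suc n) i0 w) else 0)"
    unfolding G_def *[OF sub] ..
  moreover have "Y n w = (if i0 \<in> {1..d0} then 1 else 0)"
    using *[OF sub, of "\<lambda>_. 1"] by (simp add: Y_def)
  ultimately show ?thesis by simp
qed

lemma Zs_diff: "w \<in> space M \<Longrightarrow> Zs (Suc n) w - Zs n w = Rinc n w / S (Suc n) w"
proof -
  assume w: "w \<in> space M"
  have "Zs n w * S n w = N n j w" using S_pos[OF w, of n] by (simp add: Zs_def)
  then have "Rinc n w = N (Suc n) j w - Zs n w * S (Suc n) w"
    by (simp add: Rinc_def N_Suc S_Suc algebra_simps)
  then show ?thesis using S_pos[OF w, of "Suc n"] by (simp add: Zs_def field_simps)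
qed

text \<open>Makes the denominator predictable: passing from \<open>S (Suc n)\<close> to
  \<open>S n\<close> costs two factors \<open>1 / S\<close>, hence order \<open>1 / n^2\<close>
  wherever \<open>n / S\<close> is bounded.\<close>

lemma inverse_S_diff:
  assumes w: "w \<in> space M" and x: "real (Suc n) / S n w \<le> \<kappa>"
  shows "\<bar>Rinc n w / S (Suc n) w - Rinc n w / S n w\<bar> \<le> \<beta>\<^sup>2 * \<kappa>\<^sup>2 / (real (Suc n))\<^sup>2"
proof -
  note s = S_pos[OF w, of n] S_pos[OF w, of "Suc n"] good_inc_bounds[OF w, of n]
  have "Rinc n w / S (Suc n) w - Rinc n w / S n w = - (Rinc n w * good_inc n w / (S n w * S (Suc n) w))"
    using s by (simp add: field_simps S_Suc)
  then have "\<bar>Rinc n w / S (Suc n) w - Rinc n w / S n w\<bar> = \<bar>Rinc n w\<bar> * good_inc n w / (S n w * S (Suc n) w)"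
    using s by (simp add: abs_mult)
  also have "\<dots> \<le> \<beta> * \<beta> / (S n w * S n w)"
    using s Rinc_bound[OF w, of n] \<beta> by (intro frac_le mult_mono) (auto simp: S_Suc)
  also have "\<dots> = \<beta>\<^sup>2 * (real (Suc n) / S n w)\<^sup>2 / (real (Suc n))\<^sup>2"
    by (simp add: power2_eq_square)
  also have "\<dots> \<le> \<beta>\<^sup>2 * \<kappa>\<^sup>2 / (real (Suc n))\<^sup>2"
    using x s by (intro divide_right_mono mult_left_mono power_mono) auto
  finally show ?thesis .
qed

end

section \<open>Fluctuations\<close>

text \<open>Comparison with telescoping terms \<open>1 / (k (k + 1))\<close> from above and
  below.\<close>

lemma sum_inverse_square_bounds:
  assumes "1 \<le> n" "n \<le> k"
  shows "(\<Sum>i\<in>{n..<k}. 1 / (real (Suc i))\<^sup>2) \<le> 1 / real n - 1 / real k"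
    and "1 / real (Suc n) - 1 / real (Suc k) \<le> (\<Sum>i\<in>{n..<k}. 1 / (real (Suc i))\<^sup>2)"
proof -
  show "(\<Sum>i\<in>{n..<k}. 1 / (real (Suc i))\<^sup>2) \<le> 1 / real n - 1 / real k"
    using assms(2)
  proof (induction k rule: dec_induct)
    case (step k)
    have "1 / (real (Suc k))\<^sup>2 \<le> 1 / (real k * real (Suc k))"
      using step assms by (intro divide_left_mono) (auto simp: power2_eq_square)
    also have "\<dots> = 1 / real k - 1 / real (Suc k)" using step assms by (simp add: field_simps)
    finally show ?case using step by simp
  qed simp
  show "1 / real (Suc n) - 1 / real (Suc k) \<le> (\<Sum>i\<in>{n..<k}. 1 / (real (Suc i))\<^sup>2)"
    using assms(2)
  proof (induction k rule: dec_induct)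
    case (step k)
    have "1 / real (Suc k) - 1 / real (Suc (Suc k)) = 1 / (real (Suc k) * real (Suc (Suc k)))" by (simp add: field_simps)
    also have "\<dots> \<le> 1 / (real (Suc k))\<^sup>2" by (intro divide_left_mono) (auto simp: power2_eq_square)
    finally show ?case using step by simp
  qed simp
qed

lemma inverse_sqrt_lim: "(\<lambda>n. 1 / sqrt (real n)) \<longlonglongrightarrow> 0"
  by (rule tendsto_divide_0[OF tendsto_const])
     (intro filterlim_at_top_imp_at_infinity filterlim_compose[OF sqrt_at_top filterlim_real_sequentially])

text \<open>Harmonic sums grow like a logarithm, hence more slowly than the square root; the
  finitely many uncontrolled terms form the constant \<open>D\<close>.\<close>

lemma sum_over_sqrt_tendsto_0:
  fixes f :: "nat \<Rightarrow> real"
  assumes f: "\<And>k. k \<ge> n0 \<Longrightarrow> \<bar>f k\<bar> \<le> C / real (Suc k)"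
  shows "(\<lambda>n. (\<Sum>k<n. f k) / sqrt (real n)) \<longlonglongrightarrow> 0"
proof -
  define D where "D = (\<Sum>k<n0. \<bar>f k\<bar>)"
  have "0 \<le> C / real (Suc n0)" using f[of n0] by linarith
  then have C0: "0 \<le> C" by (simp add: zero_le_divide_iff)
  have le: "\<bar>\<Sum>k<n. f k\<bar> \<le> D + C * harm n" for n
  proof -
    have "\<bar>\<Sum>k<n. f k\<bar> \<le> (\<Sum>k<n. \<bar>f k\<bar>)" by (rule sum_abs)
    also have "\<dots> \<le> (\<Sum>k<n. (if k < n0 then \<bar>f k\<bar> else 0) + C / real (Suc k))"
      by (rule sum_mono) (use f C0 in \<open>auto simp: not_less\<close>)
    also have "\<dots> = (\<Sum>k<n. if k < n0 then \<bar>f k\<bar> else 0) + C * (\<Sum>k<n. 1 / real (Suc k))"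
      by (simp add: sum.distrib sum_distrib_left)
    also have "(\<Sum>k<n. if k < n0 then \<bar>f k\<bar> else 0) \<le> D"
    proof -
      have "(\<Sum>k<n. if k < n0 then \<bar>f k\<bar> else 0) = (\<Sum>k\<in>{..<n} \<inter> {..<n0}. \<bar>f k\<bar>)"
        by (simp add: sum.inter_restrict)
      also have "\<dots> \<le> D" unfolding D_def by (rule sum_mono2) auto
      finally show ?thesis .
    qed
    also have "(\<Sum>k<n. 1 / real (Suc k)) = harm n"
      unfolding harm_def by (simp add: sum.atLeast1_atMost_eq inverse_eq_divide)
    finally show ?thesis by simp
  qed
  have h: "(\<lambda>n. harm n / sqrt (real n)) \<longlonglongrightarrow> 0"
  proof -
    have "(\<lambda>n. ln (real n) / real n powr (1/2)) \<longlonglongrightarrow> 0" by (rule lim_ln_over_power) simp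
    then have 2: "(\<lambda>n. ln (real n) / sqrt (real n)) \<longlonglongrightarrow> 0" by (simp add: powr_half_sqrt)
    have "(\<lambda>n. (harm n - ln (real n)) * (1 / sqrt (real n)) + ln (real n) / sqrt (real n)) \<longlonglongrightarrow> euler_mascheroni * 0 + 0"
      by (intro tendsto_intros euler_mascheroni_LIMSEQ inverse_sqrt_lim 2)
    moreover have "(harm n - ln (real n)) * (1 / sqrt (real n)) + ln (real n) / sqrt (real n) = harm n / sqrt (real n)" for n
      by (simp add: diff_divide_distrib)
    ultimately show ?thesis by simp
  qed
  have l: "(\<lambda>n. D * (1 / sqrt (real n)) + C * (harm n / sqrt (real n))) \<longlonglongrightarrow> D * 0 + C * 0"
    by (intro tendsto_intros inverse_sqrt_lim h)
  show ?thesis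
  proof (rule Lim_null_comparison)
    show "\<forall>\<^sub>F n in sequentially. norm ((\<Sum>k<n. f k) / sqrt (real n)) \<le> D * (1 / sqrt (real n)) + C * (harm n / sqrt (real n))"
    proof (intro always_eventually allI)
      fix n
      have "norm ((\<Sum>k<n. f k) / sqrt (real n)) = \<bar>\<Sum>k<n. f k\<bar> / sqrt (real n)" by (simp add: abs_divide)
      also have "\<dots> \<le> (D + C * harm n) / sqrt (real n)" by (rule divide_right_mono[OF le]) simp
      finally show "norm ((\<Sum>k<n. f k) / sqrt (real n)) \<le> D * (1 / sqrt (real n)) + C * (harm n / sqrt (real n))"
        by (simp add: add_divide_distrib)
    qed
    show "(\<lambda>n. D * (1 / sqrt (real n)) + C * (harm n / sqrt (real n))) \<longlonglongrightarrow> 0" using l by simp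
  qed
qed

context multicolor_urn
begin

definition \<kappa> :: real where "\<kappa> = 2 / m"

lemma \<kappa>_pos: "0 < \<kappa>" using m_pos by (simp add: \<kappa>_def)

text \<open>Truncating the ratios \<open>n / S\<close> at \<open>\<kappa>\<close> makes the martingale differences bounded; since
  \<open>n / S \<longlonglongrightarrow> 1 / m < \<kappa>\<close>, almost surely only finitely many terms are affected.\<close>

definition trunc :: "real \<Rightarrow> real" where "trunc x = (if x \<le> \<kappa> then x else 0)"

text \<open>\<open>G 0 \<rho>\<close> is \<open>- \<rho> * Rinc\<close>, hence the minus sign. The
  factor \<open>Suc n\<close> makes the quotient bounded and is undone by the weight
  \<open>1 / Suc n\<close> in \<open>MD\<close>.\<close>

definition \<rho>D :: "nat \<Rightarrow> 'w \<Rightarrow> real" where "\<rho>D n w = - trunc (real (Suc n) / S n w)"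
text \<open>\<open>K n + 1\<close> is the value of \<open>K (Suc n)\<close> on the only draws for
  which \<open>Rinc\<close> can differ from 0.\<close>

definition \<rho>C :: "nat \<Rightarrow> 'w \<Rightarrow> real" where "\<rho>C n w = trunc ((K n w + 1) / S n w)"

abbreviation cD :: "nat \<Rightarrow> 'w \<Rightarrow> real" where "cD \<equiv> G 0 \<rho>D"
abbreviation cC :: "nat \<Rightarrow> 'w \<Rightarrow> real" where "cC \<equiv> G 1 \<rho>C"

lemma trunc_meas [measurable]: "trunc \<in> borel_measurable borel" unfolding trunc_def[abs_def] by measurable

lemma trunc_bound: "0 \<le> x \<Longrightarrow> \<bar>trunc x\<bar> \<le> \<kappa>" using \<kappa>_pos by (simp add: trunc_def)

lemma \<rho>D_F: "\<rho>D n \<in> borel_measurable (F n)"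
proof -
  note [measurable] = S_F[of n]
  show ?thesis unfolding \<rho>D_def by measurable
qed

lemma \<rho>C_F: "\<rho>C n \<in> borel_measurable (F n)"
proof -
  note [measurable] = S_F[of n] K_F[of n]
  show ?thesis unfolding \<rho>C_def by measurable
qed

lemma \<rho>D_bound: "w \<in> space M \<Longrightarrow> \<bar>\<rho>D n w\<bar> \<le> \<kappa>"
  unfolding \<rho>D_def abs_minus_cancel using S_pos[of w n] by (intro trunc_bound) simp

lemma \<rho>C_bound: "w \<in> space M \<Longrightarrow> \<bar>\<rho>C n w\<bar> \<le> \<kappa>"
  unfolding \<rho>C_def using S_pos[of w n] K_bounds[of w n] by (intro trunc_bound) simp

lemmas cD_mdiff = G_mdiff[OF \<rho>D_F \<rho>D_bound, of 0]
lemmas cC_mdiff = G_mdiff[OF \<rho>C_F \<rho>C_bound, of 1]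

lemma ratio_lim:
  "AE w in M. (\<lambda>n. real (Suc n) / S n w) \<longlonglongrightarrow> 1 / m \<and> (\<lambda>n. (K n w + 1) / S n w) \<longlonglongrightarrow> 1 / m"
  using S_lim K_lim AE_space
proof eventually_elim
  case (elim w)
  note w = elim(3)
  have one: "(\<lambda>n. 1 / real n) \<longlonglongrightarrow> 0" by (rule lim_const_over_n)
  have A: "(\<lambda>n. (1 + 1 / real n) / (S n w / real n)) \<longlonglongrightarrow> (1 + 0) / m"
    by (intro tendsto_intros one elim) (use m_pos in simp)
  have "\<forall>\<^sub>F n in sequentially. (1 + 1 / real n) / (S n w / real n) = real (Suc n) / S n w"
    using eventually_gt_at_top[of 0]
  proof eventually_elim
    case (elim n)
    with S_pos[OF w, of n] show ?case by (simp add: field_simps)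
  qed
  from Lim_transform_eventually[OF A this] have 1: "(\<lambda>n. real (Suc n) / S n w) \<longlonglongrightarrow> 1 / m"
    by (simp only: add_0_right)
  have A: "(\<lambda>n. (K n w / real n + 1 / real n) / (S n w / real n)) \<longlonglongrightarrow> (1 + 0) / m"
    by (intro tendsto_intros one elim) (use m_pos in simp)
  have "\<forall>\<^sub>F n in sequentially. (K n w / real n + 1 / real n) / (S n w / real n) = (K n w + 1) / S n w"
    using eventually_gt_at_top[of 0]
  proof eventually_elim
    case (elim n)
    with S_pos[OF w, of n] show ?case by (simp add: field_simps)
  qed
  from Lim_transform_eventually[OF A this] have "(\<lambda>n. (K n w + 1) / S n w) \<longlonglongrightarrow> 1 / m"
    by (simp only: add_0_right)
  with 1 show ?case by blast
qed

lemma eventually_untruncated: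
  assumes "x \<longlonglongrightarrow> 1 / m"
  shows "\<forall>\<^sub>F n in sequentially. x n \<le> \<kappa> \<and> trunc (x n) = x n"
proof -
  have "1 / m < \<kappa>" using m_pos by (simp add: \<kappa>_def divide_strict_right_mono)
  from order_tendstoD(2)[OF assms this] show ?thesis
    by eventually_elim (simp add: trunc_def)
qed

lemma trunc_lim:
  assumes "x \<longlonglongrightarrow> 1 / m"
  shows "(\<lambda>n. trunc (x n)) \<longlonglongrightarrow> 1 / m"
proof (rule Lim_transform_eventually[OF assms])
  show "\<forall>\<^sub>F n in sequentially. x n = trunc (x n)"
    using eventually_untruncated[OF assms] by eventually_elim simp
qed

section \<open>The martingale part of \<open>Zs\<close> and almost sure limits of the
  proportions\<close>

definition MD :: "nat \<Rightarrow> 'w \<Rightarrow> real" where "MD n w = (\<Sum>k<n. 1 / real (Suc k) * cD k w)"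
text \<open>Collects the error from the predictable denominator and, at early times, the effect of
  truncation.\<close>

definition errD :: "nat \<Rightarrow> 'w \<Rightarrow> real" where "errD n w = Zs (Suc n) w - Zs n w - 1 / real (Suc n) * cD n w"

lemma MD_convergent: "AE w in M. convergent (\<lambda>n. MD n w)"
  unfolding MD_def by (rule mdiff_AE_convergent[OF cD_mdiff summable_inverse_Suc_square])

text \<open>Once the truncation is inactive only the change of denominator is left. The onset
  \<open>n0\<close> depends on the path, since the limits behind it are almost sure.\<close>

lemma errD_bound: "AE w in M. \<exists>n0. \<forall>n\<ge>n0. \<bar>errD n w\<bar> \<le> \<beta>\<^sup>2 * \<kappa>\<^sup>2 / (real (Suc n))\<^sup>2"
  using ratio_lim AE_space
proof eventually_elim
  case (elim w)
  have "\<forall>\<^sub>F n in sequentially. \<bar>errD n w\<bar> \<le> \<beta>\<^sup>2 * \<kappa>\<^sup>2 / (real (Suc n))\<^sup>2"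
    using eventually_untruncated[OF conjunct1[OF elim(1)]]
  proof eventually_elim
    case (elim n)
    have "1 / real (Suc n) * cD n w = Rinc n w / S n w"
      using elim by (simp add: G_eq \<rho>D_def)
    then show ?case
      using inverse_S_diff[OF \<open>w \<in> space M\<close>, of n \<kappa>] elim
      by (simp add: errD_def Zs_diff[OF \<open>w \<in> space M\<close>])
  qed
  then show ?case by (simp add: eventually_sequentially)
qed

lemma Zs_sum: "Zs (n + k) w - Zs n w = (MD (n + k) w - MD n w) + (\<Sum>i\<in>{n..<n + k}. errD i w)"
  by (induction k) (auto simp: MD_def errD_def)

text \<open>The martingale part converges because its weights are square summable, and the errors
  are absolutely summable.\<close>

lemma Zs_convergent: "AE w in M. convergent (\<lambda>n. Zs n w)"
  using MD_convergent errD_bound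
proof eventually_elim
  case (elim w)
  obtain n0 where n0: "\<And>n. n \<ge> n0 \<Longrightarrow> \<bar>errD n w\<bar> \<le> \<beta>\<^sup>2 * \<kappa>\<^sup>2 / (real (Suc n))\<^sup>2" using elim(2) by blast
  have "summable (\<lambda>n. \<beta>\<^sup>2 * \<kappa>\<^sup>2 * (1 / real (Suc n))\<^sup>2)"
    by (intro summable_mult summable_inverse_Suc_square)
  then have "summable (\<lambda>n. errD n w)"
    by (rule summable_comparison_test'[where N = n0]) (use n0 in \<open>auto simp: power_divide\<close>)
  then have "convergent (\<lambda>n. \<Sum>i<n. errD i w)" by (simp add: summable_iff_convergent)
  then have "convergent (\<lambda>n. Zs 0 w + (MD n w + (\<Sum>i<n. errD i w)))"
    using elim(1) by (intro convergent_add convergent_const)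
  moreover have "(\<lambda>n. Zs 0 w + (MD n w + (\<Sum>i<n. errD i w))) = (\<lambda>n. Zs n w)"
  proof
    show "Zs 0 w + (MD n w + (\<Sum>i<n. errD i w)) = Zs n w" for n
      using Zs_sum[of 0 n w] by (simp add: MD_def lessThan_atLeast0)
  qed
  ultimately show ?case by (rule back_subst[of convergent])
qed

lemma Zj_convergent: "AE w in M. convergent (\<lambda>n. Z n j w)"
  using Zs_convergent p_lim AE_space
proof eventually_elim
  case (elim w)
  obtain L where "(\<lambda>n. Zs n w) \<longlonglongrightarrow> L" using elim(1) by (auto simp: convergent_def)
  then have "(\<lambda>n. Zs n w * p n w) \<longlonglongrightarrow> L * 1" by (intro tendsto_mult elim)
  then show ?case using Z_eq_Zs[OF elim(3)] by (auto simp: convergent_def)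
qed

abbreviation Zl :: "nat \<Rightarrow> 'w \<Rightarrow> real" where "Zl i w \<equiv> urn_Zlim X A a d i w"

text \<open>The limit variance of color \<open>j\<close> involves the limits of all first
  \<open>d0\<close> colors. The only assumption on \<open>j\<close> is its range, so the locale can
  be instantiated for each of them.\<close>

lemma other_color: "i \<in> {1..d0} \<Longrightarrow> multicolor_urn M X A a q m \<beta> d d0 i"
  using multicolor_urn_axioms unfolding multicolor_urn_def multicolor_urn_axioms_def
  by (elim conjE, intro conjI) assumption+

lemma Z_lim: "AE w in M. \<forall>i\<in>{1..d0}. (\<lambda>n. Z n i w) \<longlonglongrightarrow> Zl i w"
proof -
  have "AE w in M. (\<lambda>n. Z n i w) \<longlonglongrightarrow> Zl i w" if "i \<in> {1..d0}" for i
    using multicolor_urn.Zj_convergent[OF other_color[OF that]]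
    by eventually_elim (simp add: urn_Zlim_def convergent_LIMSEQ_iff)
  then show ?thesis by (simp add: AE_ball_countable)
qed

text \<open>\<open>Z n j\<close> is \<open>Zs n * p n\<close> and \<open>p\<close> tends to 1, so
  the proportion among all colors and the one among the first \<open>d0\<close> share their
  limit.\<close>

lemma Zs_lim: "AE w in M. (\<lambda>n. Zs n w) \<longlonglongrightarrow> Zl j w"
  using Z_lim p_lim AE_space
proof eventually_elim
  case (elim w)
  have "(\<lambda>n. Z n j w / p n w) \<longlonglongrightarrow> Zl j w / 1"
    by (intro tendsto_divide elim(2) elim(1)[rule_format] j) simp
  moreover have "Z n j w / p n w = Zs n w" for n
    using Z_eq_Zs[OF elim(3), of n] S_pos[OF elim(3), of n] T_pos[OF elim(3), of n] by (simp add: p_def)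
  ultimately show ?case by simp
qed

lemma sum_Zl: "AE w in M. (\<Sum>i=1..d0. Zl i w) = 1"
  using Z_lim p_lim
proof eventually_elim
  case (elim w)
  have "(\<lambda>n. \<Sum>i=1..d0. Z n i w) \<longlonglongrightarrow> (\<Sum>i=1..d0. Zl i w)" by (intro tendsto_sum elim(1)[rule_format])
  then have "(\<lambda>n. p n w) \<longlonglongrightarrow> (\<Sum>i=1..d0. Zl i w)" by (simp add: sum_Z_good p_def)
  then show ?case using LIMSEQ_unique elim(2) by blast
qed

lemma Zl_M: "i \<in> {1..d0} \<Longrightarrow> Zl i \<in> borel_measurable M"
  unfolding urn_Zlim_def using Z_M[OF in_d] by (intro borel_measurable_lim_metric) auto

abbreviation Vj :: "'w \<Rightarrow> real" where "Vj \<equiv> urn_V X A a d d0 m q j"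
abbreviation Uj :: "'w \<Rightarrow> real" where "Uj \<equiv> urn_U X A a d d0 m q j"

lemma Vj_M: "Vj \<in> borel_measurable M"
proof -
  have [measurable]: "Zl j \<in> borel_measurable M" by (rule Zl_M[OF j])
  have [measurable]: "(\<lambda>w. \<Sum>i\<in>{1..d0} - {j}. q i * Zl i w) \<in> borel_measurable M"
    by (intro borel_measurable_sum borel_measurable_times borel_measurable_const Zl_M) auto
  show ?thesis unfolding urn_V_def Let_def by measurable
qed

lemma Uj_M: "Uj \<in> borel_measurable M"
proof -
  note [measurable] = Vj_M Zl_M[OF j]
  show ?thesis unfolding urn_U_def by measurable
qed

lemma sum_sq_dev:
  "(\<Sum>i=1..d0. Zl i w * (((if i = j then 1 else 0) - Zl j w)\<^sup>2 * c i))
    = Zl j w * (1 - Zl j w)\<^sup>2 * c j + (Zl j w)\<^sup>2 * (\<Sum>i\<in>{1..d0} - {j}. c i * Zl i w)"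
  using j by (subst sum.remove[of _ j]) (auto simp: sum_distrib_left algebra_simps intro!: sum.cong)

text \<open>The limit of \<open>V 0 \<rho>D\<close>, where \<rho> tends to \<open>- 1 / m\<close>.
  The terms that vanish for \<open>b = 0\<close> are kept so that the shape agrees with
  \<open>V_lim\<close>.\<close>

lemma Vj_eq: "Vj w = (\<Sum>i=1..d0. Zl i w * (((if i = j then 1 else 0) - Zl j w)\<^sup>2 * (0\<^sup>2 - 2 * 0 * (- 1 / m) * m + (- 1 / m)\<^sup>2 * q i)))"
  unfolding sum_sq_dev urn_V_def Let_def
  by (simp add: power2_eq_square sum_distrib_left sum_divide_distrib distrib_left mult_ac)

text \<open>The case \<open>b = 1\<close> with \<rho> tending to \<open>1 / m\<close>: the bracket
  becomes \<open>q i / m^2 - 1\<close>. Hence \<open>urn_V\<close> is diminished by the weighted sum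
  of squared deviations, which equals \<open>Zl j * (1 - Zl j)\<close> because the limits add up to
  1.\<close>

lemma Uj_eq: "(\<Sum>i=1..d0. Zl i w) = 1 \<Longrightarrow>
  Uj w = (\<Sum>i=1..d0. Zl i w * (((if i = j then 1 else 0) - Zl j w)\<^sup>2 * (1\<^sup>2 - 2 * 1 * (1 / m) * m + (1 / m)\<^sup>2 * q i)))"
proof -
  assume s: "(\<Sum>i=1..d0. Zl i w) = 1"
  have r: "(\<Sum>i\<in>{1..d0} - {j}. Zl i w) = 1 - Zl j w" using s j sum.remove[of "{1..d0}" j "\<lambda>i. Zl i w"] by simp
  have "(\<Sum>i=1..d0. Zl i w * (((if i = j then 1 else 0) - Zl j w)\<^sup>2 * (1\<^sup>2 - 2 * 1 * (1 / m) * m + (1 / m)\<^sup>2 * q i)))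
      = (\<Sum>i=1..d0. Zl i w * (((if i = j then 1 else 0) - Zl j w)\<^sup>2 * (0\<^sup>2 - 2 * 0 * (- 1 / m) * m + (- 1 / m)\<^sup>2 * q i)))
        - (\<Sum>i=1..d0. Zl i w * (((if i = j then 1 else 0) - Zl j w)\<^sup>2 * 1))"
    unfolding sum_subtractf[symmetric] using m_pos by (intro sum.cong refl) (simp add: algebra_simps)
  also have "(\<Sum>i=1..d0. Zl i w * (((if i = j then 1 else 0) - Zl j w)\<^sup>2 * 1)) = Zl j w * (1 - Zl j w)"
    unfolding sum_sq_dev by (simp add: r power2_eq_square algebra_simps)
  finally show ?thesis by (simp only: urn_U_def Vj_eq)
qed

lemma VD_lim: "AE w in M. (\<lambda>n. V 0 \<rho>D n w) \<longlonglongrightarrow> Vj w"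
  using Z_lim Zs_lim ratio_lim
proof eventually_elim
  case (elim w)
  have "(\<lambda>n. \<rho>D n w) \<longlonglongrightarrow> - 1 / m"
    unfolding \<rho>D_def using tendsto_minus[OF trunc_lim[OF conjunct1[OF elim(3)]]] by simp
  then show ?case unfolding Vj_eq
    by (intro V_lim[OF \<rho>D_F \<rho>D_bound, where L = "\<lambda>i. Zl i w"] elim(1)[rule_format] elim(2))
qed

lemma VC_lim: "AE w in M. (\<lambda>n. V 1 \<rho>C n w) \<longlonglongrightarrow> Uj w"
  using Z_lim Zs_lim ratio_lim sum_Zl
proof eventually_elim
  case (elim w)
  have "(\<lambda>n. \<rho>C n w) \<longlonglongrightarrow> 1 / m"
    unfolding \<rho>C_def by (rule trunc_lim[OF conjunct2[OF elim(3)]])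
  then show ?case unfolding Uj_eq[OF elim(4)]
    by (intro V_lim[OF \<rho>C_F \<rho>C_bound, where L = "\<lambda>i. Zl i w"] elim(1)[rule_format] elim(2))
qed

text \<open>Both are limits of conditional second moments. Off a null set the kernels are therefore
  centred Gaussian laws with exactly these variances.\<close>

lemma UV_nonneg: "AE w in M. 0 \<le> Uj w \<and> 0 \<le> Vj w"
  using VD_lim VC_lim AE_space
proof eventually_elim
  case (elim w)
  have "0 \<le> Uj w"
    by (rule LIMSEQ_le_const[OF elim(2)]) (use V_bounds(1)[OF \<rho>C_F \<rho>C_bound elim(3)] in blast)
  moreover have "0 \<le> Vj w"
    by (rule LIMSEQ_le_const[OF elim(1)]) (use V_bounds(1)[OF \<rho>D_F \<rho>D_bound elim(3)] in blast)
  ultimately show ?case by blast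
qed

lemma F_limit_UV: "F_limit Uj" "F_limit Vj"
  unfolding F_limit_def using VC_lim VD_lim V_F[OF \<rho>C_F \<rho>C_bound] V_F[OF \<rho>D_F \<rho>D_bound] by blast+

lemma F_limit_Zl: "F_limit (Zl j)"
  unfolding F_limit_def
proof (intro exI conjI allI)
  show "Zs n \<in> borel_measurable (F n)" for n by (rule Zs_F)
qed (rule Zs_lim)

section \<open>The rescaled errors \<open>CC\<close> and \<open>DD\<close>, and the limit theorem
  for \<open>DD\<close>\<close>

definition CC :: "nat \<Rightarrow> 'w \<Rightarrow> real" where "CC n w = Cstar X A a d0 n j w"
definition DD :: "nat \<Rightarrow> 'w \<Rightarrow> real" where "DD n w = Dstar X A a d d0 n j w"

lemma DD_eq: "DD n w = sqrt (real n) * (Zs n w - Zl j w)"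
  by (simp add: DD_def Dstar_def Zstar_def Zs_def S_def)

lemma CC_eq: "CC n w = sqrt (real n) * ((\<Sum>k<n. X (Suc k) j w) / K n w - Zs n w)"
proof -
  have "(\<Sum>k=1..n. X k j w) = (\<Sum>k<n. X (Suc k) j w)" by (induction n) auto
  then show ?thesis by (simp add: CC_def Cstar_def Mstar_def Zstar_def Zs_def S_def K_def)
qed

lemma Zs_M [measurable]: "Zs n \<in> borel_measurable M" by (rule measurable_F[OF Zs_F])

lemma DD_M: "DD n \<in> borel_measurable M"
proof -
  note [measurable] = Zl_M[OF j]
  show ?thesis unfolding DD_eq by measurable
qed

lemma CC_F: "CC n \<in> borel_measurable (F n)"
proof -
  have [measurable]: "(\<lambda>w. \<Sum>k<n. X (Suc k) j w) \<in> borel_measurable (F n)"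
    by (intro borel_measurable_sum X_F in_d j) auto
  note [measurable] = K_F[of n] Zs_F[of n]
  show ?thesis unfolding CC_eq by measurable
qed

lemma F_limit_DD: "F_limit (DD n)"
proof -
  have "F_limit (\<lambda>w. Zs n w - Zl j w)"
    by (rule F_limit_binop(2)[OF F_limit_of_measurable[OF Zs_F] F_limit_Zl])
  then show ?thesis unfolding DD_eq[abs_def] by (rule F_limit_compose) simp
qed

lemma cD_M [measurable]: "cD n \<in> borel_measurable M" and cC_M [measurable]: "cC n \<in> borel_measurable M"
  using mdiffD(3)[OF cD_mdiff] mdiffD(3)[OF cC_mdiff] by auto

lemma MD_M [measurable]: "MD n \<in> borel_measurable M" unfolding MD_def by measurable

lemma expectation_min_le_sqrt:
  assumes [measurable]: "x \<in> borel_measurable M" and i: "integrable M (\<lambda>w. (x w)\<^sup>2)"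
  shows "expectation (\<lambda>w. min 1 \<bar>x w\<bar>) \<le> sqrt (expectation (\<lambda>w. (x w)\<^sup>2))"
proof -
  have "integrable M x"
    by (rule square_integrable_imp_integrable[OF _ i]) simp
  then have "expectation (\<lambda>w. min 1 \<bar>x w\<bar>) \<le> expectation (\<lambda>w. \<bar>x w\<bar>)"
    by (intro integral_mono) auto
  also have "\<dots> \<le> sqrt (expectation (\<lambda>w. (x w)\<^sup>2))"
    by (rule expectation_abs_le_sqrt[OF \<open>integrable M x\<close> i])
  finally show ?thesis .
qed

lemma mdiff_sum_square_integrable:
  assumes "mdiff c C"
  shows "integrable M (\<lambda>w. (\<Sum>k\<in>{l..<u}. x k * c k w)\<^sup>2)"
proof (rule integrable_bounded)
  have [measurable]: "c k \<in> borel_measurable M" for k by (rule mdiffD(3)[OF assms])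
  show "(\<lambda>w. (\<Sum>k\<in>{l..<u}. x k * c k w)\<^sup>2) \<in> borel_measurable M" by measurable
  show "norm ((\<Sum>k\<in>{l..<u}. x k * c k w)\<^sup>2) \<le> (\<Sum>k\<in>{l..<u}. \<bar>x k\<bar> * C)\<^sup>2" if "w \<in> space M" for w
    using square_le_of_abs_le[OF mdiff_sum(2)[OF assms that]] by simp
qed

text \<open>The martingale tail from \<open>n^2\<close> on has second moment of order at most
  \<open>1 / n^2\<close>, and the square of \<open>sqrt n\<close> raises this to
  \<open>1 / n\<close>. The infinite tail is reached by dominated convergence from finite pieces,
  whose second moments have an explicit bound.\<close>

lemma null_tail:
  "null (\<lambda>n w. sqrt (real n) * (lim (\<lambda>N. MD N w) - MD (n\<^sup>2) w))"
  unfolding null_def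
proof (intro conjI allI)
  have [measurable]: "(\<lambda>w. lim (\<lambda>N. MD N w)) \<in> borel_measurable M" by (rule borel_measurable_lim_metric) simp
  show "(\<lambda>w. sqrt (real n) * (lim (\<lambda>N. MD N w) - MD (n\<^sup>2) w)) \<in> borel_measurable M" for n by measurable
  define C where "C = \<bar>0::real\<bar> + \<kappa> * \<beta>"
  have c: "mdiff cD C" unfolding C_def by (rule cD_mdiff)
  have C0: "0 \<le> C" by (rule mdiffD(4)[OF c])
  have bd: "expectation (\<lambda>w. min 1 \<bar>sqrt (real n) * (lim (\<lambda>N. MD N w) - MD (n\<^sup>2) w)\<bar>) \<le> C * (1 / sqrt (real n))"
    if n: "n \<ge> 1" for n
  proof (rule LIMSEQ_le_const2)
    show "(\<lambda>N. expectation (\<lambda>w. min 1 \<bar>sqrt (real n) * (MD N w - MD (n\<^sup>2) w)\<bar>))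
       \<longlonglongrightarrow> expectation (\<lambda>w. min 1 \<bar>sqrt (real n) * (lim (\<lambda>N. MD N w) - MD (n\<^sup>2) w)\<bar>)"
    proof (rule integral_dominated_convergence[where w = "\<lambda>_. 1"])
      show "AE w in M. (\<lambda>N. min 1 \<bar>sqrt (real n) * (MD N w - MD (n\<^sup>2) w)\<bar>)
          \<longlonglongrightarrow> min 1 \<bar>sqrt (real n) * (lim (\<lambda>N. MD N w) - MD (n\<^sup>2) w)\<bar>"
        using MD_convergent
        by eventually_elim (intro tendsto_intros, simp add: convergent_LIMSEQ_iff)
    qed auto
    have "expectation (\<lambda>w. min 1 \<bar>sqrt (real n) * (MD N w - MD (n\<^sup>2) w)\<bar>) \<le> C * (1 / sqrt (real n))" if N: "N \<ge> n\<^sup>2" for N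
    proof -
      let ?a = "\<lambda>k. sqrt (real n) * (1 / real (Suc k))"
      have eq: "sqrt (real n) * (MD N w - MD (n\<^sup>2) w) = (\<Sum>k\<in>{n\<^sup>2..<N}. ?a k * cD k w)" for w
      proof -
        have "MD N w = MD (n\<^sup>2) w + (\<Sum>k\<in>{n\<^sup>2..<N}. 1 / real (Suc k) * cD k w)"
          using sum.atLeastLessThan_concat[of 0 "n\<^sup>2" N "\<lambda>k. 1 / real (Suc k) * cD k w"] N
          by (simp add: MD_def lessThan_atLeast0)
        then show ?thesis by (simp add: sum_distrib_left mult.assoc)
      qed
      have "expectation (\<lambda>w. min 1 \<bar>\<Sum>k\<in>{n\<^sup>2..<N}. ?a k * cD k w\<bar>)
          \<le> sqrt (expectation (\<lambda>w. (\<Sum>k\<in>{n\<^sup>2..<N}. ?a k * cD k w)\<^sup>2))"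
        by (rule expectation_min_le_sqrt[OF _ mdiff_sum_square_integrable[OF c]]) measurable
      also have "\<dots> \<le> sqrt (C\<^sup>2 * (\<Sum>k\<in>{n\<^sup>2..<N}. (?a k)\<^sup>2))"
        by (intro real_sqrt_le_mono mdiff_second_moment[OF c])
      also have "\<dots> \<le> sqrt (C\<^sup>2 * (1 / real n))"
      proof (intro real_sqrt_le_mono mult_left_mono)
        have n2: "1 \<le> n\<^sup>2" using n by simp
        have "(\<Sum>k\<in>{n\<^sup>2..<N}. (?a k)\<^sup>2) = real n * (\<Sum>k\<in>{n\<^sup>2..<N}. 1 / (real (Suc k))\<^sup>2)"
          by (simp add: power_mult_distrib power_divide sum_distrib_left)
        also have "\<dots> \<le> real n * (1 / real (n\<^sup>2) - 1 / real N)"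
          by (intro mult_left_mono sum_inverse_square_bounds n2 N) simp
        also have "\<dots> \<le> real n * (1 / real (n\<^sup>2))" by (intro mult_left_mono) auto
        also have "\<dots> = 1 / real n" using n by (simp add: power2_eq_square)
        finally show "(\<Sum>k\<in>{n\<^sup>2..<N}. (?a k)\<^sup>2) \<le> 1 / real n" .
      qed simp
      also have "\<dots> = C * (1 / sqrt (real n))" using C0 by (simp add: real_sqrt_mult real_sqrt_divide)
      finally show ?thesis unfolding eq .
    qed
    then show "\<exists>N0. \<forall>N\<ge>N0. expectation (\<lambda>w. min 1 \<bar>sqrt (real n) * (MD N w - MD (n\<^sup>2) w)\<bar>) \<le> C * (1 / sqrt (real n))" by blast
  qed
  show "(\<lambda>n. expectation (\<lambda>w. min 1 \<bar>sqrt (real n) * (lim (\<lambda>N. MD N w) - MD (n\<^sup>2) w)\<bar>)) \<longlonglongrightarrow> 0"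
  proof (rule tendsto_sandwich[OF _ _ tendsto_const])
    show "\<forall>\<^sub>F n in sequentially. expectation (\<lambda>w. min 1 \<bar>sqrt (real n) * (lim (\<lambda>N. MD N w) - MD (n\<^sup>2) w)\<bar>) \<le> C * (1 / sqrt (real n))"
      using eventually_ge_at_top[of 1] by eventually_elim (rule bd)
    show "(\<lambda>n. C * (1 / sqrt (real n))) \<longlonglongrightarrow> 0"
      using tendsto_mult[OF tendsto_const inverse_sqrt_lim, of C] by simp
  qed auto
qed

text \<open>The limit of \<open>Zs\<close> minus \<open>Zs n\<close> is the sum of all later
  increments, hence the negative weights \<open>- sqrt n / (k + 1)\<close>. Their squares over
  \<open>[n, n^2)\<close> sum to about \<open>n * (1 / n - 1 / n^2)\<close>, which tends to
  1.\<close>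

lemma DD_strong: "strong_conv (\<lambda>n. n) DD Vj"
proof (rule mdiff_strong_conv[OF cD_mdiff G_cvar[OF \<rho>D_F \<rho>D_bound] Vj_M VD_lim filterlim_ident _ _ _ inverse_sqrt_lim DD_M])
  let ?a = "\<lambda>n k. - sqrt (real n) * (1 / real (Suc k))"
  show "n \<le> n\<^sup>2" for n :: nat by (simp add: power2_nat_le_imp_le power2_eq_square)
  show "\<bar>?a n k\<bar> \<le> 1 / sqrt (real n)" if "k \<in> {n..<n\<^sup>2}" for n k
  proof -
    have "real n > 0" "real n \<le> real (Suc k)" using that by (cases n; auto)+
    have "\<bar>?a n k\<bar> = sqrt (real n) / real (Suc k)" by (simp add: abs_mult)
    also have "\<dots> \<le> sqrt (real n) / real n" using \<open>real n > 0\<close> \<open>real n \<le> real (Suc k)\<close> by (intro divide_left_mono) auto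
    also have "\<dots> = 1 / sqrt (real n)" using \<open>real n > 0\<close> by (simp add: real_div_sqrt field_simps)
    finally show ?thesis .
  qed
  show "(\<lambda>n. \<Sum>k\<in>{n..<n\<^sup>2}. (?a n k)\<^sup>2) \<longlonglongrightarrow> 1"
  proof (rule tendsto_sandwich[OF _ _ _ tendsto_const])
    have eq: "(\<Sum>k\<in>{n..<n\<^sup>2}. (?a n k)\<^sup>2) = real n * (\<Sum>k\<in>{n..<n\<^sup>2}. 1 / (real (Suc k))\<^sup>2)" for n
      by (simp add: power_mult_distrib power_divide sum_distrib_left)
    have nn: "n \<le> n\<^sup>2" for n :: nat by (simp add: power2_eq_square)
    show "\<forall>\<^sub>F n in sequentially. (\<Sum>k\<in>{n..<n\<^sup>2}. (?a n k)\<^sup>2) \<le> 1"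
      using eventually_ge_at_top[of 1]
    proof eventually_elim
      case (elim n)
      have "real n * (\<Sum>k\<in>{n..<n\<^sup>2}. 1 / (real (Suc k))\<^sup>2) \<le> real n * (1 / real n - 1 / real (n\<^sup>2))"
        by (intro mult_left_mono sum_inverse_square_bounds elim nn) simp
      also have "\<dots> \<le> real n * (1 / real n)" by (intro mult_left_mono) auto
      finally show ?case unfolding eq using elim by simp
    qed
    show "\<forall>\<^sub>F n in sequentially. real n / real (Suc n) - 1 / real n \<le> (\<Sum>k\<in>{n..<n\<^sup>2}. (?a n k)\<^sup>2)"
      using eventually_ge_at_top[of 1]
    proof eventually_elim
      case (elim n)
      have "real n * (1 / real (Suc (n\<^sup>2))) \<le> real n * (1 / real (n\<^sup>2))"
        using elim by (intro mult_left_mono frac_le) auto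
      also have "\<dots> = 1 / real n" using elim by (simp add: power2_eq_square)
      finally have "real n / real (Suc n) - 1 / real n \<le> real n * (1 / real (Suc n) - 1 / real (Suc (n\<^sup>2)))"
        by (simp add: right_diff_distrib)
      also have "\<dots> \<le> real n * (\<Sum>k\<in>{n..<n\<^sup>2}. 1 / (real (Suc k))\<^sup>2)"
        by (intro mult_left_mono sum_inverse_square_bounds elim nn) simp
      finally show ?case unfolding eq .
    qed
    show "(\<lambda>n. real n / real (Suc n) - 1 / real n) \<longlonglongrightarrow> 1"
      using tendsto_diff[OF LIMSEQ_n_over_Suc_n lim_const_over_n[of 1]] by simp
  qed
  have [measurable]: "(\<lambda>w. lim (\<lambda>N. MD N w)) \<in> borel_measurable M" by (rule borel_measurable_lim_metric) simp
  note [measurable] = Zl_M[OF j]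
  \<comment> \<open>The part of \<open>DD\<close> that the martingale does not explain: up to sign,
    \<open>sqrt n\<close> times the sum of \<open>errD\<close> from \<open>n\<close> on, which is
    almost surely of order \<open>1 / sqrt n\<close>.\<close>
  define E where "E n w = - sqrt (real n) * (Zl j w - Zs n w - (lim (\<lambda>N. MD N w) - MD n w))" for n w
  have nE: "null E"
  proof (rule null_AE)
    show "E n \<in> borel_measurable M" for n unfolding E_def by measurable
    show "AE w in M. (\<lambda>n. E n w) \<longlonglongrightarrow> 0"
      using MD_convergent errD_bound Zs_lim
    proof eventually_elim
      case (elim w)
      obtain n0 where n0: "\<And>n. n \<ge> n0 \<Longrightarrow> \<bar>errD n w\<bar> \<le> \<beta>\<^sup>2 * \<kappa>\<^sup>2 / (real (Suc n))\<^sup>2" using elim(2) by blast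
      have lm: "(\<lambda>N. MD N w) \<longlonglongrightarrow> lim (\<lambda>N. MD N w)" using elim(1) by (simp add: convergent_LIMSEQ_iff)
      let ?c = "\<beta>\<^sup>2 * \<kappa>\<^sup>2"
      have bd: "\<bar>E n w\<bar> \<le> ?c * (1 / sqrt (real n))" if n: "n \<ge> max 1 n0" for n
      proof -
        have "\<bar>Zl j w - Zs n w - (lim (\<lambda>N. MD N w) - MD n w)\<bar> \<le> ?c / real n"
        proof (rule LIMSEQ_le_const2)
          show "(\<lambda>N. \<bar>Zs N w - Zs n w - (MD N w - MD n w)\<bar>) \<longlonglongrightarrow> \<bar>Zl j w - Zs n w - (lim (\<lambda>N. MD N w) - MD n w)\<bar>"
            by (intro tendsto_intros elim(3) lm)
          have "\<bar>Zs N w - Zs n w - (MD N w - MD n w)\<bar> \<le> ?c / real n" if N: "N \<ge> n" for N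
          proof -
            have "Zs N w - Zs n w - (MD N w - MD n w) = (\<Sum>i\<in>{n..<N}. errD i w)"
              using Zs_sum[of n "N - n" w] N by simp
            also have "\<bar>\<dots>\<bar> \<le> (\<Sum>i\<in>{n..<N}. \<bar>errD i w\<bar>)" by (rule sum_abs)
            also have "\<dots> \<le> (\<Sum>i\<in>{n..<N}. ?c * (1 / (real (Suc i))\<^sup>2))"
              by (rule sum_mono) (use n0 n in auto)
            also have "\<dots> = ?c * (\<Sum>i\<in>{n..<N}. 1 / (real (Suc i))\<^sup>2)" by (simp add: sum_distrib_left)
            also have "\<dots> \<le> ?c * (1 / real n - 1 / real N)"
              by (intro mult_left_mono sum_inverse_square_bounds N) (use n in auto)
            also have "\<dots> \<le> ?c * (1 / real n)" by (intro mult_left_mono) auto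
            finally show ?thesis by simp
          qed
          then show "\<exists>N0. \<forall>N\<ge>N0. \<bar>Zs N w - Zs n w - (MD N w - MD n w)\<bar> \<le> ?c / real n" by blast
        qed
        then have "\<bar>E n w\<bar> \<le> sqrt (real n) * (?c / real n)"
          unfolding E_def abs_mult by (intro mult_mono) auto
        also have "\<dots> = ?c * (1 / sqrt (real n))" using n by (simp add: real_div_sqrt field_simps)
        finally show ?thesis .
      qed
      show ?case
      proof (rule Lim_null_comparison)
        show "\<forall>\<^sub>F n in sequentially. norm (E n w) \<le> ?c * (1 / sqrt (real n))"
          using eventually_ge_at_top[of "max 1 n0"] by eventually_elim (use bd in simp)
        show "(\<lambda>n. ?c * (1 / sqrt (real n))) \<longlonglongrightarrow> 0"
          using tendsto_mult[OF tendsto_const inverse_sqrt_lim, of ?c] by simp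
      qed
    qed
  qed
  have "DD n w - (\<Sum>k\<in>{n..<n\<^sup>2}. ?a n k * cD k w) = E n w + - (sqrt (real n) * (lim (\<lambda>N. MD N w) - MD (n\<^sup>2) w))" for n w
  proof -
    have nn: "n \<le> n\<^sup>2" by (simp add: power2_eq_square)
    have "MD (n\<^sup>2) w = MD n w + (\<Sum>k\<in>{n..<n\<^sup>2}. 1 / real (Suc k) * cD k w)"
      using sum.atLeastLessThan_concat[of 0 n "n\<^sup>2" "\<lambda>k. 1 / real (Suc k) * cD k w"] nn
      by (simp add: MD_def lessThan_atLeast0)
    moreover have "(\<Sum>k\<in>{n..<n\<^sup>2}. ?a n k * cD k w) = - sqrt (real n) * (\<Sum>k\<in>{n..<n\<^sup>2}. 1 / real (Suc k) * cD k w)"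
      by (simp add: sum_distrib_left mult.assoc)
    ultimately show ?thesis by (simp add: DD_eq E_def algebra_simps)
  qed
  then show "null (\<lambda>n w. DD n w - (\<Sum>k\<in>{n..<n\<^sup>2}. ?a n k * cD k w))"
    using null_add[OF nE null_minus[OF null_tail]] by simp
qed

section \<open>Martingale decomposition and limit theorem for \<open>CC\<close>\<close>

definition WC :: "nat \<Rightarrow> 'w \<Rightarrow> real" where "WC n w = (\<Sum>k<n. X (Suc k) j w) - K n w * Zs n w"
text \<open>\<open>WC\<close> is \<open>K\<close> times the difference of \<open>Mstar\<close> and
  \<open>Zstar\<close>. The factor \<open>K\<close> clears the random denominator, so that the
  increments become the martingale differences \<open>cC\<close> up to this error.\<close>

definition errC :: "nat \<Rightarrow> 'w \<Rightarrow> real" where "errC n w = WC (Suc n) w - WC n w - cC n w"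

lemma CC_WC: "w \<in> space M \<Longrightarrow> CC n w = sqrt (real n) / K n w * WC n w"
  using K_bounds(1)[of w n] by (simp add: CC_eq WC_def field_simps)

lemma WC_sum: "WC n w = - Zs 0 w + (\<Sum>k<n. cC k w) + (\<Sum>k<n. errC k w)"
  by (induction n) (auto simp: WC_def errC_def K_0)

text \<open>Expanding \<open>K (Suc n) * Zs (Suc n)\<close>, the draw terms cancel against those of
  \<open>cC\<close>, and \<open>Rinc_Y\<close> replaces \<open>K (Suc n)\<close> by
  \<open>K n + 1\<close> in front of \<open>Rinc\<close>.\<close>

lemma errC_eq: "w \<in> space M \<Longrightarrow> errC n w = \<rho>C n w * Rinc n w - (K n w + 1) * (Rinc n w / S (Suc n) w)"
proof -
  assume w: "w \<in> space M"
  have "K (Suc n) w * Zs (Suc n) w = K (Suc n) w * Zs n w + K (Suc n) w * (Rinc n w / S (Suc n) w)"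
    using Zs_diff[OF w, of n] by (simp add: algebra_simps flip: distrib_left)
  also have "K (Suc n) w * (Rinc n w / S (Suc n) w) = (K n w + 1) * (Rinc n w / S (Suc n) w)"
  proof -
    have "K (Suc n) w * Rinc n w = K n w * Rinc n w + Rinc n w * Y n w" by (simp add: K_Suc algebra_simps)
    also have "\<dots> = (K n w + 1) * Rinc n w" by (simp only: Rinc_Y[OF w] distrib_right mult_1)
    finally show ?thesis by (simp only: times_divide_eq_right)
  qed
  finally show ?thesis by (simp add: errC_def WC_def G_eq K_Suc algebra_simps)
qed

text \<open>A factor \<open>K n + 1 <= 2 * Suc n\<close> meets a denominator error of order
  \<open>1 / n^2\<close>. Order \<open>1 / n\<close> suffices, since the errors then sum to a
  logarithm, negligible against \<open>sqrt n\<close>.\<close>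

lemma errC_bound: "AE w in M. \<exists>n0. \<forall>n\<ge>n0. \<bar>errC n w\<bar> \<le> 2 * \<beta>\<^sup>2 * \<kappa>\<^sup>2 / real (Suc n)"
  using ratio_lim AE_space
proof eventually_elim
  case (elim w)
  note w = elim(2)
  have "\<forall>\<^sub>F n in sequentially. \<bar>errC n w\<bar> \<le> 2 * \<beta>\<^sup>2 * \<kappa>\<^sup>2 / real (Suc n)"
    using eventually_untruncated[OF conjunct1[OF elim(1)]] eventually_untruncated[OF conjunct2[OF elim(1)]]
  proof eventually_elim
    case (elim n)
    have "errC n w = - ((K n w + 1) * (Rinc n w / S (Suc n) w - Rinc n w / S n w))"
      using elim by (simp add: errC_eq[OF w] \<rho>C_def algebra_simps)
    then have "\<bar>errC n w\<bar> = (K n w + 1) * \<bar>Rinc n w / S (Suc n) w - Rinc n w / S n w\<bar>"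
      using K_bounds[OF w, of n] by (simp add: abs_mult)
    also have "\<dots> \<le> (2 * real (Suc n)) * (\<beta>\<^sup>2 * \<kappa>\<^sup>2 / (real (Suc n))\<^sup>2)"
      using K_bounds[OF w, of n] elim by (intro mult_mono inverse_S_diff[OF w]) auto
    also have "\<dots> = 2 * \<beta>\<^sup>2 * \<kappa>\<^sup>2 / real (Suc n)" by (simp add: power2_eq_square del: of_nat_Suc)
    finally show ?case .
  qed
  then show ?case by (simp add: eventually_sequentially)
qed

text \<open>Start of the block for \<open>CC\<close>: it tends to infinity, so that the variance can
  be frozen there, yet is small against \<open>n\<close>, so that the omitted initial draws have
  vanishing variance.\<close>

definition rt :: "nat \<Rightarrow> nat" where "rt n = nat \<lfloor>sqrt (real n)\<rfloor>"

lemma rt_le: "real (rt n) \<le> sqrt (real n)" by (simp add: rt_def)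

lemma rt_le_n: "rt n \<le> n"
proof -
  have "sqrt (real n) \<le> real n"
    by (cases "n = 0") (auto intro: real_le_lsqrt simp: power2_eq_square real_le_lsqrt)
  with rt_le[of n] show ?thesis by linarith
qed

lemma rt_at_top: "filterlim rt at_top sequentially"
  unfolding filterlim_at_top
proof
  fix k :: nat
  show "\<forall>\<^sub>F n in sequentially. k \<le> rt n"
    using eventually_ge_at_top[of "k\<^sup>2"]
  proof eventually_elim
    case (elim n)
    have "real k \<le> sqrt (real n)" using elim by (intro real_le_rsqrt) (simp flip: of_nat_power)
    then show ?case by (simp add: rt_def le_nat_floor)
  qed
qed

lemma rt_ratio: "(\<lambda>n. real (rt n) / real n) \<longlonglongrightarrow> 0"
proof (rule tendsto_sandwich[OF _ _ tendsto_const inverse_sqrt_lim])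
  show "\<forall>\<^sub>F n in sequentially. real (rt n) / real n \<le> 1 / sqrt (real n)"
    using eventually_gt_at_top[of 0]
  proof eventually_elim
    case (elim n)
    have "real (rt n) / real n \<le> sqrt (real n) / real n" by (rule divide_right_mono[OF rt_le]) simp
    also have "\<dots> = 1 / sqrt (real n)" using elim by (simp add: real_div_sqrt field_simps)
    finally show ?case .
  qed
qed auto

text \<open>Three corrections: \<open>E1\<close> replaces the random normalisation
  \<open>n / K\<close> by 1, \<open>E2\<close> drops the terms before \<open>rt n\<close>, and
  \<open>E3\<close> carries the errors \<open>errC\<close> and the starting value
  \<open>Zs 0\<close>.\<close>

lemma CC_strong: "strong_conv rt CC Uj"
proof (rule mdiff_strong_conv[OF cC_mdiff G_cvar[OF \<rho>C_F \<rho>C_bound] Uj_M VC_lim rt_at_top rt_le_n _ _ inverse_sqrt_lim measurable_F[OF CC_F]])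
  let ?a = "\<lambda>n (k::nat). 1 / sqrt (real n)"
  define C where "C = \<bar>1::real\<bar> + \<kappa> * \<beta>"
  have c: "mdiff cC C" unfolding C_def by (rule cC_mdiff)
  have C0: "0 \<le> C" by (rule mdiffD(4)[OF c])
  show "\<bar>?a n k\<bar> \<le> 1 / sqrt (real n)" for n k by simp
  show "(\<lambda>n. \<Sum>k\<in>{rt n..<n}. (?a n k)\<^sup>2) \<longlonglongrightarrow> 1"
  proof -
    have "(\<lambda>n. 1 - real (rt n) / real n) \<longlonglongrightarrow> 1 - 0" by (intro tendsto_intros rt_ratio)
    moreover have "\<forall>\<^sub>F n in sequentially. 1 - real (rt n) / real n = (\<Sum>k\<in>{rt n..<n}. (?a n k)\<^sup>2)"
      using eventually_gt_at_top[of 0]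
      by eventually_elim (use rt_le_n in \<open>simp add: power_divide of_nat_diff diff_divide_distrib\<close>)
    ultimately show ?thesis by (simp add: filterlim_cong)
  qed
  have [measurable]: "K n \<in> borel_measurable M" "(\<lambda>w. X (Suc n) j w) \<in> borel_measurable M" for n
    using measurable_F[OF K_F] X_M[of "Suc n" j] in_d[OF j] by auto
  have [measurable]: "errC n \<in> borel_measurable M" for n unfolding errC_def WC_def by measurable
  define E1 where "E1 n w = (real n / K n w - 1) * (\<Sum>k\<in>{0..<n}. ?a n k * cC k w)" for n w
  define E2 where "E2 n w = (\<Sum>k\<in>{0..<rt n}. ?a n k * cC k w)" for n w
  define E3 where "E3 n w = (real n / K n w) * ((\<Sum>k<n. errC k w) / sqrt (real n) - Zs 0 w * (1 / sqrt (real n)))" for n w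
  \<comment> \<open>The normalised sum is bounded in \<open>L2\<close>, hence in \<open>L1\<close>,
    uniformly in \<open>n\<close>, while \<open>n / K - 1\<close> tends to 0 almost surely.\<close>
  have n1: "null E1"
    unfolding E1_def
  proof (rule null_mult)
    show "null (\<lambda>n w. real n / K n w - 1)"
    proof (rule null_AE)
      show "AE w in M. (\<lambda>n. real n / K n w - 1) \<longlonglongrightarrow> 0"
        using K_lim
      proof eventually_elim
        case (elim w)
        have "(\<lambda>n. 1 / (K n w / real n) - 1) \<longlonglongrightarrow> 1 / 1 - 1" by (intro tendsto_intros elim) simp
        then show ?case by simp
      qed
    qed measurable
    show "integrable M (\<lambda>w. \<Sum>k\<in>{0..<n}. ?a n k * cC k w)" for n
      by (rule square_integrable_imp_integrable[OF _ mdiff_sum_square_integrable[OF c]]) measurable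
    then show "expectation (\<lambda>w. \<bar>\<Sum>k\<in>{0..<n}. ?a n k * cC k w\<bar>) \<le> C" for n
    proof -
      have "expectation (\<lambda>w. \<bar>\<Sum>k\<in>{0..<n}. ?a n k * cC k w\<bar>) \<le> sqrt (expectation (\<lambda>w. (\<Sum>k\<in>{0..<n}. ?a n k * cC k w)\<^sup>2))"
        by (rule expectation_abs_le_sqrt[OF \<open>\<And>n. integrable M (\<lambda>w. \<Sum>k\<in>{0..<n}. ?a n k * cC k w)\<close> mdiff_sum_square_integrable[OF c]])
      also have "\<dots> \<le> sqrt (C\<^sup>2 * (\<Sum>k\<in>{0..<n}. (?a n k)\<^sup>2))" by (intro real_sqrt_le_mono mdiff_second_moment[OF c])
      also have "\<dots> \<le> sqrt (C\<^sup>2 * 1)" by (intro real_sqrt_le_mono mult_left_mono) (auto simp: power_divide)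
      finally show ?thesis using C0 by simp
    qed
  qed measurable
  have n2: "null E2"
  proof (rule null_L2)
    show "integrable M (\<lambda>w. (E2 n w)\<^sup>2)" for n unfolding E2_def by (rule mdiff_sum_square_integrable[OF c])
    show "expectation (\<lambda>w. (E2 n w)\<^sup>2) \<le> C\<^sup>2 * (real (rt n) / real n)" for n
      using mdiff_second_moment[OF c, where l = 0 and u = "rt n" and a = "?a n"] unfolding E2_def by (simp add: power_divide)
    show "(\<lambda>n. C\<^sup>2 * (real (rt n) / real n)) \<longlonglongrightarrow> 0" using tendsto_mult[OF tendsto_const rt_ratio, of "C\<^sup>2"] by simp
    show "E2 n \<in> borel_measurable M" for n unfolding E2_def by measurable
  qed
  have n3: "null E3"
  proof (rule null_AE)
    show "E3 n \<in> borel_measurable M" for n unfolding E3_def by measurable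
    show "AE w in M. (\<lambda>n. E3 n w) \<longlonglongrightarrow> 0"
      using K_lim errC_bound
    proof eventually_elim
      case (elim w)
      obtain n0 where n0: "\<And>n. n \<ge> n0 \<Longrightarrow> \<bar>errC n w\<bar> \<le> 2 * \<beta>\<^sup>2 * \<kappa>\<^sup>2 / real (Suc n)" using elim(2) by blast
      have "(\<lambda>n. (1 / (K n w / real n)) * ((\<Sum>k<n. errC k w) / sqrt (real n) - Zs 0 w * (1 / sqrt (real n)))) \<longlonglongrightarrow> (1 / 1) * (0 - Zs 0 w * 0)"
        by (intro tendsto_intros elim(1) sum_over_sqrt_tendsto_0[OF n0] inverse_sqrt_lim) simp_all
      then show ?case by (simp add: E3_def)
    qed
  qed
  have eq: "CC n w - (\<Sum>k\<in>{rt n..<n}. ?a n k * cC k w) = E1 n w + E2 n w + E3 n w" if w: "w \<in> space M" for n w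
  proof -
    have a: "(\<Sum>k\<in>{0..<n}. ?a n k * cC k w) = (\<Sum>k\<in>{0..<rt n}. ?a n k * cC k w) + (\<Sum>k\<in>{rt n..<n}. ?a n k * cC k w)"
      by (rule sum.atLeastLessThan_concat[symmetric]) (use rt_le_n in auto)
    have b: "(\<Sum>k\<in>{0..<n}. ?a n k * cC k w) = (\<Sum>k<n. cC k w) / sqrt (real n)"
      by (simp add: sum_divide_distrib lessThan_atLeast0)
    \<comment> \<open>Writing \<open>sqrt n\<close> as \<open>n / sqrt n\<close>, which also holds
      for \<open>n = 0\<close> where division yields 0, brings out the factor \<open>n / K\<close>
      with limit 1.\<close>
    have "CC n w = ((real n / sqrt (real n)) / K n w) * WC n w"
      unfolding CC_WC[OF w] by (simp only: real_div_sqrt[OF of_nat_0_le_iff])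
    then have "CC n w = (real n / K n w) * (WC n w / sqrt (real n))"
      by (simp add: mult.commute)
    also have "WC n w / sqrt (real n) = (\<Sum>k\<in>{0..<n}. ?a n k * cC k w) + ((\<Sum>k<n. errC k w) / sqrt (real n) - Zs 0 w * (1 / sqrt (real n)))"
      unfolding b WC_sum by (simp add: add_divide_distrib diff_divide_distrib)
    finally have "CC n w = (real n / K n w) * (\<Sum>k\<in>{0..<n}. ?a n k * cC k w) + E3 n w"
      by (simp add: E3_def distrib_left)
    then show ?thesis unfolding E1_def E2_def using a by (simp add: left_diff_distrib)
  qed
  show "null (\<lambda>n w. CC n w - (\<Sum>k\<in>{rt n..<n}. ?a n k * cC k w))"
  proof (rule null_le[OF null_add[OF null_add[OF n1 n2] n3]])
    show "(\<lambda>w. CC n w - (\<Sum>k\<in>{rt n..<n}. ?a n k * cC k w)) \<in> borel_measurable M" for n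
      using measurable_F[OF CC_F, of n] by measurable
  qed (simp only: eq order_refl)
qed

theorem urn_limits:
  "AE w in M. convergent (\<lambda>n. Z n j w) \<and> 0 \<le> Uj w \<and> 0 \<le> Vj w"
  "converges_stably M CC (gauss_kernel Uj)"
  "converges_stably_strong M F DD (gauss_kernel Vj)"
  "converges_stably M (\<lambda>n w. (CC n w, DD n w)) (kernel_prod (gauss_kernel Uj) (gauss_kernel Vj))"
proof -
  show "AE w in M. convergent (\<lambda>n. Z n j w) \<and> 0 \<le> Uj w \<and> 0 \<le> Vj w"
    using Zj_convergent UV_nonneg by eventually_elim blast
  show "converges_stably_strong M F DD (gauss_kernel Vj)"
    by (rule converges_stably_strongI[OF DD_strong DD_M Vj_M F_limit_UV(2)])
  show "converges_stably M CC (gauss_kernel Uj)"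
    "converges_stably M (\<lambda>n w. (CC n w, DD n w)) (kernel_prod (gauss_kernel Uj) (gauss_kernel Vj))"
    by (rule converges_stably_pairI[OF CC_strong rt_at_top DD_strong CC_F DD_M Uj_M Vj_M F_limit_DD F_limit_UV])+
qed

end

theorem theorem4:
  fixes M :: "'w measure"
    and X A :: "nat \<Rightarrow> nat \<Rightarrow> 'w \<Rightarrow> real"
    and a q :: "nat \<Rightarrow> real"
    and m :: real
    and d d0 j :: nat
  assumes "prob_space M"
    and "2 \<le> d" and "1 \<le> d0" and "d0 \<le> d"
    and "\<forall>n\<ge>1. \<forall>i\<in>{1..d}. X n i \<in> borel_measurable M"
    and "\<forall>n\<ge>1. \<forall>i\<in>{1..d}. A n i \<in> borel_measurable M"
    and "\<forall>i\<in>{1..d}. 0 < a i"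
    and "assumption_A M X A a d"
    and "assumption_B M A d d0 m q"
    and "j \<in> {1..d0}"
  shows "(AE w in M. convergent (\<lambda>n. urn_Z X A a d n j w) \<and>
            0 \<le> urn_U X A a d d0 m q j w \<and> 0 \<le> urn_V X A a d d0 m q j w) \<and>
         converges_stably M (\<lambda>n w. Cstar X A a d0 n j w)
           (gauss_kernel (urn_U X A a d d0 m q j)) \<and>
         converges_stably_strong M (urn_G M X A d) (\<lambda>n w. Dstar X A a d d0 n j w)
           (gauss_kernel (urn_V X A a d d0 m q j)) \<and>
         converges_stably M (\<lambda>n w. (Cstar X A a d0 n j w, Dstar X A a d d0 n j w))
           (kernel_prod (gauss_kernel (urn_U X A a d d0 m q j))
                        (gauss_kernel (urn_V X A a d d0 m q j)))"
proof -
  note AA = assms(8)[unfolded assumption_A_def]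
  note BB = assms(9)[unfolded assumption_B_def]
  obtain \<beta> where b: "\<forall>n\<ge>1. \<forall>j\<in>{1..d}. \<forall>w\<in>space M. 0 \<le> A n j w \<and> A n j w \<le> \<beta>" using AA by blast
  \<comment> \<open>The given bound need not be strictly positive;
    \<open>\<bar>\<beta>\<bar> + 1\<close> is positive and still bounds the reinforcements.\<close>
  interpret multicolor_urn M X A a q m "\<bar>\<beta>\<bar> + 1" d d0 j
  proof (rule multicolor_urn.intro[OF assms(1)], unfold_locales)
    show "A n i w \<le> \<bar>\<beta>\<bar> + 1" if "1 \<le> n" "i \<in> {1..d}" "w \<in> space M" for n i w
      using b that by (meson abs_ge_self le_add_same_cancel1 order_trans zero_le_one)
    show "prob_space.indep_set M (sets (sigma_gen M {A (Suc n) i |i. i \<in> {1..d}}))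
        (sets (sigma_join M (urn_G M X A d n) (sigma_gen M {X (Suc n) i |i. i \<in> {1..d}})))" for n
    proof -
      have "\<forall>n\<ge>1. prob_space.indep_set M (sets (sigma_gen M {A n j | j. j \<in> {1..d}}))
        (sets (sigma_join M (urn_G M X A d (n - 1)) (sigma_gen M {X n j | j. j \<in> {1..d}})))"
        using AA by blast
      from this[rule_format, of "Suc n"] show ?thesis by simp
    qed
    show "AE w in M. urn_Z X A a d n i w = real_cond_exp M (urn_G M X A d n) (indicator {v \<in> space M. X (Suc n) i v = 1}) w"
      if "i \<in> {1..d}" for n i
      using AA that by blast
    show "integral\<^sup>L M (A (Suc n) i) = integral\<^sup>L M (A (Suc n) 1)" if "i \<in> {1..d0}" for n i
    proof -
      have "\<forall>n\<ge>1. \<forall>j\<in>{1..d0}. (\<integral>w. A n j w \<partial>M) = (\<integral>w. A n 1 w \<partial>M)" using BB by blast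
      from this[rule_format, of "Suc n" i] that show ?thesis by simp
    qed
  qed (use assms AA BB b in auto)
  show ?thesis using urn_limits unfolding CC_def DD_def by blast
qed

end
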